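(* Let $u\in L^2(Q)$ be the optimal control and $y(u)$ the corresponding optimal state of the problem of minimizing $\mathcal{J}(y(v),v)=\frac12\|y(v)-y_d\|^2+\frac\lambda2\|v\|^2$ over $v\in L^2(Q)$, where $y(v)$ is the time-periodic parabolic state belonging to $v$ (equivalently, $u$ and $y(u)$ are given by the solution of the optimality system). For $\eta,\zeta\in H^{1,1}_{0,per}(Q)$ and $\boldsymbol{\tau},\boldsymbol{\rho}\in H(\mathrm{div},Q)$ define the minorant $$\begin{aligned}\mathcal{J}^\ominus(\eta,\zeta,\boldsymbol{\tau},\boldsymbol{\rho})=\ &\tfrac12\|\eta-y_d\|^2+\tfrac1{2\lambda}\|\zeta\|^2-\int_Q\big(\nu\nabla\eta\cdot\nabla\zeta+\sigma\partial_t\eta\,\zeta+\lambda^{-1}\zeta^2\big)\,d\boldsymbol{x}\,dt\\&-\frac{C_F^2}{\underline{\mu_1}^2\lambda}\big(C_F\|\mathcal{R}_3(\zeta,\boldsymbol{\rho},\eta)\|+\|\mathcal{R}_4(\zeta,\boldsymbol{\rho})\|\big)^2\\&-\frac1{\underline{\mu_1}}\big(C_F\|\mathcal{R}_1(\eta,\boldsymbol{\tau},-\lambda^{-1}\zeta)\|+\|\mathcal{R}_2(\eta,\boldsymbol{\tau})\|\big)\big(C_F\|\mathcal{R}_3(\zeta,\boldsymbol{\rho},\eta)\|+\|\mathcal{R}_4(\zeta,\boldsymbol{\rho})\|\big),\end{aligned}$$ where $\mathcal{R}_1(\eta,\boldsymbol{\tau},v)=\sigma\partial_t\eta-\nabla\cdot\boldsymbol{\tau}-v$,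 $\mathcal{R}_2(\eta,\boldsymbol{\tau})=\boldsymbol{\tau}-\nu\nabla\eta$, $\mathcal{R}_3(\zeta,\boldsymbol{\rho},\eta)=\eta-y_d+\nabla\cdot\boldsymbol{\rho}+\sigma\partial_t\zeta$, $\mathcal{R}_4(\zeta,\boldsymbol{\rho})=\boldsymbol{\rho}-\nu\nabla\zeta$ and $\underline{\mu_1}=\frac1{\sqrt2}\min\{\underline\nu,\underline\sigma\}$. Then the supremum of $\mathcal{J}^\ominus$ is attained and equals the minimum of the cost functional: $$\sup_{\eta,\zeta\in H^{1,1}_{0,per}(Q),\ \boldsymbol{\tau},\boldsymbol{\rho}\in H(\mathrm{div},Q)}\mathcal{J}^\ominus(\eta,\zeta,\boldsymbol{\tau},\boldsymbol{\rho})=\mathcal{J}(y(u),u).$$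
   Context: Setting. $\Omega\subset\mathbb{R}^d$, $d\in\{1,2,3\}$, is a bounded Lipschitz domain with boundary $\Gamma$; $T>0$, $\omega=2\pi/T$, $Q=\Omega\times(0,T)$, $\Sigma=\Gamma\times(0,T)$. The coefficients $\sigma,\nu$ are functions on $\Omega$ with $0<\underline{\sigma}\le\sigma(\boldsymbol{x})\le\overline{\sigma}$ and $0<\underline{\nu}\le\nu(\boldsymbol{x})\le\overline{\nu}$ for constants; $\lambda>0$; $y_d\in L^2(Q)$. $\|\cdot\|$ is the norm in $L^2(Q)$ (or $[L^2(Q)]^d$), $\langle\cdot,\cdot\rangle_\Omega$, $\|\cdot\|_\Omega$ are those of $L^2(\Omega)$ (componentwise for vectors); $\nabla$, $\nabla\cdot$ act in space. $C_F>0$ is Friedrichs' constant: $\|w\|_\Omega\le C_F\|\nabla w\|_\Omega$ for all $w\in H^1_0(\Omega)$. Fourier series. Every $w\in L^2(Q)$ is written $w=w_0^c+\sum_{k\ge1}(w_k^c\cos(k\omega t)+w_k^s\sin(k\omega t))$ (usual Fourier coefficients in time, in $L^2(\Omega)$); $\boldsymbol{w}_k=(w_k^c,w_k^s)^T$, $\boldsymbol{w}_k^\perp=(-w_k^s,w_k^c)^T$, $w^\perp=\sum_{k\ge1}(\boldsymbol{w}_k^\perp)^T\cdot(\cos(k\omega t),\sin(k\omega t))^T$. Define $\|\partial_t^{1/2}w\|^2=\frac T2\sum_{k\ge1}k\omega\|\boldsymbol{w}_k\|_\Omega^2$ and $\int_Q\sigma\,\partial_t^{1/2}w\,\partial_t^{1/2}z\,d\boldsymbol{x}\,dt=\frac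 T2\sum_{k\ge1}k\omega\langle\sigma\boldsymbol{w}_k,\boldsymbol{z}_k\rangle_\Omega$. With this convention $\int_Q\sigma\,\partial_t^{1/2}w\,\partial_t^{1/2}z^\perp=\int_Q\sigma\,\partial_tw\,z$ whenever $w$ is $T$-periodic in time with $\partial_tw\in L^2(Q)$. Spaces. $H^{1,\frac12}_{0,per}(Q)=\{w\in L^2(Q):\nabla w\in[L^2(Q)]^d,\ \|\partial_t^{1/2}w\|<\infty,\ w=0\text{ on }\Sigma\}$. $H^{1,1}_{0,per}(Q)=\{w\in L^2(Q):\nabla w\in[L^2(Q)]^d,\ \partial_tw\in L^2(Q),\ w=0\text{ on }\Sigma,\ w(0)=w(T)\text{ in }\overline\Omega\}$. $H(\mathrm{div},Q)=\{\boldsymbol{\tau}\in[L^2(Q)]^d:\ \nabla\cdot\boldsymbol{\tau}(\cdot,t)\in L^2(\Omega)\text{ for a.e. }t\in(0,T)\}$, with in addition $\nabla\cdot\boldsymbol{\tau}\in L^2(Q)$. State. For $v\in L^2(Q)$, $y(v)\in H^{1,\frac12}_{0,per}(Q)$ is the weak solution of $\sigma\partial_ty-\nabla\cdot(\nu\nabla y)=v$ in $Q$, $y=0$ on $\Sigma$, $y(0)=y(T)$ in $\overline\Omega$, i.e. $\int_Q(\nu\nabla y\cdot\nabla q+\sigma\partial_t^{1/2}y\,\partial_t^{1/2}q^\perp)\,d\boldsymbol{x}\,dt=\int_Qv\,q\,d\boldsymbol{x}\,dt$ for all $q\in H^{1,\frac12}_{0,per}(Q)$. Optimality system. Find $y,p\in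 H^{1,\frac12}_{0,per}(Q)$ such that for all $z,q\in H^{1,\frac12}_{0,per}(Q)$: $\int_Q(yz-\nu\nabla p\cdot\nabla z+\sigma\partial_t^{1/2}p\,\partial_t^{1/2}z^\perp)\,d\boldsymbol{x}\,dt=\int_Qy_dz\,d\boldsymbol{x}\,dt$ and $\int_Q(\nu\nabla y\cdot\nabla q+\sigma\partial_t^{1/2}y\,\partial_t^{1/2}q^\perp+\lambda^{-1}pq)\,d\boldsymbol{x}\,dt=0$. Its unique solution gives the optimal state $y=y(u)$, the adjoint state $p=p(u)$ and the optimal control $u=-\lambda^{-1}p(u)$. *)

theory Defs
  imports "HOL-Analysis.Analysis"
begin

section \<open>Square-integrable functions, test functions, weak derivatives\<close>

text \<open>
  Elements of $L^2$ are represented by total functions that are Borel measurable on \<open>S\<close>; values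
  outside \<open>S\<close> are irrelevant, and all notions below are invariant under changes on null sets of \<open>S\<close>.
\<close>

definition L2 :: "'a::euclidean_space set \<Rightarrow> ('a \<Rightarrow> 'b::euclidean_space) set" where
  "L2 S = {f. set_borel_measurable lborel S f \<and> set_integrable lborel S (\<lambda>z. (norm (f z))\<^sup>2)}"

definition l2norm :: "'a::euclidean_space set \<Rightarrow> ('a \<Rightarrow> 'b::euclidean_space) \<Rightarrow> real" where
  "l2norm S f = sqrt (LINT z:S|lborel. (norm (f z))\<^sup>2)"

definition l2inner ::
  "'a::euclidean_space set \<Rightarrow> ('a \<Rightarrow> 'b::euclidean_space) \<Rightarrow> ('a \<Rightarrow> 'b) \<Rightarrow> real" where
  "l2inner S f g = (LINT z:S|lborel. f z \<bullet> g z)"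

definition pderiv_dir :: "'a::euclidean_space \<Rightarrow> ('a \<Rightarrow> real) \<Rightarrow> 'a \<Rightarrow> real" where
  "pderiv_dir b f x = frechet_derivative f (at x) b"

text \<open>
  \<open>C\<^sup>\<infinity>\<close>: every iterated partial derivative is differentiable, hence in particular continuous.
\<close>

definition smooth_fun :: "('a::euclidean_space \<Rightarrow> real) \<Rightarrow> bool" where
  "smooth_fun f \<longleftrightarrow>
     (\<forall>bs. set bs \<subseteq> Basis \<longrightarrow> (\<forall>x. foldr pderiv_dir bs f differentiable (at x)))"

definition test_functions :: "'a::euclidean_space set \<Rightarrow> ('a \<Rightarrow> real) set" where
  "test_functions S =
     {f. smooth_fun f \<and> compact (closure {x. f x \<noteq> 0}) \<and> closure {x. f x \<noteq> 0} \<subseteq> S}"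

definition weak_pderiv ::
  "'a::euclidean_space set \<Rightarrow> 'a \<Rightarrow> ('a \<Rightarrow> real) \<Rightarrow> ('a \<Rightarrow> real) \<Rightarrow> bool" where
  "weak_pderiv S b f g \<longleftrightarrow>
     (\<forall>\<phi>\<in>test_functions S.
        (LINT x:S|lborel. f x * pderiv_dir b \<phi> x) = - (LINT x:S|lborel. g x * \<phi> x))"

definition weak_gradient ::
  "(real^'n) set \<Rightarrow> (real^'n \<Rightarrow> real) \<Rightarrow> (real^'n \<Rightarrow> real^'n) \<Rightarrow> bool" where
  "weak_gradient \<Omega> f g \<longleftrightarrow> (\<forall>i. weak_pderiv \<Omega> (axis i 1) f (\<lambda>x. g x $ i))"

definition classical_gradient :: "(real^'n \<Rightarrow> real) \<Rightarrow> real^'n \<Rightarrow> real^'n" where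
  "classical_gradient \<phi> x = (\<chi> i. pderiv_dir (axis i 1) \<phi> x)"

definition weak_divergence ::
  "(real^'n) set \<Rightarrow> (real^'n \<Rightarrow> real^'n) \<Rightarrow> (real^'n \<Rightarrow> real) \<Rightarrow> bool" where
  "weak_divergence \<Omega> \<tau> h \<longleftrightarrow>
     (\<forall>\<phi>\<in>test_functions \<Omega>.
        (LINT x:\<Omega>|lborel. \<tau> x \<bullet> classical_gradient \<phi> x) = - (LINT x:\<Omega>|lborel. h x * \<phi> x))"

text \<open>
  \<open>H10 \<Omega>\<close> is $H^1_0(\Omega)$, the closure of the test functions in the norm of $H^1(\Omega)$. On a
  bounded Lipschitz domain these are the functions in $H^1(\Omega)$ with zero trace.
\<close>

definition H10 :: "(real^'n) set \<Rightarrow> (real^'n \<Rightarrow> real) set" where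
  "H10 \<Omega> = {f \<in> L2 \<Omega>. \<exists>g\<in>L2 \<Omega>. weak_gradient \<Omega> f g \<and>
     (\<exists>\<phi>::nat \<Rightarrow> _. (\<forall>n. \<phi> n \<in> test_functions \<Omega>) \<and>
        (\<lambda>n. l2norm \<Omega> (\<lambda>x. f x - \<phi> n x)) \<longlonglongrightarrow> 0 \<and>
        (\<lambda>n. l2norm \<Omega> (\<lambda>x. g x - classical_gradient (\<phi> n) x)) \<longlonglongrightarrow> 0)}"


section \<open>Domains and Friedrichs' inequality\<close>

text \<open>
  Near each boundary point, \<open>\<Omega>\<close> is the region below the graph of a Lipschitz function in the
  direction of some unit vector \<open>e\<close>; \<open>\<gamma>\<close> is only evaluated on the orthogonal complement of \<open>e\<close>.
\<close>

definition bounded_lipschitz_domain :: "(real^'n) set \<Rightarrow> bool" where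
  "bounded_lipschitz_domain \<Omega> \<longleftrightarrow>
     open \<Omega> \<and> connected \<Omega> \<and> bounded \<Omega> \<and> \<Omega> \<noteq> {} \<and>
     (\<forall>x\<in>frontier \<Omega>. \<exists>e r \<gamma> L. norm e = 1 \<and> r > 0 \<and> L-lipschitz_on UNIV \<gamma> \<and>
        \<Omega> \<inter> ball x r = {z \<in> ball x r. e \<bullet> z < (\<gamma> (z - (e \<bullet> z) *\<^sub>R e) :: real)})"

definition friedrichs_constant :: "(real^'n) set \<Rightarrow> real \<Rightarrow> bool" where
  "friedrichs_constant \<Omega> C \<longleftrightarrow> C > 0 \<and>
     (\<forall>w\<in>H10 \<Omega>. \<forall>g\<in>L2 \<Omega>. weak_gradient \<Omega> w g \<longrightarrow> l2norm \<Omega> w \<le> C * l2norm \<Omega> g)"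


section \<open>Function spaces on the space-time cylinder\<close>

definition cyl :: "(real^'n) set \<Rightarrow> real \<Rightarrow> ((real^'n) \<times> real) set" where
  "cyl \<Omega> T = \<Omega> \<times> {0<..<T}"

text \<open>
  Spatial derivatives are taken in almost every time slice and the time derivative on almost every
  line in time direction; in each case the derivative is a function in $L^2(Q)$. By Fubini these
  are the weak derivatives on $Q$. The operators \<open>sgrad\<close>, \<open>sdiv\<close> and \<open>tderiv\<close> pick a
  representative, which is unique up to null sets of $Q$.
\<close>

definition has_sgrad ::
  "(real^'n) set \<Rightarrow> real \<Rightarrow> ((real^'n) \<times> real \<Rightarrow> real) \<Rightarrow> ((real^'n) \<times> real \<Rightarrow> real^'n) \<Rightarrow> bool" where
  "has_sgrad \<Omega> T w g \<longleftrightarrow> g \<in> L2 (cyl \<Omega> T) \<and>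
     (AE t in lborel. t \<in> {0<..<T} \<longrightarrow> weak_gradient \<Omega> (\<lambda>x. w (x, t)) (\<lambda>x. g (x, t)))"

definition has_sdiv ::
  "(real^'n) set \<Rightarrow> real \<Rightarrow> ((real^'n) \<times> real \<Rightarrow> real^'n) \<Rightarrow> ((real^'n) \<times> real \<Rightarrow> real) \<Rightarrow> bool" where
  "has_sdiv \<Omega> T \<tau> h \<longleftrightarrow> h \<in> L2 (cyl \<Omega> T) \<and>
     (AE t in lborel. t \<in> {0<..<T} \<longrightarrow> weak_divergence \<Omega> (\<lambda>x. \<tau> (x, t)) (\<lambda>x. h (x, t)))"

definition has_tderiv ::
  "(real^'n) set \<Rightarrow> real \<Rightarrow> ((real^'n) \<times> real \<Rightarrow> real) \<Rightarrow> ((real^'n) \<times> real \<Rightarrow> real) \<Rightarrow> bool" where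
  "has_tderiv \<Omega> T w h \<longleftrightarrow> h \<in> L2 (cyl \<Omega> T) \<and>
     (AE x in lborel. x \<in> \<Omega> \<longrightarrow> weak_pderiv {0<..<T} 1 (\<lambda>t. w (x, t)) (\<lambda>t. h (x, t)))"

definition sgrad ::
  "(real^'n) set \<Rightarrow> real \<Rightarrow> ((real^'n) \<times> real \<Rightarrow> real) \<Rightarrow> (real^'n) \<times> real \<Rightarrow> real^'n" where
  "sgrad \<Omega> T w = (SOME g. has_sgrad \<Omega> T w g)"

definition sdiv ::
  "(real^'n) set \<Rightarrow> real \<Rightarrow> ((real^'n) \<times> real \<Rightarrow> real^'n) \<Rightarrow> (real^'n) \<times> real \<Rightarrow> real" where
  "sdiv \<Omega> T \<tau> = (SOME h. has_sdiv \<Omega> T \<tau> h)"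

definition tderiv ::
  "(real^'n) set \<Rightarrow> real \<Rightarrow> ((real^'n) \<times> real \<Rightarrow> real) \<Rightarrow> (real^'n) \<times> real \<Rightarrow> real" where
  "tderiv \<Omega> T w = (SOME h. has_tderiv \<Omega> T w h)"

text \<open>The lateral boundary condition $w = 0$ on $\Sigma$.\<close>

definition zero_lateral ::
  "(real^'n) set \<Rightarrow> real \<Rightarrow> ((real^'n) \<times> real \<Rightarrow> real) \<Rightarrow> bool" where
  "zero_lateral \<Omega> T w \<longleftrightarrow> (AE t in lborel. t \<in> {0<..<T} \<longrightarrow> (\<lambda>x. w (x, t)) \<in> H10 \<Omega>)"

text \<open>
  The condition $w(0) = w(T)$, the values at the end points being those of the representative that
  is continuous in time.
\<close>

definition time_periodic ::
  "(real^'n) set \<Rightarrow> real \<Rightarrow> ((real^'n) \<times> real \<Rightarrow> real) \<Rightarrow> bool" where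
  "time_periodic \<Omega> T w \<longleftrightarrow> (AE x in lborel. x \<in> \<Omega> \<longrightarrow>
     (\<exists>W. continuous_on {0..T} W \<and> (AE t in lborel. t \<in> {0<..<T} \<longrightarrow> w (x, t) = W t) \<and> W 0 = W T))"

text \<open>
  Fourier coefficients in time, $\omega = 2\pi/T$. Only the indices $k \ge 1$ are used.
  The pair is $(w_k^c, w_k^s)$.
\<close>

definition fourier ::
  "real \<Rightarrow> ((real^'n) \<times> real \<Rightarrow> real) \<Rightarrow> nat \<Rightarrow> (real^'n \<Rightarrow> real) \<times> (real^'n \<Rightarrow> real)" where
  "fourier T w k =
     ((\<lambda>x. 2 / T * (LINT t:{0<..<T}|lborel. w (x, t) * cos (real k * (2 * pi / T) * t))),
      (\<lambda>x. 2 / T * (LINT t:{0<..<T}|lborel. w (x, t) * sin (real k * (2 * pi / T) * t))))"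

text \<open>The coefficients $(-w_k^s, w_k^c)$ of $w^\perp$.\<close>

definition fourier_perp ::
  "real \<Rightarrow> ((real^'n) \<times> real \<Rightarrow> real) \<Rightarrow> nat \<Rightarrow> (real^'n \<Rightarrow> real) \<times> (real^'n \<Rightarrow> real)" where
  "fourier_perp T w k = ((\<lambda>x. - snd (fourier T w k) x), fst (fourier T w k))"

text \<open>
  \<open>half_form \<Omega> T \<sigma> (fourier T w) (fourier T z)\<close> is
  $\int_Q \sigma\, \partial_t^{1/2} w\, \partial_t^{1/2} z$ and
  \<open>half_form \<Omega> T \<sigma> (fourier T w) (fourier_perp T z)\<close> is
  $\int_Q \sigma\, \partial_t^{1/2} w\, \partial_t^{1/2} z^\perp$.
\<close>

definition half_form ::
  "(real^'n) set \<Rightarrow> real \<Rightarrow> (real^'n \<Rightarrow> real) \<Rightarrow>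
     (nat \<Rightarrow> (real^'n \<Rightarrow> real) \<times> (real^'n \<Rightarrow> real)) \<Rightarrow>
     (nat \<Rightarrow> (real^'n \<Rightarrow> real) \<times> (real^'n \<Rightarrow> real)) \<Rightarrow> real" where
  "half_form \<Omega> T \<sigma> a b = T / 2 * (\<Sum>j. real (Suc j) * (2 * pi / T) *
     (l2inner \<Omega> (\<lambda>x. \<sigma> x * fst (a (Suc j)) x) (fst (b (Suc j))) +
      l2inner \<Omega> (\<lambda>x. \<sigma> x * snd (a (Suc j)) x) (snd (b (Suc j)))))"

text \<open>$\|\partial_t^{1/2} w\| < \infty$\<close>

definition finite_half_norm ::
  "(real^'n) set \<Rightarrow> real \<Rightarrow> ((real^'n) \<times> real \<Rightarrow> real) \<Rightarrow> bool" where
  "finite_half_norm \<Omega> T w \<longleftrightarrow> summable (\<lambda>j. real (Suc j) * (2 * pi / T) *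
     ((l2norm \<Omega> (fst (fourier T w (Suc j))))\<^sup>2 + (l2norm \<Omega> (snd (fourier T w (Suc j))))\<^sup>2))"

definition H1half :: "(real^'n) set \<Rightarrow> real \<Rightarrow> ((real^'n) \<times> real \<Rightarrow> real) set" where
  "H1half \<Omega> T = {w \<in> L2 (cyl \<Omega> T).
     (\<exists>g. has_sgrad \<Omega> T w g) \<and> finite_half_norm \<Omega> T w \<and> zero_lateral \<Omega> T w}"

definition H11 :: "(real^'n) set \<Rightarrow> real \<Rightarrow> ((real^'n) \<times> real \<Rightarrow> real) set" where
  "H11 \<Omega> T = {w \<in> L2 (cyl \<Omega> T).
     (\<exists>g. has_sgrad \<Omega> T w g) \<and> (\<exists>h. has_tderiv \<Omega> T w h) \<and>
     zero_lateral \<Omega> T w \<and> time_periodic \<Omega> T w}"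

definition Hdiv :: "(real^'n) set \<Rightarrow> real \<Rightarrow> ((real^'n) \<times> real \<Rightarrow> real^'n) set" where
  "Hdiv \<Omega> T = {\<tau> \<in> L2 (cyl \<Omega> T). \<exists>h. has_sdiv \<Omega> T \<tau> h}"


section \<open>The optimal control problem\<close>

definition is_state ::
  "(real^'n) set \<Rightarrow> real \<Rightarrow> (real^'n \<Rightarrow> real) \<Rightarrow> (real^'n \<Rightarrow> real) \<Rightarrow>
     ((real^'n) \<times> real \<Rightarrow> real) \<Rightarrow> ((real^'n) \<times> real \<Rightarrow> real) \<Rightarrow> bool" where
  "is_state \<Omega> T \<sigma> \<nu> v y \<longleftrightarrow> y \<in> H1half \<Omega> T \<and>
     (\<forall>q\<in>H1half \<Omega> T.
        (LINT z:cyl \<Omega> T|lborel. \<nu> (fst z) * (sgrad \<Omega> T y z \<bullet> sgrad \<Omega> T q z))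
          + half_form \<Omega> T \<sigma> (fourier T y) (fourier_perp T q)
        = (LINT z:cyl \<Omega> T|lborel. v z * q z))"

definition cost ::
  "(real^'n) set \<Rightarrow> real \<Rightarrow> real \<Rightarrow> ((real^'n) \<times> real \<Rightarrow> real) \<Rightarrow>
     ((real^'n) \<times> real \<Rightarrow> real) \<Rightarrow> ((real^'n) \<times> real \<Rightarrow> real) \<Rightarrow> real" where
  "cost \<Omega> T lam y\<^sub>d y v =
     1 / 2 * (l2norm (cyl \<Omega> T) (\<lambda>z. y z - y\<^sub>d z))\<^sup>2 + lam / 2 * (l2norm (cyl \<Omega> T) v)\<^sup>2"

definition optimal_pair ::
  "(real^'n) set \<Rightarrow> real \<Rightarrow> (real^'n \<Rightarrow> real) \<Rightarrow> (real^'n \<Rightarrow> real) \<Rightarrow> real \<Rightarrow>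
     ((real^'n) \<times> real \<Rightarrow> real) \<Rightarrow> ((real^'n) \<times> real \<Rightarrow> real) \<Rightarrow>
     ((real^'n) \<times> real \<Rightarrow> real) \<Rightarrow> bool" where
  "optimal_pair \<Omega> T \<sigma> \<nu> lam y\<^sub>d u y \<longleftrightarrow>
     u \<in> L2 (cyl \<Omega> T) \<and> is_state \<Omega> T \<sigma> \<nu> u y \<and>
     (\<forall>v\<in>L2 (cyl \<Omega> T). \<forall>z. is_state \<Omega> T \<sigma> \<nu> v z \<longrightarrow> cost \<Omega> T lam y\<^sub>d y u \<le> cost \<Omega> T lam y\<^sub>d z v)"


section \<open>The minorant\<close>

definition R1 ::
  "(real^'n) set \<Rightarrow> real \<Rightarrow> (real^'n \<Rightarrow> real) \<Rightarrow> ((real^'n) \<times> real \<Rightarrow> real) \<Rightarrow>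
     ((real^'n) \<times> real \<Rightarrow> real^'n) \<Rightarrow> ((real^'n) \<times> real \<Rightarrow> real) \<Rightarrow> (real^'n) \<times> real \<Rightarrow> real" where
  "R1 \<Omega> T \<sigma> \<eta> \<tau> v = (\<lambda>z. \<sigma> (fst z) * tderiv \<Omega> T \<eta> z - sdiv \<Omega> T \<tau> z - v z)"

definition R2 ::
  "(real^'n) set \<Rightarrow> real \<Rightarrow> (real^'n \<Rightarrow> real) \<Rightarrow> ((real^'n) \<times> real \<Rightarrow> real) \<Rightarrow>
     ((real^'n) \<times> real \<Rightarrow> real^'n) \<Rightarrow> (real^'n) \<times> real \<Rightarrow> real^'n" where
  "R2 \<Omega> T \<nu> \<eta> \<tau> = (\<lambda>z. \<tau> z - \<nu> (fst z) *\<^sub>R sgrad \<Omega> T \<eta> z)"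

definition R3 ::
  "(real^'n) set \<Rightarrow> real \<Rightarrow> (real^'n \<Rightarrow> real) \<Rightarrow> ((real^'n) \<times> real \<Rightarrow> real) \<Rightarrow>
     ((real^'n) \<times> real \<Rightarrow> real) \<Rightarrow> ((real^'n) \<times> real \<Rightarrow> real^'n) \<Rightarrow>
     ((real^'n) \<times> real \<Rightarrow> real) \<Rightarrow> (real^'n) \<times> real \<Rightarrow> real" where
  "R3 \<Omega> T \<sigma> y\<^sub>d \<zeta> \<rho> \<eta> =
     (\<lambda>z. \<eta> z - y\<^sub>d z + sdiv \<Omega> T \<rho> z + \<sigma> (fst z) * tderiv \<Omega> T \<zeta> z)"

definition R4 ::
  "(real^'n) set \<Rightarrow> real \<Rightarrow> (real^'n \<Rightarrow> real) \<Rightarrow> ((real^'n) \<times> real \<Rightarrow> real) \<Rightarrow>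
     ((real^'n) \<times> real \<Rightarrow> real^'n) \<Rightarrow> (real^'n) \<times> real \<Rightarrow> real^'n" where
  "R4 \<Omega> T \<nu> \<zeta> \<rho> = (\<lambda>z. \<rho> z - \<nu> (fst z) *\<^sub>R sgrad \<Omega> T \<zeta> z)"

definition minorant ::
  "(real^'n) set \<Rightarrow> real \<Rightarrow> (real^'n \<Rightarrow> real) \<Rightarrow> (real^'n \<Rightarrow> real) \<Rightarrow> real \<Rightarrow>
     ((real^'n) \<times> real \<Rightarrow> real) \<Rightarrow> real \<Rightarrow> real \<Rightarrow>
     ((real^'n) \<times> real \<Rightarrow> real) \<Rightarrow> ((real^'n) \<times> real \<Rightarrow> real) \<Rightarrow>
     ((real^'n) \<times> real \<Rightarrow> real^'n) \<Rightarrow> ((real^'n) \<times> real \<Rightarrow> real^'n) \<Rightarrow> real" where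
  "minorant \<Omega> T \<sigma> \<nu> lam y\<^sub>d C\<^sub>F \<mu>\<^sub>1 \<eta> \<zeta> \<tau> \<rho> =
     (let Q = cyl \<Omega> T;
          A = C\<^sub>F * l2norm Q (R1 \<Omega> T \<sigma> \<eta> \<tau> (\<lambda>z. - (1 / lam) * \<zeta> z)) + l2norm Q (R2 \<Omega> T \<nu> \<eta> \<tau>);
          B = C\<^sub>F * l2norm Q (R3 \<Omega> T \<sigma> y\<^sub>d \<zeta> \<rho> \<eta>) + l2norm Q (R4 \<Omega> T \<nu> \<zeta> \<rho>)
      in 1 / 2 * (l2norm Q (\<lambda>z. \<eta> z - y\<^sub>d z))\<^sup>2 + 1 / (2 * lam) * (l2norm Q \<zeta>)\<^sup>2
         - (LINT z:Q|lborel. \<nu> (fst z) * (sgrad \<Omega> T \<eta> z \<bullet> sgrad \<Omega> T \<zeta> z)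
              + \<sigma> (fst z) * tderiv \<Omega> T \<eta> z * \<zeta> z + 1 / lam * (\<zeta> z)\<^sup>2)
         - C\<^sub>F\<^sup>2 / (\<mu>\<^sub>1\<^sup>2 * lam) * B\<^sup>2
         - 1 / \<mu>\<^sub>1 * A * B)"

end

theory Submission
  imports Defs
begin

text \<open>
  Let \<open>y\<close> be the optimal state, \<open>u\<close> the optimal control and \<open>p = - \<lambda> u\<close>. Put \<open>e = \<eta> - y\<close> and
  \<open>\<epsilon> = \<zeta> - p\<close>. The terms of the minorant in front of the two penalty terms differ from the optimal
  cost by \<open>F - |e|\<^sup>2 / 2 - |\<epsilon>|\<^sup>2 / (2 \<lambda>)\<close>, where \<open>F\<close> is the defect of the adjoint equation at
  \<open>(\<eta>, \<zeta>)\<close>, tested with \<open>e\<close>. Integration by parts with \<open>\<rho>\<close> expresses \<open>F\<close> by the residuals \<open>R3\<close> and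
  \<open>R4\<close>, so Friedrichs' inequality gives \<open>F \<le> B |\<nabla>e|\<close> with \<open>B = C |R3| + |R4|\<close>. The state equation,
  tested with \<open>e\<close>, bounds \<open>\<nu>_lo |\<nabla>e|\<close> by \<open>A + C |\<epsilon>| / \<lambda>\<close> with \<open>A = C |R1| + |R2|\<close>, because the time
  derivative is skew symmetric on time-periodic functions. Young's inequality absorbs the product
  of \<open>B\<close> and \<open>|\<epsilon>|\<close> into \<open>|\<epsilon>|\<^sup>2 / (2 \<lambda>)\<close>; what remains is at most the two penalty terms, since
  \<open>\<mu>\<^sub>1 \<le> \<nu>_lo\<close>. This is \<open>minorant_le_cost\<close>, whose algebraic core is \<open>minorant_le_cost_algebra\<close>.

  Equality holds at \<open>(y, p, \<nu>\<nabla>y, \<nu>\<nabla>p)\<close>, where all four residuals vanish. The work lies in showing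
  that this tuple is admissible: \<open>y\<close> and \<open>p\<close> must have a time derivative in $L^2(Q)$ and their fluxes a
  divergence in $L^2(Q)$, while a state is only known to have half a time derivative and \<open>p\<close> is only a
  multiple of a control that minimises the cost. Both gaps are closed by testing with single time
  harmonics \<open>cos (k \<omega> t) a(x) + sin (k \<omega> t) b(x)\<close>. For such a source the state equation is an
  elliptic system on \<open>\<Omega>\<close>, solved by the Lax--Milgram lemma (\<open>elliptic_mode_solution\<close>), and the
  half-derivative form is an ordinary integral (\<open>half_form_mode\<close>). Perturbing the optimal control by
  a harmonic shows that \<open>p\<close> satisfies the adjoint equation when tested with solutions for harmonic
  sources (\<open>first_order_condition\<close>), and \<open>y\<close> satisfies the state equation in the same very weak sense
  (\<open>state_tested_with_mode\<close>).

  The regularity theorem \<open>very_weak_regularity\<close> says that this information suffices. Finite sums of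
  harmonics are dense in $L^2(Q)$, and for such right-hand sides the solution \<open>z\<close> can be tested with
  \<open>z\<close> and with \<open>\<partial>\<^sub>t z\<close>. The second choice removes the diffusion term, since
  \<open>\<nu>\<nabla>z \<bullet> \<nabla>\<partial>\<^sub>t z\<close> is the time derivative of a periodic function, and leaves
  \<open>\<sigma>_lo |\<partial>\<^sub>t z| \<le> |r|\<close> (\<open>reg_estimates\<close>). So the solutions converge together with both derivatives
  when the right-hand sides converge, and duality identifies the limit with the given function.
\<close>

section \<open>The Hilbert space of square-integrable functions\<close>

definition sq_int :: "('a::euclidean_space \<Rightarrow> 'b::euclidean_space) \<Rightarrow> bool" where
  "sq_int f \<longleftrightarrow> f \<in> borel_measurable lborel \<and> integrable lborel (\<lambda>x. (norm (f x))\<^sup>2)"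

lemma sq_int_inner:
  assumes "sq_int f" "sq_int g"
  shows "integrable lborel (\<lambda>x. f x \<bullet> g x)"
proof (rule Bochner_Integration.integrable_bound)
  show "integrable lborel (\<lambda>x. (norm (f x))\<^sup>2 + (norm (g x))\<^sup>2)"
    using assms by (auto simp: sq_int_def)
  show "(\<lambda>x. f x \<bullet> g x) \<in> borel_measurable lborel"
    using assms by (auto simp: sq_int_def)
  show "AE x in lborel. norm (f x \<bullet> g x) \<le> norm ((norm (f x))\<^sup>2 + (norm (g x))\<^sup>2)"
  proof (rule AE_I2)
    fix x
    have "\<bar>f x \<bullet> g x\<bar> \<le> norm (f x) * norm (g x)" by (rule Cauchy_Schwarz_ineq2)
    also have "\<dots> \<le> (norm (f x))\<^sup>2 + (norm (g x))\<^sup>2"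
    proof -
      have "2 * (norm (f x) * norm (g x)) \<le> (norm (f x))\<^sup>2 + (norm (g x))\<^sup>2"
        using sum_squares_bound[of "norm (f x)" "norm (g x)"] by (simp add: mult.assoc)
      moreover have "0 \<le> norm (f x) * norm (g x)" by simp
      ultimately show ?thesis by linarith
    qed
    finally show "norm (f x \<bullet> g x) \<le> norm ((norm (f x))\<^sup>2 + (norm (g x))\<^sup>2)" by simp
  qed
qed

lemma sq_int_zero: "sq_int (\<lambda>x. 0)"
  by (simp add: sq_int_def)

lemma sq_int_scaleR: "sq_int f \<Longrightarrow> sq_int (\<lambda>x. c *\<^sub>R f x)"
  by (auto simp: sq_int_def power_mult_distrib)

lemma sq_int_add:
  assumes "sq_int f" "sq_int g"
  shows "sq_int (\<lambda>x. f x + g x)"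
proof -
  have "(\<lambda>x. (norm (f x + g x))\<^sup>2) = (\<lambda>x. (norm (f x))\<^sup>2 + (norm (g x))\<^sup>2 + 2 * (f x \<bullet> g x))"
    by (simp add: power2_norm_eq_inner inner_add_left inner_add_right inner_commute algebra_simps)
  then show ?thesis using assms sq_int_inner[OF assms]
    unfolding sq_int_def by auto
qed

lemma sq_int_minus: "sq_int f \<Longrightarrow> sq_int (\<lambda>x. - f x)"
  using sq_int_scaleR[of f "-1"] by simp

lemma sq_int_diff: "sq_int f \<Longrightarrow> sq_int g \<Longrightarrow> sq_int (\<lambda>x. f x - g x)"
  using sq_int_add[OF _ sq_int_minus, of f g] by simp

text \<open>
  The classes of square-integrable functions on the whole space form a type, which makes
  norms, limits and closures available. The relation is partial because only square-integrable
  functions represent a class.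
\<close>

quotient_type (overloaded) ('a, 'b) l2 = "'a::euclidean_space \<Rightarrow> 'b::euclidean_space" /
  partial: "\<lambda>f g. sq_int f \<and> sq_int g \<and> (AE x in lborel. f x = g x)"
proof (rule part_equivpI)
  show "\<exists>x::'a\<Rightarrow>'b. sq_int x \<and> sq_int x \<and> (AE xa in lborel. x xa = x xa)"
    using sq_int_zero by auto
  show "symp (\<lambda>f (g::'a\<Rightarrow>'b). sq_int f \<and> sq_int g \<and> (AE x in lborel. f x = g x))"
    by (auto simp: symp_def elim: eventually_mono)
  show "transp (\<lambda>f (g::'a\<Rightarrow>'b). sq_int f \<and> sq_int g \<and> (AE x in lborel. f x = g x))"
    by (auto simp: transp_def elim: eventually_elim2)
qed

instantiation l2 :: (euclidean_space, euclidean_space) real_vector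
begin
lift_definition zero_l2 :: "('a, 'b) l2" is "\<lambda>x. 0" by (simp add: sq_int_zero)
lift_definition plus_l2 :: "('a, 'b) l2 \<Rightarrow> ('a, 'b) l2 \<Rightarrow> ('a, 'b) l2" is "\<lambda>f g x. f x + g x"
  by (auto simp: sq_int_add)
lift_definition minus_l2 :: "('a, 'b) l2 \<Rightarrow> ('a, 'b) l2 \<Rightarrow> ('a, 'b) l2" is "\<lambda>f g x. f x - g x"
  by (auto simp: sq_int_diff)
lift_definition uminus_l2 :: "('a, 'b) l2 \<Rightarrow> ('a, 'b) l2" is "\<lambda>f x. - f x"
  by (auto simp: sq_int_minus)
lift_definition scaleR_l2 :: "real \<Rightarrow> ('a, 'b) l2 \<Rightarrow> ('a, 'b) l2" is "\<lambda>c f x. c *\<^sub>R f x"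
  by (auto simp: sq_int_scaleR)
instance
  by standard (transfer; auto simp: algebra_simps sq_int_add sq_int_minus sq_int_diff sq_int_scaleR sq_int_zero)+
end

instantiation l2 :: (euclidean_space, euclidean_space) real_inner
begin
lift_definition inner_l2 :: "('a, 'b) l2 \<Rightarrow> ('a, 'b) l2 \<Rightarrow> real"
  is "\<lambda>f g. LINT x|lborel. f x \<bullet> g x"
  by (auto simp: sq_int_def intro!: integral_cong_AE borel_measurable_inner)
definition norm_l2 :: "('a, 'b) l2 \<Rightarrow> real" where "norm_l2 x = sqrt (x \<bullet> x)"
definition sgn_l2 :: "('a, 'b) l2 \<Rightarrow> ('a, 'b) l2" where "sgn_l2 x = x /\<^sub>R norm x"
definition dist_l2 :: "('a, 'b) l2 \<Rightarrow> ('a, 'b) l2 \<Rightarrow> real" where "dist_l2 x y = norm (x - y)"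
definition uniformity_l2 :: "(('a, 'b) l2 \<times> ('a, 'b) l2) filter" where
  "uniformity_l2 = (INF e\<in>{0<..}. principal {(x, y). dist x y < e})"
definition open_l2 :: "('a, 'b) l2 set \<Rightarrow> bool" where
  "open_l2 U \<longleftrightarrow> (\<forall>x\<in>U. eventually (\<lambda>(x', y). x' = x \<longrightarrow> y \<in> U) uniformity)"
instance
proof
  fix x y z :: "('a, 'b) l2" and r :: real
  show "dist x y = norm (x - y)" by (rule dist_l2_def)
  show "sgn x = x /\<^sub>R norm x" by (rule sgn_l2_def)
  show "uniformity = (INF e\<in>{0<..}. principal {(x :: ('a, 'b) l2, y). dist x y < e})"
    by (rule uniformity_l2_def)
  show "open U = (\<forall>x\<in>U. eventually (\<lambda>(x', y). x' = x \<longrightarrow> y \<in> U) uniformity)"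
    for U :: "('a, 'b) l2 set" by (rule open_l2_def)
  show "x \<bullet> y = y \<bullet> x" by transfer (simp add: inner_commute)
  show "(x + y) \<bullet> z = x \<bullet> z + y \<bullet> z"
    by transfer (simp add: inner_add_left sq_int_inner)
  show "(r *\<^sub>R x) \<bullet> y = r * (x \<bullet> y)" by transfer simp
  show "0 \<le> x \<bullet> x" by transfer simp
  show "(x \<bullet> x = 0) = (x = 0)"
  proof transfer
    fix f :: "'a \<Rightarrow> 'b"
    assume "sq_int f \<and> sq_int f \<and> (AE x in lborel. f x = f x)"
    then have f: "sq_int f" by simp
    have "(LINT x|lborel. f x \<bullet> f x) = 0 \<longleftrightarrow> (AE x in lborel. f x \<bullet> f x = 0)"
      by (rule integral_nonneg_eq_0_iff_AE) (auto simp: sq_int_inner f)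
    then show "((LINT x|lborel. f x \<bullet> f x) = 0) =
       (sq_int f \<and> sq_int (\<lambda>x::'a. 0::'b) \<and> (AE x in lborel. f x = 0))"
      using f by (simp add: sq_int_zero)
  qed
  show "norm x = sqrt (x \<bullet> x)" by (rule norm_l2_def)
qed
end

lemma l2_eq_iff: "sq_int f \<Longrightarrow> sq_int g \<Longrightarrow> abs_l2 f = abs_l2 g \<longleftrightarrow> (AE x in lborel. f x = g x)"
  using Quotient3_rel[OF Quotient3_l2, of f g] by auto

lemma l2_cases: obtains f where "sq_int f" "w = abs_l2 f"
proof -
  have "\<exists>f. sq_int f \<and> w = abs_l2 f"
    by (rule l2.abs_induct[of "\<lambda>w. \<exists>f. sq_int f \<and> w = abs_l2 f"]) auto
  then show thesis using that by auto
qed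

lemma abs_l2_simps:
  assumes "sq_int f" "sq_int g"
  shows "abs_l2 f + abs_l2 g = abs_l2 (\<lambda>x. f x + g x)"
    "abs_l2 f - abs_l2 g = abs_l2 (\<lambda>x. f x - g x)"
    "c *\<^sub>R abs_l2 f = abs_l2 (\<lambda>x. c *\<^sub>R f x)"
    "abs_l2 f \<bullet> abs_l2 g = (LINT x|lborel. f x \<bullet> g x)"
  using assms
  by (auto intro!: plus_l2.abs_eq minus_l2.abs_eq scaleR_l2.abs_eq inner_l2.abs_eq)

lemma norm_abs_l2:
  assumes "sq_int f"
  shows "(norm (abs_l2 f))\<^sup>2 = (LINT x|lborel. (norm (f x))\<^sup>2)"
  by (simp add: power2_norm_eq_inner abs_l2_simps assms)

text \<open>
  The terms of the given series tend to zero, so that eventually \<open>d k\<close> is below the geometric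
  sequence \<open>2 powr (- k / 2)\<close>.
\<close>

lemma summable_of_summable_sq:
  fixes d :: "nat \<Rightarrow> real"
  assumes s: "summable (\<lambda>k. 2 ^ k * (d k)\<^sup>2)" and nn: "\<And>k. d k \<ge> 0"
  shows "summable d"
proof (rule summable_comparison_test_ev)
  have "(\<lambda>k. 2 ^ k * (d k)\<^sup>2) \<longlonglongrightarrow> 0" using s by (rule summable_LIMSEQ_zero)
  then have "eventually (\<lambda>k. 2 ^ k * (d k)\<^sup>2 < 1) sequentially"
    by (rule order_tendstoD) simp
  then show "eventually (\<lambda>k. norm (d k) \<le> (1 / sqrt 2) ^ k) sequentially"
  proof eventually_elim
    case (elim k)
    have "(d k)\<^sup>2 \<le> 1 / 2 ^ k" using elim by (simp add: field_simps)
    also have "\<dots> = ((1 / sqrt 2) ^ k)\<^sup>2"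
    proof -
      have "(sqrt 2 ^ k)\<^sup>2 = ((sqrt 2)\<^sup>2) ^ k" by (metis power_mult mult.commute)
      then show ?thesis by (simp add: power_one_over power_divide)
    qed
    finally have "\<bar>d k\<bar> \<le> (1 / sqrt 2) ^ k" by (rule power2_le_imp_le[OF _ zero_le_power, of "\<bar>d k\<bar>", simplified]) simp
    then show ?case by simp
  qed
  show "summable (\<lambda>k. (1 / sqrt 2) ^ k)" by (rule summable_geometric) simp
qed

text \<open>
  Riesz--Fischer. Along a subsequence with consecutive distances below \<open>1 / 2 ^ k\<close>, the series
  of the squared increments with weights \<open>2 ^ k\<close> has a finite integral, hence converges almost
  everywhere, and so does the subsequence itself. Fatou's lemma shows that the pointwise limit
  is the limit in norm.
\<close>

instance l2 :: (euclidean_space, euclidean_space) complete_space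
proof
  fix X :: "nat \<Rightarrow> ('a, 'b) l2"
  assume C: "Cauchy X"
  have "\<exists>f. \<forall>n. sq_int (f n) \<and> X n = abs_l2 (f n)"
    by (rule choice) (metis l2_cases)
  then obtain f where f: "\<And>n. sq_int (f n)" "\<And>n. X n = abs_l2 (f n)" by auto
  have fm[measurable]: "\<And>n. f n \<in> borel_measurable lborel" using f by (auto simp: sq_int_def)
  define P where "P k m \<longleftrightarrow> (\<forall>i\<ge>m. \<forall>j\<ge>m. dist (X i) (X j) < 1 / 2 ^ k)" for k m :: nat
  have "\<exists>m. P k m" for k
    unfolding P_def using C[unfolded Cauchy_def, rule_format, of "1 / 2 ^ k"] by auto
  then obtain m where m: "\<And>k. P k (m k)" by metis
  \<comment> \<open>The partial sums are monotone and dominate \<open>m\<close>.\<close>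
  define r where "r k = (\<Sum>i\<le>k. m i)" for k
  have rm: "r k \<ge> m k" for k unfolding r_def by (rule member_le_sum) auto
  have rS: "r (Suc k) \<ge> r k" for k unfolding r_def by simp
  have d: "dist (X (r (Suc k))) (X (r k)) < 1 / 2 ^ k" for k
    using m[of k] rm[of k] rS[of k] unfolding P_def by simp
  define D where "D k x = norm (f (r (Suc k)) x - f (r k) x)" for k x
  have Dm[measurable]: "D k \<in> borel_measurable lborel" for k unfolding D_def by measurable
  have DI: "(\<integral>\<^sup>+x. ennreal ((norm (f i x - f j x))\<^sup>2) \<partial>lborel) = ennreal ((dist (X i) (X j))\<^sup>2)" for i j
  proof -
    have s: "sq_int (\<lambda>x. f i x - f j x)" by (intro sq_int_diff f)
    show ?thesis
      unfolding dist_norm f abs_l2_simps(2)[OF f(1) f(1)] norm_abs_l2[OF s]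
      by (rule nn_integral_eq_integral) (use s in \<open>auto simp: sq_int_def\<close>)
  qed
  have "(\<integral>\<^sup>+x. (\<Sum>k. ennreal (2 ^ k * (D k x)\<^sup>2)) \<partial>lborel) = (\<Sum>k. (\<integral>\<^sup>+x. ennreal (2 ^ k * (D k x)\<^sup>2) \<partial>lborel))"
    by (rule nn_integral_suminf) measurable
  also have "\<dots> = (\<Sum>k. ennreal (2 ^ k) * ennreal ((dist (X (r (Suc k))) (X (r k)))\<^sup>2))"
    unfolding D_def by (simp add: ennreal_mult' nn_integral_cmult DI)
  also have "\<dots> \<le> (\<Sum>k. ennreal ((1/2) ^ k))"
  proof (rule suminf_le)
    fix k
    have "(dist (X (r (Suc k))) (X (r k)))\<^sup>2 \<le> (1 / 2 ^ k)\<^sup>2"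
      using d[of k] by (intro power_mono) auto
    then have "2 ^ k * (dist (X (r (Suc k))) (X (r k)))\<^sup>2 \<le> 2 ^ k * (1 / 2 ^ k)\<^sup>2"
      by (intro mult_left_mono) auto
    also have "\<dots> = (1/2)^k" by (simp add: power2_eq_square power_one_over field_simps)
    finally show "ennreal (2 ^ k) * ennreal ((dist (X (r (Suc k))) (X (r k)))\<^sup>2) \<le> ennreal ((1/2) ^ k)"
      by (simp add: ennreal_mult'[symmetric] ennreal_leI del: ennreal_numeral)
  qed auto
  also have "\<dots> < \<infinity>"
    by (subst suminf_ennreal_eq[of _ 2]) (use power_half_series geometric_sums[of "1/2::real"] in auto)
  finally have "(\<integral>\<^sup>+x. (\<Sum>k. ennreal (2 ^ k * (D k x)\<^sup>2)) \<partial>lborel) \<noteq> \<infinity>" by simp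
  then have "AE x in lborel. (\<Sum>k. ennreal (2 ^ k * (D k x)\<^sup>2)) \<noteq> \<infinity>"
    by (intro nn_integral_PInf_AE) measurable
  then have ae: "AE x in lborel. convergent (\<lambda>k. f (r k) x)"
  proof eventually_elim
    case (elim x)
    have "summable (\<lambda>k. 2 ^ k * (D k x)\<^sup>2)"
      by (rule summable_suminf_not_top) (use elim in auto)
    then have "summable (\<lambda>k. D k x)"
      by (rule summable_of_summable_sq) (auto simp: D_def)
    then have "summable (\<lambda>k. f (r (Suc k)) x - f (r k) x)"
      unfolding D_def by (rule summable_norm_cancel)
    then have "convergent (\<lambda>n. \<Sum>k<n. f (r (Suc k)) x - f (r k) x)"
      by (simp add: summable_iff_convergent)
    then have "convergent (\<lambda>n. f (r n) x - f (r 0) x)"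
      using sum_lessThan_telescope[of "\<lambda>k. f (r k) x"] by simp
    then show ?case by (simp add: convergent_diff_const_right_iff)
  qed
  define g where "g x = lim (\<lambda>k. f (r k) x)" for x
  have gm[measurable]: "g \<in> borel_measurable lborel" unfolding g_def by measurable
  have fat: "(\<integral>\<^sup>+x. ennreal ((norm (g x - f n x))\<^sup>2) \<partial>lborel) \<le> ennreal (1 / 2 ^ k) ^ 2" if n: "n \<ge> m k" for n k
  proof -
    have "(\<integral>\<^sup>+x. ennreal ((norm (g x - f n x))\<^sup>2) \<partial>lborel)
        = (\<integral>\<^sup>+x. liminf (\<lambda>j. ennreal ((norm (f (r j) x - f n x))\<^sup>2)) \<partial>lborel)"
      using ae
    proof (intro nn_integral_cong_AE, eventually_elim)
      case (elim x)
      then have "(\<lambda>j. f (r j) x) \<longlonglongrightarrow> g x" by (simp add: g_def convergent_LIMSEQ_iff)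
      then have "(\<lambda>j. ennreal ((norm (f (r j) x - f n x))\<^sup>2)) \<longlonglongrightarrow> ennreal ((norm (g x - f n x))\<^sup>2)"
        by (intro tendsto_intros)
      then show ?case by (intro lim_imp_Liminf[symmetric]) simp_all
    qed
    also have "\<dots> \<le> liminf (\<lambda>j. \<integral>\<^sup>+x. ennreal ((norm (f (r j) x - f n x))\<^sup>2) \<partial>lborel)"
      by (rule nn_integral_liminf) measurable
    also have "\<dots> \<le> ennreal (1 / 2 ^ k) ^ 2"
    proof (rule Liminf_le)
      show "\<forall>\<^sub>F j in sequentially. (\<integral>\<^sup>+x. ennreal ((norm (f (r j) x - f n x))\<^sup>2) \<partial>lborel) \<le> ennreal (1 / 2 ^ k) ^ 2"
        using eventually_ge_at_top[of k]
      proof eventually_elim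
        case (elim j)
        have "r j \<ge> m k" using elim rm[of k] lift_Suc_mono_le[of r, OF rS] by (meson order_trans)
        then have "dist (X (r j)) (X n) < 1 / 2 ^ k" using m[of k] n unfolding P_def by simp
        then show ?case unfolding DI by (simp add: ennreal_power power_mono less_imp_le del: ennreal_numeral power_divide)
      qed
    qed simp
    finally show ?thesis .
  qed
  have gf: "sq_int (\<lambda>x. g x - f n x)" if "n \<ge> m k" for n k
    unfolding sq_int_def
    by (intro conjI integrableI_bounded)
       (use fat[OF that] in \<open>auto simp: le_less_trans ennreal_power simp del: power_divide\<close>)
  have g: "sq_int g"
    using sq_int_add[OF gf[OF order_refl, of 0] f(1)[of "m 0"]] by simp
  have "X \<longlonglongrightarrow> abs_l2 g"
  proof (rule metric_LIMSEQ_I)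
    fix e :: real assume "e > 0"
    then obtain k where k: "(1/2) ^ k < e" using real_arch_pow_inv[of e "1/2"] by auto
    have "dist (X n) (abs_l2 g) < e" if "n \<ge> m k" for n
    proof -
      have "ennreal ((norm (abs_l2 g - X n))\<^sup>2) = (\<integral>\<^sup>+x. ennreal ((norm (g x - f n x))\<^sup>2) \<partial>lborel)"
        unfolding f abs_l2_simps(2)[OF g f(1)] norm_abs_l2[OF gf[OF that]]
        by (rule nn_integral_eq_integral[symmetric]) (use gf[OF that] in \<open>auto simp: sq_int_def\<close>)
      also have "\<dots> \<le> ennreal ((1 / 2 ^ k) ^ 2)" using fat[OF that] by (simp add: ennreal_power del: power_divide)
      finally have "(norm (abs_l2 g - X n))\<^sup>2 \<le> (1 / 2 ^ k) ^ 2" by (simp add: ennreal_le_iff)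
      then have "norm (abs_l2 g - X n) \<le> 1 / 2 ^ k" by (rule power2_le_imp_le) simp
      then show ?thesis using k by (simp add: dist_norm norm_minus_commute power_one_over)
    qed
    then show "\<exists>no. \<forall>n\<ge>no. dist (X n) (abs_l2 g) < e" by blast
  qed
  then show "convergent X" by (auto simp: convergent_def)
qed

section \<open>Riesz representation and the Lax--Milgram lemma\<close>

text \<open>
  The first-order condition for a quadratic functional that is minimal at \<open>0\<close> along a line. It
  serves both the Riesz representation and the optimality condition of the control problem.
\<close>

lemma linear_term_zero_of_quadratic_nonneg:
  fixes A B :: real
  assumes "\<And>e. 0 \<le> e * A + e\<^sup>2 * B"
  shows "A = 0"
proof (rule ccontr)
  assume "A \<noteq> 0"
  define k where "k = \<bar>B\<bar> + 1"
  have k: "k > 0" "B < k" unfolding k_def by auto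
  define e where "e = - A / k"
  have "e * A + e\<^sup>2 * B = (A\<^sup>2 / k) * (B / k - 1)"
    using k unfolding e_def by (simp add: field_simps power2_eq_square)
  moreover have "A\<^sup>2 / k > 0" using \<open>A \<noteq> 0\<close> k by simp
  moreover have "B / k - 1 < 0" using k by (simp add: field_simps)
  ultimately have "e * A + e\<^sup>2 * B < 0" using mult_pos_neg by metis
  then show False using assms[of e] by linarith
qed

text \<open>
  The representing vector minimises \<open>|v|\<^sup>2 / 2 - F v\<close> on \<open>V\<close>; by the parallelogram identity every
  minimising sequence is a Cauchy sequence.
\<close>

lemma riesz_on_closed_subspace:
  fixes F :: "'a::{real_inner, complete_space} \<Rightarrow> real"
  assumes V: "subspace V" "closed V" and F: "bounded_linear F"
  shows "\<exists>r\<in>V. \<forall>v\<in>V. F v = r \<bullet> v"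
proof -
  interpret F: bounded_linear F by fact
  define J where "J v = (v \<bullet> v) / 2 - F v" for v
  obtain K where K: "\<And>v. \<bar>F v\<bar> \<le> norm v * K" "K > 0"
    using F.pos_bounded by auto
  have lb: "- (K\<^sup>2 / 2) \<le> J v" for v
  proof -
    have "0 \<le> (norm v - K)\<^sup>2" by simp
    then show ?thesis using K(1)[of v]
      unfolding J_def by (simp add: power2_eq_square algebra_simps dot_square_norm)
  qed
  have bdd: "bdd_below (J ` V)" using lb by (intro bdd_belowI2)
  define m where "m = Inf (J ` V)"
  have V0: "0 \<in> V" using V subspace_0 by blast
  have m_le: "m \<le> J v" if "v \<in> V" for v
    unfolding m_def using bdd that by (simp add: cINF_lower)
  have "\<exists>v\<in>V. J v < m + 1 / (real n + 1)" for n :: nat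
  proof -
    have "Inf (J ` V) < m + 1 / (real n + 1)" unfolding m_def by simp
    then show ?thesis using V0 bdd by (subst (asm) cInf_less_iff) auto
  qed
  then obtain x where x: "\<And>n. x n \<in> V" "\<And>n. J (x n) < m + 1 / (real n + 1)" by metis
  have par: "(norm (a - b))\<^sup>2 = 4 * (J a + J b - 2 * J ((1/2) *\<^sub>R (a + b)))" for a b
    unfolding J_def
    by (simp add: power2_norm_eq_inner inner_diff_left inner_diff_right inner_add_left inner_add_right
        F.scaleR F.add inner_commute algebra_simps)
  have close: "(norm (x i - x j))\<^sup>2 \<le> 4 * (1 / (real i + 1) + 1 / (real j + 1))" for i j
  proof -
    have "m \<le> J ((1/2) *\<^sub>R (x i + x j))"
      by (intro m_le subspace_scale subspace_add V x)
    moreover define s t where "s = 1 / (real i + 1)" and "t = 1 / (real j + 1)"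
    ultimately show ?thesis using x(2)[of i] x(2)[of j] unfolding par s_def[symmetric] t_def[symmetric]
      by (simp add: algebra_simps)
  qed
  have "Cauchy x"
  proof (rule metric_CauchyI)
    fix e :: real assume e: "e > 0"
    obtain N :: nat where N: "8 / e\<^sup>2 < real N" using reals_Archimedean2 by blast
    have "dist (x i) (x j) < e" if "i \<ge> N" "j \<ge> N" for i j
    proof -
      have "0 \<le> 8 / e\<^sup>2" by simp
      then have pos: "0 < real N" using N by linarith
      have "1 / (real i + 1) < 1 / real N" "1 / (real j + 1) < 1 / real N"
        using that pos by (auto intro!: divide_strict_left_mono mult_pos_pos)
      then have "(norm (x i - x j))\<^sup>2 < 8 / real N" using close[of i j] by simp
      also have "\<dots> < e\<^sup>2" using N e pos by (simp add: field_simps)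
      finally have "norm (x i - x j) < e" using e by (simp add: power2_less_imp_less)
      then show ?thesis by (simp add: dist_norm)
    qed
    then show "\<exists>M. \<forall>i\<ge>M. \<forall>j\<ge>M. dist (x i) (x j) < e" by blast
  qed
  then obtain r where r: "x \<longlonglongrightarrow> r" using Cauchy_convergent convergent_def by metis
  have rV: "r \<in> V" by (rule closed_sequentially[OF V(2) x(1) r])
  have "(\<lambda>n. J (x n)) \<longlonglongrightarrow> J r"
    unfolding J_def by (intro tendsto_intros F.tendsto r) auto
  moreover have "(\<lambda>n. m + 1 / (real n + 1)) \<longlonglongrightarrow> m + 0"
    by (intro tendsto_intros) (use LIMSEQ_inverse_real_of_nat in \<open>simp add: inverse_eq_divide add.commute\<close>)
  ultimately have Jr: "J r \<le> m"
    using x(2) by (intro LIMSEQ_le) (auto intro!: exI[of _ 0] less_imp_le)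
  have "F v = r \<bullet> v" if v: "v \<in> V" for v
  proof -
    have "r \<bullet> v - F v = 0"
    proof (rule linear_term_zero_of_quadratic_nonneg)
      fix e :: real
      have "J r \<le> J (r + e *\<^sub>R v)"
        using Jr by (rule order_trans) (intro m_le subspace_add subspace_scale V rV v)
      then show "0 \<le> e * (r \<bullet> v - F v) + e\<^sup>2 * ((v \<bullet> v) / 2)"
        unfolding J_def
        by (simp add: F.add F.scaleR inner_add_left inner_add_right inner_commute
            power2_eq_square algebra_simps)
    qed
    then show ?thesis by simp
  qed
  then show ?thesis using rV by blast
qed

text \<open>
  Riesz representation turns \<open>b\<close> into a map \<open>A\<close> on \<open>V\<close>, and \<open>w \<mapsto> w - \<rho> (A w - f)\<close> is a contraction for
  \<open>\<rho> = \<alpha> / K\<^sup>2\<close>: its squared Lipschitz constant is at most \<open>1 - \<alpha>\<^sup>2 / K\<^sup>2\<close>.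
\<close>

lemma lax_milgram_on_closed_subspace:
  fixes b :: "'a::{real_inner, complete_space} \<Rightarrow> 'a \<Rightarrow> real"
  assumes V: "subspace V" "closed V" and F: "bounded_linear F" and b: "bounded_bilinear b"
    and coerc: "\<alpha> > 0" "\<And>v. v \<in> V \<Longrightarrow> \<alpha> * (norm v)\<^sup>2 \<le> b v v"
  shows "\<exists>u\<in>V. \<forall>v\<in>V. b u v = F v"
proof -
  interpret b: bounded_bilinear b by fact
  obtain K0 where K0: "\<And>u v. \<bar>b u v\<bar> \<le> norm u * norm v * K0" "K0 > 0"
    using b.pos_bounded by auto
  \<comment> \<open>A bound \<open>K \<ge> \<alpha>\<close> keeps \<open>1 - \<alpha>\<^sup>2 / K\<^sup>2\<close> nonnegative.\<close>
  define K where "K = max K0 \<alpha>"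
  have K: "\<bar>b u v\<bar> \<le> norm u * norm v * K" "K > 0" "K \<ge> \<alpha>" for u v
    using K0(1)[of u v] K0(2) mult_left_mono[of K0 K "norm u * norm v"] unfolding K_def by auto
  obtain f where f: "f \<in> V" "\<And>v. v \<in> V \<Longrightarrow> F v = f \<bullet> v"
    using riesz_on_closed_subspace[OF V F] by auto
  have "\<exists>a\<in>V. \<forall>v\<in>V. b w v = a \<bullet> v" for w
    by (rule riesz_on_closed_subspace[OF V b.bounded_linear_right])
  then obtain A where A: "\<And>w. A w \<in> V" "\<And>w v. v \<in> V \<Longrightarrow> b w v = A w \<bullet> v" by metis
  define \<rho> where "\<rho> = \<alpha> / K\<^sup>2"
  define P where "P w = w - \<rho> *\<^sub>R (A w - f)" for w
  have PV: "P w \<in> V" if "w \<in> V" for w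
    unfolding P_def by (intro subspace_diff subspace_scale V A f that)
  define q where "q = 1 - \<alpha>\<^sup>2 / K\<^sup>2"
  have q: "0 \<le> q" "q < 1"
    using K(2,3) coerc(1) unfolding q_def by (auto simp: field_simps intro!: power_mono)
  have contr: "(norm (P w - P z))\<^sup>2 \<le> q * (norm (w - z))\<^sup>2" if wz: "w \<in> V" "z \<in> V" for w z
  proof -
    define d where "d = w - z"
    define a where "a = A w - A z"
    have dV: "d \<in> V" and aV: "a \<in> V" unfolding d_def a_def using wz A V by (auto intro: subspace_diff)
    have ba: "b d v = a \<bullet> v" if "v \<in> V" for v
      unfolding d_def a_def by (simp add: b.diff_left A that inner_diff_left)
    have "(norm a)\<^sup>2 = b d a" by (simp add: ba aV power2_norm_eq_inner)
    also have "\<dots> \<le> norm d * norm a * K" using K(1)[of d a] by linarith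
    finally have "norm a * norm a \<le> (norm d * K) * norm a" by (simp add: power2_eq_square mult_ac)
    then have "norm a \<le> norm d * K"
      using K by (cases "norm a = 0") auto
    then have a2: "(norm a)\<^sup>2 \<le> K\<^sup>2 * (norm d)\<^sup>2"
      using power_mono[of "norm a" "norm d * K" 2] by (simp add: power_mult_distrib mult.commute)
    have "(norm (P w - P z))\<^sup>2 = (norm (d - \<rho> *\<^sub>R a))\<^sup>2"
      unfolding P_def d_def a_def by (simp add: algebra_simps)
    also have "\<dots> = (norm d)\<^sup>2 - 2 * \<rho> * b d d + \<rho>\<^sup>2 * (norm a)\<^sup>2"
      unfolding power2_norm_eq_inner
      by (simp add: ba dV inner_diff_left inner_diff_right inner_commute power2_eq_square algebra_simps)
    also have "\<dots> \<le> (norm d)\<^sup>2 - 2 * \<rho> * (\<alpha> * (norm d)\<^sup>2) + \<rho>\<^sup>2 * (K\<^sup>2 * (norm d)\<^sup>2)"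
    proof -
      have "2 * \<rho> * (\<alpha> * (norm d)\<^sup>2) \<le> 2 * \<rho> * b d d"
        using coerc dV K unfolding \<rho>_def by (intro mult_left_mono) auto
      moreover have "\<rho>\<^sup>2 * (norm a)\<^sup>2 \<le> \<rho>\<^sup>2 * (K\<^sup>2 * (norm d)\<^sup>2)"
        using a2 by (intro mult_left_mono) auto
      ultimately show ?thesis by linarith
    qed
    also have "\<dots> = q * (norm d)\<^sup>2"
      using K(2) unfolding \<rho>_def q_def by (simp add: field_simps power2_eq_square)
    finally show ?thesis unfolding d_def .
  qed
  have "\<exists>!u\<in>V. P u = u"
  proof (rule Banach_fix)
    show "complete V" using V(2) by (simp add: complete_eq_closed)
    show "V \<noteq> {}" using V(1) subspace_0 by auto
    show "0 \<le> sqrt q" "sqrt q < 1" using q by auto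
    show "P ` V \<subseteq> V" using PV by auto
    show "dist (P x) (P y) \<le> sqrt q * dist x y" if "x \<in> V" "y \<in> V" for x y
      using real_sqrt_le_mono[OF contr[OF that]] by (simp add: real_sqrt_mult dist_norm)
  qed
  then obtain u where u: "u \<in> V" "P u = u" by auto
  have "\<rho> \<noteq> 0" using K coerc unfolding \<rho>_def by auto
  then have "A u = f" using u(2) unfolding P_def by auto
  then show ?thesis using A f u by (intro bexI[of _ u]) auto
qed

lemma subspace_closure_normed:
  fixes M :: "'a::real_normed_vector set"
  assumes "subspace M"
  shows "subspace (closure M)"
proof (rule subspaceI)
  show "0 \<in> closure M" using assms subspace_0 closure_subset by blast
  show "x + y \<in> closure M" if xy: "x \<in> closure M" "y \<in> closure M" for x y
  proof -
    obtain f g where "\<And>n. f n \<in> M" "f \<longlonglongrightarrow> x" "\<And>n. g n \<in> M" "g \<longlonglongrightarrow> y"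
      using xy unfolding closure_sequential by auto
    then have "\<forall>n::nat. f n + g n \<in> M" "(\<lambda>n. f n + g n) \<longlonglongrightarrow> x + y"
      using assms by (auto intro: subspace_add tendsto_add)
    then show ?thesis unfolding closure_sequential by (intro exI conjI)
  qed
  show "c *\<^sub>R x \<in> closure M" if xy: "x \<in> closure M" for c x
  proof -
    obtain f where "\<And>n. f n \<in> M" "f \<longlonglongrightarrow> x"
      using xy unfolding closure_sequential by auto
    then have "\<forall>n::nat. c *\<^sub>R f n \<in> M" "(\<lambda>n. c *\<^sub>R f n) \<longlonglongrightarrow> c *\<^sub>R x"
      using assms by (auto intro: subspace_scale tendsto_scaleR)
    then show ?thesis unfolding closure_sequential by (intro exI conjI)
  qed
qed

text \<open>
  The orthogonal projection of \<open>x\<close> to the closure leaves a remainder that is orthogonal to \<open>M\<close>,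
  hence to \<open>x\<close>, hence to itself.
\<close>

lemma in_closure_of_orthogonality:
  fixes x :: "'a::{real_inner, complete_space}"
  assumes M: "subspace M" and o: "\<And>d. (\<And>m. m \<in> M \<Longrightarrow> d \<bullet> m = 0) \<Longrightarrow> d \<bullet> x = 0"
  shows "x \<in> closure M"
proof -
  have s: "subspace (closure M)" using M by (rule subspace_closure_normed)
  obtain r where r: "r \<in> closure M" "\<And>v. v \<in> closure M \<Longrightarrow> x \<bullet> v = r \<bullet> v"
    using riesz_on_closed_subspace[OF s closed_closure bounded_linear_inner_right[of x]] by auto
  have "(x - r) \<bullet> m = 0" if "m \<in> M" for m
    using r(2)[of m] closure_subset that by (auto simp: inner_diff_left)
  then have "(x - r) \<bullet> x = 0" by (rule o)
  moreover have "(x - r) \<bullet> r = 0" using r by (simp add: inner_diff_left)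
  ultimately have "(x - r) \<bullet> (x - r) = 0" by (simp add: inner_diff_right)
  then show ?thesis using r(1) by simp
qed

lemma bounded_bilinear_plus:
  assumes "bounded_bilinear f" "bounded_bilinear g"
  shows "bounded_bilinear (\<lambda>x y. f x y + g x y)"
proof -
  interpret f: bounded_bilinear f by fact
  interpret g: bounded_bilinear g by fact
  obtain K where K: "\<And>x y. norm (f x y) \<le> norm x * norm y * K" using f.bounded by auto
  obtain L where L: "\<And>x y. norm (g x y) \<le> norm x * norm y * L" using g.bounded by auto
  show ?thesis
  proof
    show "\<exists>M. \<forall>x y. norm (f x y + g x y) \<le> norm x * norm y * M"
    proof (intro exI[of _ "K + L"] allI)
      fix x y
      show "norm (f x y + g x y) \<le> norm x * norm y * (K + L)"
        using norm_triangle_mono[OF K L, of x y x y] by (simp add: distrib_left)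
    qed
  qed (auto simp: f.add_left f.add_right g.add_left g.add_right f.scaleR_left f.scaleR_right
      g.scaleR_left g.scaleR_right scaleR_add_right)
qed

section \<open>Square-integrable functions on a set\<close>

text \<open>
  Extension by zero embeds the square-integrable functions on any set into one Hilbert space.
\<close>

definition ext :: "'a::euclidean_space set \<Rightarrow> ('a \<Rightarrow> 'b::euclidean_space) \<Rightarrow> 'a \<Rightarrow> 'b" where
  "ext S f = (\<lambda>x. indicat_real S x *\<^sub>R f x)"

definition cls :: "'a::euclidean_space set \<Rightarrow> ('a \<Rightarrow> 'b::euclidean_space) \<Rightarrow> ('a, 'b) l2" where
  "cls S f = abs_l2 (ext S f)"

lemma L2_iff_sq_int: "f \<in> L2 S \<longleftrightarrow> sq_int (ext S f)"
proof -
  have "(norm (indicat_real S x *\<^sub>R f x))\<^sup>2 = indicat_real S x *\<^sub>R (norm (f x))\<^sup>2" for x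
    by (auto simp: indicator_def)
  then show ?thesis
    unfolding L2_def sq_int_def ext_def set_borel_measurable_def set_integrable_def by simp
qed

lemma ext_add: "ext S (\<lambda>x. f x + g x) = (\<lambda>x. ext S f x + ext S g x)"
  and ext_diff: "ext S (\<lambda>x. f x - g x) = (\<lambda>x. ext S f x - ext S g x)"
  and ext_scaleR: "ext S (\<lambda>x. c *\<^sub>R f x) = (\<lambda>x. c *\<^sub>R ext S f x)"
  by (auto simp: ext_def scaleR_add_right scaleR_diff_right)

lemma L2_add: "f \<in> L2 S \<Longrightarrow> g \<in> L2 S \<Longrightarrow> (\<lambda>x. f x + g x) \<in> L2 S"
  and L2_diff: "f \<in> L2 S \<Longrightarrow> g \<in> L2 S \<Longrightarrow> (\<lambda>x. f x - g x) \<in> L2 S"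
  and L2_scaleR: "f \<in> L2 S \<Longrightarrow> (\<lambda>x. c *\<^sub>R f x) \<in> L2 S"
  by (auto simp: L2_iff_sq_int ext_add ext_diff ext_scaleR sq_int_add sq_int_diff sq_int_scaleR)

lemma L2_cmult: "(f :: _ \<Rightarrow> real) \<in> L2 S \<Longrightarrow> (\<lambda>x. c * f x) \<in> L2 S"
  using L2_scaleR[of f S c] by simp

lemma L2_zero: "(\<lambda>x. 0) \<in> L2 S"
  by (simp add: L2_iff_sq_int ext_def sq_int_zero)

lemma cls_add: "f \<in> L2 S \<Longrightarrow> g \<in> L2 S \<Longrightarrow> cls S (\<lambda>x. f x + g x) = cls S f + cls S g"
  and cls_diff: "f \<in> L2 S \<Longrightarrow> g \<in> L2 S \<Longrightarrow> cls S (\<lambda>x. f x - g x) = cls S f - cls S g"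
  and cls_scaleR: "f \<in> L2 S \<Longrightarrow> cls S (\<lambda>x. c *\<^sub>R f x) = c *\<^sub>R cls S f"
  by (auto simp: L2_iff_sq_int cls_def ext_add ext_diff ext_scaleR abs_l2_simps)

lemma cls_eq_iff:
  assumes "f \<in> L2 S" "g \<in> L2 S"
  shows "cls S f = cls S g \<longleftrightarrow> (AE x in lborel. x \<in> S \<longrightarrow> f x = g x)"
proof -
  have "(ext S f x = ext S g x) \<longleftrightarrow> (x \<in> S \<longrightarrow> f x = g x)" for x
    by (auto simp: ext_def indicator_def)
  then show ?thesis using assms by (simp add: L2_iff_sq_int cls_def l2_eq_iff)
qed

lemma inner_cls:
  assumes "f \<in> L2 S" "g \<in> L2 S"
  shows "cls S f \<bullet> cls S g = l2inner S f g"
proof -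
  have "ext S f x \<bullet> ext S g x = indicat_real S x *\<^sub>R (f x \<bullet> g x)" for x
    by (auto simp: ext_def indicator_def)
  then show ?thesis using assms
    by (simp add: L2_iff_sq_int cls_def abs_l2_simps l2inner_def set_lebesgue_integral_def)
qed

lemma norm_cls: "f \<in> L2 S \<Longrightarrow> norm (cls S f) = l2norm S f"
  by (simp add: norm_eq_sqrt_inner inner_cls l2inner_def l2norm_def power2_norm_eq_inner)

lemma cls_rep:
  fixes w :: "('a::euclidean_space, 'b::euclidean_space) l2"
  obtains f where "sq_int f" "w = abs_l2 f" "f \<in> L2 UNIV" "cls UNIV f = w"
proof -
  obtain f where f: "sq_int f" "w = abs_l2 f" by (rule l2_cases)
  moreover have "ext UNIV f = f" by (simp add: ext_def)
  ultimately show thesis using that by (simp add: L2_iff_sq_int cls_def)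
qed

lemma L2_subset:
  assumes "f \<in> L2 UNIV" "S \<in> sets borel"
  shows "f \<in> L2 S"
proof -
  have f: "f \<in> borel_measurable lborel" "integrable lborel (\<lambda>x. (norm (f x))\<^sup>2)"
    using assms(1) by (simp_all add: L2_iff_sq_int ext_def sq_int_def)
  have "set_integrable lborel S (\<lambda>x. (norm (f x))\<^sup>2)"
    unfolding set_integrable_def by (rule integrable_mult_indicator) (use f assms in auto)
  moreover have "set_borel_measurable lborel S f"
    unfolding set_borel_measurable_def using f assms by measurable
  ultimately show ?thesis by (simp add: L2_def)
qed

lemma L2_inner_integrable:
  assumes "f \<in> L2 S" "g \<in> L2 S"
  shows "set_integrable lborel S (\<lambda>x. f x \<bullet> g x)"
proof -
  have "ext S f x \<bullet> ext S g x = indicat_real S x *\<^sub>R (f x \<bullet> g x)" for x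
    by (auto simp: ext_def indicator_def)
  then show ?thesis using sq_int_inner[of "ext S f" "ext S g"] assms
    by (simp add: L2_iff_sq_int set_integrable_def)
qed

lemma L2_mult_bounded:
  fixes m :: "_ \<Rightarrow> real"
  assumes m: "set_borel_measurable lborel S m" "\<And>x. x \<in> S \<Longrightarrow> \<bar>m x\<bar> \<le> C" and f: "f \<in> L2 S"
  shows "(\<lambda>x. m x *\<^sub>R f x) \<in> L2 S"
proof -
  have mm[measurable]: "(\<lambda>x. indicat_real S x * m x) \<in> borel_measurable lborel"
    using m(1) by (simp add: set_borel_measurable_def)
  have fm[measurable]: "ext S f \<in> borel_measurable lborel" and fi: "integrable lborel (\<lambda>x. (norm (ext S f x))\<^sup>2)"
    using f by (auto simp: L2_iff_sq_int sq_int_def)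
  have e: "ext S (\<lambda>x. m x *\<^sub>R f x) = (\<lambda>x. (indicat_real S x * m x) *\<^sub>R ext S f x)"
    by (auto simp: ext_def indicator_def)
  show ?thesis
    unfolding L2_iff_sq_int e sq_int_def
  proof
    show "(\<lambda>x. (indicat_real S x * m x) *\<^sub>R ext S f x) \<in> borel_measurable lborel" by measurable
    show "integrable lborel (\<lambda>x. (norm ((indicat_real S x * m x) *\<^sub>R ext S f x))\<^sup>2)"
    proof (rule Bochner_Integration.integrable_bound)
      show "integrable lborel (\<lambda>x. C\<^sup>2 * (norm (ext S f x))\<^sup>2)" using fi by simp
      show "AE x in lborel. norm ((norm ((indicat_real S x * m x) *\<^sub>R ext S f x))\<^sup>2) \<le> norm (C\<^sup>2 * (norm (ext S f x))\<^sup>2)"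
      proof (rule AE_I2)
        fix x
        have "\<bar>m x\<bar>\<^sup>2 \<le> C\<^sup>2" if "x \<in> S" using m(2)[OF that] by (intro power_mono) auto
        then show "norm ((norm ((indicat_real S x * m x) *\<^sub>R ext S f x))\<^sup>2) \<le> norm (C\<^sup>2 * (norm (ext S f x))\<^sup>2)"
          by (auto simp: indicator_def power_mult_distrib intro!: mult_right_mono)
      qed
    qed measurable
  qed
qed

lemma L2_set_integrable:
  fixes f :: "'a::euclidean_space \<Rightarrow> 'b::euclidean_space"
  assumes "f \<in> L2 S" "S \<in> sets borel" "emeasure lborel S < \<infinity>"
  shows "set_integrable lborel S f"
proof -
  have fm[measurable]: "ext S f \<in> borel_measurable lborel" and fi: "integrable lborel (\<lambda>x. (norm (ext S f x))\<^sup>2)"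
    using assms by (auto simp: L2_iff_sq_int sq_int_def)
  have "integrable lborel (ext S f)"
  proof (rule Bochner_Integration.integrable_bound)
    show "integrable lborel (\<lambda>x. indicat_real S x + (norm (ext S f x))\<^sup>2)"
      using fi assms by (auto intro!: integrable_real_indicator)
    show "AE x in lborel. norm (ext S f x) \<le> norm (indicat_real S x + (norm (ext S f x))\<^sup>2)"
    proof (rule AE_I2)
      fix x
      have "0 \<le> (norm (f x) - 1)\<^sup>2" by simp
      then have "2 * norm (f x) \<le> 1 + (norm (f x))\<^sup>2"
        by (simp add: power2_diff)
      then have "norm (f x) \<le> 1 + (norm (f x))\<^sup>2"
        using norm_ge_zero[of "f x"] by linarith
      then show "norm (ext S f x) \<le> norm (indicat_real S x + (norm (ext S f x))\<^sup>2)"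
        by (auto simp: ext_def indicator_def)
    qed
  qed measurable
  then show ?thesis by (simp add: set_integrable_def ext_def)
qed

text \<open>
  The inner product with a weight, as a bounded bilinear form on classes. The case distinction
  lets it respect almost everywhere equality for every weight \<open>m\<close>.
\<close>

lift_definition wform :: "('a::euclidean_space \<Rightarrow> real) \<Rightarrow> ('a, 'b::euclidean_space) l2 \<Rightarrow> ('a, 'b) l2 \<Rightarrow> real"
  is "\<lambda>m f g. if m \<in> borel_measurable lborel then LINT x|lborel. m x * (f x \<bullet> g x) else 0"
  by (auto simp: sq_int_def intro!: integral_cong_AE)

lemma sq_int_mult:
  assumes [measurable]: "m \<in> borel_measurable lborel" and m: "\<And>x. \<bar>m x\<bar> \<le> C" and f: "sq_int f"
  shows "sq_int (\<lambda>x. m x *\<^sub>R f x)" "norm (abs_l2 (\<lambda>x. m x *\<^sub>R f x)) \<le> C * norm (abs_l2 f)"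
proof -
  have e: "f \<in> L2 UNIV" using f by (simp add: L2_iff_sq_int ext_def)
  show s: "sq_int (\<lambda>x. m x *\<^sub>R f x)"
    using L2_mult_bounded[of UNIV m C f] m e
    by (simp add: L2_iff_sq_int ext_def set_borel_measurable_def)
  have C: "C \<ge> 0" using m[of undefined] by linarith
  have "(LINT x|lborel. (norm (m x *\<^sub>R f x))\<^sup>2) \<le> (LINT x|lborel. C\<^sup>2 * (norm (f x))\<^sup>2)"
  proof (rule integral_mono)
    show "integrable lborel (\<lambda>x. (norm (m x *\<^sub>R f x))\<^sup>2)" using s by (simp add: sq_int_def)
    show "integrable lborel (\<lambda>x. C\<^sup>2 * (norm (f x))\<^sup>2)" using f by (simp add: sq_int_def)
    fix x show "(norm (m x *\<^sub>R f x))\<^sup>2 \<le> C\<^sup>2 * (norm (f x))\<^sup>2"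
      using power_mono[OF m[of x], of 2] by (auto simp: power_mult_distrib intro!: mult_right_mono)
  qed
  then have "(norm (abs_l2 (\<lambda>x. m x *\<^sub>R f x)))\<^sup>2 \<le> (C * norm (abs_l2 f))\<^sup>2"
    by (simp add: norm_abs_l2 s f power_mult_distrib)
  then show "norm (abs_l2 (\<lambda>x. m x *\<^sub>R f x)) \<le> C * norm (abs_l2 f)"
    by (rule power2_le_imp_le) (use C in auto)
qed

lemma wform_abs:
  assumes "sq_int f" "sq_int g" "m \<in> borel_measurable lborel" "\<And>x. \<bar>m x\<bar> \<le> C"
  shows "wform m (abs_l2 f) (abs_l2 g) = abs_l2 (\<lambda>x. m x *\<^sub>R f x) \<bullet> abs_l2 g"
  using sq_int_mult(1)[OF assms(3,4,1)] assms
  by (subst wform.abs_eq) (auto simp: abs_l2_simps)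

lemma bounded_bilinear_wform:
  assumes [measurable]: "m \<in> borel_measurable lborel" and m: "\<And>x. \<bar>m x\<bar> \<le> C"
  shows "bounded_bilinear (wform m :: ('a::euclidean_space, 'b::euclidean_space) l2 \<Rightarrow> _)"
proof
  fix a a' b b' :: "('a, 'b) l2" and r :: real
  obtain f where f: "sq_int f" "a = abs_l2 f" by (rule l2_cases)
  obtain f' where f': "sq_int f'" "a' = abs_l2 f'" by (rule l2_cases)
  obtain g where g: "sq_int g" "b = abs_l2 g" by (rule l2_cases)
  obtain g' where g': "sq_int g'" "b' = abs_l2 g'" by (rule l2_cases)
  note w = wform_abs[OF _ _ assms] and q = sq_int_mult(1)[OF assms]
  have "wform m (a + a') b = abs_l2 (\<lambda>x. m x *\<^sub>R f x + m x *\<^sub>R f' x) \<bullet> b"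
    unfolding f f' g abs_l2_simps(1)[OF f(1) f'(1)]
    by (simp add: w[OF sq_int_add[OF f(1) f'(1)] g(1)] scaleR_add_right)
  then show "wform m (a + a') b = wform m a b + wform m a' b"
    unfolding abs_l2_simps(1)[OF q[OF f(1)] q[OF f'(1)], symmetric]
    by (simp add: f f' g w inner_add_left)
  have "wform m a (b + b') = abs_l2 (\<lambda>x. m x *\<^sub>R f x) \<bullet> (b + b')"
    unfolding f g g' abs_l2_simps(1)[OF g(1) g'(1)] by (rule w[OF f(1) sq_int_add[OF g(1) g'(1)]])
  then show "wform m a (b + b') = wform m a b + wform m a b'"
    by (simp add: f g g' w inner_add_right)
  have "wform m (r *\<^sub>R a) b = abs_l2 (\<lambda>x. r *\<^sub>R (m x *\<^sub>R f x)) \<bullet> b"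
    unfolding f g abs_l2_simps(3)[OF f(1) f(1)]
    by (simp add: w[OF sq_int_scaleR[OF f(1)] g(1)] mult.commute)
  then show "wform m (r *\<^sub>R a) b = r *\<^sub>R wform m a b"
    unfolding abs_l2_simps(3)[OF q[OF f(1)] q[OF f(1)], symmetric]
    by (simp add: f g w)
  have "wform m a (r *\<^sub>R b) = abs_l2 (\<lambda>x. m x *\<^sub>R f x) \<bullet> (r *\<^sub>R b)"
    unfolding f g abs_l2_simps(3)[OF g(1) g(1)] by (rule w[OF f(1) sq_int_scaleR[OF g(1)]])
  then show "wform m a (r *\<^sub>R b) = r *\<^sub>R wform m a b"
    by (simp add: f g w)
next
  show "\<exists>K. \<forall>a b :: ('a, 'b) l2. norm (wform m a b) \<le> norm a * norm b * K"
  proof (intro exI[of _ C] allI)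
    fix a b :: "('a, 'b) l2"
    obtain f where f: "sq_int f" "a = abs_l2 f" by (rule l2_cases)
    obtain g where g: "sq_int g" "b = abs_l2 g" by (rule l2_cases)
    have "norm (wform m a b) \<le> norm (abs_l2 (\<lambda>x. m x *\<^sub>R f x)) * norm b"
      unfolding f g by (simp add: wform_abs[OF f(1) g(1) assms] Cauchy_Schwarz_ineq2)
    also have "\<dots> \<le> (C * norm a) * norm b"
      using sq_int_mult(2)[OF assms f(1)] f by (intro mult_right_mono) auto
    finally show "norm (wform m a b) \<le> norm a * norm b * C" by (simp add: mult_ac)
  qed
qed

lemma wform_cls:
  assumes m: "set_borel_measurable lborel S m" "\<And>x. x \<in> S \<Longrightarrow> \<bar>m x\<bar> \<le> C" and f: "f \<in> L2 S" "g \<in> L2 S"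
  shows "wform (ext S m) (cls S f) (cls S g) = (LINT x:S|lborel. m x * (f x \<bullet> g x))"
proof -
  have "ext S m \<in> borel_measurable lborel" using m(1) by (simp add: ext_def set_borel_measurable_def)
  then show ?thesis
    unfolding cls_def using f
    by (subst wform.abs_eq)
       (auto simp: L2_iff_sq_int set_lebesgue_integral_def ext_def indicator_def intro!: Bochner_Integration.integral_cong)
qed

lemma ext_bounded: "(\<And>x. x \<in> S \<Longrightarrow> \<bar>m x :: real\<bar> \<le> C) \<Longrightarrow> \<bar>ext S m x\<bar> \<le> \<bar>C\<bar>"
  by (force simp: ext_def indicator_def)

section \<open>Test functions\<close>

text \<open>
  Boxes generate the Borel sets and are stable under intersection, so that Dynkin's theorem
  applies.
\<close>

lemma borel_induct_boxes [consumes 1, case_names empty box compl union]: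
  assumes A: "A \<in> sets (borel :: 'a::euclidean_space measure)"
    and "P {}" "\<And>a b. P (box a b)" "\<And>A. A \<in> sets borel \<Longrightarrow> P A \<Longrightarrow> P (- A)"
    and "\<And>A :: nat \<Rightarrow> 'a set. disjoint_family A \<Longrightarrow> (\<And>i. A i \<in> sets borel) \<Longrightarrow> (\<And>i. P (A i)) \<Longrightarrow> P (\<Union>i. A i)"
  shows "P A"
proof -
  have st: "Int_stable (range (\<lambda>(a, b). box a b :: 'a set))"
    by (auto simp: Int_stable_def box_Int_box)
  have eq: "sets (borel :: 'a measure) = sigma_sets UNIV (range (\<lambda>(a, b). box a b))"
    by (subst borel_eq_box) simp
  have A': "A \<in> sigma_sets UNIV (range (\<lambda>(a, b). box a b))" using A eq by simp
  show ?thesis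
  proof (rule sigma_sets_induct_disjoint[OF st _ A', where P = P])
    show "P (UNIV - A)" if "A \<in> sigma_sets UNIV (range (\<lambda>(a, b). box a b))" "P A" for A
      using assms(4)[of A] that eq by (simp add: Compl_eq_Diff_UNIV)
    show "P (\<Union> (range A))" if "disjoint_family A"
      "range A \<subseteq> sigma_sets UNIV (range (\<lambda>(a, b). box a b))" "\<And>i. P (A i)" for A :: "nat \<Rightarrow> 'a set"
      using assms(5)[of A] that unfolding eq by blast
  qed (use assms in auto)
qed

text \<open>
  Inside a fixed box, induction over Borel sets extends the hypothesis from boxes to all Borel
  sets, and an integrable function without mass on any Borel set vanishes almost everywhere.
  Countably many boxes cover \<open>S\<close>.
\<close>

lemma AE_zero_of_box_integrals:
  fixes h :: "'a::euclidean_space \<Rightarrow> real"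
  assumes S: "open S" and h: "set_integrable lborel S h"
    and z: "\<And>a b. box a b \<subseteq> S \<Longrightarrow> (LINT x:box a b|lborel. h x) = 0"
  shows "AE x in lborel. x \<in> S \<longrightarrow> h x = 0"
proof -
  have hb: "AE x in lborel. x \<in> box c d \<longrightarrow> h x = 0" if cd: "box c d \<subseteq> S" for c d
  proof -
    define k where "k x = indicat_real (box c d) x * h x" for x
    have ki: "integrable lborel k"
      using set_integrable_subset[OF h _ cd] by (simp add: set_integrable_def k_def[abs_def])
    have kA: "set_integrable lborel A k" if "A \<in> sets borel" for A
      using integrable_mult_indicator[OF _ ki, of A] that by (simp add: set_integrable_def)
    have "(LINT x:A|lborel. k x) = 0" if A: "A \<in> sets borel" for A
      using A
    proof (induction rule: borel_induct_boxes)
      case empty show ?case by (simp add: set_lebesgue_integral_def)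
    next
      case (box a b)
      obtain e f where ef: "box a b \<inter> box c d = box e f" by (auto simp: box_Int_box)
      have "(LINT x:box a b|lborel. k x) = (LINT x:box e f|lborel. h x)"
        unfolding ef[symmetric] set_lebesgue_integral_def k_def
        by (rule Bochner_Integration.integral_cong) (auto simp: indicator_def)
      then show ?case using z[of e f] cd ef by auto
    next
      case (compl A)
      have "(LINT x:UNIV|lborel. k x) = (LINT x:box c d|lborel. h x)"
        unfolding set_lebesgue_integral_def k_def
        by (rule Bochner_Integration.integral_cong) (auto simp: indicator_def)
      moreover have "(LINT x:A \<union> -A|lborel. k x) = (LINT x:A|lborel. k x) + (LINT x:-A|lborel. k x)"
        by (rule set_integral_Un)
           (use compl kA[of A] kA[of "- A"] in auto)
      ultimately show ?case using z[OF cd] compl by simp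
    next
      case (union A)
      have "(LINT x:(\<Union>i. A i)|lborel. k x) = (\<Sum>i. (LINT x:A i|lborel. k x))"
        by (rule lebesgue_integral_countable_add)
           (use union kA[of "\<Union>i. A i"] in \<open>auto simp: disjoint_family_on_def\<close>)
      then show ?case using union by simp
    qed
    then have "AE x in lborel. k x = 0"
      using sigma_finite_measure.density_unique_banach[OF sigma_finite_lborel ki, of "\<lambda>x. 0"] by simp
    then show ?thesis by (auto simp: k_def indicator_def elim: eventually_mono)
  qed
  define a' where "a' f = (\<Sum>(i::'a)\<in>Basis. fst (f i :: real \<times> real) *\<^sub>R i)" for f
  define b' where "b' f = (\<Sum>(i::'a)\<in>Basis. snd (f i :: real \<times> real) *\<^sub>R i)" for f
  define I where "I = {f\<in>Basis \<rightarrow>\<^sub>E \<rat> \<times> \<rat>. box (a' f) (b' f) \<subseteq> S}"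
  have "countable (Basis \<rightarrow>\<^sub>E \<rat> \<times> \<rat> :: ('a \<Rightarrow> real \<times> real) set)"
    by (intro countable_PiE finite_Basis countable_SIGMA countable_rat)
  then have cI: "countable I" unfolding I_def by (rule countable_subset[rotated]) auto
  have SI: "S = (\<Union>f\<in>I. box (a' f) (b' f))"
    using open_UNION_box[OF S] unfolding I_def a'_def b'_def by simp
  have "AE x in lborel. \<forall>f\<in>I. x \<in> box (a' f) (b' f) \<longrightarrow> h x = 0"
    unfolding AE_ball_countable[OF cI]
  proof
    fix f assume "f \<in> I"
    then have "box (a' f) (b' f) \<subseteq> S" by (simp add: I_def)
    then show "AE x in lborel. x \<in> box (a' f) (b' f) \<longrightarrow> h x = 0" by (rule hb)
  qed
  then show ?thesis
  proof eventually_elim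
    case (elim x) then show ?case using SI by auto
  qed
qed

text \<open>
  Finite orders of smoothness. The recursion through partial derivatives admits induction on
  the order, as the product rule requires.
\<close>

primrec csm :: "nat \<Rightarrow> ('a::euclidean_space \<Rightarrow> real) \<Rightarrow> bool" where
  "csm 0 f \<longleftrightarrow> (\<forall>x. f differentiable (at x))"
| "csm (Suc k) f \<longleftrightarrow> (\<forall>x. f differentiable (at x)) \<and> (\<forall>b\<in>Basis. csm k (pderiv_dir b f))"

lemma csm_SucD: "csm (Suc k) f \<Longrightarrow> csm k f"
proof (induction k arbitrary: f)
  case (Suc k)
  have "csm k (pderiv_dir b f)" if "b \<in> Basis" for b
  proof -
    have "csm (Suc k) (pderiv_dir b f)" using Suc.prems that by (simp only: csm.simps) blast
    then show ?thesis by (rule Suc.IH)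
  qed
  moreover have "\<forall>x. f differentiable (at x)" using Suc.prems by (simp only: csm.simps) blast
  ultimately show ?case by (simp only: csm.simps) blast
qed simp

lemma smooth_funI:
  assumes "\<And>k. csm k f"
  shows "smooth_fun f"
proof -
  have "csm (length bs) f \<Longrightarrow> set bs \<subseteq> Basis \<Longrightarrow> foldr pderiv_dir bs f differentiable (at x)" for bs x
  proof (induction bs arbitrary: f rule: rev_induct)
    case (snoc b bs)
    then have "csm (length bs) (pderiv_dir b f)" by simp
    then show ?case using snoc by simp
  qed simp
  then show ?thesis using assms by (simp add: smooth_fun_def)
qed

lemma pderiv_dir_eq: "(f has_derivative D) (at x) \<Longrightarrow> pderiv_dir b f x = D b"
  unfolding pderiv_dir_def using frechet_derivative_at by metis

lemma has_derivative_frechet: "f differentiable (at x) \<Longrightarrow> (f has_derivative (\<lambda>b. pderiv_dir b f x)) (at x)"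
  unfolding pderiv_dir_def using frechet_derivative_works by (metis eta_contract_eq)

lemma csm_const: "csm k (\<lambda>x. c)"
proof (induction k arbitrary: c)
  case (Suc k)
  have "pderiv_dir b (\<lambda>x. c) = (\<lambda>x. 0)" for b :: 'a
    by (rule HOL.ext) (rule pderiv_dir_eq, rule has_derivative_const)
  then show ?case using Suc by simp
qed simp

lemma csm_add: "csm k f \<Longrightarrow> csm k g \<Longrightarrow> csm k (\<lambda>x. f x + g x)"
proof (induction k arbitrary: f g)
  case (Suc k)
  have "pderiv_dir b (\<lambda>x. f x + g x) = (\<lambda>x. pderiv_dir b f x + pderiv_dir b g x)" for b
    by (rule HOL.ext, rule pderiv_dir_eq, intro has_derivative_add has_derivative_frechet)
       (use Suc.prems in auto)
  then show ?case using Suc by (auto intro: differentiable_add)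
qed (auto intro: differentiable_add)

lemma csm_mult: "csm k f \<Longrightarrow> csm k g \<Longrightarrow> csm k (\<lambda>x. f x * g x)"
proof (induction k arbitrary: f g)
  case (Suc k)
  have d: "pderiv_dir b (\<lambda>x. f x * g x) = (\<lambda>x. f x * pderiv_dir b g x + pderiv_dir b f x * g x)" for b
    by (rule HOL.ext, rule pderiv_dir_eq, intro has_derivative_mult has_derivative_frechet)
       (use Suc.prems in auto)
  have "csm k f" "csm k g" using Suc.prems csm_SucD by blast+
  then show ?case using Suc by (auto simp: d intro!: differentiable_mult csm_add)
qed (auto intro: differentiable_mult)

lemma csm_prod: "finite I \<Longrightarrow> (\<And>i. i \<in> I \<Longrightarrow> csm k (f i)) \<Longrightarrow> csm k (\<lambda>x. \<Prod>i\<in>I. f i x)"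
  by (induction I rule: finite_induct) (auto intro: csm_const csm_mult)

text \<open>
  The building block \<open>exp (- 1 / t)\<close> of bump functions, multiplied by powers of \<open>1 / t\<close>: this
  family is closed under differentiation up to linear combinations, which gives smoothness at
  \<open>0\<close> by induction.
\<close>

definition flat :: "nat \<Rightarrow> real \<Rightarrow> real" where
  "flat m t = (if t > 0 then (1 / t) ^ m * exp (- (1 / t)) else 0)"

lemma flat_tendsto_0: "((\<lambda>t::real. (1 / t) ^ m * exp (- (1 / t))) \<longlongrightarrow> 0) (at_right 0)"
proof -
  have "((\<lambda>s::real. s ^ m / exp s) \<longlongrightarrow> 0) at_top" by (rule tendsto_power_div_exp_0)
  then have "((\<lambda>t::real. (inverse t) ^ m / exp (inverse t)) \<longlongrightarrow> 0) (at_right 0)"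
    by (rule filterlim_compose[OF _ filterlim_inverse_at_top_right])
  then show ?thesis by (simp add: exp_minus inverse_eq_divide)
qed

lemma flat_deriv: "(flat m has_field_derivative (flat (m + 2) t - real m * flat (Suc m) t)) (at t)"
proof -
  consider "t > 0" | "t < 0" | "t = 0" by linarith
  then show ?thesis
  proof cases
    case 1
    have "((\<lambda>t. (1 / t) ^ m * exp (- (1 / t))) has_field_derivative (flat (m + 2) t - real m * flat (Suc m) t)) (at t)"
    proof -
      have a: "((\<lambda>t. 1 / t) has_field_derivative - ((1 / t)\<^sup>2)) (at t)"
        using 1 by (auto intro!: derivative_eq_intros simp: power2_eq_square)
      have b: "((\<lambda>t. exp (- (1 / t))) has_field_derivative exp (- (1 / t)) * (1 / t)\<^sup>2) (at t)"
        using DERIV_chain2[OF DERIV_exp DERIV_minus[OF a]] by simp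
      have c: "((\<lambda>t. (1 / t) ^ m) has_field_derivative - (real m * (1 / t) ^ Suc m)) (at t)"
      proof (cases m)
        case (Suc n)
        show ?thesis unfolding Suc
          by (rule DERIV_cong[OF DERIV_power_Suc[OF a]]) (simp add: power2_eq_square algebra_simps)
      qed simp
      show ?thesis
        by (rule DERIV_cong[OF DERIV_mult[OF c b]]) (use 1 in \<open>simp add: flat_def power_add power2_eq_square algebra_simps\<close>)
    qed
    then show ?thesis
      by (rule has_field_derivative_transform_within[where d = t]) (use 1 in \<open>auto simp: flat_def dist_real_def\<close>)
  next
    case 2
    have "((\<lambda>t. 0) has_field_derivative (flat (m + 2) t - real m * flat (Suc m) t)) (at t)"
      using 2 by (simp add: flat_def)
    then show ?thesis
      by (rule has_field_derivative_transform_within[where d = "- t"]) (use 2 in \<open>auto simp: flat_def dist_real_def\<close>)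
  next
    case 3
    have "((\<lambda>h. flat m h / h) \<longlongrightarrow> 0) (at 0)"
    proof (rule filterlim_split_at)
      have "((\<lambda>h. flat m h / h) \<longlongrightarrow> 0) (at_left 0) \<longleftrightarrow> ((\<lambda>h. 0::real) \<longlongrightarrow> 0) (at_left (0::real))"
        by (rule tendsto_cong) (auto simp: flat_def eventually_at_left_field intro!: exI[of _ "-1"])
      then show "((\<lambda>h. flat m h / h) \<longlongrightarrow> 0) (at_left 0)" by simp
      have "((\<lambda>h. flat m h / h) \<longlongrightarrow> 0) (at_right 0) \<longleftrightarrow> ((\<lambda>t::real. (1 / t) ^ Suc m * exp (- (1 / t))) \<longlongrightarrow> 0) (at_right 0)"
      proof (rule tendsto_cong)
        show "\<forall>\<^sub>F t in at_right 0. flat m t / t = (1 / t) ^ Suc m * exp (- (1 / t))"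
          unfolding eventually_at_right_field by (intro exI[of _ 1]) (auto simp: flat_def)
      qed
      then show "((\<lambda>h. flat m h / h) \<longlongrightarrow> 0) (at_right 0)" using flat_tendsto_0 by blast
    qed
    then show ?thesis using 3 by (simp add: DERIV_def flat_def)
  qed
qed

lemma csm_flat_affine: "csm k (\<lambda>x::'a::euclidean_space. flat m (c * (x \<bullet> i) + d))"
proof (induction k arbitrary: m)
  have h: "((\<lambda>x::'a. flat m (c * (x \<bullet> i) + d)) has_derivative
     (\<lambda>b. (c * (b \<bullet> i)) * (flat (m + 2) (c * (x \<bullet> i) + d) - real m * flat (Suc m) (c * (x \<bullet> i) + d)))) (at x)" for m x
  proof -
    have "((\<lambda>x::'a. c * (x \<bullet> i) + d) has_derivative (\<lambda>b. c * (b \<bullet> i))) (at x)"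
      by (auto intro!: derivative_eq_intros)
    moreover have "(flat m has_derivative (\<lambda>s. s * (flat (m + 2) (c * (x \<bullet> i) + d) - real m * flat (Suc m) (c * (x \<bullet> i) + d))))
       (at (c * (x \<bullet> i) + d))"
      using flat_deriv[of m] by (simp add: has_field_derivative_def mult.commute[of _ "_ - _"] mult_commute_abs)
    ultimately show ?thesis using has_derivative_compose by blast
  qed
  {
    case 0
    then show ?case using h unfolding differentiable_def csm.simps by blast
  next
    case (Suc k)
    have d: "pderiv_dir b (\<lambda>x::'a. flat m (c * (x \<bullet> i) + d)) = (\<lambda>x.
     (c * (b \<bullet> i)) * (flat (m + 2) (c * (x \<bullet> i) + d) + (- real m) * flat (Suc m) (c * (x \<bullet> i) + d)))" for b
      by (rule HOL.ext) (simp add: pderiv_dir_eq[OF h])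
    have "csm k (\<lambda>x. c * (b \<bullet> i) *
               (flat (m + 2) (c * (x \<bullet> i) + d) + - real m * flat (Suc m) (c * (x \<bullet> i) + d)))" for b
      by (intro csm_mult csm_add csm_const Suc)
    then show ?case
      using h unfolding csm.simps d differentiable_def by blast
  }
qed

text \<open>
  A smooth function below the indicator of \<open>box a b\<close> which vanishes within distance \<open>1 / n\<close> of its
  faces and tends to the indicator.
\<close>

definition bump :: "'a::euclidean_space \<Rightarrow> 'a \<Rightarrow> nat \<Rightarrow> 'a \<Rightarrow> real" where
  "bump a b n x = (\<Prod>i\<in>Basis. flat 0 (real n * (x \<bullet> i) + (- real n * (a \<bullet> i) - 1)) *
     flat 0 (- real n * (x \<bullet> i) + (real n * (b \<bullet> i) - 1)))"

lemma flat_0_bounds: "0 \<le> flat 0 t" "flat 0 t \<le> 1"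
  by (auto simp: flat_def)

lemma flat_0_tendsto_1:
  assumes "u > 0"
  shows "(\<lambda>n. flat 0 (real n * u - 1)) \<longlonglongrightarrow> 1"
proof -
  have "filterlim (\<lambda>n. - 1 + real n * u) at_top sequentially"
    by (intro filterlim_tendsto_add_at_top[OF tendsto_const] filterlim_at_top_mult_tendsto_pos[OF tendsto_const assms]
        filterlim_real_sequentially)
  then have l: "filterlim (\<lambda>n. real n * u - 1) at_top sequentially" by (simp add: algebra_simps)
  then have "(\<lambda>n. inverse (real n * u - 1)) \<longlonglongrightarrow> 0"
    by (rule filterlim_compose[OF tendsto_inverse_0_at_top[OF filterlim_ident]])
  then have "(\<lambda>n. exp (- inverse (real n * u - 1))) \<longlonglongrightarrow> exp (- 0)"
    by (intro tendsto_intros)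
  moreover have "eventually (\<lambda>n. flat 0 (real n * u - 1) = exp (- inverse (real n * u - 1))) sequentially"
    using l[unfolded filterlim_at_top_dense, rule_format, of 0]
    by eventually_elim (simp add: flat_def inverse_eq_divide)
  ultimately show ?thesis by (simp add: tendsto_cong)
qed

lemma bump_bounds: "0 \<le> bump a b n x" "bump a b n x \<le> 1"
  unfolding bump_def by (auto intro!: prod_nonneg prod_le_1 mult_le_one flat_0_bounds mult_nonneg_nonneg)

lemma bump_support:
  assumes "bump a b n x \<noteq> 0" "i \<in> Basis"
  shows "a \<bullet> i + 1 / real n \<le> x \<bullet> i \<and> x \<bullet> i \<le> b \<bullet> i - 1 / real n \<and> n > 0"
proof -
  have "flat 0 (real n * (x \<bullet> i) + (- real n * (a \<bullet> i) - 1)) \<noteq> 0"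
       "flat 0 (- real n * (x \<bullet> i) + (real n * (b \<bullet> i) - 1)) \<noteq> 0"
    using assms unfolding bump_def by auto
  then have 1: "real n * (x \<bullet> i) + (- real n * (a \<bullet> i) - 1) > 0"
       "- real n * (x \<bullet> i) + (real n * (b \<bullet> i) - 1) > 0"
    by (auto simp: flat_def split: if_splits)
  then have "n > 0" by (cases n) auto
  then show ?thesis using 1 by (auto simp: field_simps)
qed

lemma bump_tendsto: "(\<lambda>n. bump a b n x) \<longlonglongrightarrow> indicat_real (box a b) x"
proof (cases "x \<in> box a b")
  case True
  have "(\<lambda>n. flat 0 (real n * (x \<bullet> i - a \<bullet> i) - 1) * flat 0 (real n * (b \<bullet> i - x \<bullet> i) - 1)) \<longlonglongrightarrow> 1 * 1"
    if "i \<in> Basis" for i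
    by (intro tendsto_mult flat_0_tendsto_1) (use True that in \<open>auto simp: mem_box\<close>)
  then have "(\<lambda>n. \<Prod>i\<in>Basis. flat 0 (real n * (x \<bullet> i - a \<bullet> i) - 1) * flat 0 (real n * (b \<bullet> i - x \<bullet> i) - 1)) \<longlonglongrightarrow> (\<Prod>i\<in>(Basis::'a set). 1 * 1)"
    by (rule tendsto_prod)
  then show ?thesis using True unfolding bump_def by (simp add: algebra_simps)
next
  case False
  then obtain i where i: "i \<in> Basis" "\<not> (a \<bullet> i < x \<bullet> i \<and> x \<bullet> i < b \<bullet> i)" by (auto simp: mem_box)
  have "bump a b n x = 0" for n
  proof (rule ccontr)
    assume nz: "bump a b n x \<noteq> 0"
    have "1 / real n > 0" using bump_support[OF nz i(1)] by simp
    then show False using bump_support[OF nz i(1)] i(2) by linarith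
  qed
  then show ?thesis using False by simp
qed

lemma bump_test_function:
  assumes "box a b \<subseteq> S"
  shows "bump a b n \<in> test_functions S"
proof -
  define K where "K = {x. n > 0 \<and> (\<forall>i\<in>Basis. a \<bullet> i + 1 / real n \<le> x \<bullet> i \<and> x \<bullet> i \<le> b \<bullet> i - 1 / real n)}"
  have Kc: "K \<subseteq> cbox (a + (1 / real n) *\<^sub>R One) (b - (1 / real n) *\<^sub>R One)"
    by (auto simp: K_def mem_box inner_add_left inner_diff_left)
  have K: "closed K"
  proof (cases "n > 0")
    case True
    then have "K = cbox (a + (1 / real n) *\<^sub>R One) (b - (1 / real n) *\<^sub>R One)"
      by (auto simp: K_def mem_box inner_add_left inner_diff_left)
    then show ?thesis by (simp only: closed_cbox)
  qed (simp add: K_def)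
  have "{x. bump a b n x \<noteq> 0} \<subseteq> K" 
  proof
    fix x assume "x \<in> {x. bump a b n x \<noteq> 0}"
    then have nz: "bump a b n x \<noteq> 0" by simp
    show "x \<in> K"
      using bump_support[OF nz] nonempty_Basis unfolding K_def by blast
  qed
  then have c: "closure {x. bump a b n x \<noteq> 0} \<subseteq> K" using K by (rule closure_minimal)
  have "compact (closure {x. bump a b n x \<noteq> 0})"
    using c Kc by (meson bounded_cbox bounded_subset closed_closure compact_eq_bounded_closed)
  moreover have "K \<subseteq> box a b"
  proof
    fix x assume x: "x \<in> K"
    then have n: "1 / real n > 0" by (auto simp: K_def)
    have "a \<bullet> i < x \<bullet> i \<and> x \<bullet> i < b \<bullet> i" if "i \<in> Basis" for i
    proof -
      have "a \<bullet> i + 1 / real n \<le> x \<bullet> i \<and> x \<bullet> i \<le> b \<bullet> i - 1 / real n"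
        using x that by (simp add: K_def)
      then show ?thesis using n by linarith
    qed
    then show "x \<in> box a b" by (simp add: mem_box)
  qed
  moreover have "smooth_fun (bump a b n)"
    unfolding bump_def[abs_def]
    by (intro smooth_funI csm_prod csm_mult csm_flat_affine finite_Basis)
  ultimately show ?thesis using c assms by (auto simp: test_functions_def)
qed

lemma test_differentiable:
  assumes "\<phi> \<in> test_functions S" "b \<in> Basis"
  shows "\<phi> differentiable (at x)" "pderiv_dir b \<phi> differentiable (at x)"
proof -
  have s: "\<And>bs x. set bs \<subseteq> Basis \<Longrightarrow> foldr pderiv_dir bs \<phi> differentiable (at x)"
    using assms by (auto simp: test_functions_def smooth_fun_def)
  show "\<phi> differentiable (at x)" using s[of "[]"] by simp
  show "pderiv_dir b \<phi> differentiable (at x)" using s[of "[b]"] assms by simp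
qed

lemma continuous_on_of_differentiable:
  assumes "\<And>x. (f :: 'a::euclidean_space \<Rightarrow> real) differentiable (at x)"
  shows "continuous_on UNIV f"
  by (meson assms continuous_at_imp_continuous_on differentiable_imp_continuous_within)

lemma pderiv_dir_zero_off_support:
  assumes "x \<notin> closure {x. \<phi> x \<noteq> 0}"
  shows "pderiv_dir b \<phi> x = 0"
proof -
  have "((\<lambda>x. 0::real) has_derivative (\<lambda>b. 0)) (at x)" by simp
  then have "(\<phi> has_derivative (\<lambda>b. 0)) (at x)"
    by (rule has_derivative_transform_within_open[where s = "- closure {x. \<phi> x \<noteq> 0}"])
       (use assms closure_subset[of "{x. \<phi> x \<noteq> 0}"] in auto)
  then show ?thesis by (simp add: pderiv_dir_eq)
qed

lemma bounded_of_compact_support: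
  fixes f :: "'a::euclidean_space \<Rightarrow> real"
  assumes "continuous_on UNIV f" "compact K" "\<And>x. x \<notin> K \<Longrightarrow> f x = 0"
  obtains M where "\<And>x. \<bar>f x\<bar> \<le> M"
proof -
  have "compact (f ` K)" using assms by (meson compact_continuous_image continuous_on_subset subset_UNIV)
  then obtain M where M: "\<And>x. x \<in> K \<Longrightarrow> \<bar>f x\<bar> \<le> M"
    using compact_imp_bounded bounded_iff by (metis imageI real_norm_def)
  have "\<bar>f x\<bar> \<le> max M 0" for x
    using M[of x] assms(3)[of x] by (cases "x \<in> K") auto
  then show ?thesis by (rule that)
qed

lemma integrable_of_compact_support:
  fixes f :: "'a::euclidean_space \<Rightarrow> real"
  assumes "continuous_on UNIV f" "compact K" "\<And>x. x \<notin> K \<Longrightarrow> f x = 0"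
  shows "integrable lborel f"
proof -
  have "set_integrable lborel K f"
    using assms(1,2) by (meson borel_integrable_compact continuous_on_subset subset_UNIV set_integrable_def)
  moreover have "(\<lambda>x. indicat_real K x *\<^sub>R f x) = f"
    using assms(3) by (auto simp: fun_eq_iff indicator_def)
  ultimately show ?thesis by (simp add: set_integrable_def)
qed

lemma integral_translate:
  fixes F :: "'a::euclidean_space \<Rightarrow> real"
  assumes "F \<in> borel_measurable borel"
  shows "(LINT x|lborel. F (x + c)) = (LINT x|lborel. F x)"
proof -
  have "(LINT x|lborel. F x) = (LINT x|distr lborel borel ((+) c). F x)" by (simp add: lborel_distr_plus)
  also have "\<dots> = (LINT x|lborel. F (c + x))" using assms by (subst integral_distr) auto
  finally show ?thesis by (simp add: add.commute)
qed

text \<open>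
  The difference quotients of \<open>F\<close> have integral zero by translation invariance. They converge
  pointwise to the derivative and are bounded on a ball, so dominated convergence applies.
\<close>

lemma integral_pderiv_dir_zero:
  fixes F :: "'a::euclidean_space \<Rightarrow> real"
  assumes d: "\<And>x. F differentiable (at x)" and c: "continuous_on UNIV (pderiv_dir b F)"
    and K: "compact K" "\<And>x. x \<notin> K \<Longrightarrow> F x = 0" "\<And>x. x \<notin> K \<Longrightarrow> pderiv_dir b F x = 0"
  shows "(LINT x|lborel. pderiv_dir b F x) = 0"
proof -
  obtain M where M: "\<And>x. \<bar>pderiv_dir b F x\<bar> \<le> M"
    using bounded_of_compact_support[OF c K(1,3)] by blast
  obtain R where R: "\<And>x. x \<in> K \<Longrightarrow> norm x \<le> R" using compact_imp_bounded[OF K(1)] bounded_iff by metis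
  have Fc: "continuous_on UNIV F" by (rule continuous_on_of_differentiable[OF d])
  have [measurable]: "F \<in> borel_measurable borel" by (rule borel_measurable_continuous_onI[OF Fc])
  have [measurable]: "pderiv_dir b F \<in> borel_measurable borel" by (rule borel_measurable_continuous_onI[OF c])
  have Fi: "integrable lborel F" by (rule integrable_of_compact_support[OF Fc K(1,2)])
  define D where "D n x = real (Suc n) * (F (x + (1 / real (Suc n)) *\<^sub>R b) - F x)" for n x
  have Ft: "integrable lborel (\<lambda>x. F (x + c))" for c
  proof -
    have "continuous_on UNIV (\<lambda>x. F (x + c))"
      by (rule continuous_on_compose2[OF Fc]) (auto intro!: continuous_intros)
    moreover have "compact ((\<lambda>x. x - c) ` K)"
      by (rule compact_continuous_image) (auto intro!: continuous_intros K)
    moreover have "F (x + c) = 0" if "x \<notin> (\<lambda>x. x - c) ` K" for x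
      using that K(2)[of "x + c"] by (metis add_diff_cancel_right' image_eqI)
    ultimately show ?thesis by (rule integrable_of_compact_support)
  qed
  have D0: "(LINT x|lborel. D n x) = 0" for n
    unfolding D_def using Fi Ft by (simp add: integral_translate)
  have deriv: "((\<lambda>t. F (x + t *\<^sub>R b)) has_real_derivative pderiv_dir b F (x + t *\<^sub>R b)) (at t)" for x t
  proof -
    have "((\<lambda>t. x + t *\<^sub>R b) has_derivative (\<lambda>s. s *\<^sub>R b)) (at t)"
      by (auto intro!: derivative_eq_intros)
    from has_derivative_compose[OF this has_derivative_frechet[OF d]]
    have h: "((\<lambda>t. F (x + t *\<^sub>R b)) has_derivative (\<lambda>s. pderiv_dir (s *\<^sub>R b) F (x + t *\<^sub>R b))) (at t)" .
    have "linear (\<lambda>v. pderiv_dir v F (x + t *\<^sub>R b))"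
      using has_derivative_frechet[OF d] has_derivative_linear by blast
    then have "pderiv_dir (s *\<^sub>R b) F (x + t *\<^sub>R b) = s * pderiv_dir b F (x + t *\<^sub>R b)" for s
      using linear_scale by fastforce
    then show ?thesis using h by (simp add: has_field_derivative_def mult.commute[of "pderiv_dir _ _ _"] mult_commute_abs)
  qed
  have lim: "(\<lambda>n. D n x) \<longlonglongrightarrow> pderiv_dir b F x" for x
  proof -
    have "((\<lambda>h. (F (x + h *\<^sub>R b) - F x) / h) \<longlongrightarrow> pderiv_dir b F x) (at 0)"
      using deriv[of x 0] by (simp add: DERIV_def)
    moreover have "filterlim (\<lambda>n. 1 / real (Suc n)) (at 0) sequentially"
      using LIMSEQ_inverse_real_of_nat by (auto simp: filterlim_at inverse_eq_divide)
    ultimately have "(\<lambda>n. (F (x + (1 / real (Suc n)) *\<^sub>R b) - F x) / (1 / real (Suc n))) \<longlonglongrightarrow> pderiv_dir b F x"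
      by (rule filterlim_compose)
    then show ?thesis unfolding D_def by (simp add: mult.commute)
  qed
  have bd: "\<bar>D n x\<bar> \<le> \<bar>M\<bar> * indicat_real (cball 0 (R + norm b)) x" for n x
  proof (cases "norm x \<le> R + norm b")
    case True
    have "\<exists>z. 0 < z \<and> z < 1 / real (Suc n) \<and>
      F (x + (1 / real (Suc n)) *\<^sub>R b) - F (x + 0 *\<^sub>R b) = (1 / real (Suc n) - 0) * pderiv_dir b F (x + z *\<^sub>R b)"
      by (rule MVT2) (auto intro: deriv)
    then obtain z where "F (x + (1 / real (Suc n)) *\<^sub>R b) - F x = (1 / real (Suc n)) * pderiv_dir b F (x + z *\<^sub>R b)"
      by auto
    then have "D n x = pderiv_dir b F (x + z *\<^sub>R b)" unfolding D_def by simp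
    then show ?thesis using True M[of "x + z *\<^sub>R b"] by (auto simp: indicator_def)
  next
    case False
    have "x \<notin> K" using False R[of x] norm_ge_zero[of b] by linarith
    moreover have "x + (1 / real (Suc n)) *\<^sub>R b \<notin> K"
    proof
      assume "x + (1 / real (Suc n)) *\<^sub>R b \<in> K"
      then have a: "norm (x + (1 / real (Suc n)) *\<^sub>R b) \<le> R" by (rule R)
      have "norm x \<le> norm (x + (1 / real (Suc n)) *\<^sub>R b) + norm ((1 / real (Suc n)) *\<^sub>R b)"
        using norm_triangle_ineq4[of "x + (1 / real (Suc n)) *\<^sub>R b" "(1 / real (Suc n)) *\<^sub>R b"] by simp
      also have "norm ((1 / real (Suc n)) *\<^sub>R b) \<le> norm b"
        by (simp add: divide_le_eq mult_left_le_one_le  mult_le_cancel_left1)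
      finally show False using a False by linarith
    qed
    ultimately show ?thesis by (simp add: D_def K)
  qed
  have "(\<lambda>n. LINT x|lborel. D n x) \<longlonglongrightarrow> (LINT x|lborel. pderiv_dir b F x)"
  proof (rule integral_dominated_convergence)
    show "integrable lborel (\<lambda>x. \<bar>M\<bar> * indicat_real (cball 0 (R + norm b)) x)"
      by (intro integrable_mult_right integrable_real_indicator) (auto simp: emeasure_lborel_cball_finite[unfolded infinity_ennreal_def])
    show "AE x in lborel. (\<lambda>n. D n x) \<longlonglongrightarrow> pderiv_dir b F x" using lim by simp
    show "AE x in lborel. norm (D n x) \<le> \<bar>M\<bar> * indicat_real (cball 0 (R + norm b)) x" for n using bd by simp
    show "pderiv_dir b F \<in> borel_measurable lborel" by measurable
    show "D n \<in> borel_measurable lborel" for n unfolding D_def[abs_def]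
      by (intro borel_measurable_times borel_measurable_diff borel_measurable_const
          borel_measurable_integrable[OF Ft] borel_measurable_integrable[OF Fi])
  qed
  then show ?thesis by (simp add: D0 LIMSEQ_const_iff)
qed

section \<open>Weak derivatives and functions vanishing on the boundary\<close>

lemma L2_of_compact_support:
  fixes f :: "'a::euclidean_space \<Rightarrow> 'b::euclidean_space"
  assumes f: "continuous_on UNIV f" "compact K" "\<And>x. x \<notin> K \<Longrightarrow> f x = 0" and S: "S \<in> sets borel"
  shows "f \<in> L2 S"
proof (rule L2_subset[OF _ S])
  have "integrable lborel (\<lambda>x. (norm (f x))\<^sup>2)"
    by (rule integrable_of_compact_support[OF _ f(2)]) (use f in \<open>auto intro!: continuous_intros\<close>)
  moreover have "f \<in> borel_measurable borel" by (rule borel_measurable_continuous_onI[OF f(1)])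
  ultimately show "f \<in> L2 UNIV" by (simp add: L2_iff_sq_int ext_def sq_int_def)
qed

lemma test_function_props:
  assumes p: "\<phi> \<in> test_functions S" and b: "b \<in> Basis"
  shows "continuous_on UNIV \<phi>" "continuous_on UNIV (pderiv_dir b \<phi>)"
    "compact (closure {x. \<phi> x \<noteq> 0})" "closure {x. \<phi> x \<noteq> 0} \<subseteq> S"
    "x \<notin> closure {x. \<phi> x \<noteq> 0} \<Longrightarrow> \<phi> x = 0" "x \<notin> closure {x. \<phi> x \<noteq> 0} \<Longrightarrow> pderiv_dir b \<phi> x = 0"
    "x \<notin> S \<Longrightarrow> \<phi> x = 0" "x \<notin> S \<Longrightarrow> pderiv_dir b \<phi> x = 0"
proof -
  show "continuous_on UNIV \<phi>" "continuous_on UNIV (pderiv_dir b \<phi>)"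
    by (rule continuous_on_of_differentiable, rule test_differentiable[OF p b])+
  show c: "compact (closure {x. \<phi> x \<noteq> 0})" "closure {x. \<phi> x \<noteq> 0} \<subseteq> S"
    using p by (auto simp: test_functions_def)
  show d: "\<phi> x = 0" if "x \<notin> closure {x. \<phi> x \<noteq> 0}" for x
    using that closure_subset[of "{x. \<phi> x \<noteq> 0}"] by auto
  show e: "pderiv_dir b \<phi> x = 0" if "x \<notin> closure {x. \<phi> x \<noteq> 0}" for x
    using that by (rule pderiv_dir_zero_off_support)
  show "x \<notin> S \<Longrightarrow> \<phi> x = 0" "x \<notin> S \<Longrightarrow> pderiv_dir b \<phi> x = 0"
    using c d e by blast+
qed

lemma test_function_continuous: "\<phi> \<in> test_functions S \<Longrightarrow> continuous_on UNIV \<phi>"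
  using test_function_props(1) nonempty_Basis by blast

lemma test_L2:
  assumes p: "\<phi> \<in> test_functions S" and b: "b \<in> Basis" and S: "open S"
  shows "\<phi> \<in> L2 S" "pderiv_dir b \<phi> \<in> L2 S"
proof -
  have Sb: "S \<in> sets borel" using S by simp
  show "\<phi> \<in> L2 S" by (rule L2_of_compact_support[OF test_function_props(1,3,5)[OF p b] Sb])
  show "pderiv_dir b \<phi> \<in> L2 S" by (rule L2_of_compact_support[OF test_function_props(2,3,6)[OF p b] Sb])
qed

lemma set_integrable_mult_test:
  fixes h :: "'a::euclidean_space \<Rightarrow> real"
  assumes h: "set_integrable lborel S h" and f: "continuous_on UNIV f" "compact K" "\<And>x. x \<notin> K \<Longrightarrow> f x = 0"
  shows "set_integrable lborel S (\<lambda>x. h x * f x)"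
proof -
  obtain M where M: "\<And>x. \<bar>f x\<bar> \<le> M" using bounded_of_compact_support[OF f] by blast
  have [measurable]: "f \<in> borel_measurable borel" by (rule borel_measurable_continuous_onI[OF f(1)])
  have hi: "integrable lborel (\<lambda>x. indicat_real S x *\<^sub>R h x)" using h by (simp add: set_integrable_def)
  then have [measurable]: "(\<lambda>x. indicat_real S x *\<^sub>R h x) \<in> borel_measurable lborel" by auto
  have "integrable lborel (\<lambda>x. (indicat_real S x *\<^sub>R h x) * f x)"
  proof (rule Bochner_Integration.integrable_bound)
    show "integrable lborel (\<lambda>x. M *\<^sub>R (indicat_real S x *\<^sub>R h x))" using hi by (intro integrable_scaleR_right)
    show "(\<lambda>x. (indicat_real S x *\<^sub>R h x) * f x) \<in> borel_measurable lborel" by measurable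
    show "AE x in lborel. norm ((indicat_real S x *\<^sub>R h x) * f x) \<le> norm (M *\<^sub>R (indicat_real S x *\<^sub>R h x))"
    proof (rule AE_I2)
      fix x
      have "\<bar>f x\<bar> \<le> \<bar>M\<bar>" using M[of x] by linarith
      then have "\<bar>h x\<bar> * \<bar>f x\<bar> \<le> \<bar>h x\<bar> * \<bar>M\<bar>" by (rule mult_left_mono) simp
      then show "norm ((indicat_real S x *\<^sub>R h x) * f x) \<le> norm (M *\<^sub>R (indicat_real S x *\<^sub>R h x))"
        by (auto simp: indicator_def abs_mult mult.commute)
    qed
  qed
  then show ?thesis by (simp add: set_integrable_def mult.assoc)
qed

lemma set_integrable_mult_test_function:
  fixes h :: "'a::euclidean_space \<Rightarrow> real"
  assumes "set_integrable lborel S h" "\<phi> \<in> test_functions S'" "b \<in> Basis"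
  shows "set_integrable lborel S (\<lambda>x. h x * \<phi> x)" "set_integrable lborel S (\<lambda>x. h x * pderiv_dir b \<phi> x)"
  using set_integrable_mult_test[OF assms(1) test_function_props(1,3,5)[OF assms(2,3)]]
    set_integrable_mult_test[OF assms(1) test_function_props(2,3,6)[OF assms(2,3)]] by auto

text \<open>
  The fundamental lemma of the calculus of variations: bump functions approximate the
  indicators of boxes.
\<close>

lemma fundamental_lemma:
  fixes h :: "'a::euclidean_space \<Rightarrow> real"
  assumes S: "open S" and h: "set_integrable lborel S h"
    and z: "\<And>\<phi>. \<phi> \<in> test_functions S \<Longrightarrow> (LINT x:S|lborel. h x * \<phi> x) = 0"
  shows "AE x in lborel. x \<in> S \<longrightarrow> h x = 0"
proof (rule AE_zero_of_box_integrals[OF S h])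
  fix a b :: 'a assume ab: "box a b \<subseteq> S"
  have hi: "integrable lborel (\<lambda>x. indicat_real S x * h x)" using h by (simp add: set_integrable_def)
  have bm: "bump a b n \<in> borel_measurable borel" for n
    by (rule borel_measurable_continuous_onI[OF test_function_continuous[OF bump_test_function[OF ab]]])
  have "(\<lambda>n. LINT x|lborel. (indicat_real S x * h x) * bump a b n x) \<longlonglongrightarrow> (LINT x|lborel. (indicat_real S x * h x) * indicat_real (box a b) x)"
  proof (rule integral_dominated_convergence)
    show "integrable lborel (\<lambda>x. norm (indicat_real S x * h x))" using hi by (rule integrable_norm)
    show "AE x in lborel. (\<lambda>n. (indicat_real S x * h x) * bump a b n x) \<longlonglongrightarrow> (indicat_real S x * h x) * indicat_real (box a b) x"
      by (intro AE_I2 tendsto_mult tendsto_const bump_tendsto)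
    show "AE x in lborel. norm ((indicat_real S x * h x) * bump a b n x) \<le> norm (indicat_real S x * h x)" for n
      using bump_bounds[of a b n] by (auto simp: abs_mult intro!: mult_right_le_one_le)
    show "(\<lambda>x. (indicat_real S x * h x) * indicat_real (box a b) x) \<in> borel_measurable lborel"
      using hi by (intro borel_measurable_times borel_measurable_integrable[OF hi]) auto
    show "(\<lambda>x. (indicat_real S x * h x) * bump a b n x) \<in> borel_measurable lborel" for n
      using hi bm by (intro borel_measurable_times borel_measurable_integrable[OF hi]) auto
  qed
  moreover have "(LINT x|lborel. (indicat_real S x * h x) * bump a b n x) = 0" for n
    using z[OF bump_test_function[OF ab], of n] by (simp add: set_lebesgue_integral_def mult.assoc)
  moreover have "(LINT x|lborel. (indicat_real S x * h x) * indicat_real (box a b) x) = (LINT x:box a b|lborel. h x)"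
    unfolding set_lebesgue_integral_def
    by (rule Bochner_Integration.integral_cong) (use ab in \<open>auto simp: indicator_def\<close>)
  ultimately show "(LINT x:box a b|lborel. h x) = 0" by (simp add: LIMSEQ_const_iff)
qed

lemma weak_pderiv_unique:
  fixes f :: "'a::euclidean_space \<Rightarrow> real"
  assumes S: "open S" and g: "set_integrable lborel S g" "set_integrable lborel S g'"
    and w: "weak_pderiv S b f g" "weak_pderiv S b f g'"
  shows "AE x in lborel. x \<in> S \<longrightarrow> g x = g' x"
proof -
  have "AE x in lborel. x \<in> S \<longrightarrow> g x - g' x = 0"
  proof (rule fundamental_lemma[OF S])
    show "set_integrable lborel S (\<lambda>x. g x - g' x)" using g by simp
    fix \<phi> :: "'a \<Rightarrow> real" assume p: "\<phi> \<in> test_functions S"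
    obtain b :: 'a where b: "b \<in> Basis" using nonempty_Basis by blast
    have "(LINT x:S|lborel. g x * \<phi> x) = (LINT x:S|lborel. g' x * \<phi> x)"
      using w p unfolding weak_pderiv_def by (metis neg_equal_iff_equal)
    then show "(LINT x:S|lborel. (g x - g' x) * \<phi> x) = 0"
      using set_integrable_mult_test_function[OF g(1) p b] set_integrable_mult_test_function[OF g(2) p b]
      by (simp add: left_diff_distrib)
  qed
  then show ?thesis by simp
qed

lemma weak_divergence_unique:
  fixes S :: "(real^'n) set"
  assumes S: "open S" and g: "set_integrable lborel S g" "set_integrable lborel S g'"
    and w: "weak_divergence S \<tau> g" "weak_divergence S \<tau> g'"
  shows "AE x in lborel. x \<in> S \<longrightarrow> g x = g' x"
proof -
  have "AE x in lborel. x \<in> S \<longrightarrow> g x - g' x = 0"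
  proof (rule fundamental_lemma[OF S])
    show "set_integrable lborel S (\<lambda>x. g x - g' x)" using g by simp
    fix \<phi> :: "real^'n \<Rightarrow> real" assume p: "\<phi> \<in> test_functions S"
    obtain b :: "real^'n" where b: "b \<in> Basis" using nonempty_Basis by blast
    have "(LINT x:S|lborel. g x * \<phi> x) = (LINT x:S|lborel. g' x * \<phi> x)"
      using w p unfolding weak_divergence_def by (metis neg_equal_iff_equal)
    then show "(LINT x:S|lborel. (g x - g' x) * \<phi> x) = 0"
      using set_integrable_mult_test_function[OF g(1) p b] set_integrable_mult_test_function[OF g(2) p b]
      by (simp add: left_diff_distrib)
  qed
  then show ?thesis by simp
qed

lemma LINT_eq_of_zero_off:
  assumes "\<And>x. x \<notin> S \<Longrightarrow> f x = (0::real)"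
  shows "(LINT x:S|lborel. f x) = (LINT x|lborel. f x)"
  unfolding set_lebesgue_integral_def
  by (rule Bochner_Integration.integral_cong) (use assms in \<open>auto simp: indicator_def\<close>)

lemma test_integration_by_parts:
  assumes p: "\<phi> \<in> test_functions S" and q: "\<psi> \<in> test_functions S" and b: "b \<in> Basis"
  shows "(LINT x:S|lborel. \<phi> x * pderiv_dir b \<psi> x) = - (LINT x:S|lborel. pderiv_dir b \<phi> x * \<psi> x)"
proof -
  note P = test_function_props[OF p b] and Q = test_function_props[OF q b]
  note dp = test_differentiable[OF p b] and dq = test_differentiable[OF q b]
  define F where "F x = \<phi> x * \<psi> x" for x
  have d: "pderiv_dir b F = (\<lambda>x. \<phi> x * pderiv_dir b \<psi> x + pderiv_dir b \<phi> x * \<psi> x)"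
    unfolding F_def
    by (rule HOL.ext, rule pderiv_dir_eq, intro has_derivative_mult has_derivative_frechet dp dq)
  have "(LINT x|lborel. pderiv_dir b F x) = 0"
  proof (rule integral_pderiv_dir_zero)
    show "F differentiable at x" for x unfolding F_def by (intro differentiable_mult dp dq)
    show "continuous_on UNIV (pderiv_dir b F)" unfolding d by (intro continuous_on_add continuous_on_mult P(1,2) Q(1,2))
    show "compact (closure {x. \<phi> x \<noteq> 0})" by (rule P)
    show "F x = 0" "pderiv_dir b F x = 0" if "x \<notin> closure {x. \<phi> x \<noteq> 0}" for x
      using P(5,6)[OF that] by (simp_all add: F_def d)
  qed
  moreover have "integrable lborel (\<lambda>x. \<phi> x * pderiv_dir b \<psi> x)"
    by (rule integrable_of_compact_support[OF _ P(3)]) (rule continuous_on_mult[OF P(1) Q(2)], drule P(5), simp)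
  moreover have "integrable lborel (\<lambda>x. pderiv_dir b \<phi> x * \<psi> x)"
    by (rule integrable_of_compact_support[OF _ P(3)]) (rule continuous_on_mult[OF P(2) Q(1)], drule P(6), simp)
  ultimately have "(LINT x|lborel. \<phi> x * pderiv_dir b \<psi> x) = - (LINT x|lborel. pderiv_dir b \<phi> x * \<psi> x)"
    unfolding d by simp
  moreover have "(LINT x:S|lborel. \<phi> x * pderiv_dir b \<psi> x) = (LINT x|lborel. \<phi> x * pderiv_dir b \<psi> x)"
    by (rule LINT_eq_of_zero_off) (simp add: P(7))
  moreover have "(LINT x:S|lborel. pderiv_dir b \<phi> x * \<psi> x) = (LINT x|lborel. pderiv_dir b \<phi> x * \<psi> x)"
    by (rule LINT_eq_of_zero_off) (simp add: P(8))
  ultimately show ?thesis by simp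
qed

lemma smooth_fun_csm: "smooth_fun f \<Longrightarrow> csm k f"
proof (induction k arbitrary: f)
  case 0 show ?case using 0[unfolded smooth_fun_def, rule_format, of "[]"] by simp
next
  case (Suc k)
  have "smooth_fun (pderiv_dir b f)" if "b \<in> Basis" for b
    unfolding smooth_fun_def
  proof (intro allI impI)
    fix bs :: "'a list" and x assume "set bs \<subseteq> Basis"
    then show "foldr pderiv_dir bs (pderiv_dir b f) differentiable at x"
      using Suc.prems[unfolded smooth_fun_def, rule_format, of "bs @ [b]"] that by simp
  qed
  moreover have "f differentiable at x" for x
    using Suc.prems[unfolded smooth_fun_def, rule_format, of "[]"] by simp
  ultimately show ?case using Suc.IH by simp
qed

lemma test_functions_linear:
  assumes p: "\<phi> \<in> test_functions S" and q: "\<psi> \<in> test_functions S"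
  shows "(\<lambda>x. c * \<phi> x + d * \<psi> x) \<in> test_functions S"
proof -
  have s: "smooth_fun (\<lambda>x. c * \<phi> x + d * \<psi> x)"
  proof (rule smooth_funI)
    fix k
    have "csm k \<phi>" "csm k \<psi>" using p q by (auto simp: test_functions_def smooth_fun_csm)
    then show "csm k (\<lambda>x. c * \<phi> x + d * \<psi> x)" by (intro csm_add csm_mult csm_const)
  qed
  let ?K = "closure {x. \<phi> x \<noteq> 0} \<union> closure {x. \<psi> x \<noteq> 0}"
  have K: "compact ?K" "?K \<subseteq> S" using p q by (auto simp: test_functions_def)
  have "{x. c * \<phi> x + d * \<psi> x \<noteq> 0} \<subseteq> ?K"
  proof
    fix x assume "x \<in> {x. c * \<phi> x + d * \<psi> x \<noteq> 0}"
    then have "x \<in> {x. \<phi> x \<noteq> 0} \<or> x \<in> {x. \<psi> x \<noteq> 0}" by auto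
    then show "x \<in> ?K" by (meson UnI1 UnI2 closure_subset subsetD)
  qed
  then have "closure {x. c * \<phi> x + d * \<psi> x \<noteq> 0} \<subseteq> ?K"
    using K by (intro closure_minimal) (auto intro: compact_imp_closed)
  moreover from this have "compact (closure {x. c * \<phi> x + d * \<psi> x \<noteq> 0})"
    using bounded_subset[OF compact_imp_bounded[OF K(1)]] unfolding compact_eq_bounded_closed by blast
  ultimately show ?thesis using s K by (auto simp: test_functions_def)
qed

lemma test_function_zero: "(\<lambda>x. 0) \<in> test_functions S"
  by (auto simp: test_functions_def intro!: smooth_funI csm_const)

lemma pderiv_dir_linear:
  assumes p: "\<phi> \<in> test_functions S" and q: "\<psi> \<in> test_functions S" and b: "b \<in> Basis"
  shows "pderiv_dir b (\<lambda>x. c * \<phi> x + d * \<psi> x) = (\<lambda>x. c * pderiv_dir b \<phi> x + d * pderiv_dir b \<psi> x)"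
  by (rule HOL.ext, rule pderiv_dir_eq,
      intro has_derivative_add has_derivative_mult_right has_derivative_frechet
        test_differentiable[OF p b] test_differentiable[OF q b])

lemma classical_gradient_linear:
  assumes p: "\<phi> \<in> test_functions S" and q: "\<psi> \<in> test_functions S"
  shows "classical_gradient (\<lambda>x. c * \<phi> x + d * \<psi> x) = (\<lambda>x. c *\<^sub>R classical_gradient \<phi> x + d *\<^sub>R classical_gradient \<psi> x)"
  by (rule HOL.ext) (simp add: classical_gradient_def vec_eq_iff pderiv_dir_linear[OF p q] axis_in_Basis_iff)

lemma classical_gradient_L2:
  fixes \<phi> :: "real^'n \<Rightarrow> real"
  assumes p: "\<phi> \<in> test_functions S" and S: "open S"
  shows "classical_gradient \<phi> \<in> L2 S"
proof (rule L2_of_compact_support)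
  have b: "axis i 1 \<in> (Basis :: (real^'n) set)" for i by (simp add: axis_in_Basis_iff)
  show "continuous_on UNIV (classical_gradient \<phi>)"
    unfolding classical_gradient_def[abs_def]
    by (intro continuous_on_vec_lambda test_function_props(2)[OF p b])
  show "compact (closure {x. \<phi> x \<noteq> 0})" by (rule test_function_props(3)[OF p b])
  show "classical_gradient \<phi> x = 0" if "x \<notin> closure {x. \<phi> x \<noteq> 0}" for x
    using test_function_props(6)[OF p b that] by (simp add: classical_gradient_def vec_eq_iff)
qed (use S in simp)

text \<open>
  The part of a limit that lives outside \<open>S\<close> is orthogonal to every member of the sequence,
  hence to the limit itself, hence zero.
\<close>

lemma closed_cls_range:
  assumes S: "S \<in> sets borel"
  shows "closed (cls S ` (L2 S :: ('a::euclidean_space \<Rightarrow> 'b::euclidean_space) set))"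
proof (rule closed_sequential_limits[THEN iffD2], intro allI impI, elim conjE)
  fix u and w :: "('a, 'b) l2" assume u: "\<forall>n. u n \<in> cls S ` L2 S" "u \<longlonglongrightarrow> w"
  obtain f where f: "f \<in> L2 UNIV" "cls UNIV f = w" using cls_rep by metis
  define g where "g x = indicat_real (- S) x *\<^sub>R f x" for x
  have g: "g \<in> L2 UNIV"
    unfolding g_def[abs_def]
    by (rule L2_mult_bounded[where C = 1]) (use S f in \<open>auto simp: set_borel_measurable_def indicator_def\<close>)
  have "cls UNIV g \<bullet> u n = 0" for n
  proof -
    obtain h where h: "h \<in> L2 S" "u n = cls S h" using u by auto
    have h': "ext S h \<in> L2 UNIV" "cls UNIV (ext S h) = u n"
      using h by (auto simp: L2_iff_sq_int cls_def ext_def)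
    have "l2inner UNIV g (ext S h) = 0"
    proof -
      have "(\<lambda>x. g x \<bullet> ext S h x) = (\<lambda>x. 0)" by (auto simp: fun_eq_iff g_def ext_def indicator_def)
      then show ?thesis by (simp add: l2inner_def set_lebesgue_integral_def)
    qed
    then show ?thesis using inner_cls[OF g h'(1)] h' by simp
  qed
  moreover have "(\<lambda>n. cls UNIV g \<bullet> u n) \<longlonglongrightarrow> cls UNIV g \<bullet> w" by (intro tendsto_intros u)
  ultimately have "cls UNIV g \<bullet> w = 0" by (simp add: LIMSEQ_const_iff)
  moreover have "cls UNIV g \<bullet> w = cls UNIV g \<bullet> cls UNIV g"
    unfolding f(2)[symmetric] inner_cls[OF g f(1)] inner_cls[OF g g] l2inner_def set_lebesgue_integral_def
    by (rule Bochner_Integration.integral_cong) (auto simp: g_def indicator_def)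
  ultimately have "cls UNIV g = cls UNIV (\<lambda>x. 0)"
    using cls_scaleR[OF g, of 0] by simp
  then have z: "AE x in lborel. g x = 0" using cls_eq_iff[OF g L2_zero] by simp
  have fS: "f \<in> L2 S" using f(1) S by (rule L2_subset)
  have e: "ext S f \<in> L2 UNIV" using fS by (simp add: L2_iff_sq_int ext_def)
  have "cls UNIV (ext S f) = cls UNIV f"
    unfolding cls_eq_iff[OF e f(1)]
    using z by eventually_elim (auto simp: ext_def g_def indicator_def split: if_splits)
  moreover have "cls UNIV (ext S f) = cls S f" by (simp add: cls_def ext_def)
  ultimately show "w \<in> cls S ` L2 S" using f fS by auto
qed

text \<open>
  A function of \<open>H10 \<Omega>\<close> is handled together with its gradient, as a point in the closure of
  these pairs in a product of Hilbert spaces. The graph norm of $H^1(\Omega)$ is then the norm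
  of the product, and \<open>H10 \<Omega>\<close> becomes a closed subspace to which Lax--Milgram applies.
\<close>

definition test_pairs :: "(real^'n) set \<Rightarrow> ((real^'n, real) l2 \<times> (real^'n, real^'n) l2) set" where
  "test_pairs \<Omega> = (\<lambda>\<phi>. (cls \<Omega> \<phi>, cls \<Omega> (classical_gradient \<phi>))) ` test_functions \<Omega>"

definition H10pair :: "(real^'n) set \<Rightarrow> (real^'n \<Rightarrow> real) \<Rightarrow> (real^'n \<Rightarrow> real^'n) \<Rightarrow> bool" where
  "H10pair \<Omega> f g \<longleftrightarrow> f \<in> L2 \<Omega> \<and> g \<in> L2 \<Omega> \<and> (cls \<Omega> f, cls \<Omega> g) \<in> closure (test_pairs \<Omega>)"

lemma subspace_test_pairs:
  assumes S: "open \<Omega>"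
  shows "subspace (test_pairs \<Omega>)"
proof -
  have b: "axis undefined 1 \<in> (Basis :: (real^'n) set)" by (simp add: axis_in_Basis_iff)
  note L = test_L2(1)[OF _ b S] classical_gradient_L2[OF _ S]
  have lin: "c *\<^sub>R (cls \<Omega> \<phi>, cls \<Omega> (classical_gradient \<phi>)) + d *\<^sub>R (cls \<Omega> \<psi>, cls \<Omega> (classical_gradient \<psi>)) \<in> test_pairs \<Omega>"
    if p: "\<phi> \<in> test_functions \<Omega>" and q: "\<psi> \<in> test_functions \<Omega>" for c d \<phi> \<psi>
  proof -
    have 1: "cls \<Omega> (\<lambda>x. c * \<phi> x + d * \<psi> x) = c *\<^sub>R cls \<Omega> \<phi> + d *\<^sub>R cls \<Omega> \<psi>"
      using cls_add[OF L2_cmult[OF L(1)[OF p], of c] L2_cmult[OF L(1)[OF q], of d]]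
        cls_scaleR[OF L(1)[OF p], of c] cls_scaleR[OF L(1)[OF q], of d] by simp
    have 2: "cls \<Omega> (classical_gradient (\<lambda>x. c * \<phi> x + d * \<psi> x)) = c *\<^sub>R cls \<Omega> (classical_gradient \<phi>) + d *\<^sub>R cls \<Omega> (classical_gradient \<psi>)"
      unfolding classical_gradient_linear[OF p q]
      using cls_add[OF L2_scaleR[OF L(2)[OF p], of c] L2_scaleR[OF L(2)[OF q], of d]]
        cls_scaleR[OF L(2)[OF p], of c] cls_scaleR[OF L(2)[OF q], of d] by simp
    show ?thesis unfolding test_pairs_def
      by (rule image_eqI[OF _ test_functions_linear[OF p q, of c d]]) (simp add: 1 2)
  qed
  show ?thesis
  proof (rule subspaceI)
    show "0 \<in> test_pairs \<Omega>" using lin[OF test_function_zero test_function_zero, of 0 0] by (simp add: zero_prod_def)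
    show "x + y \<in> test_pairs \<Omega>" if "x \<in> test_pairs \<Omega>" "y \<in> test_pairs \<Omega>" for x y
      using that lin[of _ _ 1 1] unfolding test_pairs_def[of \<Omega>] by force
    show "c *\<^sub>R x \<in> test_pairs \<Omega>" if "x \<in> test_pairs \<Omega>" for c x
      using that lin[of _ _ c 0] unfolding test_pairs_def[of \<Omega>] by force
  qed
qed

lemma H10pair_linear:
  assumes S: "open \<Omega>" and p: "H10pair \<Omega> f g" "H10pair \<Omega> f' g'"
  shows "H10pair \<Omega> (\<lambda>x. c * f x + d * f' x) (\<lambda>x. c *\<^sub>R g x + d *\<^sub>R g' x)"
proof -
  have L: "f \<in> L2 \<Omega>" "g \<in> L2 \<Omega>" "f' \<in> L2 \<Omega>" "g' \<in> L2 \<Omega>" using p by (auto simp: H10pair_def)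
  have s: "subspace (closure (test_pairs \<Omega>))" by (intro subspace_closure_normed subspace_test_pairs S)
  have 1: "cls \<Omega> (\<lambda>x. c * f x + d * f' x) = c *\<^sub>R cls \<Omega> f + d *\<^sub>R cls \<Omega> f'"
    using cls_add[OF L2_cmult[OF L(1), of c] L2_cmult[OF L(3), of d]]
      cls_scaleR[OF L(1), of c] cls_scaleR[OF L(3), of d] by simp
  have 2: "cls \<Omega> (\<lambda>x. c *\<^sub>R g x + d *\<^sub>R g' x) = c *\<^sub>R cls \<Omega> g + d *\<^sub>R cls \<Omega> g'"
    using cls_add[OF L2_scaleR[OF L(2), of c] L2_scaleR[OF L(4), of d]]
      cls_scaleR[OF L(2), of c] cls_scaleR[OF L(4), of d] by simp
  have "c *\<^sub>R (cls \<Omega> f, cls \<Omega> g) + d *\<^sub>R (cls \<Omega> f', cls \<Omega> g') \<in> closure (test_pairs \<Omega>)"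
    using p by (intro subspace_add[OF s] subspace_scale[OF s]) (auto simp: H10pair_def)
  then show ?thesis unfolding H10pair_def 1 2
    using L by (auto intro!: L2_add L2_scaleR L2_cmult)
qed

lemma H10pair_cong:
  assumes "H10pair \<Omega> f g" "f' \<in> L2 \<Omega>" "g' \<in> L2 \<Omega>"
    "AE x in lborel. x \<in> \<Omega> \<longrightarrow> f' x = f x" "AE x in lborel. x \<in> \<Omega> \<longrightarrow> g' x = g x"
  shows "H10pair \<Omega> f' g'"
  using assms cls_eq_iff[of f' \<Omega> f] cls_eq_iff[of g' \<Omega> g] by (auto simp: H10pair_def)

lemma H10pair_test:
  fixes \<Omega> :: "(real^'n) set"
  assumes "open \<Omega>" "\<phi> \<in> test_functions \<Omega>"
  shows "H10pair \<Omega> \<phi> (classical_gradient \<phi>)"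
proof -
  have b: "axis undefined 1 \<in> (Basis :: (real^'n) set)" by (simp add: axis_in_Basis_iff)
  show ?thesis using assms test_L2(1)[OF assms(2) b assms(1)] classical_gradient_L2[OF assms(2,1)]
      closure_subset[of "test_pairs \<Omega>"] by (auto simp: H10pair_def test_pairs_def)
qed

text \<open>
  The left-hand side depends continuously on the pair, so that the identity passes from test
  functions to their closure. With a weak divergence in place of \<open>c\<close> this is the divergence
  theorem.
\<close>

lemma H10pair_functional:
  fixes \<Omega> :: "(real^'n) set"
  assumes S: "open \<Omega>" and a: "a \<in> L2 \<Omega>" "c \<in> L2 \<Omega>"
    and z: "\<And>\<phi>. \<phi> \<in> test_functions \<Omega> \<Longrightarrow> l2inner \<Omega> a (classical_gradient \<phi>) + l2inner \<Omega> c \<phi> = 0"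
    and p: "H10pair \<Omega> f g"
  shows "l2inner \<Omega> a g + l2inner \<Omega> c f = 0"
proof -
  have "\<forall>q\<in>closure (test_pairs \<Omega>). cls \<Omega> a \<bullet> snd q + cls \<Omega> c \<bullet> fst q = 0"
  proof (rule ballI, rule continuous_constant_on_closure[where f = "\<lambda>q. cls \<Omega> a \<bullet> snd q + cls \<Omega> c \<bullet> fst q"])
    show "continuous_on (closure (test_pairs \<Omega>)) (\<lambda>q. cls \<Omega> a \<bullet> snd q + cls \<Omega> c \<bullet> fst q)"
      by (intro continuous_intros)
  next
    fix q assume "q \<in> test_pairs \<Omega>"
    then obtain \<phi> where \<phi>: "\<phi> \<in> test_functions \<Omega>" "q = (cls \<Omega> \<phi>, cls \<Omega> (classical_gradient \<phi>))"
      by (auto simp: test_pairs_def)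
    have h: "\<phi> \<in> L2 \<Omega>" "classical_gradient \<phi> \<in> L2 \<Omega>"
      using H10pair_test[OF S \<phi>(1)] by (auto simp: H10pair_def)
    show "cls \<Omega> a \<bullet> snd q + cls \<Omega> c \<bullet> fst q = 0" using z[OF \<phi>(1)] \<phi>(2) a h by (simp add: inner_cls)
  qed assumption
  then show ?thesis using p a by (auto simp: H10pair_def inner_cls)
qed

text \<open>
  Test functions are integrated by parts against each other, and the identity extends to the
  closure.
\<close>

lemma H10pair_weak_gradient:
  fixes \<Omega> :: "(real^'n) set"
  assumes S: "open \<Omega>" and p: "H10pair \<Omega> f g"
  shows "weak_gradient \<Omega> f g"
  unfolding weak_gradient_def weak_pderiv_def
proof (intro allI ballI)
  fix i and \<phi> :: "real^'n \<Rightarrow> real" assume \<phi>: "\<phi> \<in> test_functions \<Omega>"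
  have b: "axis i 1 \<in> (Basis :: (real^'n) set)" by (simp add: axis_in_Basis_iff)
  define a :: "real^'n \<Rightarrow> real^'n" where "a x = \<phi> x *\<^sub>R axis i 1" for x
  have a: "a \<in> L2 \<Omega>"
  proof (rule L2_of_compact_support[OF _ test_function_props(3)[OF \<phi> b]])
    show "continuous_on UNIV a" unfolding a_def[abs_def]
      by (intro continuous_on_scaleR test_function_props(1)[OF \<phi> b] continuous_on_const)
    show "a x = 0" if "x \<notin> closure {x. \<phi> x \<noteq> 0}" for x
      using test_function_props(5)[OF \<phi> b that] by (simp add: a_def)
  qed (use S in simp)
  have c: "pderiv_dir (axis i 1) \<phi> \<in> L2 \<Omega>" by (rule test_L2(2)[OF \<phi> b S])
  have "l2inner \<Omega> a g + l2inner \<Omega> (pderiv_dir (axis i 1) \<phi>) f = 0"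
  proof (rule H10pair_functional[OF S a c _ p])
    fix \<psi> :: "real^'n \<Rightarrow> real" assume \<psi>: "\<psi> \<in> test_functions \<Omega>"
    show "l2inner \<Omega> a (classical_gradient \<psi>) + l2inner \<Omega> (pderiv_dir (axis i 1) \<phi>) \<psi> = 0"
      using test_integration_by_parts[OF \<phi> \<psi> b]
      by (simp add: l2inner_def a_def inner_axis' classical_gradient_def)
  qed
  then show "(LINT x:\<Omega>|lborel. f x * pderiv_dir (axis i 1) \<phi> x) = - (LINT x:\<Omega>|lborel. g x $ i * \<phi> x)"
    by (simp add: l2inner_def a_def inner_axis' mult.commute)
qed

lemma weak_gradient_unique:
  fixes \<Omega> :: "(real^'n) set"
  assumes S: "open \<Omega>" "bounded \<Omega>" and g: "g \<in> L2 \<Omega>" "g' \<in> L2 \<Omega>"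
    and w: "weak_gradient \<Omega> f g" "weak_gradient \<Omega> f g'"
  shows "AE x in lborel. x \<in> \<Omega> \<longrightarrow> g x = g' x"
proof -
  have gi: "set_integrable lborel \<Omega> (\<lambda>x. h x $ i)" if "h \<in> L2 \<Omega>" for h :: "real^'n \<Rightarrow> real^'n" and i
  proof -
    have "set_integrable lborel \<Omega> h"
      by (rule L2_set_integrable) (use that S emeasure_bounded_finite in auto)
    then have "integrable lborel (\<lambda>x. (indicat_real \<Omega> x *\<^sub>R h x) \<bullet> axis i 1)"
      unfolding set_integrable_def by (rule integrable_inner_left) 
    then show ?thesis by (simp add: set_integrable_def inner_axis)
  qed
  have "AE x in lborel. \<forall>i\<in>UNIV. x \<in> \<Omega> \<longrightarrow> g x $ i = g' x $ i"
  proof (subst AE_ball_countable)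
    show "\<forall>i\<in>UNIV. AE x in lborel. x \<in> \<Omega> \<longrightarrow> g x $ i = g' x $ i"
      using w weak_pderiv_unique[OF S(1) gi[OF g(1)] gi[OF g(2)]] unfolding weak_gradient_def by blast
  qed (simp add: countable_finite)
  then show ?thesis by eventually_elim (simp add: vec_eq_iff)
qed

text \<open>
  The approximation of \<open>f\<close> and its gradient in the definition of \<open>H10 \<Omega>\<close> says that the pair is a
  sequential limit of test pairs.
\<close>

lemma H10_iff:
  fixes \<Omega> :: "(real^'n) set"
  assumes S: "open \<Omega>"
  shows "f \<in> H10 \<Omega> \<longleftrightarrow> (\<exists>g. H10pair \<Omega> f g)"
proof
  assume "f \<in> H10 \<Omega>"
  then obtain g \<phi> where f: "f \<in> L2 \<Omega>" "g \<in> L2 \<Omega>" and \<phi>: "\<And>n::nat. \<phi> n \<in> test_functions \<Omega>"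
    and l: "(\<lambda>n. l2norm \<Omega> (\<lambda>x. f x - \<phi> n x)) \<longlonglongrightarrow> 0"
      "(\<lambda>n. l2norm \<Omega> (\<lambda>x. g x - classical_gradient (\<phi> n) x)) \<longlonglongrightarrow> 0"
    unfolding H10_def by auto
  have h: "\<phi> n \<in> L2 \<Omega>" "classical_gradient (\<phi> n) \<in> L2 \<Omega>" for n
    using H10pair_test[OF S \<phi>] by (auto simp: H10pair_def)
  have "(\<lambda>n. cls \<Omega> (\<phi> n)) \<longlonglongrightarrow> cls \<Omega> f"
    using l(1) norm_cls[OF L2_diff[OF f(1) h(1)]]
    by (subst tendsto_dist_iff) (simp add: dist_norm norm_minus_commute cls_diff f h)
  moreover have "(\<lambda>n. cls \<Omega> (classical_gradient (\<phi> n))) \<longlonglongrightarrow> cls \<Omega> g"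
    using l(2) norm_cls[OF L2_diff[OF f(2) h(2)]]
    by (subst tendsto_dist_iff) (simp add: dist_norm norm_minus_commute cls_diff f h)
  ultimately have "(\<lambda>n. (cls \<Omega> (\<phi> n), cls \<Omega> (classical_gradient (\<phi> n)))) \<longlonglongrightarrow> (cls \<Omega> f, cls \<Omega> g)"
    by (rule tendsto_Pair)
  then have "(cls \<Omega> f, cls \<Omega> g) \<in> closure (test_pairs \<Omega>)"
    unfolding closure_sequential
    by (intro exI[of _ "\<lambda>n. (cls \<Omega> (\<phi> n), cls \<Omega> (classical_gradient (\<phi> n)))"]) (auto simp: test_pairs_def \<phi>)
  then show "\<exists>g. H10pair \<Omega> f g" using f by (auto simp: H10pair_def)
next
  assume "\<exists>g. H10pair \<Omega> f g"
  then obtain g where p: "H10pair \<Omega> f g" by auto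
  have f: "f \<in> L2 \<Omega>" "g \<in> L2 \<Omega>" using p by (auto simp: H10pair_def)
  obtain u where u: "\<And>n. u n \<in> test_pairs \<Omega>" "u \<longlonglongrightarrow> (cls \<Omega> f, cls \<Omega> g)"
    using p unfolding H10pair_def closure_sequential by auto
  have "\<forall>n. \<exists>\<phi>. \<phi> \<in> test_functions \<Omega> \<and> u n = (cls \<Omega> \<phi>, cls \<Omega> (classical_gradient \<phi>))"
    using u(1) by (auto simp: test_pairs_def)
  then obtain \<phi> where \<phi>: "\<And>n. \<phi> n \<in> test_functions \<Omega>" "\<And>n. u n = (cls \<Omega> (\<phi> n), cls \<Omega> (classical_gradient (\<phi> n)))"
    by metis
  have h: "\<phi> n \<in> L2 \<Omega>" "classical_gradient (\<phi> n) \<in> L2 \<Omega>" for n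
    using H10pair_test[OF S \<phi>(1)] by (auto simp: H10pair_def)
  have "(\<lambda>n. norm (cls \<Omega> f - cls \<Omega> (\<phi> n))) \<longlonglongrightarrow> 0"
    using tendsto_fst[OF u(2)] \<phi>(2) by (subst (asm) tendsto_dist_iff) (simp add: dist_norm norm_minus_commute)
  then have l1: "(\<lambda>n. l2norm \<Omega> (\<lambda>x. f x - \<phi> n x)) \<longlonglongrightarrow> 0"
    by (simp add: cls_diff[symmetric] f h norm_cls L2_diff)
  have "(\<lambda>n. norm (cls \<Omega> g - cls \<Omega> (classical_gradient (\<phi> n)))) \<longlonglongrightarrow> 0"
    using tendsto_snd[OF u(2)] \<phi>(2) by (subst (asm) tendsto_dist_iff) (simp add: dist_norm norm_minus_commute)
  then have l2: "(\<lambda>n. l2norm \<Omega> (\<lambda>x. g x - classical_gradient (\<phi> n) x)) \<longlonglongrightarrow> 0"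
    by (simp add: cls_diff[symmetric] f h norm_cls L2_diff)
  show "f \<in> H10 \<Omega>"
    unfolding H10_def using f H10pair_weak_gradient[OF S p] \<phi>(1) l1 l2 by blast
qed

lemma H10pair_of_weak_gradient:
  fixes \<Omega> :: "(real^'n) set"
  assumes S: "open \<Omega>" "bounded \<Omega>" and f: "f \<in> H10 \<Omega>" "g \<in> L2 \<Omega>" "weak_gradient \<Omega> f g"
  shows "H10pair \<Omega> f g"
proof -
  obtain h where h: "H10pair \<Omega> f h" using f H10_iff[OF S(1)] by auto
  have hL: "h \<in> L2 \<Omega>" "f \<in> L2 \<Omega>" using h by (auto simp: H10pair_def)
  show ?thesis
    by (rule H10pair_cong[OF h hL(2) f(2) _ weak_gradient_unique[OF S f(2) hL(1) f(3) H10pair_weak_gradient[OF S(1) h]]]) simp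
qed

text \<open>
  Points of the closure are classes of functions on \<open>\<Omega>\<close>, since these classes form a closed set.
\<close>

lemma H10pair_rep:
  fixes \<Omega> :: "(real^'n) set"
  assumes S: "open \<Omega>" and p: "p \<in> closure (test_pairs \<Omega>)"
  obtains f g where "H10pair \<Omega> f g" "p = (cls \<Omega> f, cls \<Omega> g)"
proof -
  have sub: "test_pairs \<Omega> \<subseteq> cls \<Omega> ` L2 \<Omega> \<times> cls \<Omega> ` L2 \<Omega>"
    using H10pair_test[OF S] by (auto simp: test_pairs_def H10pair_def)
  have "closed (cls \<Omega> ` (L2 \<Omega> :: (real^'n \<Rightarrow> real) set) \<times> cls \<Omega> ` (L2 \<Omega> :: (real^'n \<Rightarrow> real^'n) set))"
    using S by (intro closed_Times closed_cls_range) auto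
  then have "p \<in> cls \<Omega> ` L2 \<Omega> \<times> cls \<Omega> ` L2 \<Omega>"
    using closure_minimal[OF sub] p by blast
  then obtain f g where "f \<in> L2 \<Omega>" "g \<in> L2 \<Omega>" "p = (cls \<Omega> f, cls \<Omega> g)" by auto
  then show thesis using p that by (auto simp: H10pair_def)
qed

lemma H10pair_friedrichs:
  fixes \<Omega> :: "(real^'n) set"
  assumes S: "open \<Omega>" and C: "friedrichs_constant \<Omega> C" and p: "H10pair \<Omega> f g"
  shows "l2norm \<Omega> f \<le> C * l2norm \<Omega> g"
proof -
  have "f \<in> H10 \<Omega>" using p H10_iff[OF S] by blast
  moreover have "g \<in> L2 \<Omega>" using p by (simp add: H10pair_def)
  moreover have "weak_gradient \<Omega> f g" by (rule H10pair_weak_gradient[OF S p])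
  ultimately show ?thesis using C unfolding friedrichs_constant_def by blast
qed

lemma wform_commute: "wform m f g = wform m g f"
  by transfer (simp add: inner_commute)

text \<open>
  The equation \<open>\<sigma> \<partial>\<^sub>t z - div (\<nu> \<nabla>z) = f\<close> for one time harmonic: the cosine and sine
  coefficients of \<open>z\<close> solve an elliptic system, with \<open>\<kappa>\<close> the angular frequency, up to the sign of
  the time derivative. The coupling terms are skew symmetric and cancel on the diagonal, so
  that the form is coercive with a constant from \<open>\<nu>\<close> and Friedrichs' inequality alone, whatever
  \<open>\<kappa>\<close> is.
\<close>

lemma elliptic_mode_solution:
  fixes \<Omega> :: "(real^'n) set" and \<kappa> :: real
  assumes S: "open \<Omega>" and C: "friedrichs_constant \<Omega> C"
    and \<sigma>: "set_borel_measurable lborel \<Omega> \<sigma>" "\<And>x. x \<in> \<Omega> \<Longrightarrow> \<bar>\<sigma> x\<bar> \<le> \<sigma>_hi"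
    and \<nu>: "set_borel_measurable lborel \<Omega> \<nu>" "\<And>x. x \<in> \<Omega> \<Longrightarrow> \<bar>\<nu> x\<bar> \<le> \<nu>_hi"
    and lo: "\<nu>_lo > 0" "\<And>x. x \<in> \<Omega> \<Longrightarrow> \<nu>_lo \<le> \<nu> x"
    and ab: "a \<in> L2 \<Omega>" "b \<in> L2 \<Omega>"
  shows "\<exists>zc gc zs gs. H10pair \<Omega> zc gc \<and> H10pair \<Omega> zs gs \<and> (\<forall>q \<gamma>. H10pair \<Omega> q \<gamma> \<longrightarrow>
     (LINT x:\<Omega>|lborel. \<nu> x * (gc x \<bullet> \<gamma> x)) + \<kappa> * (LINT x:\<Omega>|lborel. \<sigma> x * (zs x * q x)) = (LINT x:\<Omega>|lborel. a x * q x) \<and>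
     (LINT x:\<Omega>|lborel. \<nu> x * (gs x \<bullet> \<gamma> x)) - \<kappa> * (LINT x:\<Omega>|lborel. \<sigma> x * (zc x * q x)) = (LINT x:\<Omega>|lborel. b x * q x))"
proof -
  define X where "X = closure (test_pairs \<Omega>)"
  have X: "subspace X" "closed X" unfolding X_def by (auto intro: subspace_closure_normed subspace_test_pairs S)
  define N where "N = (wform (ext \<Omega> \<nu>) :: (real^'n, real^'n) l2 \<Rightarrow> _)"
  define M where "M = (wform (ext \<Omega> \<sigma>) :: (real^'n, real) l2 \<Rightarrow> _)"
  have mN: "ext \<Omega> \<nu> \<in> borel_measurable lborel" and mM: "ext \<Omega> \<sigma> \<in> borel_measurable lborel"
    using \<sigma> \<nu> by (simp_all add: ext_def set_borel_measurable_def)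
  interpret N: bounded_bilinear N unfolding N_def by (rule bounded_bilinear_wform[OF mN ext_bounded[OF \<nu>(2)]])
  interpret M: bounded_bilinear M unfolding M_def by (rule bounded_bilinear_wform[OF mM ext_bounded[OF \<sigma>(2)]])
  have Ne: "N (cls \<Omega> f) (cls \<Omega> g) = (LINT x:\<Omega>|lborel. \<nu> x * (f x \<bullet> g x))" if "f \<in> L2 \<Omega>" "g \<in> L2 \<Omega>" for f g
    unfolding N_def by (rule wform_cls[OF \<nu> that])
  have Me: "M (cls \<Omega> f) (cls \<Omega> g) = (LINT x:\<Omega>|lborel. \<sigma> x * (f x * g x))" if "f \<in> L2 \<Omega>" "g \<in> L2 \<Omega>" for f g
    unfolding M_def using wform_cls[OF \<sigma> that] by simp
  define V where "V = X \<times> X"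
  define B where "B u v = (N (snd (fst u)) (snd (fst v)) + N (snd (snd u)) (snd (snd v)))
     + (M (\<kappa> *\<^sub>R fst (snd u)) (fst (fst v)) + M ((- \<kappa>) *\<^sub>R fst (fst u)) (fst (snd v)))" for u v
  define F where "F v = cls \<Omega> a \<bullet> fst (fst v) + cls \<Omega> b \<bullet> fst (snd v)"
    for v :: "((real^'n, real) l2 \<times> (real^'n, real^'n) l2) \<times> ((real^'n, real) l2 \<times> (real^'n, real^'n) l2)"
  have bB: "bounded_bilinear B"
    unfolding B_def[abs_def]
    by (intro bounded_bilinear_plus N.comp M.comp bounded_linear_intros)
  have bF: "bounded_linear F"
    unfolding F_def[abs_def] by (intro bounded_linear_add bounded_linear_inner_right_comp bounded_linear_intros)
  have V: "subspace V" "closed V"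
    unfolding V_def using X by (auto intro: subspace_Times closed_Times)
  have C0: "C > 0" using C by (simp add: friedrichs_constant_def)
  define \<alpha> where "\<alpha> = \<nu>_lo / (1 + C\<^sup>2)"
  have \<alpha>: "\<alpha> > 0" using lo(1) unfolding \<alpha>_def by (intro divide_pos_pos) (auto intro: add_pos_nonneg)
  have one: "\<alpha> * ((norm f)\<^sup>2 + (norm g)\<^sup>2) \<le> N g g" if fg: "(f, g) \<in> X" for f g
  proof -
    obtain u v where p: "H10pair \<Omega> u v" and e: "(f, g) = (cls \<Omega> u, cls \<Omega> v)"
      using H10pair_rep[OF S] fg unfolding X_def by metis
    have L: "u \<in> L2 \<Omega>" "v \<in> L2 \<Omega>" using p by (auto simp: H10pair_def)
    have "norm f \<le> C * norm g" using H10pair_friedrichs[OF S C p] e L by (simp add: norm_cls)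
    then have "(norm f)\<^sup>2 \<le> C\<^sup>2 * (norm g)\<^sup>2" using power_mono[of "norm f" "C * norm g" 2] by (simp add: power_mult_distrib)
    then have "\<alpha> * ((norm f)\<^sup>2 + (norm g)\<^sup>2) \<le> \<alpha> * ((1 + C\<^sup>2) * (norm g)\<^sup>2)"
      using \<alpha> by (intro mult_left_mono) (auto simp: distrib_right)
    also have "\<dots> = \<nu>_lo * (norm g)\<^sup>2"
    proof -
      have "1 + C\<^sup>2 \<noteq> 0" by (metis add_pos_nonneg less_numeral_extra(1) less_numeral_extra(3) zero_le_power2)
      then show ?thesis unfolding \<alpha>_def by simp
    qed
    also have "\<dots> = (LINT x:\<Omega>|lborel. \<nu>_lo * (v x \<bullet> v x))"
      using e inner_cls[OF L(2) L(2)] by (simp add: power2_norm_eq_inner l2inner_def)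
    also have "\<dots> \<le> (LINT x:\<Omega>|lborel. \<nu> x * (v x \<bullet> v x))"
    proof (rule set_integral_mono)
      show "set_integrable lborel \<Omega> (\<lambda>x. \<nu>_lo * (v x \<bullet> v x))"
        using L2_inner_integrable[OF L(2) L(2)] by simp
      show "set_integrable lborel \<Omega> (\<lambda>x. \<nu> x * (v x \<bullet> v x))"
        using L2_inner_integrable[OF L2_mult_bounded[OF \<nu> L(2)] L(2)] by simp
    qed (use lo in \<open>auto intro: mult_right_mono\<close>)
    also have "\<dots> = N g g" using Ne[OF L(2) L(2)] e by simp
    finally show ?thesis .
  qed
  have coerc: "\<alpha> * (norm v)\<^sup>2 \<le> B v v" if "v \<in> V" for v
  proof -
    obtain f g f' g' where v: "v = ((f, g), (f', g'))" by (metis surj_pair)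
    have vX: "(f, g) \<in> X" "(f', g') \<in> X" using that unfolding v V_def by auto
    have "M (\<kappa> *\<^sub>R f') f + M ((- \<kappa>) *\<^sub>R f) f' = 0"
      by (simp only: M.scaleR_left) (simp add: M_def wform_commute[of _ f f'])
    then have "B v v = N g g + N g' g'" by (simp add: B_def v)
    moreover have "(norm v)\<^sup>2 = ((norm f)\<^sup>2 + (norm g)\<^sup>2) + ((norm f')\<^sup>2 + (norm g')\<^sup>2)"
      by (simp add: v norm_prod_def)
    ultimately show ?thesis using one[OF vX(1)] one[OF vX(2)] by (simp add: distrib_left)
  qed
  obtain u where u: "u \<in> V" "\<And>v. v \<in> V \<Longrightarrow> B u v = F v"
    using lax_milgram_on_closed_subspace[OF V bF bB \<alpha> coerc] by blast
  have uX: "fst u \<in> closure (test_pairs \<Omega>)" "snd u \<in> closure (test_pairs \<Omega>)"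
    using u(1) by (auto simp: V_def X_def mem_Times_iff)
  obtain zc gc where z1: "H10pair \<Omega> zc gc" "fst u = (cls \<Omega> zc, cls \<Omega> gc)"
    using H10pair_rep[OF S uX(1)] by blast
  obtain zs gs where z2: "H10pair \<Omega> zs gs" "snd u = (cls \<Omega> zs, cls \<Omega> gs)"
    using H10pair_rep[OF S uX(2)] by blast
  have L: "zc \<in> L2 \<Omega>" "gc \<in> L2 \<Omega>" "zs \<in> L2 \<Omega>" "gs \<in> L2 \<Omega>" using z1 z2 by (auto simp: H10pair_def)
  have "(LINT x:\<Omega>|lborel. \<nu> x * (gc x \<bullet> \<gamma> x)) + \<kappa> * (LINT x:\<Omega>|lborel. \<sigma> x * (zs x * q x)) = (LINT x:\<Omega>|lborel. a x * q x) \<and>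
     (LINT x:\<Omega>|lborel. \<nu> x * (gs x \<bullet> \<gamma> x)) - \<kappa> * (LINT x:\<Omega>|lborel. \<sigma> x * (zc x * q x)) = (LINT x:\<Omega>|lborel. b x * q x)"
    if p: "H10pair \<Omega> q \<gamma>" for q \<gamma>
  proof -
    have LL: "q \<in> L2 \<Omega>" "\<gamma> \<in> L2 \<Omega>" and pX: "(cls \<Omega> q, cls \<Omega> \<gamma>) \<in> X" using p by (auto simp: H10pair_def X_def)
    have X0: "(0, 0) \<in> X" using subspace_0[OF X(1)] by (simp add: zero_prod_def)
    have "B u ((cls \<Omega> q, cls \<Omega> \<gamma>), (0, 0)) = F ((cls \<Omega> q, cls \<Omega> \<gamma>), (0, 0))"
         "B u ((0, 0), (cls \<Omega> q, cls \<Omega> \<gamma>)) = F ((0, 0), (cls \<Omega> q, cls \<Omega> \<gamma>))"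
      using pX X0 by (auto intro!: u(2) simp: V_def)
    then show ?thesis
      by (simp add: B_def F_def z1 z2 N.zero_right M.zero_right M.scaleR_left M.minus_left Ne Me L LL inner_cls ab l2inner_def)
  qed
  then show ?thesis using z1 z2 by blast
qed

section \<open>Slices of functions on a product\<close>

lemma fubini_fst:
  fixes f :: "'a::euclidean_space \<times> 'b::euclidean_space \<Rightarrow> 'c::euclidean_space"
  assumes f: "integrable lborel f"
  shows "AE x in lborel. integrable lborel (\<lambda>y. f (x, y))"
    "integrable lborel (\<lambda>x. LINT y|lborel. f (x, y))"
    "(LINT z|lborel. f z) = (LINT x|lborel. LINT y|lborel. f (x, y))"
proof -
  have f': "integrable (lborel \<Otimes>\<^sub>M lborel) f" using f by (simp add: lborel_prod)
  show "AE x in lborel. integrable lborel (\<lambda>y. f (x, y))" by (rule lborel_pair.AE_integrable_fst'[OF f'])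
  show "integrable lborel (\<lambda>x. LINT y|lborel. f (x, y))" by (rule lborel_pair.integrable_fst'[OF f'])
  show "(LINT z|lborel. f z) = (LINT x|lborel. LINT y|lborel. f (x, y))"
    using lborel_pair.integral_fst'[OF f'] by (simp add: lborel_prod)
qed

lemma fubini_snd:
  fixes f :: "'a::euclidean_space \<times> 'b::euclidean_space \<Rightarrow> 'c::euclidean_space"
  assumes f: "integrable lborel f"
  shows "AE y in lborel. integrable lborel (\<lambda>x. f (x, y))"
    "integrable lborel (\<lambda>y. LINT x|lborel. f (x, y))"
    "(LINT z|lborel. f z) = (LINT y|lborel. LINT x|lborel. f (x, y))"
proof -
  have f': "integrable (lborel \<Otimes>\<^sub>M lborel) (case_prod (\<lambda>x y. f (x, y)))" using f by (simp add: lborel_prod)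
  show "AE y in lborel. integrable lborel (\<lambda>x. f (x, y))" by (rule lborel_pair.AE_integrable_snd[OF f'])
  show "integrable lborel (\<lambda>y. LINT x|lborel. f (x, y))" by (rule lborel_pair.integrable_snd[OF f'])
  show "(LINT z|lborel. f z) = (LINT y|lborel. LINT x|lborel. f (x, y))"
    using lborel_pair.integral_snd[OF f'] by (simp add: lborel_prod)
qed

lemma indicator_prod: "indicat_real (A \<times> B) (x, y) = indicat_real A x * indicat_real B y"
  by (auto simp: indicator_def)

lemma set_fubini_fst:
  fixes f :: "'a::euclidean_space \<times> 'b::euclidean_space \<Rightarrow> 'c::euclidean_space"
  assumes f: "set_integrable lborel (A \<times> B) f"
  shows "AE x in lborel. x \<in> A \<longrightarrow> set_integrable lborel B (\<lambda>y. f (x, y))"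
    "set_integrable lborel A (\<lambda>x. LINT y:B|lborel. f (x, y))"
    "(LINT z:A \<times> B|lborel. f z) = (LINT x:A|lborel. LINT y:B|lborel. f (x, y))"
proof -
  note F = fubini_fst[OF f[unfolded set_integrable_def]]
  have 1: "(LINT y|lborel. indicat_real (A \<times> B) (x, y) *\<^sub>R f (x, y)) = indicat_real A x *\<^sub>R (LINT y:B|lborel. f (x, y))" for x
    by (simp add: indicator_prod set_lebesgue_integral_def flip: scaleR_scaleR)
  show "AE x in lborel. x \<in> A \<longrightarrow> set_integrable lborel B (\<lambda>y. f (x, y))"
    using F(1) by eventually_elim (auto simp: set_integrable_def indicator_prod)
  show "set_integrable lborel A (\<lambda>x. LINT y:B|lborel. f (x, y))"
    using F(2) unfolding 1 by (simp add: set_integrable_def)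
  show "(LINT z:A \<times> B|lborel. f z) = (LINT x:A|lborel. LINT y:B|lborel. f (x, y))"
    using F(3) unfolding 1 by (simp add: set_lebesgue_integral_def)
qed

lemma set_fubini_snd:
  fixes f :: "'a::euclidean_space \<times> 'b::euclidean_space \<Rightarrow> 'c::euclidean_space"
  assumes f: "set_integrable lborel (A \<times> B) f"
  shows "AE y in lborel. y \<in> B \<longrightarrow> set_integrable lborel A (\<lambda>x. f (x, y))"
    "set_integrable lborel B (\<lambda>y. LINT x:A|lborel. f (x, y))"
    "(LINT z:A \<times> B|lborel. f z) = (LINT y:B|lborel. LINT x:A|lborel. f (x, y))"
proof -
  note F = fubini_snd[OF f[unfolded set_integrable_def]]
  have 1: "(LINT x|lborel. indicat_real (A \<times> B) (x, y) *\<^sub>R f (x, y)) = indicat_real B y *\<^sub>R (LINT x:A|lborel. f (x, y))" for y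
    by (simp add: indicator_prod set_lebesgue_integral_def mult.commute[of _ "indicat_real B y"] flip: scaleR_scaleR)
  show "AE y in lborel. y \<in> B \<longrightarrow> set_integrable lborel A (\<lambda>x. f (x, y))"
    using F(1) by eventually_elim (auto simp: set_integrable_def indicator_prod)
  show "set_integrable lborel B (\<lambda>y. LINT x:A|lborel. f (x, y))"
    using F(2) unfolding 1 by (simp add: set_integrable_def)
  show "(LINT z:A \<times> B|lborel. f z) = (LINT y:B|lborel. LINT x:A|lborel. f (x, y))"
    using F(3) unfolding 1 by (simp add: set_lebesgue_integral_def)
qed

lemma measurable_slice:
  fixes f :: "'a::euclidean_space \<times> 'b::euclidean_space \<Rightarrow> 'c::euclidean_space"
  assumes f: "f \<in> borel_measurable lborel"
  shows "(\<lambda>y. f (x, y)) \<in> borel_measurable lborel" "(\<lambda>x. f (x, y)) \<in> borel_measurable lborel"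
proof -
  have [measurable]: "f \<in> borel_measurable (borel \<Otimes>\<^sub>M borel)" using f by (simp add: borel_prod)
  show "(\<lambda>y. f (x, y)) \<in> borel_measurable lborel" "(\<lambda>x. f (x, y)) \<in> borel_measurable lborel" by measurable
qed

lemma L2_slices:
  fixes f :: "'a::euclidean_space \<times> 'b::euclidean_space \<Rightarrow> 'c::euclidean_space"
  assumes f: "f \<in> L2 (A \<times> B)"
  shows "AE x in lborel. x \<in> A \<longrightarrow> (\<lambda>y. f (x, y)) \<in> L2 B"
    "AE y in lborel. y \<in> B \<longrightarrow> (\<lambda>x. f (x, y)) \<in> L2 A"
proof -
  have m: "ext (A \<times> B) f \<in> borel_measurable lborel" and i: "set_integrable lborel (A \<times> B) (\<lambda>z. (norm (f z))\<^sup>2)"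
    using f by (auto simp: L2_def set_borel_measurable_def ext_def)
  have 1: "set_borel_measurable lborel B (\<lambda>y. f (x, y))" if "x \<in> A" for x
    using measurable_slice(1)[OF m, of x] that by (simp add: set_borel_measurable_def ext_def indicator_prod)
  have 2: "set_borel_measurable lborel A (\<lambda>x. f (x, y))" if "y \<in> B" for y
    using measurable_slice(2)[OF m, of y] that by (simp add: set_borel_measurable_def ext_def indicator_prod)
  show "AE x in lborel. x \<in> A \<longrightarrow> (\<lambda>y. f (x, y)) \<in> L2 B"
    using set_fubini_fst(1)[OF i] by eventually_elim (simp add: L2_def 1)
  show "AE y in lborel. y \<in> B \<longrightarrow> (\<lambda>x. f (x, y)) \<in> L2 A"
    using set_fubini_snd(1)[OF i] by eventually_elim (simp add: L2_def 2)
qed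

lemma l2norm_sq: "(l2norm S f)\<^sup>2 = (LINT z:S|lborel. (norm (f z))\<^sup>2)"
proof -
  have "0 \<le> (LINT z:S|lborel. (norm (f z))\<^sup>2)"
    unfolding set_lebesgue_integral_def by (rule Bochner_Integration.integral_nonneg) auto
  then show ?thesis by (simp add: l2norm_def)
qed

lemma l2norm_nonneg: "0 \<le> l2norm S f"
  unfolding l2norm_def set_lebesgue_integral_def
  by (intro real_sqrt_ge_zero Bochner_Integration.integral_nonneg) auto

lemma L2_norm_sq_integrable: "f \<in> L2 S \<Longrightarrow> set_integrable lborel S (\<lambda>z. (norm (f z))\<^sup>2)"
  by (simp add: L2_def)

lemma l2norm_sq_slices:
  fixes f :: "'a::euclidean_space \<times> 'b::euclidean_space \<Rightarrow> 'c::euclidean_space"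
  assumes f: "f \<in> L2 (A \<times> B)"
  shows "set_integrable lborel A (\<lambda>x. (l2norm B (\<lambda>y. f (x, y)))\<^sup>2)"
    "(l2norm (A \<times> B) f)\<^sup>2 = (LINT x:A|lborel. (l2norm B (\<lambda>y. f (x, y)))\<^sup>2)"
    "set_integrable lborel B (\<lambda>y. (l2norm A (\<lambda>x. f (x, y)))\<^sup>2)"
    "(l2norm (A \<times> B) f)\<^sup>2 = (LINT y:B|lborel. (l2norm A (\<lambda>x. f (x, y)))\<^sup>2)"
  unfolding l2norm_sq
  using set_fubini_fst(2,3)[OF L2_norm_sq_integrable[OF f]] set_fubini_snd(2,3)[OF L2_norm_sq_integrable[OF f]] by auto

lemma l2norm_eq_0:
  assumes f: "f \<in> L2 S" and 0: "l2norm S f = 0"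
  shows "AE z in lborel. z \<in> S \<longrightarrow> f z = 0"
proof -
  have "cls S f = cls S (\<lambda>x. 0)"
    using norm_cls[OF f] 0 norm_cls[OF L2_zero, of S] by (simp add: l2norm_def)
  then show ?thesis using cls_eq_iff[OF f L2_zero] by simp
qed

lemma l2norm_AE_0:
  assumes "AE z in lborel. z \<in> S \<longrightarrow> f z = 0"
  shows "l2norm S f = 0"
proof -
  have "(LINT z:S|lborel. (norm (f z))\<^sup>2) = 0"
    unfolding set_lebesgue_integral_def
    by (rule integral_eq_zero_AE) (use assms in eventually_elim, auto simp: indicator_def)
  then show ?thesis by (simp add: l2norm_def)
qed

text \<open>
  Fubini computes the norm from the norms of the slices, in either direction. Equality on the
  slices is thus enough to show that derivatives defined slice by slice are unique.
\<close>

lemma L2_AE_zero_of_slices: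
  fixes f :: "'a::euclidean_space \<times> 'b::euclidean_space \<Rightarrow> 'c::euclidean_space"
  assumes f: "f \<in> L2 (A \<times> B)"
    and z: "(AE x in lborel. x \<in> A \<longrightarrow> (AE y in lborel. y \<in> B \<longrightarrow> f (x, y) = 0)) \<or>
      (AE y in lborel. y \<in> B \<longrightarrow> (AE x in lborel. x \<in> A \<longrightarrow> f (x, y) = 0))"
  shows "AE z in lborel. z \<in> A \<times> B \<longrightarrow> f z = 0"
proof (rule l2norm_eq_0[OF f])
  have "(l2norm (A \<times> B) f)\<^sup>2 = 0"
    using z
  proof
    assume "AE x in lborel. x \<in> A \<longrightarrow> (AE y in lborel. y \<in> B \<longrightarrow> f (x, y) = 0)"
    then have "AE x in lborel. indicat_real A x *\<^sub>R (l2norm B (\<lambda>y. f (x, y)))\<^sup>2 = 0"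
      by eventually_elim (auto simp: l2norm_AE_0 indicator_def)
    then show ?thesis unfolding l2norm_sq_slices(2)[OF f] set_lebesgue_integral_def by (rule integral_eq_zero_AE)
  next
    assume "AE y in lborel. y \<in> B \<longrightarrow> (AE x in lborel. x \<in> A \<longrightarrow> f (x, y) = 0)"
    then have "AE y in lborel. indicat_real B y *\<^sub>R (l2norm A (\<lambda>x. f (x, y)))\<^sup>2 = 0"
      by eventually_elim (auto simp: l2norm_AE_0 indicator_def)
    then show ?thesis unfolding l2norm_sq_slices(4)[OF f] set_lebesgue_integral_def by (rule integral_eq_zero_AE)
  qed
  then show "l2norm (A \<times> B) f = 0" by simp
qed

lemma tendsto_cls_iff:
  assumes "\<And>n. f n \<in> L2 S" "g \<in> L2 S"
  shows "(\<lambda>n. cls S (f n)) \<longlonglongrightarrow> cls S g \<longleftrightarrow> (\<lambda>n. l2norm S (\<lambda>z. f n z - g z)) \<longlonglongrightarrow> 0"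
  unfolding tendsto_dist_iff[of _ "cls S g"]
  by (simp add: dist_norm cls_diff[symmetric] assms norm_cls L2_diff)

text \<open>
  The integral of the sum of squares is finite by monotone convergence, so that the series of
  squares converges almost everywhere.
\<close>

lemma AE_tendsto_0_of_summable_integrals:
  fixes u :: "nat \<Rightarrow> 'a::euclidean_space \<Rightarrow> real"
  assumes i: "\<And>n. set_integrable lborel A (\<lambda>x. (u n x)\<^sup>2)" and s: "summable (\<lambda>n. LINT x:A|lborel. (u n x)\<^sup>2)"
  shows "AE x in lborel. x \<in> A \<longrightarrow> (\<lambda>n. u n x) \<longlonglongrightarrow> 0"
proof -
  define v where "v n x = indicat_real A x * (u n x)\<^sup>2" for n x
  have vi: "integrable lborel (v n)" for n using i[of n] by (simp add: set_integrable_def v_def[abs_def])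
  have [measurable]: "v n \<in> borel_measurable lborel" for n using vi by (rule borel_measurable_integrable)
  have v0: "0 \<le> v n x" for n x by (simp add: v_def)
  have vs: "summable (\<lambda>n. LINT x|lborel. v n x)" using s by (simp add: set_lebesgue_integral_def v_def)
  have "(\<integral>\<^sup>+x. (\<Sum>n. ennreal (v n x)) \<partial>lborel) = (\<Sum>n. \<integral>\<^sup>+x. ennreal (v n x) \<partial>lborel)"
    by (rule nn_integral_suminf) measurable
  also have "\<dots> = (\<Sum>n. ennreal (LINT x|lborel. v n x))"
    using nn_integral_eq_integral[OF vi AE_I2[OF v0]] by simp
  also have "\<dots> \<noteq> \<infinity>"
    unfolding suminf_ennreal2[OF Bochner_Integration.integral_nonneg[OF v0] vs] by simp
  finally have "AE x in lborel. (\<Sum>n. ennreal (v n x)) \<noteq> \<infinity>"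
    by (intro nn_integral_PInf_AE) measurable
  then show ?thesis
  proof eventually_elim
    case (elim x)
    show ?case
    proof
      assume x: "x \<in> A"
      have "summable (\<lambda>n. v n x)" by (rule summable_suminf_not_top[OF v0]) (use elim in simp)
      then have "(\<lambda>n. v n x) \<longlonglongrightarrow> 0" by (rule summable_LIMSEQ_zero)
      then have "(\<lambda>n. sqrt ((u n x)\<^sup>2)) \<longlonglongrightarrow> sqrt 0" using x by (intro tendsto_real_sqrt) (simp add: v_def)
      then show "(\<lambda>n. u n x) \<longlonglongrightarrow> 0" by (simp add: tendsto_rabs_zero_iff)
    qed
  qed
qed

text \<open>
  Convergence in $L^2$ alone gives convergence of the slices only along a subsequence. With
  summable errors the whole sequence has this property, and several sequences can be used on
  the same slice.
\<close>

lemma slices_tendsto: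
  fixes f :: "nat \<Rightarrow> 'a::euclidean_space \<times> 'b::euclidean_space \<Rightarrow> 'c::euclidean_space"
  assumes f: "\<And>n. f n \<in> L2 (A \<times> B)" "g \<in> L2 (A \<times> B)" and s: "summable (\<lambda>n. (l2norm (A \<times> B) (\<lambda>z. f n z - g z))\<^sup>2)"
  shows "AE x in lborel. x \<in> A \<longrightarrow> (\<lambda>n. cls B (\<lambda>y. f n (x, y))) \<longlonglongrightarrow> cls B (\<lambda>y. g (x, y))"
    "AE y in lborel. y \<in> B \<longrightarrow> (\<lambda>n. cls A (\<lambda>x. f n (x, y))) \<longlonglongrightarrow> cls A (\<lambda>x. g (x, y))"
proof -
  have d: "(\<lambda>z. f n z - g z) \<in> L2 (A \<times> B)" for n by (intro L2_diff f)
  note D = l2norm_sq_slices[OF d]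
  have l: "AE x in lborel. x \<in> A \<longrightarrow> (\<lambda>n. l2norm B (\<lambda>y. f n (x, y) - g (x, y))) \<longlonglongrightarrow> 0"
    "AE y in lborel. y \<in> B \<longrightarrow> (\<lambda>n. l2norm A (\<lambda>x. f n (x, y) - g (x, y))) \<longlonglongrightarrow> 0"
    using AE_tendsto_0_of_summable_integrals[OF D(1)] AE_tendsto_0_of_summable_integrals[OF D(3)] s D(2,4) by simp_all
  have L: "AE x in lborel. \<forall>n. x \<in> A \<longrightarrow> (\<lambda>y. f n (x, y)) \<in> L2 B" "AE y in lborel. \<forall>n. y \<in> B \<longrightarrow> (\<lambda>x. f n (x, y)) \<in> L2 A"
    unfolding AE_all_countable using L2_slices[OF f(1)] by auto
  show "AE x in lborel. x \<in> A \<longrightarrow> (\<lambda>n. cls B (\<lambda>y. f n (x, y))) \<longlonglongrightarrow> cls B (\<lambda>y. g (x, y))"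
    using l(1) L(1) L2_slices(1)[OF f(2)] by eventually_elim (auto simp: tendsto_cls_iff)
  show "AE y in lborel. y \<in> B \<longrightarrow> (\<lambda>n. cls A (\<lambda>x. f n (x, y))) \<longlonglongrightarrow> cls A (\<lambda>x. g (x, y))"
    using l(2) L(2) L2_slices(2)[OF f(2)] by eventually_elim (auto simp: tendsto_cls_iff)
qed

section \<open>Weak derivatives on a time interval\<close>

definition prim :: "(real \<Rightarrow> real) \<Rightarrow> real \<Rightarrow> real" where
  "prim h t = (LINT s:{0<..<t}|lborel. h s)"

lemma prim_continuous:
  assumes h: "set_integrable lborel {0<..<T} h"
  shows "continuous_on {0..T} (prim h)"
proof -
  define k where "k s = indicat_real {0<..<T} s * h s" for s
  have ki: "integrable lborel k" using h by (simp add: set_integrable_def k_def[abs_def])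
  have ks: "set_integrable lborel {a..b} k" for a b
    using integrable_mult_indicator[OF _ ki, of "{a..b}"] by (simp add: set_integrable_def)
  have e: "prim h t = integral {0..t} k" if t: "t \<in> {0..T}" for t
  proof -
    have "(LINT s:{0..t}|lborel. k s) = prim h t"
      unfolding prim_def set_lebesgue_integral_def
    proof (rule integral_cong_AE)
      show "(\<lambda>x. indicat_real {0..t} x *\<^sub>R k x) \<in> borel_measurable lborel"
        using ks[of 0 t] by (auto simp: set_integrable_def)
      have "set_integrable lborel {0<..<t} h"
        by (rule set_integrable_subset[OF h]) (use t in auto)
      then show "(\<lambda>x. indicat_real {0<..<t} x *\<^sub>R h x) \<in> borel_measurable lborel" by (auto simp: set_integrable_def)
      show "AE x in lborel. indicat_real {0..t} x *\<^sub>R k x = indicat_real {0<..<t} x *\<^sub>R h x"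
        using AE_lborel_singleton[of 0] AE_lborel_singleton[of t]
        by eventually_elim (use t in \<open>auto simp: k_def indicator_def\<close>)
    qed
    then show ?thesis using set_borel_integral_eq_integral(2)[OF ks[of 0 t]] by simp
  qed
  have "continuous_on {0..T} (\<lambda>t. integral {0..t} k)"
    by (rule indefinite_integral_continuous_1) (rule set_borel_integral_eq_integral(1)[OF ks])
  then show ?thesis by (rule continuous_on_eq) (use e in auto)
qed

lemma prim_0: "prim h 0 = 0"
  by (simp add: prim_def set_lebesgue_integral_def)

lemma continuous_set_integrable_mult:
  fixes h g :: "real \<Rightarrow> real"
  assumes h: "set_integrable lborel {0<..<T} h" and g: "continuous_on {0..T} g"
  shows "set_integrable lborel {0<..<T} (\<lambda>t. h t * g t)"
proof -
  have "compact (g ` {0..T})" using g by (rule compact_continuous_image) simp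
  then obtain M where M: "\<And>t. t \<in> {0..T} \<Longrightarrow> \<bar>g t\<bar> \<le> M"
    using compact_imp_bounded bounded_iff by (metis imageI real_norm_def)
  have gm: "(\<lambda>x. indicat_real {0..T} x *\<^sub>R g x) \<in> borel_measurable borel"
    using borel_measurable_continuous_on_indicator[OF _ g] by simp
  have hm: "integrable lborel (\<lambda>x. indicat_real {0<..<T} x *\<^sub>R h x)" using h by (simp add: set_integrable_def)
  have "integrable lborel (\<lambda>x. (indicat_real {0<..<T} x *\<^sub>R h x) * (indicat_real {0..T} x *\<^sub>R g x))"
  proof (rule Bochner_Integration.integrable_bound)
    show "integrable lborel (\<lambda>x. M *\<^sub>R (indicat_real {0<..<T} x *\<^sub>R h x))" using hm by (intro integrable_scaleR_right)
    show "(\<lambda>x. (indicat_real {0<..<T} x *\<^sub>R h x) * (indicat_real {0..T} x *\<^sub>R g x)) \<in> borel_measurable lborel"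
      using gm by (intro borel_measurable_times borel_measurable_integrable[OF hm]) simp
    show "AE x in lborel. norm ((indicat_real {0<..<T} x *\<^sub>R h x) * (indicat_real {0..T} x *\<^sub>R g x)) \<le> norm (M *\<^sub>R (indicat_real {0<..<T} x *\<^sub>R h x))"
    proof (rule AE_I2)
      fix x
      have "\<bar>h x\<bar> * \<bar>g x\<bar> \<le> \<bar>h x\<bar> * \<bar>M\<bar>" if "x \<in> {0<..<T}" using M[of x] that by (intro mult_left_mono) auto
      then show "norm ((indicat_real {0<..<T} x *\<^sub>R h x) * (indicat_real {0..T} x *\<^sub>R g x)) \<le> norm (M *\<^sub>R (indicat_real {0<..<T} x *\<^sub>R h x))"
        by (auto simp: indicator_def abs_mult mult.commute)
    qed
  qed
  moreover have "(\<lambda>x. (indicat_real {0<..<T} x *\<^sub>R h x) * (indicat_real {0..T} x *\<^sub>R g x)) = (\<lambda>x. indicat_real {0<..<T} x *\<^sub>R (h x * g x))"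
    by (auto simp: fun_eq_iff indicator_def)
  ultimately show ?thesis by (simp add: set_integrable_def)
qed

lemma continuous_set_integrable:
  fixes g :: "real \<Rightarrow> real"
  assumes "continuous_on {0..T} g"
  shows "set_integrable lborel {0<..<T} g"
proof -
  have "set_integrable lborel {0<..<T} (\<lambda>t. 1::real)"
    using emeasure_bounded_finite[of "{0<..<T}"]
    by (auto simp: set_integrable_def simp del: emeasure_lborel_Ioo intro!: integrable_real_indicator)
  from continuous_set_integrable_mult[OF this assms] show ?thesis by simp
qed

text \<open>
  Integration by parts for the primitives of integrable functions: both sides are the integral
  of \<open>h(t) k(s)\<close> over a square, which the diagonal cuts into two triangles.
\<close>

lemma prim_product_integral:
  assumes T: "T > 0" and h: "set_integrable lborel {0<..<T} h" and k: "set_integrable lborel {0<..<T} k"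
  shows "(LINT t:{0<..<T}|lborel. h t * prim k t) + (LINT t:{0<..<T}|lborel. k t * prim h t)
    = (LINT t:{0<..<T}|lborel. h t) * (LINT t:{0<..<T}|lborel. k t)"
proof -
  define H where "H t = indicat_real {0<..<T} t * h t" for t
  define K where "K t = indicat_real {0<..<T} t * k t" for t
  have Hi: "integrable lborel H" and Ki: "integrable lborel K"
    using h k by (simp_all add: set_integrable_def H_def[abs_def] K_def[abs_def])
  have [measurable]: "H \<in> borel_measurable borel" "K \<in> borel_measurable borel"
    using Hi Ki by (auto dest: borel_measurable_integrable)
  have pK: "(LINT s|lborel. indicat_real {..<t} s * K s) = prim k t" if "t \<in> {0<..<T}" for t
    unfolding prim_def set_lebesgue_integral_def
    by (rule Bochner_Integration.integral_cong) (use that in \<open>auto simp: K_def indicator_def\<close>)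
  have pH: "(LINT s|lborel. indicat_real {..<t} s * H s) = prim h t" if "t \<in> {0<..<T}" for t
    unfolding prim_def set_lebesgue_integral_def
    by (rule Bochner_Integration.integral_cong) (use that in \<open>auto simp: H_def indicator_def\<close>)
  have IK: "integrable lborel (\<lambda>s. indicat_real A s * K s)" and IH: "integrable lborel (\<lambda>s. indicat_real A s * H s)"
    if "A \<in> sets borel" for A
    using integrable_mult_indicator[OF _ Ki, of A] integrable_mult_indicator[OF _ Hi, of A] that by simp_all
  have split: "(LINT s|lborel. K s) = (LINT s|lborel. indicat_real {..<t} s * K s) + (LINT s|lborel. indicat_real {t<..} s * K s)" for t
  proof -
    have "(LINT s|lborel. K s) = (LINT s|lborel. indicat_real {..<t} s * K s + indicat_real {t<..} s * K s)"
    proof (rule integral_cong_AE)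
      show "AE s in lborel. K s = indicat_real {..<t} s * K s + indicat_real {t<..} s * K s"
        using AE_lborel_singleton[of t] by eventually_elim (auto simp: indicator_def)
    qed (use IK in auto)
    also have "\<dots> = (LINT s|lborel. indicat_real {..<t} s * K s) + (LINT s|lborel. indicat_real {t<..} s * K s)"
      using IK by simp
    finally show ?thesis .
  qed
  have sw: "(LINT t|lborel. H t * (LINT s|lborel. indicat_real {t<..} s * K s)) = (LINT s|lborel. K s * (LINT t|lborel. indicat_real {..<s} t * H t))"
  proof -
    have i: "integrable (lborel \<Otimes>\<^sub>M lborel) (\<lambda>(t, s). H t * K s)"
    proof (rule lborel_pair.Fubini_integrable)
      show "(\<lambda>(t, s). H t * K s) \<in> borel_measurable (lborel \<Otimes>\<^sub>M lborel)" by measurable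
      show "integrable lborel (\<lambda>x. LINT y|lborel. norm (case (x, y) of (t, s) \<Rightarrow> H t * K s))"
        using Hi Ki by (simp add: abs_mult)
      show "AE x in lborel. integrable lborel (\<lambda>y. case (x, y) of (t, s) \<Rightarrow> H t * K s)" using Ki by simp
    qed
    have "integrable (lborel \<Otimes>\<^sub>M lborel) (\<lambda>z. indicat_real {z. fst z < snd z} z *\<^sub>R (case z of (t, s) \<Rightarrow> H t * K s))"
    proof (rule integrable_mult_indicator[OF _ i])
      have "open {z::real\<times>real. fst z < snd z}" by (intro open_Collect_less continuous_intros)
      then have "{z::real\<times>real. fst z < snd z} \<in> sets borel" by (rule borel_open)
      then show "{z::real\<times>real. fst z < snd z} \<in> sets (lborel \<Otimes>\<^sub>M lborel)" unfolding lborel_prod by simp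
    qed
    then have i2: "integrable (lborel \<Otimes>\<^sub>M lborel) (case_prod (\<lambda>t s. (if t < s then 1 else 0) * (H t * K s)))"
      by (rule Bochner_Integration.integrable_cong[THEN iffD1, rotated -1]) (auto simp: indicator_def)
    have "(LINT t|lborel. H t * (LINT s|lborel. indicat_real {t<..} s * K s)) = (LINT t|lborel. LINT s|lborel. (if t < s then 1 else 0) * (H t * K s))"
      by (intro Bochner_Integration.integral_cong refl, subst integral_mult_right_zero[symmetric],
          intro Bochner_Integration.integral_cong refl) (auto simp: indicator_def)
    also have "\<dots> = (LINT s|lborel. LINT t|lborel. (if t < s then 1 else 0) * (H t * K s))"
      using lborel_pair.Fubini_integral[OF i2] by simp
    also have "\<dots> = (LINT s|lborel. K s * (LINT t|lborel. indicat_real {..<s} t * H t))"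
      by (intro Bochner_Integration.integral_cong refl, subst integral_mult_right_zero[symmetric],
          intro Bochner_Integration.integral_cong refl) (auto simp: indicator_def)
    finally show ?thesis .
  qed
  have a: "(LINT t:{0<..<T}|lborel. h t * prim k t) = (LINT t|lborel. H t * (LINT s|lborel. indicat_real {..<t} s * K s))"
    unfolding set_lebesgue_integral_def
    by (rule Bochner_Integration.integral_cong) (use pK in \<open>auto simp: H_def indicator_def\<close>)
  have b: "(LINT t:{0<..<T}|lborel. k t * prim h t) = (LINT t|lborel. K t * (LINT s|lborel. indicat_real {..<t} s * H s))"
    unfolding set_lebesgue_integral_def
    by (rule Bochner_Integration.integral_cong) (use pH in \<open>auto simp: K_def indicator_def\<close>)
  have ia: "integrable lborel (\<lambda>t. H t * (LINT s|lborel. indicat_real {..<t} s * K s))"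
  proof -
    have "set_integrable lborel {0<..<T} (\<lambda>t. h t * prim k t)" by (rule continuous_set_integrable_mult[OF h prim_continuous[OF k]])
    then show ?thesis unfolding set_integrable_def
      by (rule Bochner_Integration.integrable_cong[THEN iffD1, rotated -1]) (use pK in \<open>auto simp: H_def indicator_def\<close>)
  qed
  have "(LINT t:{0<..<T}|lborel. k t * prim h t) = (LINT t|lborel. H t * (LINT s|lborel. indicat_real {t<..} s * K s))"
    unfolding b sw ..
  also have "\<dots> = (LINT t|lborel. H t * (LINT s|lborel. K s) - H t * (LINT s|lborel. indicat_real {..<t} s * K s))"
  proof (rule Bochner_Integration.integral_cong[OF refl])
    fix t
    show "H t * (LINT s|lborel. indicat_real {t<..} s * K s) = H t * (LINT s|lborel. K s) - H t * (LINT s|lborel. indicat_real {..<t} s * K s)"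
      unfolding split[of t] by (simp add: algebra_simps)
  qed
  also have "\<dots> = (LINT t|lborel. H t) * (LINT s|lborel. K s) - (LINT t:{0<..<T}|lborel. h t * prim k t)"
    using ia Hi by (simp add: a)
  finally show ?thesis by (simp add: set_lebesgue_integral_def H_def K_def)
qed

lemma set_integral_FTC:
  fixes F f :: "real \<Rightarrow> real"
  assumes "a \<le> b" "\<And>t. t \<in> {a..b} \<Longrightarrow> (F has_real_derivative f t) (at t)" "continuous_on {a..b} f"
  shows "(LINT t:{a<..<b}|lborel. f t) = F b - F a"
proof -
  have "(LINT x|lborel. indicat_real {a..b} x *\<^sub>R f x) = F b - F a"
    by (rule integral_FTC_Icc)
       (use assms in \<open>auto intro: has_vector_derivative_at_within simp: has_real_derivative_iff_has_vector_derivative\<close>)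
  moreover have "(LINT t:{a<..<b}|lborel. f t) = (LINT x|lborel. indicat_real {a..b} x *\<^sub>R f x)"
    unfolding set_lebesgue_integral_def
  proof (rule integral_cong_AE)
    have m: "(\<lambda>x. indicat_real {a..b} x *\<^sub>R f x) \<in> borel_measurable borel"
      using borel_measurable_continuous_on_indicator[OF _ assms(3)] by simp
    then show "(\<lambda>x. indicat_real {a..b} x *\<^sub>R f x) \<in> borel_measurable lborel" by simp
    have "(\<lambda>x. indicat_real {a<..<b} x *\<^sub>R (indicat_real {a..b} x *\<^sub>R f x)) \<in> borel_measurable lborel"
      by (rule borel_measurable_scaleR[OF borel_measurable_indicator]) (use m in simp_all)
    moreover have "(\<lambda>x. indicat_real {a<..<b} x *\<^sub>R (indicat_real {a..b} x *\<^sub>R f x)) = (\<lambda>x. indicat_real {a<..<b} x *\<^sub>R f x)"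
      by (auto simp: fun_eq_iff indicator_def)
    ultimately show "(\<lambda>x. indicat_real {a<..<b} x *\<^sub>R f x) \<in> borel_measurable lborel" by simp
    show "AE x in lborel. indicat_real {a<..<b} x *\<^sub>R f x = indicat_real {a..b} x *\<^sub>R f x"
      using AE_lborel_singleton[of a] AE_lborel_singleton[of b]
      by eventually_elim (auto simp: indicator_def)
  qed
  ultimately show ?thesis by simp
qed

lemma pderiv_dir_1: "(f has_real_derivative D) (at x) \<Longrightarrow> pderiv_dir 1 f x = D"
  by (simp add: pderiv_dir_eq has_field_derivative_def)

lemma test_real_derivative:
  assumes "\<phi> \<in> test_functions (S :: real set)"
  shows "(\<phi> has_real_derivative pderiv_dir 1 \<phi> x) (at x)"
proof -
  have d: "\<phi> differentiable (at x)" by (rule test_differentiable(1)[OF assms, of 1]) simp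
  then obtain D where "(\<phi> has_real_derivative D) (at x)" by (auto simp: real_differentiable_def)
  then show ?thesis using pderiv_dir_1 by metis
qed

lemma test_real_props:
  assumes "\<phi> \<in> test_functions {0<..<T::real}"
  shows "continuous_on UNIV \<phi>" "continuous_on UNIV (pderiv_dir 1 \<phi>)" "t \<notin> {0<..<T} \<Longrightarrow> \<phi> t = 0"
  by (rule test_function_props(1)[OF assms, of 1], simp)
     (rule test_function_props(2)[OF assms, of 1], simp, rule test_function_props(7)[OF assms, of 1], simp_all)

lemma exists_unit_test_function:
  fixes T :: real
  assumes T: "T > 0"
  shows "\<exists>\<theta>\<in>test_functions {0<..<T}. (LINT t:{0<..<T}|lborel. \<theta> t) = 1"
proof -
  have bx: "box 0 T = {0<..<T}" by (rule box_real)
  have b: "bump 0 T n \<in> test_functions {0<..<T}" for n by (rule bump_test_function) (simp add: bx)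
  have "(\<lambda>n. LINT t|lborel. bump 0 T n t) \<longlonglongrightarrow> (LINT t|lborel. indicat_real {0<..<T} t)"
  proof (rule integral_dominated_convergence)
    show "integrable lborel (indicat_real {0<..<T})" using T by (intro integrable_real_indicator) auto
    show "AE t in lborel. (\<lambda>n. bump 0 T n t) \<longlonglongrightarrow> indicat_real {0<..<T} t"
      using bump_tendsto[of 0 T] by (simp add: bx)
    show "AE t in lborel. norm (bump 0 T n t) \<le> indicat_real {0<..<T} t" for n
      using bump_bounds[of 0 T n] test_real_props(3)[OF b[of n]] by (intro AE_I2) (auto simp: indicator_def)
    show "bump 0 T n \<in> borel_measurable lborel" for n
      using borel_measurable_continuous_onI[OF test_real_props(1)[OF b]] by simp
  qed simp
  then have "(\<lambda>n. LINT t|lborel. bump 0 T n t) \<longlonglongrightarrow> T" using T by simp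
  then have "eventually (\<lambda>n. (LINT t|lborel. bump 0 T n t) > 0) sequentially" using T by (rule order_tendstoD)
  then obtain n where n: "(LINT t|lborel. bump 0 T n t) > 0" using eventually_happens'[OF sequentially_bot] by blast
  define c where "c = (LINT t|lborel. bump 0 T n t)"
  have "(\<lambda>x. (1 / c) * bump 0 T n x + 0 * bump 0 T n x) \<in> test_functions {0<..<T}"
    by (rule test_functions_linear[OF b b])
  moreover have "(LINT t:{0<..<T}|lborel. (1 / c) * bump 0 T n t + 0 * bump 0 T n t) = 1"
    using n LINT_eq_of_zero_off[of "{0<..<T}" "bump 0 T n"] test_real_props(3)[OF b[of n]] by (simp add: c_def)
  ultimately show ?thesis by blast
qed

text \<open>
  The primitive of \<open>\<psi>\<close> is constant on both sides of the support of \<open>\<psi>\<close>: it vanishes on the left by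
  the choice of the lower bound, and on the right because \<open>\<psi>\<close> has mean zero.
\<close>

lemma test_antiderivative:
  fixes T :: real
  assumes T: "T > 0" and p: "\<psi> \<in> test_functions {0<..<T}" and z: "(LINT t:{0<..<T}|lborel. \<psi> t) = 0"
  shows "\<exists>\<phi>\<in>test_functions {0<..<T}. pderiv_dir 1 \<phi> = \<psi>"
proof -
  define \<phi> where "\<phi> t = (LBINT s=0..t. \<psi> s)" for t :: real
  have c: "continuous_on A \<psi>" for A using test_real_props(1)[OF p] continuous_on_subset by blast
  have d: "(\<phi> has_real_derivative \<psi> t) (at t)" for t
  proof -
    define a b where "a = min 0 t - 1" and "b = max 0 t + 1"
    have ab: "a < 0" "0 < b" "a < t" "t < b" by (auto simp: a_def b_def)
    have "((\<lambda>u. LBINT y=0..u. \<psi> y) has_vector_derivative \<psi> t) (at t within {a..b})"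
      using interval_integral_FTC2[of a 0 b \<psi> t] ab c by (simp add: zero_ereal_def)
    then have "(\<phi> has_vector_derivative \<psi> t) (at t within {a<..<b})"
      unfolding \<phi>_def by (rule has_vector_derivative_within_subset) auto
    then have "(\<phi> has_vector_derivative \<psi> t) (at t)"
      using ab by (subst (asm) has_vector_derivative_within_open) auto
    then show ?thesis by (simp add: has_real_derivative_iff_has_vector_derivative)
  qed
  have pd: "pderiv_dir 1 \<phi> = \<psi>" by (rule HOL.ext) (rule pderiv_dir_1[OF d])
  have s: "smooth_fun \<phi>"
    unfolding smooth_fun_def
  proof (intro allI impI)
    fix bs :: "real list" and x :: real assume bs: "set bs \<subseteq> Basis"
    show "foldr pderiv_dir bs \<phi> differentiable at x"
    proof (cases bs rule: rev_cases)
      case Nil then show ?thesis using d by (auto simp: real_differentiable_def)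
    next
      case (snoc cs b)
      then have "b = 1" using bs by auto
      then show ?thesis using snoc bs p pd by (auto simp: test_functions_def smooth_fun_def)
    qed
  qed
  define K where "K = closure {x. \<psi> x \<noteq> 0}"
  have K: "compact K" "K \<subseteq> {0<..<T}" using p by (auto simp: test_functions_def K_def)
  have \<psi>0: "\<psi> t = 0" if "t \<notin> K" for t
    using that closure_subset[of "{x. \<psi> x \<noteq> 0}"] by (auto simp: K_def)
  have \<phi>d: "\<phi> b - \<phi> a = (LINT t:{a<..<b}|lborel. \<psi> t)" if "a \<le> b" for a b
    using set_integral_FTC[OF that d c] by simp
  have \<phi>0: "\<phi> 0 = 0" by (simp add: \<phi>_def zero_ereal_def)
  obtain a b where ab: "0 < a" "b < T" "K \<subseteq> {a..b}"
  proof (cases "K = {}")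
    case True then show thesis using that[of 1 0] T by (auto intro: that[of "1" "T/2"])
  next
    case False
    obtain a where a: "a \<in> K" "\<And>x. x \<in> K \<Longrightarrow> a \<le> x" using compact_attains_inf[OF K(1) False] by auto
    obtain b where b: "b \<in> K" "\<And>x. x \<in> K \<Longrightarrow> x \<le> b" using compact_attains_sup[OF K(1) False] by auto
    show thesis by (rule that[of a b]) (use a b K(2) in auto)
  qed
  have out: "\<phi> t = 0" if t: "t \<notin> {a..b}" for t
  proof -
    consider "t \<le> 0" | "0 \<le> t" "t < a" | "t > b" "t \<le> T" | "t \<ge> T" using t by fastforce
    then show ?thesis
    proof cases
      case 1
      have "(LINT s:{t<..<0}|lborel. \<psi> s) = (LINT s:{t<..<0}|lborel. 0)"
        using ab by (intro set_lebesgue_integral_cong) (auto intro!: \<psi>0)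
      then show ?thesis using \<phi>d[OF 1] \<phi>0 by simp
    next
      case 2
      have "(LINT s:{0<..<t}|lborel. \<psi> s) = (LINT s:{0<..<t}|lborel. 0)"
        using ab 2 by (intro set_lebesgue_integral_cong) (auto intro!: \<psi>0)
      then show ?thesis using \<phi>d[OF 2(1)] \<phi>0 by simp
    next
      case 3
      have "(LINT s:{t<..<T}|lborel. \<psi> s) = (LINT s:{t<..<T}|lborel. 0)"
        using ab 3 by (intro set_lebesgue_integral_cong) (auto intro!: \<psi>0)
      then show ?thesis using \<phi>d[OF 3(2)] \<phi>d[of 0 T] \<phi>0 z T by simp
    next
      case 4
      have "(LINT s:{T<..<t}|lborel. \<psi> s) = (LINT s:{T<..<t}|lborel. 0)"
        using ab 4 by (intro set_lebesgue_integral_cong) (auto intro!: \<psi>0)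
      then show ?thesis using \<phi>d[OF 4] \<phi>d[of 0 T] \<phi>0 z T by simp
    qed
  qed
  have "{x. \<phi> x \<noteq> 0} \<subseteq> {a..b}" using out by blast
  then have cl: "closure {x. \<phi> x \<noteq> 0} \<subseteq> {a..b}" by (rule closure_minimal) simp
  then have "compact (closure {x. \<phi> x \<noteq> 0})"
    by (meson bounded_closed_interval bounded_subset closed_closure compact_eq_bounded_closed)
  then have "\<phi> \<in> test_functions {0<..<T}" using cl s ab by (auto simp: test_functions_def)
  then show ?thesis using pd by blast
qed

text \<open>
  A test function minus a suitable multiple of a fixed test function of mass one has mean
  zero, hence is the derivative of a test function. So \<open>k - c\<close> is orthogonal to all test
  functions for the mean \<open>c\<close> of \<open>k\<close> with respect to the fixed one.
\<close>

lemma du_bois_reymond: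
  fixes T :: real
  assumes T: "T > 0" and k: "set_integrable lborel {0<..<T} k"
    and z: "\<And>\<phi>. \<phi> \<in> test_functions {0<..<T} \<Longrightarrow> (LINT t:{0<..<T}|lborel. k t * pderiv_dir 1 \<phi> t) = 0"
  shows "\<exists>c. AE t in lborel. t \<in> {0<..<T} \<longrightarrow> k t = c"
proof -
  obtain \<theta> where \<theta>: "\<theta> \<in> test_functions {0<..<T}" "(LINT t:{0<..<T}|lborel. \<theta> t) = 1"
    using exists_unit_test_function[OF T] by blast
  define c where "c = (LINT t:{0<..<T}|lborel. k t * \<theta> t)"
  have I1: "set_integrable lborel {0<..<T} (\<lambda>t. 1::real)" by (rule continuous_set_integrable) simp
  have si: "set_integrable lborel {0<..<T} (\<lambda>t. g t * \<psi> t)"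
    if "set_integrable lborel {0<..<T} g" "\<psi> \<in> test_functions {0<..<T}" for g \<psi>
    by (rule set_integrable_mult_test_function(1)[OF that, of 1]) simp
  have "AE t in lborel. t \<in> {0<..<T} \<longrightarrow> k t - c = 0"
  proof (rule fundamental_lemma)
    show "set_integrable lborel {0<..<T} (\<lambda>t. k t - c)"
      by (intro set_integral_diff(1) k continuous_set_integrable continuous_on_const)
    fix \<psi> assume \<psi>: "\<psi> \<in> test_functions {0<..<T}"
    define m where "m = (LINT t:{0<..<T}|lborel. \<psi> t)"
    have i\<psi>: "set_integrable lborel {0<..<T} \<psi>" and i\<theta>: "set_integrable lborel {0<..<T} \<theta>"
      using si[OF I1 \<psi>] si[OF I1 \<theta>(1)] by simp_all
    have t0: "(\<lambda>x. 1 * \<psi> x + (- m) * \<theta> x) \<in> test_functions {0<..<T}"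
      by (rule test_functions_linear[OF \<psi> \<theta>(1)])
    have "(LINT t:{0<..<T}|lborel. 1 * \<psi> t + (- m) * \<theta> t) = 0"
      using i\<psi> i\<theta> \<theta>(2) by (simp add: m_def)
    then obtain \<phi> where \<phi>: "\<phi> \<in> test_functions {0<..<T}" "pderiv_dir 1 \<phi> = (\<lambda>x. 1 * \<psi> x + (- m) * \<theta> x)"
      using test_antiderivative[OF T t0] by blast
    have "(LINT t:{0<..<T}|lborel. k t * \<psi> t - m * (k t * \<theta> t)) = 0"
      using z[OF \<phi>(1)] by (simp add: \<phi>(2) algebra_simps)
    then have "(LINT t:{0<..<T}|lborel. k t * \<psi> t) = m * c"
      using si[OF k \<psi>] si[OF k \<theta>(1)] by (simp add: c_def)
    moreover have "(LINT t:{0<..<T}|lborel. (k t - c) * \<psi> t) = (LINT t:{0<..<T}|lborel. k t * \<psi> t) - c * m"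
      using si[OF k \<psi>] i\<psi> by (simp add: left_diff_distrib m_def)
    ultimately show "(LINT t:{0<..<T}|lborel. (k t - c) * \<psi> t) = 0" by simp
  qed (simp)
  then show ?thesis by auto
qed

text \<open>
  The product formula for primitives shows that \<open>w - prim h\<close> is orthogonal to the derivatives of
  all test functions.
\<close>

lemma weak_derivative_primitive:
  fixes T :: real
  assumes T: "T > 0" and w: "set_integrable lborel {0<..<T} w" and h: "set_integrable lborel {0<..<T} h"
    and d: "weak_pderiv {0<..<T} 1 w h"
  shows "\<exists>c. AE t in lborel. t \<in> {0<..<T} \<longrightarrow> w t = c + prim h t"
proof -
  have ph: "set_integrable lborel {0<..<T} (prim h)"
    by (rule continuous_set_integrable[OF prim_continuous[OF h]])
  have "\<exists>c. AE t in lborel. t \<in> {0<..<T} \<longrightarrow> w t - prim h t = c"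
  proof (rule du_bois_reymond[OF T])
    show "set_integrable lborel {0<..<T} (\<lambda>t. w t - prim h t)" using w ph by simp
    fix \<phi> assume \<phi>: "\<phi> \<in> test_functions {0<..<T}"
    note P = test_real_props[OF \<phi>]
    have c: "continuous_on A (pderiv_dir 1 \<phi>)" for A using P(2) continuous_on_subset by blast
    have FTC: "(LINT s:{a<..<b}|lborel. pderiv_dir 1 \<phi> s) = \<phi> b - \<phi> a" if "a \<le> b" for a b
      by (rule set_integral_FTC[OF that test_real_derivative[OF \<phi>] c])
    have pr: "prim (pderiv_dir 1 \<phi>) t = \<phi> t" if "t \<in> {0<..<T}" for t
      using FTC[of 0 t] that P(3)[of 0] by (simp add: prim_def)
    have i\<phi>: "set_integrable lborel {0<..<T} (pderiv_dir 1 \<phi>)" by (rule continuous_set_integrable[OF c])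
    have "(LINT t:{0<..<T}|lborel. h t * prim (pderiv_dir 1 \<phi>) t) + (LINT t:{0<..<T}|lborel. pderiv_dir 1 \<phi> t * prim h t) = 0"
      using prim_product_integral[OF T h i\<phi>] FTC[of 0 T] T P(3)[of 0] P(3)[of T] by simp
    moreover have "(LINT t:{0<..<T}|lborel. h t * prim (pderiv_dir 1 \<phi>) t) = (LINT t:{0<..<T}|lborel. h t * \<phi> t)"
      by (rule set_lebesgue_integral_cong) (auto simp: pr)
    moreover have "(LINT t:{0<..<T}|lborel. w t * pderiv_dir 1 \<phi> t) = - (LINT t:{0<..<T}|lborel. h t * \<phi> t)"
      using d \<phi> by (simp add: weak_pderiv_def)
    moreover have "(LINT t:{0<..<T}|lborel. (w t - prim h t) * pderiv_dir 1 \<phi> t)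
      = (LINT t:{0<..<T}|lborel. w t * pderiv_dir 1 \<phi> t) - (LINT t:{0<..<T}|lborel. pderiv_dir 1 \<phi> t * prim h t)"
      using set_integrable_mult_test_function(2)[OF w \<phi>, of 1] set_integrable_mult_test_function(2)[OF ph \<phi>, of 1]
      by (simp add: left_diff_distrib mult.commute[of _ "prim h _"])
    ultimately show "(LINT t:{0<..<T}|lborel. (w t - prim h t) * pderiv_dir 1 \<phi> t) = 0" by simp
  qed
  then obtain c where "AE t in lborel. t \<in> {0<..<T} \<longrightarrow> w t - prim h t = c" by blast
  then have "AE t in lborel. t \<in> {0<..<T} \<longrightarrow> w t = c + prim h t" by eventually_elim auto
  then show ?thesis by blast
qed

lemma continuous_AE_zero:
  fixes T :: real
  assumes T: "T > 0" and g: "continuous_on {0..T} (g :: real \<Rightarrow> real)"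
    and z: "AE t in lborel. t \<in> {0<..<T} \<longrightarrow> g t = 0" and t: "t \<in> {0..T}"
  shows "g t = 0"
proof -
  define C where "C = {t \<in> {0..T}. g t = 0}"
  have C: "closed C" unfolding C_def using g by (intro continuous_closed_preimage_constant) auto
  have "{0<..<T} \<subseteq> C"
  proof
    fix x assume x: "x \<in> {0<..<T}"
    have "AE t in lebesgue. t \<in> {0<..<T} \<longrightarrow> t \<in> C"
      using AE_completion[OF z] by eventually_elim (auto simp: C_def)
    then show "x \<in> C" using x by (intro mem_closed_if_AE_lebesgue_open[OF _ C _ x]) auto
  qed
  then have "closure {0<..<T} \<subseteq> C" using C by (rule closure_minimal)
  then show ?thesis using T t by (auto simp: C_def)
qed

text \<open>
  The pointwise condition in \<open>time_periodic\<close>, for one line in time direction.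
\<close>

definition periodic_rep :: "real \<Rightarrow> (real \<Rightarrow> real) \<Rightarrow> bool" where
  "periodic_rep T w \<longleftrightarrow> (\<exists>W. continuous_on {0..T} W \<and> (AE t in lborel. t \<in> {0<..<T} \<longrightarrow> w t = W t) \<and> W 0 = W T)"

text \<open>
  A function with a weak derivative is a constant plus the primitive of that derivative, so
  that the values at both ends differ by its integral. In this form periodicity is preserved
  by $L^2$ limits.
\<close>

lemma periodic_rep_iff:
  fixes T :: real
  assumes T: "T > 0" and w: "set_integrable lborel {0<..<T} w" and h: "set_integrable lborel {0<..<T} h"
    and d: "weak_pderiv {0<..<T} 1 w h"
  shows "periodic_rep T w \<longleftrightarrow> (LINT t:{0<..<T}|lborel. h t) = 0"
proof -
  obtain c where c: "AE t in lborel. t \<in> {0<..<T} \<longrightarrow> w t = c + prim h t"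
    using weak_derivative_primitive[OF assms] by blast
  have pc: "continuous_on {0..T} (\<lambda>t. c + prim h t)" by (intro continuous_intros prim_continuous[OF h])
  show ?thesis
  proof
    assume "periodic_rep T w"
    then obtain W where W: "continuous_on {0..T} W" "AE t in lborel. t \<in> {0<..<T} \<longrightarrow> w t = W t" "W 0 = W T"
      by (auto simp: periodic_rep_def)
    have "AE t in lborel. t \<in> {0<..<T} \<longrightarrow> W t - (c + prim h t) = 0"
      using c W(2) by eventually_elim auto
    then have "W t - (c + prim h t) = 0" if "t \<in> {0..T}" for t
      by (rule continuous_AE_zero[OF T continuous_on_diff[OF W(1) pc] _ that])
    from this[of 0] this[of T] show "(LINT t:{0<..<T}|lborel. h t) = 0"
      using T W(3) by (simp add: prim_0) (simp add: prim_def)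
  next
    assume "(LINT t:{0<..<T}|lborel. h t) = 0"
    then show "periodic_rep T w"
      unfolding periodic_rep_def using c pc
      by (intro exI[of _ "\<lambda>t. c + prim h t"]) (auto simp: prim_0, simp add: prim_def)
  qed
qed

text \<open>
  Both functions are constants plus primitives, and their derivatives have mean zero, which
  removes the constants and the boundary term.
\<close>

lemma periodic_integration_by_parts:
  fixes T :: real
  assumes T: "T > 0" and w: "set_integrable lborel {0<..<T} w" "set_integrable lborel {0<..<T} v"
    and h: "set_integrable lborel {0<..<T} h" "set_integrable lborel {0<..<T} k"
    and d: "weak_pderiv {0<..<T} 1 w h" "weak_pderiv {0<..<T} 1 v k"
    and p: "periodic_rep T w" "periodic_rep T v"
  shows "(LINT t:{0<..<T}|lborel. h t * v t) + (LINT t:{0<..<T}|lborel. w t * k t) = 0"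
proof -
  obtain c where c: "AE t in lborel. t \<in> {0<..<T} \<longrightarrow> w t = c + prim h t"
    using weak_derivative_primitive[OF T w(1) h(1) d(1)] by blast
  obtain e where e: "AE t in lborel. t \<in> {0<..<T} \<longrightarrow> v t = e + prim k t"
    using weak_derivative_primitive[OF T w(2) h(2) d(2)] by blast
  have h0: "(LINT t:{0<..<T}|lborel. h t) = 0" "(LINT t:{0<..<T}|lborel. k t) = 0"
    using periodic_rep_iff[OF T w(1) h(1) d(1)] periodic_rep_iff[OF T w(2) h(2) d(2)] p by auto
  have eq: "(LINT t:{0<..<T}|lborel. f t * u t) = a * (LINT t:{0<..<T}|lborel. f t) + (LINT t:{0<..<T}|lborel. f t * prim g t)"
    if f: "set_integrable lborel {0<..<T} f" and u: "set_integrable lborel {0<..<T} u" and g: "set_integrable lborel {0<..<T} g"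
      and ae: "AE t in lborel. t \<in> {0<..<T} \<longrightarrow> u t = a + prim g t" for f u g a
  proof -
    have i: "set_integrable lborel {0<..<T} (\<lambda>t. f t * prim g t)"
      by (rule continuous_set_integrable_mult[OF f prim_continuous[OF g]])
    have "(LINT t:{0<..<T}|lborel. f t * u t) = (LINT t:{0<..<T}|lborel. a * f t + f t * prim g t)"
      unfolding set_lebesgue_integral_def
    proof (rule integral_cong_AE)
      have "(\<lambda>x. indicat_real {0<..<T} x *\<^sub>R f x) \<in> borel_measurable lborel" "(\<lambda>x. indicat_real {0<..<T} x *\<^sub>R u x) \<in> borel_measurable lborel"
        using f u by (auto simp: set_integrable_def)
      then have "(\<lambda>x. (indicat_real {0<..<T} x *\<^sub>R f x) * (indicat_real {0<..<T} x *\<^sub>R u x)) \<in> borel_measurable lborel"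
        by (rule borel_measurable_times)
      moreover have "(\<lambda>x. (indicat_real {0<..<T} x *\<^sub>R f x) * (indicat_real {0<..<T} x *\<^sub>R u x)) = (\<lambda>x. indicat_real {0<..<T} x *\<^sub>R (f x * u x))"
        by (auto simp: fun_eq_iff indicator_def)
      ultimately show "(\<lambda>x. indicat_real {0<..<T} x *\<^sub>R (f x * u x)) \<in> borel_measurable lborel" by simp
      have "set_integrable lborel {0<..<T} (\<lambda>t. a * f t + f t * prim g t)" using f i by simp
      then show "(\<lambda>x. indicat_real {0<..<T} x *\<^sub>R (a * f x + f x * prim g x)) \<in> borel_measurable lborel"
        by (auto simp: set_integrable_def)
      show "AE x in lborel. indicat_real {0<..<T} x *\<^sub>R (f x * u x) = indicat_real {0<..<T} x *\<^sub>R (a * f x + f x * prim g x)"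
        using ae by eventually_elim (auto simp: indicator_def algebra_simps)
    qed
    then show ?thesis using f i by simp
  qed
  have "(LINT t:{0<..<T}|lborel. h t * v t) = (LINT t:{0<..<T}|lborel. h t * prim k t)"
    using eq[OF h(1) w(2) h(2) e] h0 by simp
  moreover have "(LINT t:{0<..<T}|lborel. k t * w t) = (LINT t:{0<..<T}|lborel. k t * prim h t)"
    using eq[OF h(2) w(1) h(1) c] h0 by simp
  ultimately show ?thesis
    using prim_product_integral[OF T h] h0 by (simp add: mult.commute)
qed

section \<open>Completeness of the time harmonics\<close>

inductive_set trig :: "real \<Rightarrow> (real \<Rightarrow> real) set" for \<omega> :: real where
  cos: "(\<lambda>t. cos (real k * \<omega> * t)) \<in> trig \<omega>"
| sin: "(\<lambda>t. sin (real k * \<omega> * t)) \<in> trig \<omega>"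
| add: "f \<in> trig \<omega> \<Longrightarrow> g \<in> trig \<omega> \<Longrightarrow> (\<lambda>t. f t + g t) \<in> trig \<omega>"
| scale: "f \<in> trig \<omega> \<Longrightarrow> (\<lambda>t. c * f t) \<in> trig \<omega>"

lemma trig_const: "(\<lambda>t. c) \<in> trig \<omega>"
  using trig.scale[OF trig.cos[of 0 \<omega>], of c] by simp

lemma trig_diff: "f \<in> trig \<omega> \<Longrightarrow> g \<in> trig \<omega> \<Longrightarrow> (\<lambda>t. f t - g t) \<in> trig \<omega>"
  using trig.add[OF _ trig.scale[of g \<omega> "-1"], of f] by simp

lemma trig_cos_diff: "(\<lambda>t. cos (real j * \<omega> * t - real k * \<omega> * t)) \<in> trig \<omega>"
proof (cases "k \<le> j")
  case True
  then show ?thesis using trig.cos[of "j - k" \<omega>] by (simp add: of_nat_diff algebra_simps)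
next
  case False
  then have "(\<lambda>t. cos (real j * \<omega> * t - real k * \<omega> * t)) = (\<lambda>t. cos (real (k - j) * \<omega> * t))"
    by (subst cos_minus[symmetric]) (simp add: of_nat_diff algebra_simps)
  then show ?thesis using trig.cos[of "k - j" \<omega>] by simp
qed

lemma trig_sin_diff: "(\<lambda>t. sin (real j * \<omega> * t - real k * \<omega> * t)) \<in> trig \<omega>"
proof (cases "k \<le> j")
  case True
  then show ?thesis using trig.sin[of "j - k" \<omega>] by (simp add: of_nat_diff algebra_simps)
next
  case False
  have "sin (real j * \<omega> * t - real k * \<omega> * t) = - 1 * sin (real (k - j) * \<omega> * t)" for t
    using False sin_minus[of "real (k - j) * \<omega> * t"] by (simp add: of_nat_diff algebra_simps)
  then show ?thesis using trig.scale[OF trig.sin[of "k - j" \<omega>], of "-1"] by simp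
qed

lemma trig_sum_arg:
  "(\<lambda>t. cos (real j * \<omega> * t + real k * \<omega> * t)) \<in> trig \<omega>" "(\<lambda>t. sin (real j * \<omega> * t + real k * \<omega> * t)) \<in> trig \<omega>"
  using trig.cos[of "j + k" \<omega>] trig.sin[of "j + k" \<omega>] by (simp_all add: algebra_simps)

lemma trig_mult_basic:
  "(\<lambda>t. cos (real j * \<omega> * t) * cos (real k * \<omega> * t)) \<in> trig \<omega>"
  "(\<lambda>t. sin (real j * \<omega> * t) * sin (real k * \<omega> * t)) \<in> trig \<omega>"
  "(\<lambda>t. sin (real j * \<omega> * t) * cos (real k * \<omega> * t)) \<in> trig \<omega>"
proof -
  have "(\<lambda>t. (1/2) * (cos (real j * \<omega> * t - real k * \<omega> * t) + cos (real j * \<omega> * t + real k * \<omega> * t))) \<in> trig \<omega>"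
    by (intro trig.scale trig.add trig_cos_diff trig_sum_arg)
  then show "(\<lambda>t. cos (real j * \<omega> * t) * cos (real k * \<omega> * t)) \<in> trig \<omega>"
    by (simp add: cos_times_cos)
  have "(\<lambda>t. (1/2) * (cos (real j * \<omega> * t - real k * \<omega> * t) - cos (real j * \<omega> * t + real k * \<omega> * t))) \<in> trig \<omega>"
    by (intro trig.scale trig_diff trig_cos_diff trig_sum_arg)
  then show "(\<lambda>t. sin (real j * \<omega> * t) * sin (real k * \<omega> * t)) \<in> trig \<omega>"
    by (simp add: sin_times_sin)
  have "(\<lambda>t. (1/2) * (sin (real j * \<omega> * t + real k * \<omega> * t) + sin (real j * \<omega> * t - real k * \<omega> * t))) \<in> trig \<omega>"
    by (intro trig.scale trig.add trig_sin_diff trig_sum_arg)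
  then show "(\<lambda>t. sin (real j * \<omega> * t) * cos (real k * \<omega> * t)) \<in> trig \<omega>"
    by (simp add: sin_times_cos)
qed

text \<open>
  The product formulas for sine and cosine make the trigonometric polynomials an algebra.
\<close>

lemma trig_mult:
  assumes "f \<in> trig \<omega>" "g \<in> trig \<omega>"
  shows "(\<lambda>t. f t * g t) \<in> trig \<omega>"
proof -
  have c: "(\<lambda>t. f t * cos (real k * \<omega> * t)) \<in> trig \<omega>" if "f \<in> trig \<omega>" for f k
    using that
  proof induction
    case (add f g) then show ?case using trig.add by (simp add: distrib_right)
  next
    case (scale f c) then show ?case using trig.scale[OF scale.IH, of c] by (simp add: mult.assoc)
  qed (rule trig_mult_basic)+
  have s: "(\<lambda>t. f t * sin (real k * \<omega> * t)) \<in> trig \<omega>" if "f \<in> trig \<omega>" for f k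
    using that
  proof induction
    case (cos j) then show ?case using trig_mult_basic(3)[of k \<omega> j] by (simp add: mult.commute)
  next
    case (add f g) then show ?case using trig.add by (simp add: distrib_right)
  next
    case (scale f c) then show ?case using trig.scale[OF scale.IH, of c] by (simp add: mult.assoc)
  qed (rule trig_mult_basic)+
  show ?thesis using assms(2)
  proof induction
    case (cos k) show ?case by (rule c[OF assms(1)])
  next
    case (sin k) show ?case by (rule s[OF assms(1)])
  next
    case (add g h) then show ?case using trig.add by (simp add: distrib_left)
  next
    case (scale g c) then show ?case using trig.scale[OF scale.IH, of c] by (simp add: mult.left_commute)
  qed
qed

lemma trig_polynomial:
  assumes "real_polynomial_function (p :: complex \<Rightarrow> real)"
  shows "(\<lambda>t. p (cis (\<omega> * t))) \<in> trig \<omega>"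
  using assms
proof induction
  case (linear f)
  interpret bounded_linear f by fact
  have "cis (\<omega> * t) = cos (\<omega> * t) *\<^sub>R 1 + sin (\<omega> * t) *\<^sub>R \<i>" for t
    by (simp add: complex_eq_iff)
  then have "f (cis (\<omega> * t)) = f 1 * cos (real 1 * \<omega> * t) + f \<i> * sin (real 1 * \<omega> * t)" for t
    by (simp only: add scaleR) simp
  then show ?case by (simp only:) (intro trig.add trig.scale trig.cos trig.sin)
next
  case (const c) show ?case by (rule trig_const)
next
  case (add f g) show ?case by (rule trig.add[OF add.IH])
next
  case (mult f g) show ?case by (rule trig_mult[OF mult.IH])
qed

lemma trig_continuous: "f \<in> trig \<omega> \<Longrightarrow> continuous_on A f"
  by (induction rule: trig.induct) (auto intro!: continuous_intros)

lemma continuous_on_cis_line: "continuous_on A (\<lambda>t. cis (\<omega> * t))"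
  by (intro continuous_intros)

text \<open>
  By the Stone--Weierstrass theorem on the unit circle, \<open>g\<close> is orthogonal to every continuous
  function of the point \<open>cis (\<omega> t)\<close>. The indicator of a subinterval is a limit of such
  functions, so the integrals of \<open>g\<close> over intervals vanish.
\<close>

lemma trig_complete_1d:
  fixes T :: real
  assumes T: "T > 0" and g: "set_integrable lborel {0<..<T} g"
    and zc: "\<And>k. (LINT t:{0<..<T}|lborel. g t * cos (real k * (2 * pi / T) * t)) = 0"
    and zs: "\<And>k. (LINT t:{0<..<T}|lborel. g t * sin (real k * (2 * pi / T) * t)) = 0"
  shows "AE t in lborel. t \<in> {0<..<T} \<longrightarrow> g t = 0"
proof (rule AE_zero_of_box_integrals[OF _ g])
  define \<omega> where "\<omega> = 2 * pi / T"
  have \<omega>: "\<omega> > 0" "\<omega> * T = 2 * pi" using T by (auto simp: \<omega>_def)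
  have si: "set_integrable lborel {0<..<T} (\<lambda>t. g t * f t)" if "continuous_on {0..T} f" for f
    by (rule continuous_set_integrable_mult[OF g that])
  have tr: "(LINT t:{0<..<T}|lborel. g t * f t) = 0" if "f \<in> trig \<omega>" for f
    using that
  proof induction
    case (add f h)
    then show ?case using si[OF trig_continuous[OF add.hyps(1)]] si[OF trig_continuous[OF add.hyps(2)]]
      by (simp add: distrib_left)
  next
    case (scale f c)
    then show ?case using si[OF trig_continuous[OF scale.hyps(1)]] by (simp add: mult.left_commute)
  qed (use zc zs in \<open>simp_all add: \<omega>_def\<close>)
  have cont: "(LINT t:{0<..<T}|lborel. g t * F (cis (\<omega> * t))) = 0" if F: "continuous_on UNIV F" for F :: "complex \<Rightarrow> real"
  proof (rule ccontr)
    have gn: "set_integrable lborel {0<..<T} (\<lambda>t. \<bar>g t\<bar>)" by (rule set_integrable_abs[OF g])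
    define N where "N = (LINT t:{0<..<T}|lborel. \<bar>g t\<bar>)"
    have N0: "N \<ge> 0" unfolding N_def set_lebesgue_integral_def by (rule Bochner_Integration.integral_nonneg) simp
    let ?L = "LINT t:{0<..<T}|lborel. g t * F (cis (\<omega> * t))"
    assume ne: "?L \<noteq> 0"
    define e where "e = \<bar>?L\<bar> / (2 * (N + 1))"
    have e: "e > 0" using ne N0 by (auto simp: e_def)
    have Fs: "continuous_on (sphere 0 1) F" using F continuous_on_subset by blast
    obtain p where p: "real_polynomial_function p" "\<And>z. z \<in> sphere 0 1 \<Longrightarrow> \<bar>F z - p z\<bar> < e"
      using Stone_Weierstrass_real_polynomial_function[OF compact_sphere Fs e] by metis
    have i1: "set_integrable lborel {0<..<T} (\<lambda>t. g t * F (cis (\<omega> * t)))"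
      by (intro si continuous_on_compose2[OF F] continuous_on_cis_line) auto
    have i2: "set_integrable lborel {0<..<T} (\<lambda>t. g t * p (cis (\<omega> * t)))"
      by (intro si trig_continuous[OF trig_polynomial[OF p(1)]])
    have "?L = (LINT t:{0<..<T}|lborel. g t * F (cis (\<omega> * t)) - g t * p (cis (\<omega> * t)))"
      using i1 i2 tr[OF trig_polynomial[OF p(1)]] by simp
    also have "\<bar>\<dots>\<bar> \<le> (LINT t:{0<..<T}|lborel. \<bar>g t * F (cis (\<omega> * t)) - g t * p (cis (\<omega> * t))\<bar>)"
      using set_integral_norm_bound[of lborel "{0<..<T}" "\<lambda>t. g t * F (cis (\<omega> * t)) - g t * p (cis (\<omega> * t))"] i1 i2 by simp
    also have "\<dots> \<le> (LINT t:{0<..<T}|lborel. e * \<bar>g t\<bar>)"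
    proof (rule set_integral_mono)
      show "set_integrable lborel {0<..<T} (\<lambda>t. \<bar>g t * F (cis (\<omega> * t)) - g t * p (cis (\<omega> * t))\<bar>)"
        using i1 i2 by (intro set_integrable_abs) simp
      show "set_integrable lborel {0<..<T} (\<lambda>t. e * \<bar>g t\<bar>)" using gn by simp
      fix t
      have "\<bar>F (cis (\<omega> * t)) - p (cis (\<omega> * t))\<bar> \<le> e" using p(2)[of "cis (\<omega> * t)"] by (simp add: less_imp_le)
      then have "\<bar>g t\<bar> * \<bar>F (cis (\<omega> * t)) - p (cis (\<omega> * t))\<bar> \<le> \<bar>g t\<bar> * e" by (intro mult_left_mono) auto
      then show "\<bar>g t * F (cis (\<omega> * t)) - g t * p (cis (\<omega> * t))\<bar> \<le> e * \<bar>g t\<bar>"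
        by (simp add: abs_mult[symmetric] right_diff_distrib mult.commute)
    qed
    also have "\<dots> = e * N" using gn by (simp add: N_def)
    also have "\<dots> \<le> \<bar>?L\<bar> / 2"
    proof -
      have "N / (N + 1) \<le> 1" using N0 by simp
      then have "\<bar>?L\<bar> / 2 * (N / (N + 1)) \<le> \<bar>?L\<bar> / 2 * 1" by (intro mult_left_mono) auto
      then show ?thesis by (simp add: e_def field_simps)
    qed
    finally show False using ne by simp
  qed
  fix a b :: real assume ab: "box a b \<subseteq> {0<..<T}"
  \<comment> \<open>The complement of the arc over the interval; it contains the common image of \<open>0\<close> and \<open>T\<close>.\<close>
  define C where "C = (\<lambda>t. cis (\<omega> * t)) ` ({0..T} - {a<..<b})"
  have "compact ({0..T} - {a<..<b})" by (intro compact_diff) auto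
  then have Cc: "closed C" unfolding C_def by (intro compact_imp_closed compact_continuous_image continuous_on_cis_line)
  have ab': "{a<..<b} \<subseteq> {0<..<T}" using ab by (simp add: box_real)
  have "0 \<in> {0..T} - {a<..<b}" using ab' T by auto
  then have Cn: "C \<noteq> {}" unfolding C_def by blast
  have inj: "s = t" if "cis (\<omega> * s) = cis (\<omega> * t)" "s \<in> {0..T}" "t \<in> {0<..<T}" for s t
  proof -
    have "sin (\<omega> * s) = sin (\<omega> * t) \<and> cos (\<omega> * s) = cos (\<omega> * t)" using that(1) by (simp add: complex_eq_iff)
    then obtain n :: int where n: "\<omega> * s = \<omega> * t + 2 * pi * real_of_int n" using sin_cos_eq_iff by metis
    have "\<omega> * (s - t) = \<omega> * (T * real_of_int n)" using n \<omega> by (simp add: algebra_simps)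
    then have st: "s - t = T * real_of_int n" using \<omega>(1) by simp
    have "T * real_of_int n < T * 1" "T * (-1) < T * real_of_int n"
      unfolding st[symmetric] using that(2,3) by simp_all
    then have "real_of_int n < 1" "-1 < real_of_int n" using T by (simp_all only: mult_less_cancel_left_pos)
    then have "n = 0" by linarith
    then show ?thesis using st by simp
  qed
  \<comment> \<open>Urysohn functions that vanish on \<open>C\<close> and increase to \<open>1\<close> elsewhere.\<close>
  define F where "F n z = min 1 (real n * infdist z C)" for n z
  have Fc: "continuous_on UNIV (F n)" for n unfolding F_def[abs_def]
    by (intro continuous_on_min continuous_on_const continuous_on_mult continuous_on_infdist continuous_on_id)
  have lim: "(\<lambda>n. F n (cis (\<omega> * t))) \<longlonglongrightarrow> indicat_real {a<..<b} t" if t: "t \<in> {0<..<T}" for t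
  proof (cases "t \<in> {a<..<b}")
    case True
    have "cis (\<omega> * t) \<notin> C"
    proof
      assume "cis (\<omega> * t) \<in> C"
      then obtain s where s: "cis (\<omega> * t) = cis (\<omega> * s)" "s \<in> {0..T} - {a<..<b}" unfolding C_def by blast
      then have "s = t" using inj[OF s(1)[symmetric] _ t] by simp
      then show False using s(2) True by simp
    qed
    then have d: "infdist (cis (\<omega> * t)) C > 0" using Cc Cn by (simp add: infdist_pos_not_in_closed)
    obtain n0 :: nat where n0: "1 / infdist (cis (\<omega> * t)) C < real n0" using reals_Archimedean2 by blast
    have "F n (cis (\<omega> * t)) = 1" if "n \<ge> n0" for n
    proof -
      have "1 / infdist (cis (\<omega> * t)) C < real n" using n0 that by linarith
      then show ?thesis using d by (simp add: F_def min_def field_simps)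
    qed
    then have "eventually (\<lambda>n. F n (cis (\<omega> * t)) = 1) sequentially" by (auto simp: eventually_sequentially)
    then show ?thesis using True by (simp add: tendsto_eventually)
  next
    case False
    then have "cis (\<omega> * t) \<in> C" using t by (auto simp: C_def)
    then have "F n (cis (\<omega> * t)) = 0" for n by (simp add: F_def)
    then show ?thesis using False by simp
  qed
  have gi: "integrable lborel (\<lambda>t. indicat_real {0<..<T} t * g t)" using g by (simp add: set_integrable_def)
  have "(\<lambda>n. LINT t:{0<..<T}|lborel. g t * F n (cis (\<omega> * t))) \<longlonglongrightarrow> (LINT t|lborel. (indicat_real {0<..<T} t * g t) * indicat_real {a<..<b} t)"
    unfolding set_lebesgue_integral_def
  proof (rule integral_dominated_convergence)
    show "integrable lborel (\<lambda>t. norm (indicat_real {0<..<T} t * g t))" using gi by (rule integrable_norm)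
    show "(\<lambda>t. (indicat_real {0<..<T} t * g t) * indicat_real {a<..<b} t) \<in> borel_measurable lborel"
      by (intro borel_measurable_times borel_measurable_integrable[OF gi]) auto
    show "(\<lambda>x. indicat_real {0<..<T} x *\<^sub>R (g x * F n (cis (\<omega> * x)))) \<in> borel_measurable lborel" for n
    proof -
      have "set_integrable lborel {0<..<T} (\<lambda>t. g t * F n (cis (\<omega> * t)))"
        by (intro si continuous_on_compose2[OF Fc] continuous_on_cis_line) auto
      then show ?thesis by (auto simp: set_integrable_def)
    qed
    show "AE x in lborel. (\<lambda>n. indicat_real {0<..<T} x *\<^sub>R (g x * F n (cis (\<omega> * x)))) \<longlonglongrightarrow> (indicat_real {0<..<T} x * g x) * indicat_real {a<..<b} x"
    proof (rule AE_I2)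
      fix x
      show "(\<lambda>n. indicat_real {0<..<T} x *\<^sub>R (g x * F n (cis (\<omega> * x)))) \<longlonglongrightarrow> (indicat_real {0<..<T} x * g x) * indicat_real {a<..<b} x"
        using tendsto_mult[OF tendsto_const[of "g x"] lim[of x]] by (cases "x \<in> {0<..<T}") auto
    qed
    show "AE x in lborel. norm (indicat_real {0<..<T} x *\<^sub>R (g x * F n (cis (\<omega> * x)))) \<le> norm (indicat_real {0<..<T} x * g x)" for n
    proof (rule AE_I2)
      fix x
      have "0 \<le> F n (cis (\<omega> * x))" "F n (cis (\<omega> * x)) \<le> 1" by (auto simp: F_def infdist_nonneg)
      then show "norm (indicat_real {0<..<T} x *\<^sub>R (g x * F n (cis (\<omega> * x)))) \<le> norm (indicat_real {0<..<T} x * g x)"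
        by (auto simp: indicator_def abs_mult intro!: mult_right_le_one_le)
    qed
  qed
  then have "(LINT t|lborel. (indicat_real {0<..<T} t * g t) * indicat_real {a<..<b} t) = 0"
    by (simp add: cont[OF Fc] LIMSEQ_const_iff)
  moreover have "(LINT t|lborel. (indicat_real {0<..<T} t * g t) * indicat_real {a<..<b} t) = (LINT t:box a b|lborel. g t)"
    unfolding set_lebesgue_integral_def
    by (rule Bochner_Integration.integral_cong) (use ab' in \<open>auto simp: indicator_def box_real\<close>)
  ultimately show "(LINT t:box a b|lborel. g t) = 0" by simp
qed simp

lemma integrable_tensor:
  fixes F :: "'a::euclidean_space \<Rightarrow> real" and G :: "'b::euclidean_space \<Rightarrow> real"
  assumes F: "integrable lborel F" and G: "integrable lborel G"
  shows "integrable lborel (\<lambda>z. F (fst z) * G (snd z))"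
proof -
  have [measurable]: "F \<in> borel_measurable borel" "G \<in> borel_measurable borel"
    using F G by (auto dest: borel_measurable_integrable)
  have "integrable (lborel \<Otimes>\<^sub>M lborel) (\<lambda>z. F (fst z) * G (snd z))"
  proof (rule lborel_pair.Fubini_integrable)
    show "(\<lambda>z. F (fst z) * G (snd z)) \<in> borel_measurable (lborel \<Otimes>\<^sub>M lborel)" by measurable
    show "integrable lborel (\<lambda>x. LINT y|lborel. norm (F (fst (x, y)) * G (snd (x, y))))"
      using F G by (simp add: abs_mult)
    show "AE x in lborel. integrable lborel (\<lambda>y. F (fst (x, y)) * G (snd (x, y)))" using G by simp
  qed
  then show ?thesis unfolding lborel_prod .
qed

lemma L2_tensor:
  fixes f :: "'a::euclidean_space \<Rightarrow> 'c::euclidean_space" and c :: "'b::euclidean_space \<Rightarrow> real"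
  assumes f: "f \<in> L2 A" and B: "B \<in> sets borel" "emeasure lborel B < \<infinity>"
    and c: "c \<in> borel_measurable borel" "\<And>y. \<bar>c y\<bar> \<le> M" and A: "A \<in> sets borel"
  shows "(\<lambda>z. c (snd z) *\<^sub>R f (fst z)) \<in> L2 (A \<times> B)"
proof (rule L2_mult_bounded)
  have fm: "ext A f \<in> borel_measurable borel" and fi: "integrable lborel (\<lambda>x. (norm (ext A f x))\<^sup>2)"
    using f by (auto simp: L2_iff_sq_int sq_int_def)
  have [measurable]: "B \<in> sets borel" by (rule B)
  have e: "ext (A \<times> B) (\<lambda>z. f (fst z)) = (\<lambda>z. indicat_real B (snd z) *\<^sub>R ext A f (fst z))"
    by (auto simp: fun_eq_iff ext_def indicator_def)
  have n: "(\<lambda>z. (norm (indicat_real B (snd z) *\<^sub>R ext A f (fst z)))\<^sup>2) = (\<lambda>z. (norm (ext A f (fst z)))\<^sup>2 * indicat_real B (snd z))"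
    by (auto simp: fun_eq_iff indicator_def)
  have m: "(\<lambda>z. indicat_real B (snd z) *\<^sub>R ext A f (fst z)) \<in> borel_measurable (borel \<Otimes>\<^sub>M borel)"
    using fm by measurable
  show "(\<lambda>z. f (fst z)) \<in> L2 (A \<times> B)"
    unfolding L2_iff_sq_int e sq_int_def n
  proof
    show "(\<lambda>z. indicat_real B (snd z) *\<^sub>R ext A f (fst z)) \<in> borel_measurable lborel"
      using m by (simp add: borel_prod)
    show "integrable lborel (\<lambda>z. (norm (ext A f (fst z)))\<^sup>2 * indicat_real B (snd z))"
      by (rule integrable_tensor[OF fi]) (use B in \<open>auto intro!: integrable_real_indicator\<close>)
  qed
  have "(\<lambda>z::'a \<times> 'b. c (snd z)) \<in> borel_measurable (borel \<Otimes>\<^sub>M borel)" using c by measurable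
  then have "(\<lambda>z. c (snd z)) \<in> borel_measurable (borel :: ('a \<times> 'b) measure)" by (simp add: borel_prod)
  moreover have "A \<times> B \<in> sets borel" using A B by (metis borel_prod pair_measureI)
  ultimately show "set_borel_measurable lborel (A \<times> B) (\<lambda>z. c (snd z))"
    unfolding set_borel_measurable_def by simp
  show "\<bar>c (snd z)\<bar> \<le> M" for z using c by simp
qed

text \<open>
  A single time harmonic. Vector-valued coefficients are allowed, so that the gradient of a
  harmonic is again a harmonic.
\<close>

definition mode :: "real \<Rightarrow> nat \<Rightarrow> ('a::euclidean_space \<Rightarrow> 'c::euclidean_space) \<Rightarrow> ('a \<Rightarrow> 'c) \<Rightarrow> 'a \<times> real \<Rightarrow> 'c" where
  "mode T k a b = (\<lambda>z. cos (real k * (2 * pi / T) * snd z) *\<^sub>R a (fst z) + sin (real k * (2 * pi / T) * snd z) *\<^sub>R b (fst z))"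

lemma interval_finite: "emeasure lborel {0<..<T::real} < \<infinity>"
  by (rule emeasure_bounded_finite) simp

lemma mode_L2:
  assumes A: "A \<in> sets borel" and a: "a \<in> L2 A" "b \<in> L2 A"
  shows "mode T k a b \<in> L2 (A \<times> {0<..<T})"
  unfolding mode_def
  by (intro L2_add L2_tensor[where M = 1] a A interval_finite)
     (auto intro!: borel_measurable_continuous_onI continuous_intros)

lemma mode_slice_L2: "a \<in> L2 A \<Longrightarrow> b \<in> L2 A \<Longrightarrow> (\<lambda>x. mode T k a b (x, t)) \<in> L2 A"
  unfolding mode_def by (auto intro!: L2_add L2_scaleR)

text \<open>
  Coefficients that are indicators of boxes show that the Fourier coefficients in time vanish
  at almost every point of \<open>A\<close>, so the one-dimensional result applies on almost every line.
\<close>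

lemma trig_complete:
  fixes f :: "'a::euclidean_space \<times> real \<Rightarrow> real"
  assumes A: "open A" "bounded A" and T: "T > 0" and f: "f \<in> L2 (A \<times> {0<..<T})"
    and z: "\<And>k a b. a \<in> L2 A \<Longrightarrow> b \<in> L2 A \<Longrightarrow> l2inner (A \<times> {0<..<T}) f (mode T k a b) = 0"
  shows "AE z in lborel. z \<in> A \<times> {0<..<T} \<longrightarrow> f z = 0"
proof (rule L2_AE_zero_of_slices[OF f], rule disjI1)
  have Ab: "A \<in> sets borel" using A by simp
  have key: "AE x in lborel. x \<in> A \<longrightarrow> (LINT t:{0<..<T}|lborel. f (x, t) * e t) = 0"
    if e: "continuous_on UNIV e" "\<And>t. \<bar>e t\<bar> \<le> 1"
      and ze: "\<And>a. a \<in> L2 A \<Longrightarrow> l2inner (A \<times> {0<..<T}) f (\<lambda>z. e (snd z) *\<^sub>R a (fst z)) = 0" for e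
  proof (rule AE_zero_of_box_integrals[OF A(1)])
    have em: "e \<in> borel_measurable borel" by (rule borel_measurable_continuous_onI[OF e(1)])
    have tens: "(\<lambda>z. e (snd z) *\<^sub>R a (fst z)) \<in> L2 (A \<times> {0<..<T})" if "a \<in> L2 A" for a :: "'a \<Rightarrow> real"
      by (rule L2_tensor[OF that _ interval_finite em e(2) Ab]) simp
    have one: "(\<lambda>x. 1::real) \<in> L2 A"
      using A emeasure_bounded_finite[OF A(2)]
      by (auto simp: L2_def set_borel_measurable_def set_integrable_def intro!: integrable_real_indicator)
    have fi: "set_integrable lborel (A \<times> {0<..<T}) (\<lambda>z. f z * (e (snd z) * a (fst z)))" if "a \<in> L2 A" for a :: "'a \<Rightarrow> real"
      using L2_inner_integrable[OF f tens[OF that]] by simp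
    show "set_integrable lborel A (\<lambda>x. LINT t:{0<..<T}|lborel. f (x, t) * e t)"
      using set_fubini_fst(2)[OF fi[OF one]] by simp
    fix a b :: 'a assume ab: "box a b \<subseteq> A"
    have ind: "indicat_real (box a b) \<in> L2 A"
    proof -
      have "(\<lambda>x. indicat_real (box a b) x *\<^sub>R (1::real)) \<in> L2 A"
        by (rule L2_mult_bounded[OF _ _ one, where C = 1]) (use Ab in \<open>auto simp: set_borel_measurable_def\<close>)
      then show ?thesis by simp
    qed
    have "0 = (LINT z:A \<times> {0<..<T}|lborel. f z * (e (snd z) * indicat_real (box a b) (fst z)))"
      using ze[OF ind] by (simp add: l2inner_def)
    also have "\<dots> = (LINT x:A|lborel. LINT t:{0<..<T}|lborel. f (x, t) * (e t * indicat_real (box a b) x))"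
      using set_fubini_fst(3)[OF fi[OF ind]] by simp
    also have "\<dots> = (LINT x:A|lborel. (LINT t:{0<..<T}|lborel. f (x, t) * e t) * indicat_real (box a b) x)"
      by (simp add: mult.assoc[symmetric])
    also have "\<dots> = (LINT x:box a b|lborel. LINT t:{0<..<T}|lborel. f (x, t) * e t)"
      unfolding set_lebesgue_integral_def
      by (rule Bochner_Integration.integral_cong) (use ab in \<open>auto simp: indicator_def\<close>)
    finally show "(LINT x:box a b|lborel. LINT t:{0<..<T}|lborel. f (x, t) * e t) = 0" by simp
  qed
  have c: "AE x in lborel. x \<in> A \<longrightarrow> (LINT t:{0<..<T}|lborel. f (x, t) * cos (real k * (2 * pi / T) * t)) = 0" for k
    by (rule key) (use z[of _ "\<lambda>x. 0" k] L2_zero T in \<open>auto simp: mode_def intro!: continuous_intros\<close>)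
  have s: "AE x in lborel. x \<in> A \<longrightarrow> (LINT t:{0<..<T}|lborel. f (x, t) * sin (real k * (2 * pi / T) * t)) = 0" for k
    by (rule key) (use z[of "\<lambda>x. 0" _ k] L2_zero T in \<open>auto simp: mode_def intro!: continuous_intros\<close>)
  have "AE x in lborel. \<forall>k. x \<in> A \<longrightarrow> (LINT t:{0<..<T}|lborel. f (x, t) * cos (real k * (2 * pi / T) * t)) = 0"
       "AE x in lborel. \<forall>k. x \<in> A \<longrightarrow> (LINT t:{0<..<T}|lborel. f (x, t) * sin (real k * (2 * pi / T) * t)) = 0"
    unfolding AE_all_countable using c s by auto
  then show "AE x in lborel. x \<in> A \<longrightarrow> (AE t in lborel. t \<in> {0<..<T} \<longrightarrow> f (x, t) = 0)"
    using L2_slices(1)[OF f]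
  proof eventually_elim
    case (elim x)
    show ?case
    proof
      assume x: "x \<in> A"
      have "set_integrable lborel {0<..<T} (\<lambda>t. f (x, t))"
        using elim(3) x interval_finite by (intro L2_set_integrable) auto
      then show "AE t in lborel. t \<in> {0<..<T} \<longrightarrow> f (x, t) = 0"
        using elim(1,2) x by (intro trig_complete_1d[OF T]) auto
    qed
  qed
qed

section \<open>Derivatives on the space-time cylinder\<close>

locale parabolic =
  fixes \<Omega> :: "(real^'n) set" and T \<sigma>_lo \<sigma>_hi \<nu>_lo \<nu>_hi C :: real and \<sigma> \<nu> :: "real^'n \<Rightarrow> real"
  assumes open_\<Omega>: "open \<Omega>" and bounded_\<Omega>: "bounded \<Omega>" and T: "T > 0"
    and meas: "set_borel_measurable lborel \<Omega> \<sigma>" "set_borel_measurable lborel \<Omega> \<nu>"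
    and \<sigma>_lo: "0 < \<sigma>_lo" and \<sigma>: "\<And>x. x \<in> \<Omega> \<Longrightarrow> \<sigma>_lo \<le> \<sigma> x \<and> \<sigma> x \<le> \<sigma>_hi"
    and \<nu>_lo: "0 < \<nu>_lo" and \<nu>: "\<And>x. x \<in> \<Omega> \<Longrightarrow> \<nu>_lo \<le> \<nu> x \<and> \<nu> x \<le> \<nu>_hi"
    and friedrichs: "friedrichs_constant \<Omega> C"
begin

abbreviation I :: "real set" where "I \<equiv> {0<..<T}"
abbreviation Q :: "((real^'n) \<times> real) set" where "Q \<equiv> cyl \<Omega> T"

lemma Q_eq: "Q = \<Omega> \<times> I" by (simp add: cyl_def)

lemma \<Omega>_borel: "\<Omega> \<in> sets borel" using open_\<Omega> by simp
lemma Q_borel: "Q \<in> sets borel"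
proof -
  have "open Q" unfolding Q_eq by (intro open_Times open_\<Omega>) simp
  then show ?thesis by simp
qed
lemma \<Omega>_finite: "emeasure lborel \<Omega> < \<infinity>" by (rule emeasure_bounded_finite[OF bounded_\<Omega>])

lemma \<sigma>_bound: "x \<in> \<Omega> \<Longrightarrow> \<bar>\<sigma> x\<bar> \<le> \<sigma>_hi" using \<sigma>[of x] \<sigma>_lo by auto
lemma \<nu>_bound: "x \<in> \<Omega> \<Longrightarrow> \<bar>\<nu> x\<bar> \<le> \<nu>_hi" using \<nu>[of x] \<nu>_lo by auto
lemma C_pos: "C > 0" using friedrichs by (simp add: friedrichs_constant_def)

lemma \<sigma>_L2: "f \<in> L2 \<Omega> \<Longrightarrow> (\<lambda>x. \<sigma> x *\<^sub>R f x) \<in> L2 \<Omega>"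
  by (rule L2_mult_bounded[OF meas(1) \<sigma>_bound])
lemma \<nu>_L2: "f \<in> L2 \<Omega> \<Longrightarrow> (\<lambda>x. \<nu> x *\<^sub>R f x) \<in> L2 \<Omega>"
  by (rule L2_mult_bounded[OF meas(2) \<nu>_bound])

lemma coeff_measurable_Q:
  assumes m: "set_borel_measurable lborel \<Omega> m"
  shows "set_borel_measurable lborel Q (\<lambda>z. m (fst z) :: real)"
proof -
  have mm: "(\<lambda>x. indicat_real \<Omega> x *\<^sub>R m x) \<in> borel_measurable borel" using m by (simp add: set_borel_measurable_def)
  have "(\<lambda>z::(real^'n) \<times> real. indicat_real I (snd z) * (indicat_real \<Omega> (fst z) *\<^sub>R m (fst z))) \<in> borel_measurable (borel \<Otimes>\<^sub>M borel)"
    by (intro borel_measurable_times measurable_compose[OF measurable_fst mm] measurable_compose[OF measurable_snd]) auto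
  moreover have "(\<lambda>z::(real^'n) \<times> real. indicat_real I (snd z) * (indicat_real \<Omega> (fst z) *\<^sub>R m (fst z))) = (\<lambda>z. indicat_real Q z *\<^sub>R m (fst z))"
    by (auto simp: fun_eq_iff indicator_def Q_eq)
  ultimately show ?thesis by (simp add: set_borel_measurable_def borel_prod)
qed

lemma \<sigma>_L2_Q: "f \<in> L2 Q \<Longrightarrow> (\<lambda>z. \<sigma> (fst z) *\<^sub>R f z) \<in> L2 Q"
  by (rule L2_mult_bounded[OF coeff_measurable_Q[OF meas(1)]]) (use \<sigma>_bound in \<open>auto simp: Q_eq\<close>)
lemma \<nu>_L2_Q: "f \<in> L2 Q \<Longrightarrow> (\<lambda>z. \<nu> (fst z) *\<^sub>R f z) \<in> L2 Q"
  by (rule L2_mult_bounded[OF coeff_measurable_Q[OF meas(2)]]) (use \<nu>_bound in \<open>auto simp: Q_eq\<close>)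

lemma L2Q_slice_t: "f \<in> L2 Q \<Longrightarrow> AE t in lborel. t \<in> I \<longrightarrow> (\<lambda>x. f (x, t)) \<in> L2 \<Omega>"
  unfolding Q_eq by (rule L2_slices(2))
lemma L2Q_slice_x: "f \<in> L2 Q \<Longrightarrow> AE x in lborel. x \<in> \<Omega> \<longrightarrow> (\<lambda>t. f (x, t)) \<in> L2 I"
  unfolding Q_eq by (rule L2_slices(1))

lemma L2_I_integrable: "(f :: real \<Rightarrow> real) \<in> L2 I \<Longrightarrow> set_integrable lborel I f"
  using interval_finite by (intro L2_set_integrable) auto
lemma L2_\<Omega>_integrable: "(f :: real^'n \<Rightarrow> 'b::euclidean_space) \<in> L2 \<Omega> \<Longrightarrow> set_integrable lborel \<Omega> f"
  using \<Omega>_finite \<Omega>_borel by (intro L2_set_integrable) auto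

text \<open>
  The operators \<open>sgrad\<close>, \<open>tderiv\<close> and \<open>sdiv\<close> select a representative by choice, which is awkward in
  limits and linear combinations. The following relations carry the derivative as an explicit
  second argument; \<open>sgrad_AE\<close>, \<open>tderiv_AE\<close> and \<open>sdiv_AE\<close> translate back. Boundary condition and
  periodicity are included.
\<close>

definition spair :: "((real^'n) \<times> real \<Rightarrow> real) \<Rightarrow> ((real^'n) \<times> real \<Rightarrow> real^'n) \<Rightarrow> bool" where
  "spair w g \<longleftrightarrow> w \<in> L2 Q \<and> g \<in> L2 Q \<and>
     (AE t in lborel. t \<in> I \<longrightarrow> H10pair \<Omega> (\<lambda>x. w (x, t)) (\<lambda>x. g (x, t)))"

definition tpair :: "((real^'n) \<times> real \<Rightarrow> real) \<Rightarrow> ((real^'n) \<times> real \<Rightarrow> real) \<Rightarrow> bool" where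
  "tpair w h \<longleftrightarrow> w \<in> L2 Q \<and> h \<in> L2 Q \<and>
     (AE x in lborel. x \<in> \<Omega> \<longrightarrow> weak_pderiv I 1 (\<lambda>t. w (x, t)) (\<lambda>t. h (x, t)) \<and> periodic_rep T (\<lambda>t. w (x, t)))"

definition dpair :: "((real^'n) \<times> real \<Rightarrow> real^'n) \<Rightarrow> ((real^'n) \<times> real \<Rightarrow> real) \<Rightarrow> bool" where
  "dpair \<tau> d \<longleftrightarrow> \<tau> \<in> L2 Q \<and> has_sdiv \<Omega> T \<tau> d"

lemma spair_has_sgrad: "spair w g \<Longrightarrow> has_sgrad \<Omega> T w g" "spair w g \<Longrightarrow> zero_lateral \<Omega> T w"
proof -
  assume s: "spair w g"
  then have ae: "AE t in lborel. t \<in> I \<longrightarrow> H10pair \<Omega> (\<lambda>x. w (x, t)) (\<lambda>x. g (x, t))" by (simp add: spair_def)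
  show "has_sgrad \<Omega> T w g" unfolding has_sgrad_def
  proof
    show "g \<in> L2 Q" using s by (simp add: spair_def)
    show "AE t in lborel. t \<in> I \<longrightarrow> weak_gradient \<Omega> (\<lambda>x. w (x, t)) (\<lambda>x. g (x, t))"
      using ae by eventually_elim (auto intro: H10pair_weak_gradient[OF open_\<Omega>])
  qed
  show "zero_lateral \<Omega> T w" unfolding zero_lateral_def
    using ae by eventually_elim (use H10_iff[OF open_\<Omega>] in blast)
qed

lemma spair_of_has_sgrad:
  assumes "w \<in> L2 Q" "has_sgrad \<Omega> T w g" "zero_lateral \<Omega> T w"
  shows "spair w g"
proof -
  have g: "g \<in> L2 Q" "AE t in lborel. t \<in> I \<longrightarrow> weak_gradient \<Omega> (\<lambda>x. w (x, t)) (\<lambda>x. g (x, t))"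
    using assms by (auto simp: has_sgrad_def)
  have "AE t in lborel. t \<in> I \<longrightarrow> H10pair \<Omega> (\<lambda>x. w (x, t)) (\<lambda>x. g (x, t))"
    using g(2) L2Q_slice_t[OF g(1)] assms(3)[unfolded zero_lateral_def]
    by eventually_elim (auto intro: H10pair_of_weak_gradient[OF open_\<Omega> bounded_\<Omega>])
  then show ?thesis using assms g by (simp add: spair_def)
qed

lemma L2Q_eq_of_slices_t:
  fixes f g :: "(real^'n) \<times> real \<Rightarrow> 'c::euclidean_space"
  assumes f: "f \<in> L2 Q" "g \<in> L2 Q"
    and z: "AE t in lborel. t \<in> I \<longrightarrow> (AE x in lborel. x \<in> \<Omega> \<longrightarrow> f (x, t) = g (x, t))"
  shows "AE z in lborel. z \<in> Q \<longrightarrow> f z = g z"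
proof -
  have "AE z in lborel. z \<in> \<Omega> \<times> I \<longrightarrow> f z - g z = 0"
  proof (rule L2_AE_zero_of_slices)
    show "(\<lambda>z. f z - g z) \<in> L2 (\<Omega> \<times> I)" using L2_diff[OF f] by (simp add: Q_eq)
  qed (use z in simp)
  then show ?thesis by (simp add: Q_eq)
qed

lemma L2Q_eq_of_slices_x:
  fixes f g :: "(real^'n) \<times> real \<Rightarrow> 'c::euclidean_space"
  assumes f: "f \<in> L2 Q" "g \<in> L2 Q"
    and z: "AE x in lborel. x \<in> \<Omega> \<longrightarrow> (AE t in lborel. t \<in> I \<longrightarrow> f (x, t) = g (x, t))"
  shows "AE z in lborel. z \<in> Q \<longrightarrow> f z = g z"
proof -
  have "AE z in lborel. z \<in> \<Omega> \<times> I \<longrightarrow> f z - g z = 0"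
  proof (rule L2_AE_zero_of_slices)
    show "(\<lambda>z. f z - g z) \<in> L2 (\<Omega> \<times> I)" using L2_diff[OF f] by (simp add: Q_eq)
  qed (use z in simp)
  then show ?thesis by (simp add: Q_eq)
qed

lemma has_sgrad_unique:
  assumes "has_sgrad \<Omega> T w g" "has_sgrad \<Omega> T w g'"
  shows "AE z in lborel. z \<in> Q \<longrightarrow> g z = g' z"
proof (rule L2Q_eq_of_slices_t)
  show L: "g \<in> L2 Q" "g' \<in> L2 Q" using assms by (auto simp: has_sgrad_def)
  have a: "AE t in lborel. t \<in> I \<longrightarrow> weak_gradient \<Omega> (\<lambda>x. w (x, t)) (\<lambda>x. g (x, t))"
    "AE t in lborel. t \<in> I \<longrightarrow> weak_gradient \<Omega> (\<lambda>x. w (x, t)) (\<lambda>x. g' (x, t))"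
    using assms by (auto simp: has_sgrad_def)
  show "AE t in lborel. t \<in> I \<longrightarrow> (AE x in lborel. x \<in> \<Omega> \<longrightarrow> g (x, t) = g' (x, t))"
    using a L2Q_slice_t[OF L(1)] L2Q_slice_t[OF L(2)]
    by eventually_elim (auto intro: weak_gradient_unique[OF open_\<Omega> bounded_\<Omega>])
qed

lemma has_sdiv_unique:
  assumes "has_sdiv \<Omega> T w g" "has_sdiv \<Omega> T w g'"
  shows "AE z in lborel. z \<in> Q \<longrightarrow> g z = g' z"
proof (rule L2Q_eq_of_slices_t)
  show L: "g \<in> L2 Q" "g' \<in> L2 Q" using assms by (auto simp: has_sdiv_def)
  have a: "AE t in lborel. t \<in> I \<longrightarrow> weak_divergence \<Omega> (\<lambda>x. w (x, t)) (\<lambda>x. g (x, t))"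
    "AE t in lborel. t \<in> I \<longrightarrow> weak_divergence \<Omega> (\<lambda>x. w (x, t)) (\<lambda>x. g' (x, t))"
    using assms by (auto simp: has_sdiv_def)
  show "AE t in lborel. t \<in> I \<longrightarrow> (AE x in lborel. x \<in> \<Omega> \<longrightarrow> g (x, t) = g' (x, t))"
    using a L2Q_slice_t[OF L(1)] L2Q_slice_t[OF L(2)]
    by eventually_elim (auto intro: weak_divergence_unique[OF open_\<Omega>] L2_\<Omega>_integrable)
qed

lemma has_tderiv_unique:
  assumes "has_tderiv \<Omega> T w g" "has_tderiv \<Omega> T w g'"
  shows "AE z in lborel. z \<in> Q \<longrightarrow> g z = g' z"
proof (rule L2Q_eq_of_slices_x)
  show L: "g \<in> L2 Q" "g' \<in> L2 Q" using assms by (auto simp: has_tderiv_def)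
  have a: "AE x in lborel. x \<in> \<Omega> \<longrightarrow> weak_pderiv I 1 (\<lambda>t. w (x, t)) (\<lambda>t. g (x, t))"
    "AE x in lborel. x \<in> \<Omega> \<longrightarrow> weak_pderiv I 1 (\<lambda>t. w (x, t)) (\<lambda>t. g' (x, t))"
    using assms by (auto simp: has_tderiv_def)
  show "AE x in lborel. x \<in> \<Omega> \<longrightarrow> (AE t in lborel. t \<in> I \<longrightarrow> g (x, t) = g' (x, t))"
    using a L2Q_slice_x[OF L(1)] L2Q_slice_x[OF L(2)]
  proof eventually_elim
    case (elim x)
    then show ?case
      using weak_pderiv_unique[of I "\<lambda>t. g (x, t)" "\<lambda>t. g' (x, t)" 1 "\<lambda>t. w (x, t)"] L2_I_integrable
        open_greaterThanLessThan[of 0 T] by blast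
  qed
qed

lemma sgrad_works: "has_sgrad \<Omega> T w g \<Longrightarrow> has_sgrad \<Omega> T w (sgrad \<Omega> T w)"
  using someI[of "has_sgrad \<Omega> T w" g] by (simp add: sgrad_def)
lemma tderiv_works: "has_tderiv \<Omega> T w h \<Longrightarrow> has_tderiv \<Omega> T w (tderiv \<Omega> T w)"
  using someI[of "has_tderiv \<Omega> T w" h] by (simp add: tderiv_def)
lemma sdiv_works: "has_sdiv \<Omega> T \<tau> d \<Longrightarrow> has_sdiv \<Omega> T \<tau> (sdiv \<Omega> T \<tau>)"
  using someI[of "has_sdiv \<Omega> T \<tau>" d] by (simp add: sdiv_def)

lemma H11_pairs:
  assumes "w \<in> H11 \<Omega> T"
  shows "spair w (sgrad \<Omega> T w)" "tpair w (tderiv \<Omega> T w)"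
proof -
  have g: "has_sgrad \<Omega> T w (sgrad \<Omega> T w)" using assms sgrad_works unfolding H11_def by blast
  have h: "has_tderiv \<Omega> T w (tderiv \<Omega> T w)" using assms tderiv_works unfolding H11_def by blast
  show "spair w (sgrad \<Omega> T w)" using assms g by (intro spair_of_has_sgrad) (auto simp: H11_def)
  have p: "AE x in lborel. x \<in> \<Omega> \<longrightarrow> periodic_rep T (\<lambda>t. w (x, t))"
    using assms unfolding H11_def time_periodic_def periodic_rep_def by blast
  have "AE x in lborel. x \<in> \<Omega> \<longrightarrow> weak_pderiv I 1 (\<lambda>t. w (x, t)) (\<lambda>t. tderiv \<Omega> T w (x, t)) \<and> periodic_rep T (\<lambda>t. w (x, t))"
    using p h[unfolded has_tderiv_def, THEN conjunct2] by eventually_elim auto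
  then show "tpair w (tderiv \<Omega> T w)" using assms h by (auto simp: tpair_def H11_def has_tderiv_def)
qed

lemma H1half_spair: "w \<in> H1half \<Omega> T \<Longrightarrow> spair w (sgrad \<Omega> T w)"
  by (intro spair_of_has_sgrad) (auto simp: H1half_def intro: sgrad_works)

lemma sgrad_AE: "spair w g \<Longrightarrow> AE z in lborel. z \<in> Q \<longrightarrow> sgrad \<Omega> T w z = g z"
  using spair_has_sgrad(1) has_sgrad_unique sgrad_works by blast

lemma sgrad_spair: "spair w g \<Longrightarrow> spair w (sgrad \<Omega> T w)"
  using spair_has_sgrad[of w g] by (intro spair_of_has_sgrad) (auto simp: spair_def intro: sgrad_works)

lemma tpair_has_tderiv: "tpair w h \<Longrightarrow> has_tderiv \<Omega> T w h" "tpair w h \<Longrightarrow> time_periodic \<Omega> T w"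
proof -
  assume t: "tpair w h"
  then have ae: "AE x in lborel. x \<in> \<Omega> \<longrightarrow> weak_pderiv I 1 (\<lambda>t. w (x, t)) (\<lambda>t. h (x, t)) \<and> periodic_rep T (\<lambda>t. w (x, t))"
    by (simp add: tpair_def)
  have "AE x in lborel. x \<in> \<Omega> \<longrightarrow> weak_pderiv I 1 (\<lambda>t. w (x, t)) (\<lambda>t. h (x, t))"
    using ae by eventually_elim auto
  then show "has_tderiv \<Omega> T w h" using t by (simp add: tpair_def has_tderiv_def)
  have "AE x in lborel. x \<in> \<Omega> \<longrightarrow> periodic_rep T (\<lambda>t. w (x, t))"
    using ae by eventually_elim auto
  then show "time_periodic \<Omega> T w" by (simp add: time_periodic_def periodic_rep_def)
qed

lemma tderiv_AE: "tpair w h \<Longrightarrow> AE z in lborel. z \<in> Q \<longrightarrow> tderiv \<Omega> T w z = h z"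
  using tpair_has_tderiv(1) has_tderiv_unique tderiv_works by blast

lemma pairs_H11: "spair w g \<Longrightarrow> tpair w h \<Longrightarrow> w \<in> H11 \<Omega> T"
  using spair_has_sgrad[of w g] tpair_has_tderiv[of w h] by (auto simp: H11_def spair_def)

lemma Hdiv_dpair: "\<tau> \<in> Hdiv \<Omega> T \<Longrightarrow> dpair \<tau> (sdiv \<Omega> T \<tau>)"
  unfolding dpair_def Hdiv_def by (auto intro: sdiv_works)

lemma dpair_Hdiv: "dpair \<tau> d \<Longrightarrow> \<tau> \<in> Hdiv \<Omega> T"
  unfolding dpair_def Hdiv_def by auto

lemma sdiv_AE: "dpair \<tau> d \<Longrightarrow> AE z in lborel. z \<in> Q \<longrightarrow> sdiv \<Omega> T \<tau> z = d z"
  unfolding dpair_def using has_sdiv_unique sdiv_works by blast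

lemma spair_linear:
  assumes "spair w g" "spair w' g'"
  shows "spair (\<lambda>z. c * w z + d * w' z) (\<lambda>z. c *\<^sub>R g z + d *\<^sub>R g' z)"
proof -
  have "AE t in lborel. t \<in> I \<longrightarrow> H10pair \<Omega> (\<lambda>x. w (x, t)) (\<lambda>x. g (x, t))"
    "AE t in lborel. t \<in> I \<longrightarrow> H10pair \<Omega> (\<lambda>x. w' (x, t)) (\<lambda>x. g' (x, t))"
    using assms by (auto simp: spair_def)
  then have "AE t in lborel. t \<in> I \<longrightarrow> H10pair \<Omega> (\<lambda>x. c * w (x, t) + d * w' (x, t)) (\<lambda>x. c *\<^sub>R g (x, t) + d *\<^sub>R g' (x, t))"
    by eventually_elim (auto intro: H10pair_linear[OF open_\<Omega>])
  then show ?thesis using assms by (auto simp: spair_def intro!: L2_add L2_scaleR L2_cmult)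
qed

lemma weak_pderiv_linear:
  assumes I: "set_integrable lborel I f" "set_integrable lborel I f'" "set_integrable lborel I g" "set_integrable lborel I g'"
    and w: "weak_pderiv I 1 f g" "weak_pderiv I 1 f' g'"
  shows "weak_pderiv I 1 (\<lambda>t. c * f t + d * f' t) (\<lambda>t. c * g t + d * g' t)"
  unfolding weak_pderiv_def
proof
  fix \<phi> :: "real \<Rightarrow> real" assume \<phi>: "\<phi> \<in> test_functions I"
  have i: "set_integrable lborel I (\<lambda>t. k t * \<phi> t)" "set_integrable lborel I (\<lambda>t. k t * pderiv_dir 1 \<phi> t)"
    if "set_integrable lborel I k" for k
    using set_integrable_mult_test_function[OF that \<phi>, of 1] by auto
  have "(LINT t:I|lborel. f t * pderiv_dir 1 \<phi> t) = - (LINT t:I|lborel. g t * \<phi> t)"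
    "(LINT t:I|lborel. f' t * pderiv_dir 1 \<phi> t) = - (LINT t:I|lborel. g' t * \<phi> t)"
    using w \<phi> by (auto simp: weak_pderiv_def)
  then show "(LINT t:I|lborel. (c * f t + d * f' t) * pderiv_dir 1 \<phi> t) = - (LINT t:I|lborel. (c * g t + d * g' t) * \<phi> t)"
    using i[OF I(1)] i[OF I(2)] i[OF I(3)] i[OF I(4)] by (simp add: distrib_right mult.assoc)
qed

lemma periodic_rep_linear:
  assumes "periodic_rep T f" "periodic_rep T g"
  shows "periodic_rep T (\<lambda>t. c * f t + d * g t)"
proof -
  obtain F G where F: "continuous_on {0..T} F" "AE t in lborel. t \<in> I \<longrightarrow> f t = F t" "F 0 = F T"
    and G: "continuous_on {0..T} G" "AE t in lborel. t \<in> I \<longrightarrow> g t = G t" "G 0 = G T"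
    using assms by (auto simp: periodic_rep_def)
  have "AE t in lborel. t \<in> I \<longrightarrow> c * f t + d * g t = c * F t + d * G t"
    using F(2) G(2) by eventually_elim auto
  then show ?thesis unfolding periodic_rep_def using F G
    by (intro exI[of _ "\<lambda>t. c * F t + d * G t"]) (auto intro!: continuous_intros)
qed

lemma tpair_linear:
  assumes "tpair w h" "tpair w' h'"
  shows "tpair (\<lambda>z. c * w z + d * w' z) (\<lambda>z. c * h z + d * h' z)"
proof -
  have L: "w \<in> L2 Q" "h \<in> L2 Q" "w' \<in> L2 Q" "h' \<in> L2 Q" using assms by (auto simp: tpair_def)
  have "AE x in lborel. x \<in> \<Omega> \<longrightarrow> weak_pderiv I 1 (\<lambda>t. c * w (x, t) + d * w' (x, t)) (\<lambda>t. c * h (x, t) + d * h' (x, t))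
     \<and> periodic_rep T (\<lambda>t. c * w (x, t) + d * w' (x, t))"
    using assms[unfolded tpair_def, THEN conjunct2, THEN conjunct2]
      L2Q_slice_x[OF L(1)] L2Q_slice_x[OF L(2)] L2Q_slice_x[OF L(3)] L2Q_slice_x[OF L(4)]
    by eventually_elim (auto intro!: weak_pderiv_linear periodic_rep_linear L2_I_integrable)
  then show ?thesis using L by (auto simp: tpair_def intro!: L2_add L2_cmult)
qed

text \<open>
  Friedrichs' inequality on almost every time slice, integrated in time.
\<close>

lemma spair_friedrichs:
  assumes "spair w g"
  shows "l2norm Q w \<le> C * l2norm Q g"
proof -
  have L: "w \<in> L2 (\<Omega> \<times> I)" "g \<in> L2 (\<Omega> \<times> I)" using assms by (auto simp: spair_def Q_eq)
  have ae: "AE t in lborel. t \<in> I \<longrightarrow> l2norm \<Omega> (\<lambda>x. w (x, t)) \<le> C * l2norm \<Omega> (\<lambda>x. g (x, t))"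
    using assms[unfolded spair_def, THEN conjunct2, THEN conjunct2]
    by eventually_elim (auto intro: H10pair_friedrichs[OF open_\<Omega> friedrichs])
  have "(l2norm Q w)\<^sup>2 = (LINT t:I|lborel. (l2norm \<Omega> (\<lambda>x. w (x, t)))\<^sup>2)"
    using l2norm_sq_slices(4)[OF L(1)] by (simp add: Q_eq)
  also have "\<dots> \<le> (LINT t:I|lborel. C\<^sup>2 * (l2norm \<Omega> (\<lambda>x. g (x, t)))\<^sup>2)"
    unfolding set_lebesgue_integral_def
  proof (rule integral_mono_AE)
    show "integrable lborel (\<lambda>t. indicat_real I t *\<^sub>R (l2norm \<Omega> (\<lambda>x. w (x, t)))\<^sup>2)"
      using l2norm_sq_slices(3)[OF L(1)] by (simp add: set_integrable_def)
    have "set_integrable lborel I (\<lambda>t. C\<^sup>2 * (l2norm \<Omega> (\<lambda>x. g (x, t)))\<^sup>2)"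
      using l2norm_sq_slices(3)[OF L(2)] by simp
    then show "integrable lborel (\<lambda>t. indicat_real I t *\<^sub>R (C\<^sup>2 * (l2norm \<Omega> (\<lambda>x. g (x, t)))\<^sup>2))"
      by (simp add: set_integrable_def)
    show "AE t in lborel. indicat_real I t *\<^sub>R (l2norm \<Omega> (\<lambda>x. w (x, t)))\<^sup>2 \<le> indicat_real I t *\<^sub>R (C\<^sup>2 * (l2norm \<Omega> (\<lambda>x. g (x, t)))\<^sup>2)"
      using ae
    proof eventually_elim
      case (elim t)
      show ?case
      proof (cases "t \<in> I")
        case True
        then have "(l2norm \<Omega> (\<lambda>x. w (x, t)))\<^sup>2 \<le> (C * l2norm \<Omega> (\<lambda>x. g (x, t)))\<^sup>2"
          using elim by (intro power_mono l2norm_nonneg) auto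
        then show ?thesis using True by (simp add: power_mult_distrib)
      qed simp
    qed
  qed
  also have "\<dots> = (C * l2norm Q g)\<^sup>2"
    using l2norm_sq_slices(4)[OF L(2)] by (simp add: Q_eq power_mult_distrib)
  finally show ?thesis using C_pos l2norm_nonneg by (intro power2_le_imp_le[of "l2norm Q w"]) (auto intro: mult_nonneg_nonneg less_imp_le)
qed

text \<open>
  On almost every time slice the weak divergence is tested with a limit of test functions.
\<close>

lemma divergence_theorem:
  assumes d: "dpair \<tau> d" and s: "spair q \<gamma>"
  shows "l2inner Q \<tau> \<gamma> + l2inner Q d q = 0"
proof -
  have L: "\<tau> \<in> L2 Q" "d \<in> L2 Q" "q \<in> L2 Q" "\<gamma> \<in> L2 Q" using d s by (auto simp: dpair_def spair_def has_sdiv_def)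
  have ae: "AE t in lborel. t \<in> I \<longrightarrow> weak_divergence \<Omega> (\<lambda>x. \<tau> (x, t)) (\<lambda>x. d (x, t))"
    "AE t in lborel. t \<in> I \<longrightarrow> H10pair \<Omega> (\<lambda>x. q (x, t)) (\<lambda>x. \<gamma> (x, t))"
    using d s by (auto simp: dpair_def spair_def has_sdiv_def)
  have i: "set_integrable lborel (\<Omega> \<times> I) (\<lambda>z. \<tau> z \<bullet> \<gamma> z)" "set_integrable lborel (\<Omega> \<times> I) (\<lambda>z. d z \<bullet> q z)"
    using L2_inner_integrable[OF L(1,4)] L2_inner_integrable[OF L(2,3)] by (auto simp: Q_eq)
  have "AE t in lborel. t \<in> I \<longrightarrow> (LINT x:\<Omega>|lborel. \<tau> (x, t) \<bullet> \<gamma> (x, t)) + (LINT x:\<Omega>|lborel. d (x, t) \<bullet> q (x, t)) = 0"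
    using ae L2Q_slice_t[OF L(1)] L2Q_slice_t[OF L(2)]
  proof eventually_elim
    case (elim t)
    show ?case
    proof
      assume t: "t \<in> I"
      have "l2inner \<Omega> (\<lambda>x. \<tau> (x, t)) (\<lambda>x. \<gamma> (x, t)) + l2inner \<Omega> (\<lambda>x. d (x, t)) (\<lambda>x. q (x, t)) = 0"
      proof (rule H10pair_functional[OF open_\<Omega>])
        fix \<phi> assume "\<phi> \<in> test_functions \<Omega>"
        then show "l2inner \<Omega> (\<lambda>x. \<tau> (x, t)) (classical_gradient \<phi>) + l2inner \<Omega> (\<lambda>x. d (x, t)) \<phi> = 0"
          using elim(1) t by (simp add: weak_divergence_def l2inner_def)
      qed (use elim t in auto)
      then show "(LINT x:\<Omega>|lborel. \<tau> (x, t) \<bullet> \<gamma> (x, t)) + (LINT x:\<Omega>|lborel. d (x, t) \<bullet> q (x, t)) = 0"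
        by (simp add: l2inner_def)
    qed
  qed
  then have z: "AE t in lborel. indicat_real I t *\<^sub>R ((LINT x:\<Omega>|lborel. \<tau> (x, t) \<bullet> \<gamma> (x, t)) + (LINT x:\<Omega>|lborel. d (x, t) \<bullet> q (x, t))) = 0"
    by eventually_elim (auto simp: indicator_def)
  have "l2inner Q \<tau> \<gamma> + l2inner Q d q = (LINT t:I|lborel. (LINT x:\<Omega>|lborel. \<tau> (x, t) \<bullet> \<gamma> (x, t)) + (LINT x:\<Omega>|lborel. d (x, t) \<bullet> q (x, t)))"
    unfolding l2inner_def Q_eq
    using set_fubini_snd(2,3)[OF i(1)] set_fubini_snd(2,3)[OF i(2)] by simp
  also have "\<dots> = 0"
    unfolding set_lebesgue_integral_def[of lborel I] by (rule integral_eq_zero_AE[OF z])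
  finally show ?thesis .
qed

text \<open>
  The weight does not depend on time, so that the one-dimensional formula applies on almost
  every line.
\<close>

lemma time_integration_by_parts:
  assumes w: "tpair w h" "tpair v k"
  shows "l2inner Q (\<lambda>z. \<sigma> (fst z) *\<^sub>R h z) v + l2inner Q (\<lambda>z. \<sigma> (fst z) *\<^sub>R w z) k = 0"
proof -
  have L: "w \<in> L2 Q" "h \<in> L2 Q" "v \<in> L2 Q" "k \<in> L2 Q" using w by (auto simp: tpair_def)
  have i: "set_integrable lborel (\<Omega> \<times> I) (\<lambda>z. (\<sigma> (fst z) *\<^sub>R h z) \<bullet> v z)" "set_integrable lborel (\<Omega> \<times> I) (\<lambda>z. (\<sigma> (fst z) *\<^sub>R w z) \<bullet> k z)"
    using L2_inner_integrable[OF \<sigma>_L2_Q[OF L(2)] L(3)] L2_inner_integrable[OF \<sigma>_L2_Q[OF L(1)] L(4)] by (auto simp: Q_eq)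
  have "AE x in lborel. x \<in> \<Omega> \<longrightarrow> (LINT t:I|lborel. h (x, t) * v (x, t)) + (LINT t:I|lborel. w (x, t) * k (x, t)) = 0"
    using w[unfolded tpair_def, THEN conjunct2, THEN conjunct2]
      L2Q_slice_x[OF L(1)] L2Q_slice_x[OF L(2)] L2Q_slice_x[OF L(3)] L2Q_slice_x[OF L(4)]
    by eventually_elim (auto intro!: periodic_integration_by_parts[OF T] L2_I_integrable)
  then have z: "AE x in lborel. indicat_real \<Omega> x *\<^sub>R ((LINT t:I|lborel. (\<sigma> x *\<^sub>R h (x, t)) \<bullet> v (x, t)) + (LINT t:I|lborel. (\<sigma> x *\<^sub>R w (x, t)) \<bullet> k (x, t))) = 0"
  proof eventually_elim
    case (elim x)
    have "(LINT t:I|lborel. (\<sigma> x *\<^sub>R h (x, t)) \<bullet> v (x, t)) + (LINT t:I|lborel. (\<sigma> x *\<^sub>R w (x, t)) \<bullet> k (x, t))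
       = \<sigma> x * ((LINT t:I|lborel. h (x, t) * v (x, t)) + (LINT t:I|lborel. w (x, t) * k (x, t)))"
      by (simp add: distrib_left mult.assoc)
    then show ?case using elim by (auto simp: indicator_def)
  qed
  have "l2inner Q (\<lambda>z. \<sigma> (fst z) *\<^sub>R h z) v + l2inner Q (\<lambda>z. \<sigma> (fst z) *\<^sub>R w z) k
    = (LINT x:\<Omega>|lborel. (LINT t:I|lborel. (\<sigma> x *\<^sub>R h (x, t)) \<bullet> v (x, t)) + (LINT t:I|lborel. (\<sigma> x *\<^sub>R w (x, t)) \<bullet> k (x, t)))"
    unfolding l2inner_def Q_eq
    using set_fubini_fst(2,3)[OF i(1)] set_fubini_fst(2,3)[OF i(2)] by simp
  also have "\<dots> = 0"
    unfolding set_lebesgue_integral_def[of lborel \<Omega>] by (rule integral_eq_zero_AE[OF z])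
  finally show ?thesis .
qed

end

section \<open>Regularity of very weak solutions\<close>

lemma l2inner_commute: "l2inner S f g = l2inner S g f"
  by (simp add: l2inner_def inner_commute)

lemma l2inner_linear_left:
  assumes "f \<in> L2 S" "g \<in> L2 S" "h \<in> L2 S"
  shows "l2inner S (\<lambda>x. c *\<^sub>R f x + d *\<^sub>R g x) h = c * l2inner S f h + d * l2inner S g h"
  using assms by (simp flip: inner_cls add: L2_add L2_scaleR cls_add cls_scaleR inner_add_left)

lemma l2inner_bound:
  assumes "f \<in> L2 S" "g \<in> L2 S"
  shows "\<bar>l2inner S f g\<bar> \<le> l2norm S f * l2norm S g"
  using Cauchy_Schwarz_ineq2[of "cls S f" "cls S g"] assms by (simp add: inner_cls norm_cls)

lemma l2inner_self: "l2inner S f f = (l2norm S f)\<^sup>2"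
  by (simp add: l2norm_sq l2inner_def power2_norm_eq_inner)

lemma l2inner_ge_of_bound:
  fixes m :: "'a::euclidean_space \<Rightarrow> real"
  assumes mf: "(\<lambda>x. m x *\<^sub>R f x) \<in> L2 S" and f: "f \<in> L2 S" and lo: "\<And>x. x \<in> S \<Longrightarrow> lo \<le> m x"
  shows "lo * (l2norm S f)\<^sup>2 \<le> l2inner S (\<lambda>x. m x *\<^sub>R f x) f"
proof -
  have "lo * (l2norm S f)\<^sup>2 = (LINT x:S|lborel. lo * (f x \<bullet> f x))"
    unfolding l2inner_self[symmetric] by (simp add: l2inner_def)
  also have "\<dots> \<le> (LINT x:S|lborel. (m x *\<^sub>R f x) \<bullet> f x)"
  proof (rule set_integral_mono)
    show "set_integrable lborel S (\<lambda>x. lo * (f x \<bullet> f x))" using L2_inner_integrable[OF f f] by simp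
    show "set_integrable lborel S (\<lambda>x. (m x *\<^sub>R f x) \<bullet> f x)" by (rule L2_inner_integrable[OF mf f])
  qed (use lo in \<open>auto intro!: mult_right_mono\<close>)
  finally show ?thesis by (simp add: l2inner_def)
qed

lemma l2inner_zero_left: "l2inner S (\<lambda>x. 0) f = 0"
  by (simp add: l2inner_def set_lebesgue_integral_def)

lemma weak_pderiv_of_C1:
  fixes T :: real
  assumes T: "T > 0" and d: "\<And>t. (f has_real_derivative f' t) (at t)" and c: "continuous_on UNIV f'"
  shows "weak_pderiv {0<..<T} 1 f f'"
  unfolding weak_pderiv_def
proof
  fix \<phi> :: "real \<Rightarrow> real" assume \<phi>: "\<phi> \<in> test_functions {0<..<T}"
  note P = test_real_props[OF \<phi>]
  have cf: "continuous_on UNIV f" using d DERIV_isCont by (auto intro!: continuous_at_imp_continuous_on)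
  have c1: "continuous_on A (\<lambda>t. f t * pderiv_dir 1 \<phi> t)" and c2: "continuous_on A (\<lambda>t. f' t * \<phi> t)" for A
    using continuous_on_mult[OF cf P(2)] continuous_on_mult[OF c P(1)] continuous_on_subset by blast+
  have "(LINT t:{0<..<T}|lborel. f t * pderiv_dir 1 \<phi> t + f' t * \<phi> t) = f T * \<phi> T - f 0 * \<phi> 0"
  proof (rule set_integral_FTC)
    show "((\<lambda>t. f t * \<phi> t) has_real_derivative f t * pderiv_dir 1 \<phi> t + f' t * \<phi> t) (at t)" for t
      using DERIV_mult[OF d test_real_derivative[OF \<phi>], of t] by (simp add: algebra_simps)
    show "continuous_on {0..T} (\<lambda>t. f t * pderiv_dir 1 \<phi> t + f' t * \<phi> t)" by (intro continuous_on_add c1 c2)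
  qed (use T in simp)
  then show "(LINT t:{0<..<T}|lborel. f t * pderiv_dir 1 \<phi> t) = - (LINT t:{0<..<T}|lborel. f' t * \<phi> t)"
    using continuous_set_integrable[OF c1] continuous_set_integrable[OF c2] P(3)[of 0] P(3)[of T] by simp
qed

context parabolic
begin

text \<open>
  The elliptic system for the coefficients of a harmonic of angular frequency \<open>\<bar>\<kappa>\<bar>\<close>.
\<close>

definition ellip :: "real \<Rightarrow> (real^'n \<Rightarrow> real) \<Rightarrow> (real^'n \<Rightarrow> real) \<Rightarrow> (real^'n \<Rightarrow> real) \<Rightarrow> (real^'n \<Rightarrow> real^'n) \<Rightarrow>
    (real^'n \<Rightarrow> real) \<Rightarrow> (real^'n \<Rightarrow> real^'n) \<Rightarrow> bool" where
  "ellip \<kappa> a b zc gc zs gs \<longleftrightarrow> a \<in> L2 \<Omega> \<and> b \<in> L2 \<Omega> \<and> H10pair \<Omega> zc gc \<and> H10pair \<Omega> zs gs \<and> (\<forall>q \<rho>. H10pair \<Omega> q \<rho> \<longrightarrow>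
     l2inner \<Omega> (\<lambda>x. \<nu> x *\<^sub>R gc x) \<rho> + \<kappa> * l2inner \<Omega> (\<lambda>x. \<sigma> x *\<^sub>R zs x) q = l2inner \<Omega> a q \<and>
     l2inner \<Omega> (\<lambda>x. \<nu> x *\<^sub>R gs x) \<rho> - \<kappa> * l2inner \<Omega> (\<lambda>x. \<sigma> x *\<^sub>R zc x) q = l2inner \<Omega> b q)"

lemma ellip_exists:
  assumes "a \<in> L2 \<Omega>" "b \<in> L2 \<Omega>"
  obtains zc gc zs gs where "ellip \<kappa> a b zc gc zs gs"
proof -
  have lo: "\<And>x. x \<in> \<Omega> \<Longrightarrow> \<nu>_lo \<le> \<nu> x" using \<nu> by auto
  show thesis
    using elliptic_mode_solution[OF open_\<Omega> friedrichs meas(1) \<sigma>_bound meas(2) \<nu>_bound \<nu>_lo lo assms, of \<kappa>] that assms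
    unfolding ellip_def l2inner_def by (simp add: mult.assoc) blast
qed

text \<open>
  Here \<open>z\<close> is a time-periodic solution of \<open>s \<sigma> \<partial>\<^sub>t z - div (\<nu> \<nabla>z) = r\<close> with \<open>g = \<nabla>z\<close>, \<open>h = \<partial>\<^sub>t z\<close> and
  \<open>\<gamma> = \<nabla>\<partial>\<^sub>t z\<close>, smooth enough in time to be tested with \<open>h\<close>, and valid at every time and not just
  almost every time. The sign \<open>s\<close> is \<open>1\<close> for the state equation and \<open>- 1\<close> for the adjoint equation.
  Finite sums of harmonics are of this kind.
\<close>

definition reg :: "real \<Rightarrow> ((real^'n) \<times> real \<Rightarrow> real) \<Rightarrow> ((real^'n) \<times> real \<Rightarrow> real) \<Rightarrow> ((real^'n) \<times> real \<Rightarrow> real^'n) \<Rightarrow>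
    ((real^'n) \<times> real \<Rightarrow> real) \<Rightarrow> ((real^'n) \<times> real \<Rightarrow> real^'n) \<Rightarrow> bool" where
  "reg s r z g h \<gamma> \<longleftrightarrow> r \<in> L2 Q \<and> z \<in> L2 Q \<and> g \<in> L2 Q \<and> h \<in> L2 Q \<and> \<gamma> \<in> L2 Q \<and>
     (\<forall>t. (\<lambda>x. r (x, t)) \<in> L2 \<Omega> \<and> H10pair \<Omega> (\<lambda>x. z (x, t)) (\<lambda>x. g (x, t)) \<and> H10pair \<Omega> (\<lambda>x. h (x, t)) (\<lambda>x. \<gamma> (x, t))) \<and>
     (\<forall>x t. ((\<lambda>t. z (x, t)) has_real_derivative h (x, t)) (at t) \<and> ((\<lambda>t. g (x, t)) has_vector_derivative \<gamma> (x, t)) (at t)) \<and>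
     (\<forall>x. continuous_on UNIV (\<lambda>t. h (x, t)) \<and> continuous_on UNIV (\<lambda>t. \<gamma> (x, t)) \<and> z (x, 0) = z (x, T) \<and> g (x, 0) = g (x, T)) \<and>
     (\<forall>t q \<rho>. H10pair \<Omega> q \<rho> \<longrightarrow>
        l2inner \<Omega> (\<lambda>x. \<nu> x *\<^sub>R g (x, t)) \<rho> + s * l2inner \<Omega> (\<lambda>x. \<sigma> x *\<^sub>R h (x, t)) q = l2inner \<Omega> (\<lambda>x. r (x, t)) q)"

lemma regD:
  assumes "reg s r z g h \<gamma>"
  shows "r \<in> L2 Q" "z \<in> L2 Q" "g \<in> L2 Q" "h \<in> L2 Q" "\<gamma> \<in> L2 Q"
    "\<And>t. (\<lambda>x. r (x, t)) \<in> L2 \<Omega>" "\<And>t. H10pair \<Omega> (\<lambda>x. z (x, t)) (\<lambda>x. g (x, t))" "\<And>t. H10pair \<Omega> (\<lambda>x. h (x, t)) (\<lambda>x. \<gamma> (x, t))"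
    "\<And>x t. ((\<lambda>t. z (x, t)) has_real_derivative h (x, t)) (at t)" "\<And>x t. ((\<lambda>t. g (x, t)) has_vector_derivative \<gamma> (x, t)) (at t)"
    "\<And>x. continuous_on UNIV (\<lambda>t. h (x, t))" "\<And>x. continuous_on UNIV (\<lambda>t. \<gamma> (x, t))"
    "\<And>x. z (x, 0) = z (x, T)" "\<And>x. g (x, 0) = g (x, T)"
    "\<And>t q \<rho>. H10pair \<Omega> q \<rho> \<Longrightarrow>
        l2inner \<Omega> (\<lambda>x. \<nu> x *\<^sub>R g (x, t)) \<rho> + s * l2inner \<Omega> (\<lambda>x. \<sigma> x *\<^sub>R h (x, t)) q = l2inner \<Omega> (\<lambda>x. r (x, t)) q"
  using assms unfolding reg_def by blast+

lemma H10pair_L2: "H10pair \<Omega> f g \<Longrightarrow> f \<in> L2 \<Omega>" "H10pair \<Omega> f g \<Longrightarrow> g \<in> L2 \<Omega>"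
  by (auto simp: H10pair_def)

lemma mode_Q_L2: "a \<in> L2 \<Omega> \<Longrightarrow> b \<in> L2 \<Omega> \<Longrightarrow> mode T k a b \<in> L2 Q"
  unfolding Q_eq by (rule mode_L2[OF \<Omega>_borel])

lemma weighted_linear_left:
  assumes "(\<lambda>x. m x *\<^sub>R f x) \<in> L2 S" "(\<lambda>x. m x *\<^sub>R g x) \<in> L2 S" "h \<in> L2 S"
  shows "l2inner S (\<lambda>x. m x *\<^sub>R (c *\<^sub>R f x + d *\<^sub>R g x)) h = c * l2inner S (\<lambda>x. m x *\<^sub>R f x) h + d * l2inner S (\<lambda>x. m x *\<^sub>R g x) h"
  using l2inner_linear_left[OF assms, of c d] by (simp add: scaleR_add_right mult.commute)

lemma mode_reg:
  assumes e: "ellip (s * (real k * (2 * pi / T))) a b zc gc zs gs"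
  shows "reg s (mode T k a b) (mode T k zc zs) (mode T k gc gs)
     (mode T k (\<lambda>x. (real k * (2 * pi / T)) *\<^sub>R zs x) (\<lambda>x. (- (real k * (2 * pi / T))) *\<^sub>R zc x))
     (mode T k (\<lambda>x. (real k * (2 * pi / T)) *\<^sub>R gs x) (\<lambda>x. (- (real k * (2 * pi / T))) *\<^sub>R gc x))"
proof -
  define w where "w = real k * (2 * pi / T)"
  have ab: "a \<in> L2 \<Omega>" "b \<in> L2 \<Omega>" and p: "H10pair \<Omega> zc gc" "H10pair \<Omega> zs gs"
    and eq: "\<And>q \<rho>. H10pair \<Omega> q \<rho> \<Longrightarrow> l2inner \<Omega> (\<lambda>x. \<nu> x *\<^sub>R gc x) \<rho> + s * w * l2inner \<Omega> (\<lambda>x. \<sigma> x *\<^sub>R zs x) q = l2inner \<Omega> a q"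
      "\<And>q \<rho>. H10pair \<Omega> q \<rho> \<Longrightarrow> l2inner \<Omega> (\<lambda>x. \<nu> x *\<^sub>R gs x) \<rho> - s * w * l2inner \<Omega> (\<lambda>x. \<sigma> x *\<^sub>R zc x) q = l2inner \<Omega> b q"
    using e unfolding ellip_def w_def by blast+
  note L = H10pair_L2[OF p(1)] H10pair_L2[OF p(2)]
  have m: "mode T k f1 f2 = (\<lambda>z. cos (w * snd z) *\<^sub>R f1 (fst z) + sin (w * snd z) *\<^sub>R f2 (fst z))" for f1 f2 :: "real^'n \<Rightarrow> 'c::euclidean_space"
    by (simp add: mode_def w_def)
  have wT: "cos (w * T) = 1" "sin (w * T) = 0"
  proof -
    have "w * T = 2 * pi * real k" using T by (simp add: w_def)
    then show "cos (w * T) = 1" "sin (w * T) = 0"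
      using cos_2npi[of k] sin_2npi[of k] by (simp_all add: mult_ac)
  qed
  show ?thesis
    unfolding reg_def w_def[symmetric]
  proof (intro conjI allI impI)
    show "mode T k a b \<in> L2 Q" "mode T k zc zs \<in> L2 Q" "mode T k gc gs \<in> L2 Q"
      "mode T k (\<lambda>x. w *\<^sub>R zs x) (\<lambda>x. (- w) *\<^sub>R zc x) \<in> L2 Q" "mode T k (\<lambda>x. w *\<^sub>R gs x) (\<lambda>x. (- w) *\<^sub>R gc x) \<in> L2 Q"
      by (intro mode_Q_L2 L2_scaleR ab L)+
    show "(\<lambda>x. mode T k a b (x, t)) \<in> L2 \<Omega>" for t by (rule mode_slice_L2[OF ab])
    show "H10pair \<Omega> (\<lambda>x. mode T k zc zs (x, t)) (\<lambda>x. mode T k gc gs (x, t))" for t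
      unfolding m using H10pair_linear[OF open_\<Omega> p] by simp
    show "H10pair \<Omega> (\<lambda>x. mode T k (\<lambda>x. w *\<^sub>R zs x) (\<lambda>x. (- w) *\<^sub>R zc x) (x, t)) (\<lambda>x. mode T k (\<lambda>x. w *\<^sub>R gs x) (\<lambda>x. (- w) *\<^sub>R gc x) (x, t))" for t
      unfolding m using H10pair_linear[OF open_\<Omega> p(2,1), of "cos (w * t) * w" "- (sin (w * t) * w)"] by (simp add: mult.assoc)
    show "((\<lambda>t. mode T k zc zs (x, t)) has_real_derivative mode T k (\<lambda>x. w *\<^sub>R zs x) (\<lambda>x. (- w) *\<^sub>R zc x) (x, t)) (at t)" for x t
      unfolding m by (auto intro!: derivative_eq_intros simp: algebra_simps)
    show "((\<lambda>t. mode T k gc gs (x, t)) has_vector_derivative mode T k (\<lambda>x. w *\<^sub>R gs x) (\<lambda>x. (- w) *\<^sub>R gc x) (x, t)) (at t)" for x t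
      unfolding m has_vector_derivative_def by (auto intro!: derivative_eq_intros simp: algebra_simps)
    show "continuous_on UNIV (\<lambda>t. mode T k (\<lambda>x. w *\<^sub>R zs x) (\<lambda>x. (- w) *\<^sub>R zc x) (x, t))" for x
      unfolding m fst_conv snd_conv by (intro continuous_intros)
    show "continuous_on UNIV (\<lambda>t. mode T k (\<lambda>x. w *\<^sub>R gs x) (\<lambda>x. (- w) *\<^sub>R gc x) (x, t))" for x
      unfolding m fst_conv snd_conv by (intro continuous_intros)
    show "mode T k zc zs (x, 0) = mode T k zc zs (x, T)" "mode T k gc gs (x, 0) = mode T k gc gs (x, T)" for x
      by (simp_all add: m wT)
    fix t q \<rho> assume H: "H10pair \<Omega> q \<rho>"
    note LL = H10pair_L2[OF H]
    have 1: "l2inner \<Omega> (\<lambda>x. \<nu> x *\<^sub>R mode T k gc gs (x, t)) \<rho>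
      = cos (w * t) * l2inner \<Omega> (\<lambda>x. \<nu> x *\<^sub>R gc x) \<rho> + sin (w * t) * l2inner \<Omega> (\<lambda>x. \<nu> x *\<^sub>R gs x) \<rho>"
      unfolding m fst_conv snd_conv by (rule weighted_linear_left[OF \<nu>_L2[OF L(2)] \<nu>_L2[OF L(4)] LL(2)])
    have 2: "l2inner \<Omega> (\<lambda>x. \<sigma> x *\<^sub>R mode T k (\<lambda>x. w *\<^sub>R zs x) (\<lambda>x. (- w) *\<^sub>R zc x) (x, t)) q
      = (cos (w * t) * w) * l2inner \<Omega> (\<lambda>x. \<sigma> x *\<^sub>R zs x) q + (sin (w * t) * (- w)) * l2inner \<Omega> (\<lambda>x. \<sigma> x *\<^sub>R zc x) q"
      unfolding m fst_conv snd_conv scaleR_scaleR by (rule weighted_linear_left[OF \<sigma>_L2[OF L(3)] \<sigma>_L2[OF L(1)] LL(1)])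
    have 3: "l2inner \<Omega> (\<lambda>x. mode T k a b (x, t)) q = cos (w * t) * l2inner \<Omega> a q + sin (w * t) * l2inner \<Omega> b q"
      unfolding m fst_conv snd_conv by (rule l2inner_linear_left[OF ab LL(1)])
    show "l2inner \<Omega> (\<lambda>x. \<nu> x *\<^sub>R mode T k gc gs (x, t)) \<rho>
      + s * l2inner \<Omega> (\<lambda>x. \<sigma> x *\<^sub>R mode T k (\<lambda>x. w *\<^sub>R zs x) (\<lambda>x. (- w) *\<^sub>R zc x) (x, t)) q
      = l2inner \<Omega> (\<lambda>x. mode T k a b (x, t)) q"
      unfolding 1 2 3 eq(1)[OF H, symmetric] eq(2)[OF H, symmetric] by (simp add: algebra_simps)
  qed
qed

lemma reg_linear:
  assumes 1: "reg s r z g h \<gamma>" and 2: "reg s r' z' g' h' \<gamma>'"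
  shows "reg s (\<lambda>x. c * r x + d * r' x) (\<lambda>x. c * z x + d * z' x) (\<lambda>x. c *\<^sub>R g x + d *\<^sub>R g' x)
    (\<lambda>x. c * h x + d * h' x) (\<lambda>x. c *\<^sub>R \<gamma> x + d *\<^sub>R \<gamma>' x)"
  unfolding reg_def
proof (intro conjI allI impI)
  note A = regD[OF 1] and B = regD[OF 2]
  show "(\<lambda>x. c * r x + d * r' x) \<in> L2 Q" "(\<lambda>x. c * z x + d * z' x) \<in> L2 Q" "(\<lambda>x. c *\<^sub>R g x + d *\<^sub>R g' x) \<in> L2 Q"
    "(\<lambda>x. c * h x + d * h' x) \<in> L2 Q" "(\<lambda>x. c *\<^sub>R \<gamma> x + d *\<^sub>R \<gamma>' x) \<in> L2 Q"
    by (intro L2_add L2_cmult L2_scaleR A(1-5) B(1-5))+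
  show "(\<lambda>x. c * r (x, t) + d * r' (x, t)) \<in> L2 \<Omega>" for t by (intro L2_add L2_cmult A(6) B(6))
  show "H10pair \<Omega> (\<lambda>x. c * z (x, t) + d * z' (x, t)) (\<lambda>x. c *\<^sub>R g (x, t) + d *\<^sub>R g' (x, t))"
    "H10pair \<Omega> (\<lambda>x. c * h (x, t) + d * h' (x, t)) (\<lambda>x. c *\<^sub>R \<gamma> (x, t) + d *\<^sub>R \<gamma>' (x, t))" for t
    by (intro H10pair_linear[OF open_\<Omega>] A(7,8) B(7,8))+
  show "((\<lambda>t. c * z (x, t) + d * z' (x, t)) has_real_derivative c * h (x, t) + d * h' (x, t)) (at t)" for x t
    by (intro DERIV_add DERIV_cmult A(9) B(9))
  show "((\<lambda>t. c *\<^sub>R g (x, t) + d *\<^sub>R g' (x, t)) has_vector_derivative c *\<^sub>R \<gamma> (x, t) + d *\<^sub>R \<gamma>' (x, t)) (at t)" for x t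
    by (intro has_vector_derivative_add bounded_linear.has_vector_derivative[OF bounded_linear_scaleR_right] A(10) B(10))
  show "continuous_on UNIV (\<lambda>t. c * h (x, t) + d * h' (x, t))" "continuous_on UNIV (\<lambda>t. c *\<^sub>R \<gamma> (x, t) + d *\<^sub>R \<gamma>' (x, t))" for x
    by (intro continuous_on_add continuous_on_mult continuous_on_scaleR continuous_on_const A(11,12) B(11,12))+
  show "c * z (x, 0) + d * z' (x, 0) = c * z (x, T) + d * z' (x, T)"
    "c *\<^sub>R g (x, 0) + d *\<^sub>R g' (x, 0) = c *\<^sub>R g (x, T) + d *\<^sub>R g' (x, T)" for x
    by (simp_all add: A(13,14) B(13,14))
  fix t q \<rho> assume H: "H10pair \<Omega> q \<rho>"
  note LL = H10pair_L2[OF H]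
  have 1: "l2inner \<Omega> (\<lambda>x. \<nu> x *\<^sub>R (c *\<^sub>R g (x, t) + d *\<^sub>R g' (x, t))) \<rho>
    = c * l2inner \<Omega> (\<lambda>x. \<nu> x *\<^sub>R g (x, t)) \<rho> + d * l2inner \<Omega> (\<lambda>x. \<nu> x *\<^sub>R g' (x, t)) \<rho>"
    by (rule weighted_linear_left[OF \<nu>_L2[OF H10pair_L2(2)[OF A(7)]] \<nu>_L2[OF H10pair_L2(2)[OF B(7)]] LL(2)])
  have 2: "l2inner \<Omega> (\<lambda>x. \<sigma> x *\<^sub>R (c * h (x, t) + d * h' (x, t))) q
    = c * l2inner \<Omega> (\<lambda>x. \<sigma> x *\<^sub>R h (x, t)) q + d * l2inner \<Omega> (\<lambda>x. \<sigma> x *\<^sub>R h' (x, t)) q"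
    using weighted_linear_left[OF \<sigma>_L2[OF H10pair_L2(1)[OF A(8)[of t]]] \<sigma>_L2[OF H10pair_L2(1)[OF B(8)[of t]]] LL(1), of c d] by simp
  have 3: "l2inner \<Omega> (\<lambda>x. c * r (x, t) + d * r' (x, t)) q = c * l2inner \<Omega> (\<lambda>x. r (x, t)) q + d * l2inner \<Omega> (\<lambda>x. r' (x, t)) q"
    using l2inner_linear_left[OF A(6)[of t] B(6)[of t] LL(1), of c d] by simp
  show "l2inner \<Omega> (\<lambda>x. \<nu> x *\<^sub>R (c *\<^sub>R g (x, t) + d *\<^sub>R g' (x, t))) \<rho> + s * l2inner \<Omega> (\<lambda>x. \<sigma> x *\<^sub>R (c * h (x, t) + d * h' (x, t))) q
    = l2inner \<Omega> (\<lambda>x. c * r (x, t) + d * r' (x, t)) q"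
    unfolding 1 2 3 A(15)[OF H, symmetric] B(15)[OF H, symmetric] by (simp add: algebra_simps)
qed

lemma reg_spair:
  assumes "reg s r z g h \<gamma>"
  shows "spair z g" "spair h \<gamma>"
  using regD[OF assms] by (auto simp: spair_def)

lemma reg_tpair:
  assumes "reg s r z g h \<gamma>"
  shows "tpair z h"
proof -
  note A = regD[OF assms]
  have "periodic_rep T (\<lambda>t. z (x, t))" for x
    unfolding periodic_rep_def
    by (rule exI[of _ "\<lambda>t. z (x, t)"])
       (use A(13) DERIV_isCont[OF A(9)] in \<open>auto intro!: continuous_at_imp_continuous_on\<close>)
  then show ?thesis
    using A(2,4) weak_pderiv_of_C1[OF T A(9) A(11)] by (simp add: tpair_def)
qed

lemma reg_weak_form:
  assumes r: "reg s r z g h \<gamma>" and q: "spair q \<rho>"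
  shows "l2inner Q (\<lambda>z. \<nu> (fst z) *\<^sub>R g z) \<rho> + s * l2inner Q (\<lambda>z. \<sigma> (fst z) *\<^sub>R h z) q = l2inner Q r q"
proof -
  note A = regD[OF r]
  have L: "q \<in> L2 Q" "\<rho> \<in> L2 Q" using q by (auto simp: spair_def)
  have i: "set_integrable lborel (\<Omega> \<times> I) (\<lambda>z. (\<nu> (fst z) *\<^sub>R g z) \<bullet> \<rho> z)"
    "set_integrable lborel (\<Omega> \<times> I) (\<lambda>z. (\<sigma> (fst z) *\<^sub>R h z) \<bullet> q z)" "set_integrable lborel (\<Omega> \<times> I) (\<lambda>z. r z \<bullet> q z)"
    using L2_inner_integrable[OF \<nu>_L2_Q[OF A(3)] L(2)] L2_inner_integrable[OF \<sigma>_L2_Q[OF A(4)] L(1)] L2_inner_integrable[OF A(1) L(1)]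
    by (simp_all add: Q_eq)
  have z: "AE t in lborel. indicat_real I t *\<^sub>R ((LINT x:\<Omega>|lborel. (\<nu> x *\<^sub>R g (x, t)) \<bullet> \<rho> (x, t))
      + s * (LINT x:\<Omega>|lborel. (\<sigma> x *\<^sub>R h (x, t)) \<bullet> q (x, t)) - (LINT x:\<Omega>|lborel. r (x, t) \<bullet> q (x, t))) = 0"
    using q[unfolded spair_def, THEN conjunct2, THEN conjunct2]
  proof eventually_elim
    case (elim t)
    then show ?case using A(15)[of "\<lambda>x. q (x, t)" "\<lambda>x. \<rho> (x, t)" t] by (auto simp: indicator_def l2inner_def)
  qed
  have "l2inner Q (\<lambda>z. \<nu> (fst z) *\<^sub>R g z) \<rho> + s * l2inner Q (\<lambda>z. \<sigma> (fst z) *\<^sub>R h z) q - l2inner Q r q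
    = (LINT t:I|lborel. (LINT x:\<Omega>|lborel. (\<nu> x *\<^sub>R g (x, t)) \<bullet> \<rho> (x, t))
      + s * (LINT x:\<Omega>|lborel. (\<sigma> x *\<^sub>R h (x, t)) \<bullet> q (x, t)) - (LINT x:\<Omega>|lborel. r (x, t) \<bullet> q (x, t)))"
    unfolding l2inner_def Q_eq
    using set_fubini_snd(2,3)[OF i(1)] set_fubini_snd(2,3)[OF i(2)] set_fubini_snd(2,3)[OF i(3)] by simp
  also have "\<dots> = 0"
    unfolding set_lebesgue_integral_def[of lborel I] by (rule integral_eq_zero_AE[OF z])
  finally show ?thesis by simp
qed

text \<open>
  The integrand \<open>\<nu> g \<bullet> \<gamma>\<close> is the time derivative of the periodic function \<open>\<nu> |g|\<^sup>2 / 2\<close>.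
\<close>

lemma reg_gradient_orthogonal:
  assumes r: "reg s r z g h \<gamma>"
  shows "l2inner Q (\<lambda>z. \<nu> (fst z) *\<^sub>R g z) \<gamma> = 0"
proof -
  note A = regD[OF r]
  have i: "set_integrable lborel (\<Omega> \<times> I) (\<lambda>z. (\<nu> (fst z) *\<^sub>R g z) \<bullet> \<gamma> z)"
    using L2_inner_integrable[OF \<nu>_L2_Q[OF A(3)] A(5)] by (simp add: Q_eq)
  have z: "(LINT t:I|lborel. g (x, t) \<bullet> \<gamma> (x, t)) = 0" for x
  proof -
    have gc: "continuous_on UNIV (\<lambda>t. g (x, t))"
      using A(10) has_vector_derivative_continuous by (blast intro: continuous_at_imp_continuous_on)
    have "(LINT t:I|lborel. g (x, t) \<bullet> \<gamma> (x, t)) = (g (x, T) \<bullet> g (x, T)) / 2 - (g (x, 0) \<bullet> g (x, 0)) / 2"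
    proof (rule set_integral_FTC)
      show "((\<lambda>t. g (x, t) \<bullet> g (x, t) / 2) has_real_derivative g (x, t) \<bullet> \<gamma> (x, t)) (at t)" for t
      proof -
        have "((\<lambda>t. g (x, t) \<bullet> g (x, t)) has_derivative (\<lambda>u. g (x, t) \<bullet> (u *\<^sub>R \<gamma> (x, t)) + (u *\<^sub>R \<gamma> (x, t)) \<bullet> g (x, t))) (at t)"
          by (rule has_derivative_inner) (use A(10) in \<open>simp_all add: has_vector_derivative_def\<close>)
        then have "((\<lambda>t. g (x, t) \<bullet> g (x, t)) has_real_derivative 2 * (g (x, t) \<bullet> \<gamma> (x, t))) (at t)"
          by (rule has_derivative_imp_has_field_derivative) (simp add: inner_commute algebra_simps)
        from DERIV_cdivide[OF this, of 2] show ?thesis by simp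
      qed
      show "continuous_on {0..T} (\<lambda>t. g (x, t) \<bullet> \<gamma> (x, t))"
        by (intro continuous_on_inner continuous_on_subset[OF gc] continuous_on_subset[OF A(12)]) auto
    qed (use T in simp)
    then show ?thesis by (simp add: A(14))
  qed
  have "l2inner Q (\<lambda>z. \<nu> (fst z) *\<^sub>R g z) \<gamma> = (LINT x:\<Omega>|lborel. LINT t:I|lborel. (\<nu> x *\<^sub>R g (x, t)) \<bullet> \<gamma> (x, t))"
    unfolding l2inner_def Q_eq using set_fubini_fst(3)[OF i] by simp
  then show ?thesis by (simp add: z)
qed

text \<open>
  The form \<open>(h, z)\<close> with weight \<open>\<sigma>\<close> is skew symmetric on periodic functions.
\<close>

lemma energy_identity:
  assumes "tpair z h"
  shows "l2inner Q (\<lambda>z. \<sigma> (fst z) *\<^sub>R h z) z = 0"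
proof -
  have "l2inner Q (\<lambda>x. \<sigma> (fst x) *\<^sub>R z x) h = l2inner Q (\<lambda>x. \<sigma> (fst x) *\<^sub>R h x) z"
    by (simp add: l2inner_def mult_ac)
  then show ?thesis using time_integration_by_parts[OF assms assms] by simp
qed

lemma \<nu>_coercive: "g \<in> L2 Q \<Longrightarrow> \<nu>_lo * (l2norm Q g)\<^sup>2 \<le> l2inner Q (\<lambda>z. \<nu> (fst z) *\<^sub>R g z) g"
  by (rule l2inner_ge_of_bound[OF \<nu>_L2_Q]) (use \<nu> in \<open>auto simp: Q_eq\<close>)
lemma \<sigma>_coercive: "g \<in> L2 Q \<Longrightarrow> \<sigma>_lo * (l2norm Q g)\<^sup>2 \<le> l2inner Q (\<lambda>z. \<sigma> (fst z) *\<^sub>R g z) g"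
  by (rule l2inner_ge_of_bound[OF \<sigma>_L2_Q]) (use \<sigma> in \<open>auto simp: Q_eq\<close>)

text \<open>
  Testing the equation with \<open>z\<close> removes the time derivative and bounds the gradient; testing
  with \<open>h\<close> removes the diffusion term and bounds the time derivative. Neither step
  differentiates the coefficients.
\<close>

lemma reg_estimates:
  assumes r: "reg s r z g h \<gamma>" and s: "s * s = 1"
  shows "l2norm Q g \<le> C / \<nu>_lo * l2norm Q r" "l2norm Q z \<le> C * (C / \<nu>_lo) * l2norm Q r" "l2norm Q h \<le> 1 / \<sigma>_lo * l2norm Q r"
proof -
  note A = regD[OF r]
  have "\<nu>_lo * (l2norm Q g)\<^sup>2 \<le> l2inner Q r z"
    using reg_weak_form[OF r reg_spair(1)[OF r]] energy_identity[OF reg_tpair[OF r]] \<nu>_coercive[OF A(3)] by simp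
  also have "\<dots> \<le> l2norm Q r * l2norm Q z" using l2inner_bound[OF A(1,2)] by linarith
  also have "\<dots> \<le> l2norm Q r * (C * l2norm Q g)"
    by (intro mult_left_mono spair_friedrichs[OF reg_spair(1)[OF r]] l2norm_nonneg)
  finally have "(\<nu>_lo * l2norm Q g) * l2norm Q g \<le> (C * l2norm Q r) * l2norm Q g"
    by (simp add: power2_eq_square mult_ac)
  then have "\<nu>_lo * l2norm Q g \<le> C * l2norm Q r"
    using l2norm_nonneg[of Q g] l2norm_nonneg[of Q r] C_pos by (cases "l2norm Q g = 0") auto
  then show g: "l2norm Q g \<le> C / \<nu>_lo * l2norm Q r" using \<nu>_lo by (simp add: field_simps)
  have "l2norm Q z \<le> C * l2norm Q g" by (rule spair_friedrichs[OF reg_spair(1)[OF r]])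
  also have "\<dots> \<le> C * (C / \<nu>_lo * l2norm Q r)" using g C_pos by (intro mult_left_mono) auto
  finally show "l2norm Q z \<le> C * (C / \<nu>_lo) * l2norm Q r" by (simp add: mult.assoc)
  have "s * l2inner Q (\<lambda>z. \<sigma> (fst z) *\<^sub>R h z) h = l2inner Q r h"
    using reg_weak_form[OF r reg_spair(2)[OF r]] reg_gradient_orthogonal[OF r] by simp
  then have "s * s * l2inner Q (\<lambda>z. \<sigma> (fst z) *\<^sub>R h z) h = s * l2inner Q r h" by (simp add: mult.assoc)
  then have "\<sigma>_lo * (l2norm Q h)\<^sup>2 \<le> s * l2inner Q r h" using \<sigma>_coercive[OF A(4)] s by simp
  also have "\<dots> \<le> \<bar>s * l2inner Q r h\<bar>" by simp
  also have "\<dots> = \<bar>l2inner Q r h\<bar>"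
  proof -
    have "\<bar>s\<bar> = 1" using s by (auto simp: square_eq_1_iff)
    then show ?thesis by (simp add: abs_mult)
  qed
  also have "\<dots> \<le> l2norm Q r * l2norm Q h" by (rule l2inner_bound[OF A(1,4)])
  finally have "(\<sigma>_lo * l2norm Q h) * l2norm Q h \<le> l2norm Q r * l2norm Q h" by (simp add: power2_eq_square mult_ac)
  then have "\<sigma>_lo * l2norm Q h \<le> l2norm Q r"
    using l2norm_nonneg[of Q h] l2norm_nonneg[of Q r] by (cases "l2norm Q h = 0") auto
  then show "l2norm Q h \<le> 1 / \<sigma>_lo * l2norm Q r" using \<sigma>_lo by (simp add: field_simps)
qed

text \<open>
  The operators with opposite signs of the time derivative are adjoint to each other.
\<close>

lemma reg_duality:
  assumes r: "reg s r z g h \<gamma>" and r': "reg (- s) r' z' g' h' \<gamma>'"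
  shows "l2inner Q r z' = l2inner Q r' z"
proof -
  have "l2inner Q (\<lambda>x. \<nu> (fst x) *\<^sub>R g' x) g = l2inner Q (\<lambda>x. \<nu> (fst x) *\<^sub>R g x) g'"
    by (simp add: l2inner_def inner_commute)
  moreover have "l2inner Q (\<lambda>x. \<sigma> (fst x) *\<^sub>R h' x) z = l2inner Q (\<lambda>x. \<sigma> (fst x) *\<^sub>R z x) h'"
    by (simp add: l2inner_def mult_ac)
  moreover have "s * l2inner Q (\<lambda>z. \<sigma> (fst z) *\<^sub>R h z) z' + s * l2inner Q (\<lambda>x. \<sigma> (fst x) *\<^sub>R z x) h' = 0"
    using time_integration_by_parts[OF reg_tpair[OF r] reg_tpair[OF r']] by (simp flip: distrib_left)
  ultimately show ?thesis
    using reg_weak_form[OF r reg_spair(1)[OF r']] reg_weak_form[OF r' reg_spair(1)[OF r]] by simp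
qed

text \<open>
  The right-hand sides that admit such a solution form a subspace which contains all
  harmonics, and these are complete. The approximation is chosen with geometric rate for the
  sake of \<open>slices_tendsto\<close>.
\<close>

lemma reg_dense:
  assumes r: "r \<in> L2 Q"
  obtains rn zn gn hn \<gamma>n where "\<And>n::nat. reg s (rn n) (zn n) (gn n) (hn n) (\<gamma>n n)" "\<And>n. dist (cls Q (rn n)) (cls Q r) \<le> (1 / 2) ^ n"
proof -
  define M where "M = {cls Q f |f. \<exists>z g h \<gamma>. reg s f z g h \<gamma>}"
  have modeM: "cls Q (mode T k a b) \<in> M" if ab: "a \<in> L2 \<Omega>" "b \<in> L2 \<Omega>" for k a b
  proof -
    obtain zc gc zs gs where "ellip (s * (real k * (2 * pi / T))) a b zc gc zs gs" by (rule ellip_exists[OF ab])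
    then show ?thesis unfolding M_def using mode_reg by blast
  qed
  have lin: "c *\<^sub>R u + d *\<^sub>R v \<in> M" if uv: "u \<in> M" "v \<in> M" for c d u v
  proof -
    obtain f z g h \<gamma> where f: "u = cls Q f" "reg s f z g h \<gamma>" using uv(1) by (auto simp: M_def)
    obtain f' z' g' h' \<gamma>' where f': "v = cls Q f'" "reg s f' z' g' h' \<gamma>'" using uv(2) by (auto simp: M_def)
    have L: "f \<in> L2 Q" "f' \<in> L2 Q" using regD(1)[OF f(2)] regD(1)[OF f'(2)] by auto
    have "c *\<^sub>R u + d *\<^sub>R v = cls Q (\<lambda>x. c * f x + d * f' x)"
      using cls_add[OF L2_scaleR[OF L(1), of c] L2_scaleR[OF L(2), of d]] cls_scaleR[OF L(1), of c] cls_scaleR[OF L(2), of d] f f' by simp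
    then show ?thesis unfolding M_def using reg_linear[OF f(2) f'(2), of c d] by blast
  qed
  have m0: "cls Q (mode T 0 (\<lambda>x. 0) (\<lambda>x. 0)) \<in> M" by (rule modeM) (rule L2_zero)+
  have M: "subspace M"
  proof (rule subspaceI)
    show "0 \<in> M" using lin[OF m0 m0, of 0 0] by simp
    show "x + y \<in> M" if "x \<in> M" "y \<in> M" for x y using lin[OF that, of 1 1] by simp
    show "c *\<^sub>R x \<in> M" if "x \<in> M" for c x using lin[OF that that, of c 0] by simp
  qed
  have "cls Q r \<in> closure M"
  proof (rule in_closure_of_orthogonality[OF M])
    fix d assume d: "\<And>m. m \<in> M \<Longrightarrow> d \<bullet> m = 0"
    obtain f where f: "f \<in> L2 UNIV" "cls UNIV f = d" using cls_rep by metis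
    have fQ: "f \<in> L2 Q" by (rule L2_subset[OF f(1) Q_borel])
    have inn: "d \<bullet> cls Q m = l2inner Q f m" if m: "m \<in> L2 Q" for m
    proof -
      have m': "ext Q m \<in> L2 UNIV" "cls UNIV (ext Q m) = cls Q m"
        using m by (auto simp: L2_iff_sq_int cls_def ext_def)
      have "d \<bullet> cls Q m = l2inner UNIV f (ext Q m)" using inner_cls[OF f(1) m'(1)] m' f by simp
      also have "\<dots> = l2inner Q f m"
        unfolding l2inner_def set_lebesgue_integral_def
        by (rule Bochner_Integration.integral_cong) (auto simp: ext_def indicator_def)
      finally show ?thesis .
    qed
    have "AE z in lborel. z \<in> \<Omega> \<times> I \<longrightarrow> f z = 0"
    proof (rule trig_complete[OF open_\<Omega> bounded_\<Omega> T])
      show "f \<in> L2 (\<Omega> \<times> I)" using fQ by (simp add: Q_eq)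
      show "l2inner (\<Omega> \<times> I) f (mode T k a b) = 0" if "a \<in> L2 \<Omega>" "b \<in> L2 \<Omega>" for k a b
        using inn[OF mode_Q_L2[OF that]] d[OF modeM[OF that]] by (simp add: Q_eq)
    qed
    then have "cls Q f = cls Q (\<lambda>x. 0)" using cls_eq_iff[OF fQ L2_zero] by (simp add: Q_eq)
    then have "l2inner Q f r = l2inner Q (\<lambda>x. 0) r" using inner_cls[OF fQ r] inner_cls[OF L2_zero r] by metis
    then show "d \<bullet> cls Q r = 0" using inn[OF r] by (simp add: l2inner_zero_left)
  qed
  then have near: "\<forall>e>0. \<exists>u\<in>M. dist u (cls Q r) < e" unfolding closure_approachable .
  have "\<exists>u\<in>M. dist u (cls Q r) < (1 / 2) ^ n" for n :: nat
    using near[rule_format, of "(1 / 2) ^ n"] by simp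
  then have "\<exists>f z g h \<gamma>. reg s f z g h \<gamma> \<and> dist (cls Q f) (cls Q r) < (1 / 2) ^ n" for n :: nat
    unfolding M_def by blast
  then obtain rn zn gn hn \<gamma>n where w: "\<And>n. reg s (rn n) (zn n) (gn n) (hn n) (\<gamma>n n) \<and> dist (cls Q (rn n)) (cls Q r) < (1 / 2) ^ n"
    by metis
  show thesis by (rule that[of rn zn gn hn \<gamma>n]) (use w less_imp_le in blast)+
qed

lemma geometric_L2_convergence:
  fixes f :: "nat \<Rightarrow> 'a::euclidean_space \<Rightarrow> 'c::euclidean_space"
  assumes f: "\<And>n. f n \<in> L2 S" "g \<in> L2 S" and d: "\<And>n. dist (cls S (f n)) (cls S g) \<le> K * (1 / 2) ^ n"
  shows "(\<lambda>n. cls S (f n)) \<longlonglongrightarrow> cls S g" "summable (\<lambda>n. (l2norm S (\<lambda>z. f n z - g z))\<^sup>2)"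
proof -
  have "(\<lambda>n. K * (1 / 2) ^ n) \<longlonglongrightarrow> K * 0" by (intro tendsto_mult tendsto_const LIMSEQ_power_zero) simp
  then have l: "(\<lambda>n. K * (1 / 2) ^ n) \<longlonglongrightarrow> 0" by simp
  have "(\<lambda>n. dist (cls S (f n)) (cls S g)) \<longlonglongrightarrow> 0"
    by (rule Lim_null_comparison[OF always_eventually l]) (use d in simp)
  then show "(\<lambda>n. cls S (f n)) \<longlonglongrightarrow> cls S g" by (simp flip: tendsto_dist_iff)
  show "summable (\<lambda>n. (l2norm S (\<lambda>z. f n z - g z))\<^sup>2)"
  proof (rule summable_comparison_test)
    show "summable (\<lambda>n. K\<^sup>2 * ((1 / 2)\<^sup>2) ^ n)" by (intro summable_mult summable_geometric) (simp add: power2_eq_square)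
    have "(l2norm S (\<lambda>z. f n z - g z))\<^sup>2 \<le> K\<^sup>2 * ((1 / 2)\<^sup>2) ^ n" for n
    proof -
      have "(dist (cls S (f n)) (cls S g))\<^sup>2 \<le> (K * (1 / 2) ^ n)\<^sup>2" by (rule power_mono[OF d]) simp
      then have "(l2norm S (\<lambda>z. f n z - g z))\<^sup>2 \<le> (K * (1 / 2) ^ n)\<^sup>2"
        by (simp add: dist_norm norm_cls L2_diff f flip: cls_diff)
      also have "\<dots> = K\<^sup>2 * ((1 / 2)\<^sup>2) ^ n" by (simp only: power_mult_distrib power_mult[symmetric] mult.commute[of n 2])
      finally show ?thesis .
    qed
    then show "\<exists>N. \<forall>n\<ge>N. norm ((l2norm S (\<lambda>z. f n z - g z))\<^sup>2) \<le> K\<^sup>2 * ((1 / 2)\<^sup>2) ^ n" by simp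
  qed
qed

text \<open>
  A linear estimate of \<open>f\<close> by \<open>r\<close> transports geometric convergence from \<open>r\<close> to \<open>f\<close>.
\<close>

lemma cls_limit_of_estimate:
  fixes f :: "nat \<Rightarrow> (real^'n) \<times> real \<Rightarrow> 'c::euclidean_space" and r :: "nat \<Rightarrow> (real^'n) \<times> real \<Rightarrow> real"
  assumes f: "\<And>n. f n \<in> L2 Q" and r: "\<And>n. r n \<in> L2 Q" and c: "\<And>n. dist (cls Q (r n)) a \<le> (1 / 2) ^ n"
    and e: "\<And>m n. l2norm Q (\<lambda>z. f m z - f n z) \<le> K * l2norm Q (\<lambda>z. r m z - r n z)"
  obtains g where "g \<in> L2 Q" "\<And>n. dist (cls Q (f n)) (cls Q g) \<le> \<bar>K\<bar> * (1 / 2) ^ n"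
proof -
  have e': "dist (cls Q (f m)) (cls Q (f n)) \<le> \<bar>K\<bar> * ((1 / 2) ^ m + (1 / 2) ^ n)" for m n
  proof -
    have "dist (cls Q (f m)) (cls Q (f n)) \<le> K * dist (cls Q (r m)) (cls Q (r n))"
      using e[of m n] by (simp add: dist_norm norm_cls L2_diff f r flip: cls_diff)
    also have "\<dots> \<le> \<bar>K\<bar> * dist (cls Q (r m)) (cls Q (r n))" by (intro mult_right_mono) auto
    also have "\<dots> \<le> \<bar>K\<bar> * ((1 / 2) ^ m + (1 / 2) ^ n)"
      by (intro mult_left_mono order_trans[OF dist_triangle2[of _ _ a]] add_mono c) simp
    finally show ?thesis .
  qed
  have p: "(\<lambda>n. (1 / 2) ^ n) \<longlonglongrightarrow> (0::real)" by (rule LIMSEQ_power_zero) simp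
  have "Cauchy (\<lambda>n. cls Q (f n))"
  proof (rule metric_CauchyI)
    fix \<epsilon> :: real assume \<epsilon>: "\<epsilon> > 0"
    have "(\<lambda>n. \<bar>K\<bar> * ((1 / 2) ^ n + (1 / 2) ^ n)) \<longlonglongrightarrow> \<bar>K\<bar> * (0 + 0)" by (intro tendsto_intros p)
    then have "eventually (\<lambda>n. \<bar>K\<bar> * ((1 / 2) ^ n + (1 / 2) ^ n) < \<epsilon>) sequentially"
      by (rule order_tendstoD) (use \<epsilon> in simp)
    then obtain N where N: "\<bar>K\<bar> * ((1 / 2) ^ N + (1 / 2) ^ N) < \<epsilon>" by (auto simp: eventually_sequentially)
    have "dist (cls Q (f m)) (cls Q (f n)) < \<epsilon>" if "m \<ge> N" "n \<ge> N" for m n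
    proof -
      have "\<bar>K\<bar> * ((1 / 2) ^ m + (1 / 2) ^ n) \<le> \<bar>K\<bar> * ((1 / 2) ^ N + (1 / 2) ^ N)"
        using that by (intro mult_left_mono add_mono power_decreasing) auto
      then show ?thesis using e'[of m n] N by linarith
    qed
    then show "\<exists>M. \<forall>m\<ge>M. \<forall>n\<ge>M. dist (cls Q (f m)) (cls Q (f n)) < \<epsilon>" by blast
  qed
  then obtain w where w: "(\<lambda>n. cls Q (f n)) \<longlonglongrightarrow> w" using Cauchy_convergent convergent_def by metis
  have "w \<in> cls Q ` L2 Q"
    by (rule closed_sequentially[OF closed_cls_range[OF Q_borel] _ w]) (use f in auto)
  then obtain g where g: "g \<in> L2 Q" "w = cls Q g" by auto
  have d: "dist (cls Q (f n)) w \<le> \<bar>K\<bar> * (1 / 2) ^ n" for n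
  proof (rule LIMSEQ_le)
    show "(\<lambda>m. dist (cls Q (f n)) (cls Q (f m))) \<longlonglongrightarrow> dist (cls Q (f n)) w" by (intro tendsto_intros w)
    show "(\<lambda>m. \<bar>K\<bar> * ((1 / 2) ^ n + (1 / 2) ^ m)) \<longlonglongrightarrow> \<bar>K\<bar> * (1 / 2) ^ n"
      using tendsto_mult[OF tendsto_const tendsto_add[OF tendsto_const p], of "\<bar>K\<bar>" "(1 / 2) ^ n"] by simp
  qed (use e' in blast)
  then show thesis using that[OF g(1)] g(2) by blast
qed

lemma tendsto_l2inner:
  assumes f: "\<And>n. f n \<in> L2 S" "g \<in> L2 S" "h \<in> L2 S" and l: "(\<lambda>n. cls S (f n)) \<longlonglongrightarrow> cls S g"
  shows "(\<lambda>n. l2inner S (f n) h) \<longlonglongrightarrow> l2inner S g h"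
  using tendsto_inner[OF l tendsto_const[of "cls S h"]] by (simp add: inner_cls f)

text \<open>
  Let \<open>r\<close> be the limit of right-hand sides \<open>rn\<close> of solutions \<open>zn\<close> of the equation with sign \<open>- s\<close>. By
  \<open>reg_estimates\<close> the \<open>zn\<close> converge with their derivatives, and by \<open>reg_duality\<close> their limit has the
  same products with all harmonics as \<open>w\<close>, hence equals \<open>w\<close>. Finally the equation and the boundary
  and periodicity conditions pass to the limit on almost every slice.
\<close>

theorem very_weak_regularity:
  assumes s: "s * s = 1" and w: "w \<in> L2 Q" and r: "r \<in> L2 Q"
    and dual: "\<And>k a b zc gc zs gs. ellip (s * (real k * (2 * pi / T))) a b zc gc zs gs \<Longrightarrow>
       l2inner Q w (mode T k a b) = l2inner Q r (mode T k zc zs)"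
  obtains g h where "spair w g" "tpair w h" "dpair (\<lambda>z. \<nu> (fst z) *\<^sub>R g z) (\<lambda>z. - (s * (\<sigma> (fst z) * h z)) - r z)"
proof -
  obtain rn zn gn hn \<gamma>n where R: "\<And>n::nat. reg (- s) (rn n) (zn n) (gn n) (hn n) (\<gamma>n n)"
    and rn: "\<And>n. dist (cls Q (rn n)) (cls Q r) \<le> (1 / 2) ^ n"
    using reg_dense[OF r] by blast
  note RL = regD(1-5)[OF R]
  have D: "reg (- s) (\<lambda>z. rn m z - rn n z) (\<lambda>z. zn m z - zn n z) (\<lambda>z. gn m z - gn n z)
      (\<lambda>z. hn m z - hn n z) (\<lambda>z. \<gamma>n m z - \<gamma>n n z)" for m n
    using reg_linear[OF R R, of 1 m "-1" n] by simp
  have s': "(- s) * (- s) = 1" using s by simp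
  note est = reg_estimates[OF D s']
  obtain g Kg where g: "g \<in> L2 Q" "\<And>n. dist (cls Q (gn n)) (cls Q g) \<le> Kg * (1 / 2) ^ n"
    using cls_limit_of_estimate[OF RL(3) RL(1) rn est(1)] by metis
  obtain z Kz where z: "z \<in> L2 Q" "\<And>n. dist (cls Q (zn n)) (cls Q z) \<le> Kz * (1 / 2) ^ n"
    using cls_limit_of_estimate[OF RL(2) RL(1) rn est(2)] by metis
  obtain h Kh where h: "h \<in> L2 Q" "\<And>n. dist (cls Q (hn n)) (cls Q h) \<le> Kh * (1 / 2) ^ n"
    using cls_limit_of_estimate[OF RL(4) RL(1) rn est(3)] by metis
  have rf: "dist (cls Q (rn n)) (cls Q r) \<le> 1 * (1 / 2) ^ n" for n using rn[of n] by simp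
  note rl = geometric_L2_convergence(1)[OF RL(1) r rf] and zl = geometric_L2_convergence(1)[OF RL(2) z]
  have "AE x in lborel. x \<in> \<Omega> \<times> I \<longrightarrow> w x - z x = 0"
  proof (rule trig_complete[OF open_\<Omega> bounded_\<Omega> T])
    show "(\<lambda>x. w x - z x) \<in> L2 (\<Omega> \<times> I)" using L2_diff[OF w z(1)] by (simp add: Q_eq)
    fix k :: nat and a b :: "real^'n \<Rightarrow> real" assume ab: "a \<in> L2 \<Omega>" "b \<in> L2 \<Omega>"
    obtain zc gc zs gs where e: "ellip (s * (real k * (2 * pi / T))) a b zc gc zs gs" by (rule ellip_exists[OF ab])
    note mr = mode_reg[OF e]
    have mL: "mode T k a b \<in> L2 Q" "mode T k zc zs \<in> L2 Q" using regD(1,2)[OF mr] by auto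
    have "l2inner Q (zn n) (mode T k a b) = l2inner Q (rn n) (mode T k zc zs)" for n
      using reg_duality[OF mr R[of n]] by (simp add: l2inner_commute)
    then have "(\<lambda>n. l2inner Q (rn n) (mode T k zc zs)) \<longlonglongrightarrow> l2inner Q z (mode T k a b)"
      using tendsto_l2inner[OF RL(2) z(1) mL(1) zl] by simp
    moreover have "(\<lambda>n. l2inner Q (rn n) (mode T k zc zs)) \<longlonglongrightarrow> l2inner Q r (mode T k zc zs)"
      by (rule tendsto_l2inner[OF RL(1) r mL(2) rl])
    ultimately have "l2inner Q z (mode T k a b) = l2inner Q w (mode T k a b)"
      using LIMSEQ_unique dual[OF e] by metis
    then have "l2inner Q (\<lambda>x. w x - z x) (mode T k a b) = 0"
      using l2inner_linear_left[OF w z(1) mL(1), of 1 "-1"] by simp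
    then show "l2inner (\<Omega> \<times> I) (\<lambda>x. w x - z x) (mode T k a b) = 0" by (simp add: Q_eq)
  qed
  then have "cls Q w = cls Q z" unfolding cls_eq_iff[OF w z(1)] by (simp add: Q_eq)
  then have wz: "dist (cls Q (zn n)) (cls Q w) \<le> Kz * (1 / 2) ^ n" for n using z(2) by simp
  note slices = slices_tendsto[OF RL(1)[unfolded Q_eq] r[unfolded Q_eq] geometric_L2_convergence(2)[OF RL(1) r rf, unfolded Q_eq]]
    slices_tendsto[OF RL(2)[unfolded Q_eq] w[unfolded Q_eq] geometric_L2_convergence(2)[OF RL(2) w wz, unfolded Q_eq]]
    slices_tendsto[OF RL(3)[unfolded Q_eq] g(1)[unfolded Q_eq] geometric_L2_convergence(2)[OF RL(3) g, unfolded Q_eq]]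
    slices_tendsto[OF RL(4)[unfolded Q_eq] h(1)[unfolded Q_eq] geometric_L2_convergence(2)[OF RL(4) h, unfolded Q_eq]]
  have "AE x in lborel. \<forall>n. x \<in> \<Omega> \<longrightarrow> (\<lambda>t. zn n (x, t)) \<in> L2 I" "AE x in lborel. \<forall>n. x \<in> \<Omega> \<longrightarrow> (\<lambda>t. hn n (x, t)) \<in> L2 I"
    "AE x in lborel. \<forall>n. x \<in> \<Omega> \<longrightarrow> weak_pderiv I 1 (\<lambda>t. zn n (x, t)) (\<lambda>t. hn n (x, t)) \<and> periodic_rep T (\<lambda>t. zn n (x, t))"
    unfolding AE_all_countable using L2Q_slice_x[OF RL(2)] L2Q_slice_x[OF RL(4)] reg_tpair[OF R] by (auto simp: tpair_def)
  then have "AE x in lborel. x \<in> \<Omega> \<longrightarrow> weak_pderiv I 1 (\<lambda>t. w (x, t)) (\<lambda>t. h (x, t)) \<and> periodic_rep T (\<lambda>t. w (x, t))"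
    using slices(3,7) L2Q_slice_x[OF w] L2Q_slice_x[OF h(1)]
  proof eventually_elim
    case (elim x)
    show ?case
    proof
      assume x: "x \<in> \<Omega>"
      have L: "\<And>n. (\<lambda>t. zn n (x, t)) \<in> L2 I" "\<And>n. (\<lambda>t. hn n (x, t)) \<in> L2 I" "(\<lambda>t. w (x, t)) \<in> L2 I" "(\<lambda>t. h (x, t)) \<in> L2 I"
        and wp: "\<And>n. weak_pderiv I 1 (\<lambda>t. zn n (x, t)) (\<lambda>t. hn n (x, t))" "\<And>n. periodic_rep T (\<lambda>t. zn n (x, t))"
        and l: "(\<lambda>n. cls I (\<lambda>t. zn n (x, t))) \<longlonglongrightarrow> cls I (\<lambda>t. w (x, t))" "(\<lambda>n. cls I (\<lambda>t. hn n (x, t))) \<longlonglongrightarrow> cls I (\<lambda>t. h (x, t))"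
        using elim x by auto
      have wd: "weak_pderiv I 1 (\<lambda>t. w (x, t)) (\<lambda>t. h (x, t))"
        unfolding weak_pderiv_def
      proof
        fix \<phi> :: "real \<Rightarrow> real" assume \<phi>: "\<phi> \<in> test_functions I"
        have \<phi>L: "\<phi> \<in> L2 I" "pderiv_dir 1 \<phi> \<in> L2 I" using test_L2[OF \<phi>, of 1] by auto
        have 1: "(\<lambda>n. l2inner I (\<lambda>t. zn n (x, t)) (pderiv_dir 1 \<phi>)) \<longlonglongrightarrow> l2inner I (\<lambda>t. w (x, t)) (pderiv_dir 1 \<phi>)"
          by (rule tendsto_l2inner[OF L(1) L(3) \<phi>L(2) l(1)])
        have 2: "(\<lambda>n. - l2inner I (\<lambda>t. hn n (x, t)) \<phi>) \<longlonglongrightarrow> - l2inner I (\<lambda>t. h (x, t)) \<phi>"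
          by (intro tendsto_minus tendsto_l2inner[OF L(2) L(4) \<phi>L(1) l(2)])
        have "l2inner I (\<lambda>t. zn n (x, t)) (pderiv_dir 1 \<phi>) = - l2inner I (\<lambda>t. hn n (x, t)) \<phi>" for n
          using wp(1)[of n] \<phi> by (simp add: weak_pderiv_def l2inner_def)
        then have "l2inner I (\<lambda>t. w (x, t)) (pderiv_dir 1 \<phi>) = - l2inner I (\<lambda>t. h (x, t)) \<phi>"
          using 1 2 LIMSEQ_unique by simp
        then show "(LINT t:I|lborel. w (x, t) * pderiv_dir 1 \<phi> t) = - (LINT t:I|lborel. h (x, t) * \<phi> t)"
          by (simp add: l2inner_def)
      qed
      have one: "(\<lambda>t. 1::real) \<in> L2 I"
        using interval_finite by (auto simp: L2_def set_borel_measurable_def set_integrable_def intro!: integrable_real_indicator)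
      have "(\<lambda>n. l2inner I (\<lambda>t. hn n (x, t)) (\<lambda>t. 1)) \<longlonglongrightarrow> l2inner I (\<lambda>t. h (x, t)) (\<lambda>t. 1)"
        by (rule tendsto_l2inner[OF L(2) L(4) one l(2)])
      moreover have "l2inner I (\<lambda>t. hn n (x, t)) (\<lambda>t. 1) = 0" for n
        using periodic_rep_iff[OF T L2_I_integrable[OF L(1)] L2_I_integrable[OF L(2)] wp(1)] wp(2) by (simp add: l2inner_def)
      ultimately have "(LINT t:I|lborel. h (x, t)) = 0" by (simp add: LIMSEQ_const_iff l2inner_def)
      then show "weak_pderiv I 1 (\<lambda>t. w (x, t)) (\<lambda>t. h (x, t)) \<and> periodic_rep T (\<lambda>t. w (x, t))"
        using wd periodic_rep_iff[OF T L2_I_integrable[OF L(3)] L2_I_integrable[OF L(4)] wd] by simp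
    qed
  qed
  then have tp: "tpair w h" using w h(1) by (simp add: tpair_def)

  have both: "AE t in lborel. t \<in> I \<longrightarrow> H10pair \<Omega> (\<lambda>x. w (x, t)) (\<lambda>x. g (x, t)) \<and>
      weak_divergence \<Omega> (\<lambda>x. \<nu> x *\<^sub>R g (x, t)) (\<lambda>x. - (s * (\<sigma> x * h (x, t))) - r (x, t))"
    using slices(4,6,8,2) L2Q_slice_t[OF w] L2Q_slice_t[OF g(1)] L2Q_slice_t[OF h(1)] L2Q_slice_t[OF r]
  proof eventually_elim
    case (elim t)
    show ?case
    proof
      assume t: "t \<in> I"
      have L: "(\<lambda>x. w (x, t)) \<in> L2 \<Omega>" "(\<lambda>x. g (x, t)) \<in> L2 \<Omega>" "(\<lambda>x. h (x, t)) \<in> L2 \<Omega>" "(\<lambda>x. r (x, t)) \<in> L2 \<Omega>"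
        and l: "(\<lambda>n. cls \<Omega> (\<lambda>x. zn n (x, t))) \<longlonglongrightarrow> cls \<Omega> (\<lambda>x. w (x, t))"
          "(\<lambda>n. cls \<Omega> (\<lambda>x. gn n (x, t))) \<longlonglongrightarrow> cls \<Omega> (\<lambda>x. g (x, t))"
          "(\<lambda>n. cls \<Omega> (\<lambda>x. hn n (x, t))) \<longlonglongrightarrow> cls \<Omega> (\<lambda>x. h (x, t))"
          "(\<lambda>n. cls \<Omega> (\<lambda>x. rn n (x, t))) \<longlonglongrightarrow> cls \<Omega> (\<lambda>x. r (x, t))"
        using elim t by auto
      note Rt = regD(6,7,8,15)[OF R]
      have zL: "(\<lambda>x. gn n (x, t)) \<in> L2 \<Omega>" "(\<lambda>x. hn n (x, t)) \<in> L2 \<Omega>" for n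
        using H10pair_L2[OF Rt(2)] H10pair_L2[OF Rt(3)] by auto
      have "(cls \<Omega> (\<lambda>x. w (x, t)), cls \<Omega> (\<lambda>x. g (x, t))) \<in> closure (test_pairs \<Omega>)"
        by (rule closed_sequentially[OF closed_closure _ tendsto_Pair[OF l(1,2)]])
           (use Rt(2) in \<open>auto simp: H10pair_def\<close>)
      then have hp: "H10pair \<Omega> (\<lambda>x. w (x, t)) (\<lambda>x. g (x, t))" using L by (simp add: H10pair_def)
      have "weak_divergence \<Omega> (\<lambda>x. \<nu> x *\<^sub>R g (x, t)) (\<lambda>x. - (s * (\<sigma> x * h (x, t))) - r (x, t))"
        unfolding weak_divergence_def
      proof
        fix \<phi> assume \<phi>: "\<phi> \<in> test_functions \<Omega>"
        note hp = H10pair_test[OF open_\<Omega> \<phi>]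
        note pL = H10pair_L2[OF hp]
        have mv: "l2inner \<Omega> (\<lambda>x. \<nu> x *\<^sub>R f x) (classical_gradient \<phi>) = l2inner \<Omega> f (\<lambda>x. \<nu> x *\<^sub>R classical_gradient \<phi> x)" for f
          by (simp add: l2inner_def)
        have ms: "l2inner \<Omega> (\<lambda>x. \<sigma> x *\<^sub>R f x) \<phi> = l2inner \<Omega> f (\<lambda>x. \<sigma> x *\<^sub>R \<phi> x)" for f
          by (simp add: l2inner_def mult_ac)
        have "(\<lambda>n. l2inner \<Omega> (\<lambda>x. gn n (x, t)) (\<lambda>x. \<nu> x *\<^sub>R classical_gradient \<phi> x) + (- s) * l2inner \<Omega> (\<lambda>x. hn n (x, t)) (\<lambda>x. \<sigma> x *\<^sub>R \<phi> x))
          \<longlonglongrightarrow> l2inner \<Omega> (\<lambda>x. g (x, t)) (\<lambda>x. \<nu> x *\<^sub>R classical_gradient \<phi> x) + (- s) * l2inner \<Omega> (\<lambda>x. h (x, t)) (\<lambda>x. \<sigma> x *\<^sub>R \<phi> x)"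
          by (intro tendsto_add tendsto_mult tendsto_const tendsto_l2inner[OF zL(1) L(2) \<nu>_L2[OF pL(2)] l(2)]
              tendsto_l2inner[OF zL(2) L(3) \<sigma>_L2[OF pL(1)] l(3)])
        moreover have "l2inner \<Omega> (\<lambda>x. gn n (x, t)) (\<lambda>x. \<nu> x *\<^sub>R classical_gradient \<phi> x) + (- s) * l2inner \<Omega> (\<lambda>x. hn n (x, t)) (\<lambda>x. \<sigma> x *\<^sub>R \<phi> x)
          = l2inner \<Omega> (\<lambda>x. rn n (x, t)) \<phi>" for n
          using Rt(4)[OF hp, of n t] unfolding mv ms .
        moreover have "(\<lambda>n. l2inner \<Omega> (\<lambda>x. rn n (x, t)) \<phi>) \<longlonglongrightarrow> l2inner \<Omega> (\<lambda>x. r (x, t)) \<phi>"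
          by (rule tendsto_l2inner[OF Rt(1) L(4) pL(1) l(4)])
        ultimately have eq: "l2inner \<Omega> (\<lambda>x. \<nu> x *\<^sub>R g (x, t)) (classical_gradient \<phi>) + (- s) * l2inner \<Omega> (\<lambda>x. \<sigma> x *\<^sub>R h (x, t)) \<phi> = l2inner \<Omega> (\<lambda>x. r (x, t)) \<phi>"
          unfolding mv ms using LIMSEQ_unique by simp
        have "l2inner \<Omega> (\<lambda>x. - (s * (\<sigma> x * h (x, t))) - r (x, t)) \<phi> = (- s) * l2inner \<Omega> (\<lambda>x. \<sigma> x *\<^sub>R h (x, t)) \<phi> + (- 1) * l2inner \<Omega> (\<lambda>x. r (x, t)) \<phi>"
          using l2inner_linear_left[OF \<sigma>_L2[OF L(3)] L(4) pL(1), of "- s" "- 1"] by simp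
        then show "(LINT x:\<Omega>|lborel. (\<nu> x *\<^sub>R g (x, t)) \<bullet> classical_gradient \<phi> x) = - (LINT x:\<Omega>|lborel. (- (s * (\<sigma> x * h (x, t))) - r (x, t)) * \<phi> x)"
          using eq by (simp add: l2inner_def)
      qed
      then show "H10pair \<Omega> (\<lambda>x. w (x, t)) (\<lambda>x. g (x, t)) \<and>
        weak_divergence \<Omega> (\<lambda>x. \<nu> x *\<^sub>R g (x, t)) (\<lambda>x. - (s * (\<sigma> x * h (x, t))) - r (x, t))" using hp by blast
    qed
  qed
  have "AE t in lborel. t \<in> I \<longrightarrow> H10pair \<Omega> (\<lambda>x. w (x, t)) (\<lambda>x. g (x, t))" using both by eventually_elim auto
  then have sp: "spair w g" using w g(1) by (simp add: spair_def)
  have "AE t in lborel. t \<in> I \<longrightarrow> weak_divergence \<Omega> (\<lambda>x. \<nu> x *\<^sub>R g (x, t)) (\<lambda>x. - (s * (\<sigma> x * h (x, t))) - r (x, t))"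
    using both by eventually_elim auto
  moreover have "(\<lambda>z. - (s * (\<sigma> (fst z) * h z)) - r z) \<in> L2 Q"
    using L2_diff[OF L2_scaleR[OF \<sigma>_L2_Q[OF h(1)], of "- s"] r] by simp
  ultimately have "dpair (\<lambda>z. \<nu> (fst z) *\<^sub>R g z) (\<lambda>z. - (s * (\<sigma> (fst z) * h z)) - r z)"
    using \<nu>_L2_Q[OF g(1)] by (simp add: dpair_def has_sdiv_def)
  then show thesis using that sp tp by blast
qed

end

section \<open>Optimal pairs\<close>

lemma l2inner_cong_AE:
  assumes "f \<in> L2 S" "f' \<in> L2 S" "g \<in> L2 S" "AE x in lborel. x \<in> S \<longrightarrow> f x = f' x"
  shows "l2inner S f g = l2inner S f' g"
  using assms cls_eq_iff[of f S f'] by (simp flip: inner_cls)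

lemma l2norm_cong_AE:
  assumes "f \<in> L2 S" "f' \<in> L2 S" "AE x in lborel. x \<in> S \<longrightarrow> f x = f' x"
  shows "l2norm S f = l2norm S f'"
  using assms cls_eq_iff[of f S f'] by (simp flip: norm_cls)

lemma l2inner_minus_right: "l2inner S f (\<lambda>x. - g x) = - l2inner S f g"
  by (simp add: l2inner_def set_lebesgue_integral_def)

lemma l2inner_scale_left: "l2inner S (\<lambda>x. c *\<^sub>R f x) g = c * l2inner S f g"
  by (simp add: l2inner_def)

lemma l2norm_mult_bounded:
  fixes m :: "'a::euclidean_space \<Rightarrow> real"
  assumes mf: "(\<lambda>x. m x *\<^sub>R f x) \<in> L2 S" and f: "f \<in> L2 S" and b: "\<And>x. x \<in> S \<Longrightarrow> \<bar>m x\<bar> \<le> M" and M: "M \<ge> 0"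
  shows "l2norm S (\<lambda>x. m x *\<^sub>R f x) \<le> M * l2norm S f"
proof -
  have "(l2norm S (\<lambda>x. m x *\<^sub>R f x))\<^sup>2 \<le> (LINT x:S|lborel. M\<^sup>2 * (norm (f x))\<^sup>2)"
    unfolding l2norm_sq
  proof (rule set_integral_mono)
    show "set_integrable lborel S (\<lambda>x. (norm (m x *\<^sub>R f x))\<^sup>2)" by (rule L2_norm_sq_integrable[OF mf])
    show "set_integrable lborel S (\<lambda>x. M\<^sup>2 * (norm (f x))\<^sup>2)" using L2_norm_sq_integrable[OF f] by simp
    show "(norm (m x *\<^sub>R f x))\<^sup>2 \<le> M\<^sup>2 * (norm (f x))\<^sup>2" if "x \<in> S" for x
      using power_mono[OF b[OF that], of 2] by (simp add: power_mult_distrib mult_right_mono)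
  qed
  also have "\<dots> = (M * l2norm S f)\<^sup>2" by (simp add: power_mult_distrib l2norm_sq)
  finally show ?thesis using M l2norm_nonneg[of S f] by (intro power2_le_imp_le[of "l2norm S (\<lambda>x. m x *\<^sub>R f x)"]) auto
qed

lemma integral_cos_int:
  fixes T :: real and n :: int
  assumes T: "T > 0"
  shows "(LINT t:{0<..<T}|lborel. cos (real_of_int n * (2 * pi / T) * t)) = (if n = 0 then T else 0)"
    "(LINT t:{0<..<T}|lborel. sin (real_of_int n * (2 * pi / T) * t)) = 0"
proof -
  define w where "w = real_of_int n * (2 * pi / T)"
  have wT: "w * T = of_int n * 2 * pi" using T by (simp add: w_def)
  have s: "sin (w * T) = 0" "cos (w * T) = 1"
    unfolding wT using sin_int_2pin[of n] cos_int_2pin[of n] by (simp_all add: mult_ac)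
  have 1: "(LINT t:{0<..<T}|lborel. cos (w * t)) = (if n = 0 then T else 0)"
  proof (cases "n = 0")
    case True
    have "(LINT t:{0<..<T}|lborel. 1) = T - 0"
      by (rule set_integral_FTC[where F = "\<lambda>t. t"]) (use T in \<open>auto intro!: derivative_eq_intros\<close>)
    then show ?thesis using True by (simp add: w_def)
  next
    case False
    then have w0: "w \<noteq> 0" using T by (simp add: w_def)
    have "(LINT t:{0<..<T}|lborel. cos (w * t)) = sin (w * T) / w - sin (w * 0) / w"
      by (rule set_integral_FTC) (use T w0 in \<open>auto intro!: derivative_eq_intros continuous_intros\<close>)
    then show ?thesis using False s by simp
  qed
  have 2: "(LINT t:{0<..<T}|lborel. sin (w * t)) = 0"
  proof (cases "n = 0")
    case True then show ?thesis by (simp add: w_def set_lebesgue_integral_def)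
  next
    case False
    then have w0: "w \<noteq> 0" using T by (simp add: w_def)
    have "(LINT t:{0<..<T}|lborel. sin (w * t)) = - cos (w * T) / w - - cos (w * 0) / w"
      by (rule set_integral_FTC) (use T w0 in \<open>auto intro!: derivative_eq_intros continuous_intros\<close>)
    then show ?thesis using s by simp
  qed
  show "(LINT t:{0<..<T}|lborel. cos (real_of_int n * (2 * pi / T) * t)) = (if n = 0 then T else 0)"
    "(LINT t:{0<..<T}|lborel. sin (real_of_int n * (2 * pi / T) * t)) = 0"
    using 1 2 by (simp_all add: w_def)
qed

lemma trig_orthogonality:
  fixes T :: real and j k :: nat
  assumes T: "T > 0" and j: "j > 0"
  defines "a \<equiv> \<lambda>k t. real k * (2 * pi / T) * t"
  shows "(LINT t:{0<..<T}|lborel. cos (a k t) * cos (a j t)) = (if k = j then T / 2 else 0)"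
    "(LINT t:{0<..<T}|lborel. sin (a k t) * cos (a j t)) = 0"
    "(LINT t:{0<..<T}|lborel. cos (a k t) * sin (a j t)) = 0"
    "(LINT t:{0<..<T}|lborel. sin (a k t) * sin (a j t)) = (if k = j then T / 2 else 0)"
proof -
  have d: "a k t - a j t = real_of_int (int k - int j) * (2 * pi / T) * t" for k j t
    by (simp add: a_def algebra_simps diff_divide_distrib)
  have p: "a k t + a j t = real_of_int (int k + int j) * (2 * pi / T) * t" for k j t
    by (simp add: a_def algebra_simps add_divide_distrib)
  have i: "set_integrable lborel {0<..<T} (\<lambda>t. cos (c * t))" "set_integrable lborel {0<..<T} (\<lambda>t. sin (c * t))" for c
    by (rule continuous_set_integrable, intro continuous_intros)+
  have i1: "set_integrable lborel {0<..<T} (\<lambda>t. cos (a k t - a j t))" "set_integrable lborel {0<..<T} (\<lambda>t. cos (a k t + a j t))"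
     "set_integrable lborel {0<..<T} (\<lambda>t. sin (a k t - a j t))" "set_integrable lborel {0<..<T} (\<lambda>t. sin (a k t + a j t))" for k j
    unfolding d p by (rule i)+
  have c: "(LINT t:{0<..<T}|lborel. cos (a k t - a j t)) = (if k = j then T else 0)" "(LINT t:{0<..<T}|lborel. sin (a k t - a j t)) = 0" for k j
    unfolding d integral_cos_int[OF T] by auto
  have s: "(LINT t:{0<..<T}|lborel. cos (a k t + a j t)) = (if k = 0 \<and> j = 0 then T else 0)" "(LINT t:{0<..<T}|lborel. sin (a k t + a j t)) = 0" for k j
    unfolding p integral_cos_int[OF T] by auto
  show "(LINT t:{0<..<T}|lborel. cos (a k t) * cos (a j t)) = (if k = j then T / 2 else 0)"
    using j i1[of k j] unfolding cos_times_cos by (simp add: c s)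
  show "(LINT t:{0<..<T}|lborel. sin (a k t) * sin (a j t)) = (if k = j then T / 2 else 0)"
    using j i1[of k j] unfolding sin_times_sin by (simp add: c s)
  show "(LINT t:{0<..<T}|lborel. sin (a k t) * cos (a j t)) = 0"
    using i1[of k j] unfolding sin_times_cos by (simp add: c s)
  show "(LINT t:{0<..<T}|lborel. cos (a k t) * sin (a j t)) = 0"
    using i1[of k j] unfolding cos_times_sin by (simp add: c s)
qed

lemma fourier_mode:
  fixes a b :: "real^'n \<Rightarrow> real"
  assumes T: "T > 0"
  shows "fst (fourier T (mode T k a b) (Suc j)) = (\<lambda>x. if k = Suc j then a x else 0)"
    "snd (fourier T (mode T k a b) (Suc j)) = (\<lambda>x. if k = Suc j then b x else 0)"
proof -
  note O = trig_orthogonality[OF T, of "Suc j" k]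
  have i: "set_integrable lborel {0<..<T} (\<lambda>t. f t * g t)" if "continuous_on UNIV f" "continuous_on UNIV g" for f g :: "real \<Rightarrow> real"
    by (rule continuous_set_integrable, rule continuous_on_subset[OF continuous_on_mult[OF that]]) simp
  let ?c = "\<lambda>k t. cos (real k * (2 * pi / T) * t)" and ?s = "\<lambda>k t. sin (real k * (2 * pi / T) * t)"
  have cc: "continuous_on UNIV (?c k)" "continuous_on UNIV (?s k)" for k by (intro continuous_intros)+
  note ii = i[OF cc(1)[of k] cc(1)[of "Suc j"]] i[OF cc(2)[of k] cc(1)[of "Suc j"]] i[OF cc(1)[of k] cc(2)[of "Suc j"]] i[OF cc(2)[of k] cc(2)[of "Suc j"]]
  have "(LINT t:{0<..<T}|lborel. mode T k a b (x, t) * ?c (Suc j) t)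
      = (LINT t:{0<..<T}|lborel. a x * (?c k t * ?c (Suc j) t) + b x * (?s k t * ?c (Suc j) t))" for x
    by (simp add: mode_def algebra_simps)
  also have "\<dots> x = a x * (if k = Suc j then T / 2 else 0)" for x
    using ii O by simp
  finally have 1: "(LINT t:{0<..<T}|lborel. mode T k a b (x, t) * ?c (Suc j) t) = a x * (if k = Suc j then T / 2 else 0)" for x .
  have "(LINT t:{0<..<T}|lborel. mode T k a b (x, t) * ?s (Suc j) t)
      = (LINT t:{0<..<T}|lborel. a x * (?c k t * ?s (Suc j) t) + b x * (?s k t * ?s (Suc j) t))" for x
    by (simp add: mode_def algebra_simps)
  also have "\<dots> x = b x * (if k = Suc j then T / 2 else 0)" for x
    using ii O by simp
  finally have 2: "(LINT t:{0<..<T}|lborel. mode T k a b (x, t) * ?s (Suc j) t) = b x * (if k = Suc j then T / 2 else 0)" for x .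
  show "fst (fourier T (mode T k a b) (Suc j)) = (\<lambda>x. if k = Suc j then a x else 0)"
    unfolding fourier_def fst_conv 1 using T by auto
  show "snd (fourier T (mode T k a b) (Suc j)) = (\<lambda>x. if k = Suc j then b x else 0)"
    unfolding fourier_def snd_conv 2 using T by auto
qed

context parabolic
begin

abbreviation fcos :: "nat \<Rightarrow> real \<Rightarrow> real" where "fcos k t \<equiv> cos (real k * (2 * pi / T) * t)"
abbreviation fsin :: "nat \<Rightarrow> real \<Rightarrow> real" where "fsin k t \<equiv> sin (real k * (2 * pi / T) * t)"

text \<open>
  The Cauchy--Schwarz inequality in time bounds the coefficient by the norm of the time line.
\<close>

lemma coefficient_L2:
  fixes e :: "real \<Rightarrow> real"
  assumes w: "w \<in> L2 Q" and e: "continuous_on UNIV e" "\<And>t. \<bar>e t\<bar> \<le> 1"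
  shows "(\<lambda>x. LINT t:I|lborel. w (x, t) * e t) \<in> L2 \<Omega>"
proof -
  have em: "e \<in> borel_measurable borel" by (rule borel_measurable_continuous_onI[OF e(1)])
  have one: "(\<lambda>x. 1::real) \<in> L2 \<Omega>"
    using \<Omega>_finite \<Omega>_borel by (auto simp: L2_def set_borel_measurable_def set_integrable_def intro!: integrable_real_indicator)
  have tens: "(\<lambda>z. e (snd z) *\<^sub>R (1::real)) \<in> L2 (\<Omega> \<times> I)"
    by (rule L2_tensor[OF one _ interval_finite em e(2) \<Omega>_borel]) simp
  have eI: "e \<in> L2 I"
  proof -
    have "(\<lambda>t. 1::real) \<in> L2 I"
      using interval_finite by (auto simp: L2_def set_borel_measurable_def set_integrable_def intro!: integrable_real_indicator)
    then have "(\<lambda>t. e t *\<^sub>R (1::real)) \<in> L2 I"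
      by (rule L2_mult_bounded[OF _ e(2), rotated 1]) (use em in \<open>auto simp: set_borel_measurable_def\<close>)
    then show ?thesis by simp
  qed
  have i: "set_integrable lborel (\<Omega> \<times> I) (\<lambda>z. w z * e (snd z))"
    using L2_inner_integrable[OF w[unfolded Q_eq] tens] by simp
  have si: "set_integrable lborel \<Omega> (\<lambda>x. LINT t:I|lborel. w (x, t) * e t)" using set_fubini_fst(2)[OF i] by simp
  then have m: "set_borel_measurable lborel \<Omega> (\<lambda>x. LINT t:I|lborel. w (x, t) * e t)"
    by (auto simp: set_integrable_def set_borel_measurable_def)
  have "integrable lborel (\<lambda>x. indicat_real \<Omega> x *\<^sub>R (norm (LINT t:I|lborel. w (x, t) * e t))\<^sup>2)"
  proof (rule Bochner_Integration.integrable_bound)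
    have "set_integrable lborel \<Omega> (\<lambda>x. (l2norm I e)\<^sup>2 * (l2norm I (\<lambda>t. w (x, t)))\<^sup>2)"
      using l2norm_sq_slices(1)[OF w[unfolded Q_eq]] by simp
    then show "integrable lborel (\<lambda>x. indicat_real \<Omega> x *\<^sub>R ((l2norm I e)\<^sup>2 * (l2norm I (\<lambda>t. w (x, t)))\<^sup>2))"
      by (simp add: set_integrable_def)
    have "(\<lambda>x. (indicat_real \<Omega> x *\<^sub>R (LINT t:I|lborel. w (x, t) * e t))\<^sup>2) \<in> borel_measurable lborel"
      using m unfolding set_borel_measurable_def by (rule borel_measurable_power)
    moreover have "(\<lambda>x. (indicat_real \<Omega> x *\<^sub>R (LINT t:I|lborel. w (x, t) * e t))\<^sup>2) = (\<lambda>x. indicat_real \<Omega> x *\<^sub>R (norm (LINT t:I|lborel. w (x, t) * e t))\<^sup>2)"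
      by (auto simp: fun_eq_iff indicator_def)
    ultimately show "(\<lambda>x. indicat_real \<Omega> x *\<^sub>R (norm (LINT t:I|lborel. w (x, t) * e t))\<^sup>2) \<in> borel_measurable lborel" by simp
    show "AE x in lborel. norm (indicat_real \<Omega> x *\<^sub>R (norm (LINT t:I|lborel. w (x, t) * e t))\<^sup>2)
        \<le> norm (indicat_real \<Omega> x *\<^sub>R ((l2norm I e)\<^sup>2 * (l2norm I (\<lambda>t. w (x, t)))\<^sup>2))"
      using L2Q_slice_x[OF w]
    proof eventually_elim
      case (elim x)
      show ?case
      proof (cases "x \<in> \<Omega>")
        case True
        have "\<bar>LINT t:I|lborel. w (x, t) * e t\<bar> \<le> l2norm I (\<lambda>t. w (x, t)) * l2norm I e"
          using l2inner_bound[OF _ eI, of "\<lambda>t. w (x, t)"] elim True by (simp add: l2inner_def)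
        then have "\<bar>LINT t:I|lborel. w (x, t) * e t\<bar>\<^sup>2 \<le> (l2norm I (\<lambda>t. w (x, t)) * l2norm I e)\<^sup>2"
          by (intro power_mono) auto
        then show ?thesis using True by (simp add: power_mult_distrib mult.commute)
      qed simp
    qed
  qed
  then show ?thesis using m by (simp add: L2_def set_integrable_def)
qed

lemma fourier_L2:
  assumes "w \<in> L2 Q"
  shows "fst (fourier T w k) \<in> L2 \<Omega>" "snd (fourier T w k) \<in> L2 \<Omega>"
proof -
  have 1: "(\<lambda>x. LINT t:I|lborel. w (x, t) * fcos k t) \<in> L2 \<Omega>" and 2: "(\<lambda>x. LINT t:I|lborel. w (x, t) * fsin k t) \<in> L2 \<Omega>"
    by (rule coefficient_L2[OF assms], intro continuous_intros, simp)+
  show "fst (fourier T w k) \<in> L2 \<Omega>" unfolding fourier_def fst_conv by (rule L2_cmult[OF 1])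
  show "snd (fourier T w k) \<in> L2 \<Omega>" unfolding fourier_def snd_conv by (rule L2_cmult[OF 2])
qed

lemma tensor_pairing:
  fixes e :: "real \<Rightarrow> real"
  assumes w: "w \<in> L2 Q" and a: "a \<in> L2 \<Omega>" and e: "continuous_on UNIV e" "\<And>t. \<bar>e t\<bar> \<le> 1"
  shows "(\<lambda>z. e (snd z) *\<^sub>R a (fst z)) \<in> L2 Q"
    "l2inner Q w (\<lambda>z. e (snd z) *\<^sub>R a (fst z)) = l2inner \<Omega> (\<lambda>x. LINT t:I|lborel. w (x, t) * e t) (a :: real^'n \<Rightarrow> real)"
proof -
  have em: "e \<in> borel_measurable borel" by (rule borel_measurable_continuous_onI[OF e(1)])
  show L: "(\<lambda>z. e (snd z) *\<^sub>R a (fst z)) \<in> L2 Q" unfolding Q_eq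
    by (rule L2_tensor[OF a _ interval_finite em e(2) \<Omega>_borel]) simp
  have i: "set_integrable lborel (\<Omega> \<times> I) (\<lambda>z. w z * (e (snd z) * a (fst z)))"
    using L2_inner_integrable[OF w L] by (simp add: Q_eq)
  have "l2inner Q w (\<lambda>z. e (snd z) *\<^sub>R a (fst z)) = (LINT x:\<Omega>|lborel. LINT t:I|lborel. w (x, t) * (e t * a x))"
    using set_fubini_fst(3)[OF i] by (simp add: l2inner_def Q_eq)
  also have "\<dots> = l2inner \<Omega> (\<lambda>x. LINT t:I|lborel. w (x, t) * e t) a"
    by (simp add: l2inner_def mult.assoc[symmetric])
  finally show "l2inner Q w (\<lambda>z. e (snd z) *\<^sub>R a (fst z)) = l2inner \<Omega> (\<lambda>x. LINT t:I|lborel. w (x, t) * e t) a" .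
qed

lemma mode_pairing:
  assumes w: "w \<in> L2 Q" and ab: "a \<in> L2 \<Omega>" "b \<in> L2 \<Omega>"
  shows "l2inner Q w (mode T k a b) = T / 2 * (l2inner \<Omega> (fst (fourier T w k)) a + l2inner \<Omega> (snd (fourier T w k)) b)"
proof -
  have c: "continuous_on UNIV (fcos k)" "continuous_on UNIV (fsin k)" by (intro continuous_intros)+
  have b: "\<And>t. \<bar>fcos k t\<bar> \<le> 1" "\<And>t. \<bar>fsin k t\<bar> \<le> 1" by simp_all
  note C = tensor_pairing[OF w ab(1) c(1) b(1)] and S = tensor_pairing[OF w ab(2) c(2) b(2)]
  have "l2inner Q w (mode T k a b) = l2inner Q w (\<lambda>z. fcos k (snd z) *\<^sub>R a (fst z)) + l2inner Q w (\<lambda>z. fsin k (snd z) *\<^sub>R b (fst z))"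
    unfolding mode_def using l2inner_linear_left[OF C(1) S(1) w, of 1 1] by (simp add: l2inner_commute[of Q w])
  also have "\<dots> = l2inner \<Omega> (\<lambda>x. LINT t:I|lborel. w (x, t) * fcos k t) a + l2inner \<Omega> (\<lambda>x. LINT t:I|lborel. w (x, t) * fsin k t) b"
    unfolding C(2) S(2) ..
  also have "\<dots> = T / 2 * (l2inner \<Omega> (fst (fourier T w k)) a + l2inner \<Omega> (snd (fourier T w k)) b)"
  proof -
    have "l2inner \<Omega> (fst (fourier T w k)) a = 2 / T * l2inner \<Omega> (\<lambda>x. LINT t:I|lborel. w (x, t) * fcos k t) a"
      unfolding fourier_def fst_conv
      using l2inner_scale_left[of \<Omega> "2 / T" "\<lambda>x. LINT t:I|lborel. w (x, t) * fcos k t" a] by (simp only: real_scaleR_def)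
    note c1 = this
    have c2: "l2inner \<Omega> (snd (fourier T w k)) b = 2 / T * l2inner \<Omega> (\<lambda>x. LINT t:I|lborel. w (x, t) * fsin k t) b"
      unfolding fourier_def snd_conv
      using l2inner_scale_left[of \<Omega> "2 / T" "\<lambda>x. LINT t:I|lborel. w (x, t) * fsin k t" b] by (simp only: real_scaleR_def)
    have "x + y = T / 2 * (2 / T * x + 2 / T * y)" for x y :: real using T by (simp add: field_simps)
    then show ?thesis unfolding c1 c2 .
  qed
  finally show ?thesis .
qed

definition mode_deriv :: "nat \<Rightarrow> (real^'n \<Rightarrow> real) \<Rightarrow> (real^'n \<Rightarrow> real) \<Rightarrow> (real^'n) \<times> real \<Rightarrow> real" where
  "mode_deriv k a b = mode T k (\<lambda>x. (real k * (2 * pi / T)) *\<^sub>R b x) (\<lambda>x. (- (real k * (2 * pi / T))) *\<^sub>R a x)"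

lemma mode_deriv_pairing:
  assumes w: "w \<in> L2 Q" and ab: "a \<in> L2 \<Omega>" "b \<in> L2 \<Omega>"
  shows "l2inner Q (\<lambda>z. \<sigma> (fst z) *\<^sub>R mode_deriv k a b z) w = T / 2 * (real k * (2 * pi / T) *
     (l2inner \<Omega> (\<lambda>x. \<sigma> x *\<^sub>R b x) (fst (fourier T w k)) - l2inner \<Omega> (\<lambda>x. \<sigma> x *\<^sub>R a x) (snd (fourier T w k))))"
proof -
  let ?w = "real k * (2 * pi / T)"
  have "(\<lambda>z. \<sigma> (fst z) *\<^sub>R mode_deriv k a b z) = mode T k (\<lambda>x. ?w *\<^sub>R (\<sigma> x *\<^sub>R b x)) (\<lambda>x. (- ?w) *\<^sub>R (\<sigma> x *\<^sub>R a x))"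
    unfolding mode_deriv_def mode_def by (simp add: fun_eq_iff algebra_simps)
  then have "l2inner Q (\<lambda>z. \<sigma> (fst z) *\<^sub>R mode_deriv k a b z) w = l2inner Q w (mode T k (\<lambda>x. ?w *\<^sub>R (\<sigma> x *\<^sub>R b x)) (\<lambda>x. (- ?w) *\<^sub>R (\<sigma> x *\<^sub>R a x)))"
    by (simp only: l2inner_commute)
  also have "\<dots> = T / 2 * (l2inner \<Omega> (fst (fourier T w k)) (\<lambda>x. ?w *\<^sub>R (\<sigma> x *\<^sub>R b x)) + l2inner \<Omega> (snd (fourier T w k)) (\<lambda>x. (- ?w) *\<^sub>R (\<sigma> x *\<^sub>R a x)))"
    by (rule mode_pairing[OF w]) (intro L2_scaleR \<sigma>_L2 ab)+
  also have "\<dots> = T / 2 * (?w * l2inner \<Omega> (\<lambda>x. \<sigma> x *\<^sub>R b x) (fst (fourier T w k)) + (- ?w) * l2inner \<Omega> (\<lambda>x. \<sigma> x *\<^sub>R a x) (snd (fourier T w k)))"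
    unfolding l2inner_commute[of \<Omega> "fst (fourier T w k)"] l2inner_commute[of \<Omega> "snd (fourier T w k)"] l2inner_scale_left ..
  finally show ?thesis by (simp add: algebra_simps)
qed

text \<open>
  The summands of the half-derivative form against the perpendicular of \<open>q\<close>, with the signs of
  \<open>fourier_perp\<close> resolved.
\<close>

definition hterm :: "((real^'n) \<times> real \<Rightarrow> real) \<Rightarrow> ((real^'n) \<times> real \<Rightarrow> real) \<Rightarrow> nat \<Rightarrow> real" where
  "hterm w q j = real (Suc j) * (2 * pi / T) *
     (l2inner \<Omega> (\<lambda>x. \<sigma> x *\<^sub>R snd (fourier T w (Suc j)) x) (fst (fourier T q (Suc j)))
      - l2inner \<Omega> (\<lambda>x. \<sigma> x *\<^sub>R fst (fourier T w (Suc j)) x) (snd (fourier T q (Suc j))))"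

lemma half_form_hterm: "half_form \<Omega> T \<sigma> (fourier T w) (fourier_perp T q) = T / 2 * (\<Sum>j. hterm w q j)"
  by (simp add: half_form_def fourier_perp_def hterm_def l2inner_minus_right algebra_simps)

lemma hterm_mode:
  assumes "k \<noteq> Suc j"
  shows "hterm (mode T k a b) q j = 0" "hterm q (mode T k a b) j = 0"
  using assms by (simp_all add: hterm_def fourier_mode[OF T] l2inner_zero_left l2inner_commute[of _ _ "\<lambda>x. 0"])

lemma suminf_single:
  fixes f :: "nat \<Rightarrow> real"
  assumes "\<And>j. k \<noteq> Suc j \<Longrightarrow> f j = 0"
  shows "summable f" "(\<Sum>j. f j) = (if k = 0 then 0 else f (k - 1))"
proof -
  have z: "f j = 0" if "j \<notin> {k - 1}" for j using assms[of j] that by auto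
  show "summable f" by (rule summable_finite[of "{k - 1}"]) (use z in auto)
  have "(\<Sum>j. f j) = f (k - 1)" using suminf_finite[of "{k - 1}" f] z by simp
  then show "(\<Sum>j. f j) = (if k = 0 then 0 else f (k - 1))" using assms[of 0] by auto
qed

text \<open>
  For a single harmonic all but one summand vanish, and the form is the integral with the full
  time derivative. The sign changes with the position of the harmonic, because the
  perpendicular pair is skew.
\<close>

lemma half_form_mode:
  assumes w: "w \<in> L2 Q" and ab: "a \<in> L2 \<Omega>" "b \<in> L2 \<Omega>"
  shows "half_form \<Omega> T \<sigma> (fourier T (mode T k a b)) (fourier_perp T w) = l2inner Q (\<lambda>z. \<sigma> (fst z) *\<^sub>R mode_deriv k a b z) w"
    "half_form \<Omega> T \<sigma> (fourier T w) (fourier_perp T (mode T k a b)) = - l2inner Q (\<lambda>z. \<sigma> (fst z) *\<^sub>R mode_deriv k a b z) w"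
proof -
  have e: "l2inner \<Omega> (\<lambda>x. \<sigma> x *\<^sub>R f x) g = l2inner \<Omega> (\<lambda>x. \<sigma> x *\<^sub>R g x) f" for f g :: "real^'n \<Rightarrow> real"
    by (simp add: l2inner_def mult_ac)
  \<comment> \<open>The summand with index \<open>j\<close> belongs to the frequency \<open>Suc j\<close>; a constant in time contributes nothing.\<close>
  have S1: "(\<Sum>j. hterm (mode T k a b) w j) = (if k = 0 then 0 else hterm (mode T k a b) w (k - 1))"
    by (rule suminf_single(2)) (rule hterm_mode(1))
  have S2: "(\<Sum>j. hterm w (mode T k a b) j) = (if k = 0 then 0 else hterm w (mode T k a b) (k - 1))"
    by (rule suminf_single(2)) (rule hterm_mode(2))
  show "half_form \<Omega> T \<sigma> (fourier T (mode T k a b)) (fourier_perp T w) = l2inner Q (\<lambda>z. \<sigma> (fst z) *\<^sub>R mode_deriv k a b z) w"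
    unfolding half_form_hterm mode_deriv_pairing[OF w ab] S1
    by (cases k) (simp_all add: hterm_def fourier_mode[OF T])
  show "half_form \<Omega> T \<sigma> (fourier T w) (fourier_perp T (mode T k a b)) = - l2inner Q (\<lambda>z. \<sigma> (fst z) *\<^sub>R mode_deriv k a b z) w"
    unfolding half_form_hterm mode_deriv_pairing[OF w ab] S2
    using e[of "fst (fourier T w k)" b] e[of "snd (fourier T w k)" a]
    by (cases k) (simp_all add: hterm_def fourier_mode[OF T] algebra_simps)
qed

lemma mode_finite_half_norm: "finite_half_norm \<Omega> T (mode T k a b)"
  unfolding finite_half_norm_def
  by (rule suminf_single(1)[of k]) (simp add: fourier_mode[OF T] l2norm_def set_lebesgue_integral_def)

lemma mode_H1half:
  assumes e: "ellip (s * (real k * (2 * pi / T))) a b zc gc zs gs"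
  shows "mode T k zc zs \<in> H1half \<Omega> T"
  using spair_has_sgrad[OF reg_spair(1)[OF mode_reg[OF e]]] regD(2)[OF mode_reg[OF e]] mode_finite_half_norm
  by (auto simp: H1half_def)

lemma grad_form:
  assumes y: "spair y g" and q: "q \<in> H1half \<Omega> T"
  shows "(LINT z:Q|lborel. \<nu> (fst z) * (sgrad \<Omega> T y z \<bullet> sgrad \<Omega> T q z)) = l2inner Q (\<lambda>z. \<nu> (fst z) *\<^sub>R g z) (sgrad \<Omega> T q)"
proof -
  have L: "g \<in> L2 Q" "sgrad \<Omega> T y \<in> L2 Q" "sgrad \<Omega> T q \<in> L2 Q"
    using y sgrad_spair[OF y] H1half_spair[OF q] by (auto simp: spair_def)
  have "l2inner Q (\<lambda>z. \<nu> (fst z) *\<^sub>R sgrad \<Omega> T y z) (sgrad \<Omega> T q) = l2inner Q (\<lambda>z. \<nu> (fst z) *\<^sub>R g z) (sgrad \<Omega> T q)"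
    by (rule l2inner_cong_AE[OF \<nu>_L2_Q[OF L(2)] \<nu>_L2_Q[OF L(1)] L(3)]) (use sgrad_AE[OF y] in eventually_elim, auto)
  then show ?thesis by (simp add: l2inner_def)
qed

lemma mode_is_state:
  assumes e: "ellip (1 * (real k * (2 * pi / T))) a b zc gc zs gs"
  shows "is_state \<Omega> T \<sigma> \<nu> (mode T k a b) (mode T k zc zs)"
  unfolding is_state_def
proof (intro conjI ballI)
  show "mode T k zc zs \<in> H1half \<Omega> T" by (rule mode_H1half[OF e])
  fix q assume q: "q \<in> H1half \<Omega> T"
  note mr = mode_reg[OF e]
  have z: "zc \<in> L2 \<Omega>" "zs \<in> L2 \<Omega>" using e H10pair_L2 unfolding ellip_def by blast+
  have qL: "q \<in> L2 Q" using q by (simp add: H1half_def)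
  show "(LINT z:Q|lborel. \<nu> (fst z) * (sgrad \<Omega> T (mode T k zc zs) z \<bullet> sgrad \<Omega> T q z))
      + half_form \<Omega> T \<sigma> (fourier T (mode T k zc zs)) (fourier_perp T q) = (LINT z:Q|lborel. mode T k a b z * q z)"
    unfolding grad_form[OF reg_spair(1)[OF mr] q] half_form_mode(1)[OF qL z]
    using reg_weak_form[OF mr H1half_spair[OF q]] by (simp add: l2inner_def mode_deriv_def)
qed

text \<open>
  The harmonic solution of the adjoint equation is admissible as a test function in the state
  equation, where the half-derivative form moves the derivative to the harmonic.
\<close>

lemma state_tested_with_mode:
  assumes st: "is_state \<Omega> T \<sigma> \<nu> u y" and u: "u \<in> L2 Q" and e: "ellip ((- 1) * (real k * (2 * pi / T))) a b zc gc zs gs"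
  shows "l2inner Q y (mode T k a b) = l2inner Q u (mode T k zc zs)"
proof -
  note mr = mode_reg[OF e] and q = mode_H1half[OF e]
  have z: "zc \<in> L2 \<Omega>" "zs \<in> L2 \<Omega>" using e H10pair_L2 unfolding ellip_def by blast+
  have y: "y \<in> H1half \<Omega> T" "y \<in> L2 Q" using st by (auto simp: is_state_def H1half_def)
  have "(LINT z:Q|lborel. \<nu> (fst z) * (sgrad \<Omega> T (mode T k zc zs) z \<bullet> sgrad \<Omega> T y z))
     + half_form \<Omega> T \<sigma> (fourier T y) (fourier_perp T (mode T k zc zs)) = l2inner Q u (mode T k zc zs)"
  proof -
    have "(LINT z:Q|lborel. \<nu> (fst z) * (sgrad \<Omega> T y z \<bullet> sgrad \<Omega> T (mode T k zc zs) z))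
       + half_form \<Omega> T \<sigma> (fourier T y) (fourier_perp T (mode T k zc zs)) = (LINT z:Q|lborel. u z * mode T k zc zs z)"
      using st q unfolding is_state_def by blast
    moreover have "(LINT z:Q|lborel. \<nu> (fst z) * (sgrad \<Omega> T y z \<bullet> sgrad \<Omega> T (mode T k zc zs) z))
      = (LINT z:Q|lborel. \<nu> (fst z) * (sgrad \<Omega> T (mode T k zc zs) z \<bullet> sgrad \<Omega> T y z))"
      by (simp add: inner_commute)
    ultimately show ?thesis by (simp add: l2inner_def)
  qed
  then show ?thesis
    unfolding grad_form[OF reg_spair(1)[OF mr] y(1)] half_form_mode(2)[OF y(2) z]
    using reg_weak_form[OF mr H1half_spair[OF y(1)]] by (simp add: l2inner_commute[of Q y] mode_deriv_def)
qed

lemma fourier_linear: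
  assumes w: "w \<in> L2 Q" "v \<in> L2 Q"
  shows "AE x in lborel. x \<in> \<Omega> \<longrightarrow> fst (fourier T (\<lambda>z. w z + c * v z) k) x = fst (fourier T w k) x + c * fst (fourier T v k) x"
    "AE x in lborel. x \<in> \<Omega> \<longrightarrow> snd (fourier T (\<lambda>z. w z + c * v z) k) x = snd (fourier T w k) x + c * snd (fourier T v k) x"
proof -
  have key: "AE x in lborel. x \<in> \<Omega> \<longrightarrow> 2 / T * (LINT t:I|lborel. (w (x, t) + c * v (x, t)) * e t)
      = 2 / T * (LINT t:I|lborel. w (x, t) * e t) + c * (2 / T * (LINT t:I|lborel. v (x, t) * e t))"
    if e: "continuous_on UNIV e" for e :: "real \<Rightarrow> real"
    using L2Q_slice_x[OF w(1)] L2Q_slice_x[OF w(2)]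
  proof eventually_elim
    case (elim x)
    show ?case
    proof
      assume x: "x \<in> \<Omega>"
      have i: "set_integrable lborel I (\<lambda>t. w (x, t) * e t)" "set_integrable lborel I (\<lambda>t. v (x, t) * e t)"
        by (rule continuous_set_integrable_mult[OF L2_I_integrable continuous_on_subset[OF e]], use elim x in auto)+
      then show "2 / T * (LINT t:I|lborel. (w (x, t) + c * v (x, t)) * e t)
        = 2 / T * (LINT t:I|lborel. w (x, t) * e t) + c * (2 / T * (LINT t:I|lborel. v (x, t) * e t))"
        by (simp add: distrib_right distrib_left mult.assoc)
    qed
  qed
  show "AE x in lborel. x \<in> \<Omega> \<longrightarrow> fst (fourier T (\<lambda>z. w z + c * v z) k) x = fst (fourier T w k) x + c * fst (fourier T v k) x"
    unfolding fourier_def fst_conv by (rule key) (intro continuous_intros)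
  show "AE x in lborel. x \<in> \<Omega> \<longrightarrow> snd (fourier T (\<lambda>z. w z + c * v z) k) x = snd (fourier T w k) x + c * snd (fourier T v k) x"
    unfolding fourier_def snd_conv by (rule key) (intro continuous_intros)
qed

text \<open>
  The value of \<open>suminf\<close> is additive only on convergent series; here the finite half norms
  dominate.
\<close>

lemma hterm_summable:
  assumes w: "w \<in> L2 Q" "finite_half_norm \<Omega> T w" and q: "q \<in> L2 Q" "finite_half_norm \<Omega> T q"
  shows "summable (hterm w q)"
proof (rule summable_comparison_test)
  let ?N = "\<lambda>w j. (l2norm \<Omega> (fst (fourier T w (Suc j))))\<^sup>2 + (l2norm \<Omega> (snd (fourier T w (Suc j))))\<^sup>2"
  have hi: "\<sigma>_hi \<ge> 0" if "x \<in> \<Omega>" for x using \<sigma>_bound[OF that] by linarith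
  show "summable (\<lambda>j. \<bar>\<sigma>_hi\<bar> * (real (Suc j) * (2 * pi / T) * ?N w j + real (Suc j) * (2 * pi / T) * ?N q j))"
    using w(2) q(2) unfolding finite_half_norm_def by (intro summable_mult summable_add)
  have b: "\<bar>l2inner \<Omega> (\<lambda>x. \<sigma> x *\<^sub>R f x) g\<bar> \<le> \<bar>\<sigma>_hi\<bar> * ((l2norm \<Omega> f)\<^sup>2 + (l2norm \<Omega> g)\<^sup>2) / 2"
    if fg: "f \<in> L2 \<Omega>" "g \<in> L2 \<Omega>" for f g :: "real^'n \<Rightarrow> real"
  proof -
    have "\<bar>l2inner \<Omega> (\<lambda>x. \<sigma> x *\<^sub>R f x) g\<bar> \<le> l2norm \<Omega> (\<lambda>x. \<sigma> x *\<^sub>R f x) * l2norm \<Omega> g"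
      by (rule l2inner_bound[OF \<sigma>_L2[OF fg(1)] fg(2)])
    also have "\<dots> \<le> (\<bar>\<sigma>_hi\<bar> * l2norm \<Omega> f) * l2norm \<Omega> g"
    proof (intro mult_right_mono l2norm_nonneg l2norm_mult_bounded[OF \<sigma>_L2[OF fg(1)] fg(1)])
      show "\<bar>\<sigma> x\<bar> \<le> \<bar>\<sigma>_hi\<bar>" if "x \<in> \<Omega>" for x using \<sigma>_bound[OF that] by linarith
    qed simp
    also have "\<dots> = \<bar>\<sigma>_hi\<bar> * (l2norm \<Omega> f * l2norm \<Omega> g)" by simp
    also have "\<dots> \<le> \<bar>\<sigma>_hi\<bar> * (((l2norm \<Omega> f)\<^sup>2 + (l2norm \<Omega> g)\<^sup>2) / 2)"
      using sum_squares_bound[of "l2norm \<Omega> f" "l2norm \<Omega> g"] by (intro mult_left_mono) auto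
    finally show ?thesis by simp
  qed
  show "\<exists>N. \<forall>n\<ge>N. norm (hterm w q n) \<le> \<bar>\<sigma>_hi\<bar> * (real (Suc n) * (2 * pi / T) * ?N w n + real (Suc n) * (2 * pi / T) * ?N q n)"
  proof (intro exI[of _ 0] allI impI)
    fix j
    let ?w = "real (Suc j) * (2 * pi / T)"
    have w0: "?w \<ge> 0" using T by simp
    let ?x = "l2inner \<Omega> (\<lambda>x. \<sigma> x *\<^sub>R snd (fourier T w (Suc j)) x) (fst (fourier T q (Suc j)))"
    let ?y = "l2inner \<Omega> (\<lambda>x. \<sigma> x *\<^sub>R fst (fourier T w (Suc j)) x) (snd (fourier T q (Suc j)))"
    have gen: "\<bar>d\<bar> \<le> K * ((C + A) + (B + D))"
      if "\<bar>x\<bar> \<le> K * (A + B) / 2" "\<bar>y\<bar> \<le> K * (C + D) / 2" "\<bar>d\<bar> \<le> \<bar>x\<bar> + \<bar>y\<bar>" for x y d K A B C D :: real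
    proof -
      define p q where "p = K * (A + B) / 2" and "q = K * (C + D) / 2"
      have "K * ((C + A) + (B + D)) = 2 * (p + q)" by (simp add: p_def q_def field_simps)
      moreover have "\<bar>x\<bar> \<le> p" "\<bar>y\<bar> \<le> q" using that(1,2) by (simp_all add: p_def q_def)
      moreover have "\<bar>d\<bar> \<le> p + q"
        by (rule order_trans[OF that(3) add_mono[OF \<open>\<bar>x\<bar> \<le> p\<close> \<open>\<bar>y\<bar> \<le> q\<close>]])
      moreover have "p + q \<le> 2 * (p + q)" using order_trans[OF abs_ge_zero that(3)] \<open>\<bar>d\<bar> \<le> p + q\<close> by simp
      ultimately show ?thesis by simp
    qed
    have "\<bar>?x - ?y\<bar> \<le> \<bar>\<sigma>_hi\<bar> * (?N w j + ?N q j)"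
      using b[OF fourier_L2(2)[OF w(1), of "Suc j"] fourier_L2(1)[OF q(1), of "Suc j"]]
        b[OF fourier_L2(1)[OF w(1), of "Suc j"] fourier_L2(2)[OF q(1), of "Suc j"]]
        abs_triangle_ineq4[of ?x ?y] gen by meson
    then have "?w * \<bar>?x - ?y\<bar> \<le> ?w * (\<bar>\<sigma>_hi\<bar> * (?N w j + ?N q j))" using w0 by (rule mult_left_mono)
    moreover have "norm (hterm w q j) = ?w * \<bar>?x - ?y\<bar>" using w0 T by (simp add: hterm_def abs_mult)
    ultimately show "norm (hterm w q j) \<le> \<bar>\<sigma>_hi\<bar> * (?w * ?N w j + ?w * ?N q j)" by (simp add: algebra_simps)
  qed
qed

text \<open>
  States depend linearly on the control. The half norm of the perturbed state stays finite
  because a harmonic changes only one pair of Fourier coefficients.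
\<close>

lemma is_state_add_mode:
  assumes st: "is_state \<Omega> T \<sigma> \<nu> u y" and u: "u \<in> L2 Q" and e: "ellip (1 * (real k * (2 * pi / T))) a b zc gc zs gs"
  shows "is_state \<Omega> T \<sigma> \<nu> (\<lambda>z. u z + c * mode T k a b z) (\<lambda>z. y z + c * mode T k zc zs z)"
  unfolding is_state_def
proof (intro conjI ballI)
  note mr = mode_reg[OF e]
  let ?f = "mode T k a b" and ?m = "mode T k zc zs" and ?v = "\<lambda>z. y z + c * mode T k zc zs z"
  have y: "y \<in> H1half \<Omega> T" "y \<in> L2 Q" "finite_half_norm \<Omega> T y" using st by (auto simp: is_state_def H1half_def)
  have m: "?m \<in> H1half \<Omega> T" "?m \<in> L2 Q" using mode_H1half[OF e] by (auto simp: H1half_def)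
  have fL: "?f \<in> L2 Q" by (rule regD(1)[OF mr])
  have vL: "?v \<in> L2 Q" by (intro L2_add y L2_cmult m)
  have sp: "spair ?v (\<lambda>z. sgrad \<Omega> T y z + c *\<^sub>R sgrad \<Omega> T ?m z)"
    using spair_linear[OF H1half_spair[OF y(1)] H1half_spair[OF m(1)], of 1 c] by simp
  have fin: "finite_half_norm \<Omega> T ?v"
  proof -
    have eq: "l2norm \<Omega> (fst (fourier T ?v (Suc j))) = l2norm \<Omega> (fst (fourier T y (Suc j)))"
      "l2norm \<Omega> (snd (fourier T ?v (Suc j))) = l2norm \<Omega> (snd (fourier T y (Suc j)))" if j: "k \<noteq> Suc j" for j
    proof -
      show "l2norm \<Omega> (fst (fourier T ?v (Suc j))) = l2norm \<Omega> (fst (fourier T y (Suc j)))"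
        using fourier_linear(1)[OF y(2) m(2), of c "Suc j"] j fourier_L2[OF vL] fourier_L2[OF y(2)]
        by (intro l2norm_cong_AE) (auto simp: fourier_mode[OF T])
      show "l2norm \<Omega> (snd (fourier T ?v (Suc j))) = l2norm \<Omega> (snd (fourier T y (Suc j)))"
        using fourier_linear(2)[OF y(2) m(2), of c "Suc j"] j fourier_L2[OF vL] fourier_L2[OF y(2)]
        by (intro l2norm_cong_AE) (auto simp: fourier_mode[OF T])
    qed
    have "eventually (\<lambda>j. k \<noteq> Suc j) sequentially"
      using eventually_ge_at_top[of k] by eventually_elim auto
    then have "eventually (\<lambda>j. real (Suc j) * (2 * pi / T) * ((l2norm \<Omega> (fst (fourier T ?v (Suc j))))\<^sup>2 + (l2norm \<Omega> (snd (fourier T ?v (Suc j))))\<^sup>2)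
      = real (Suc j) * (2 * pi / T) * ((l2norm \<Omega> (fst (fourier T y (Suc j))))\<^sup>2 + (l2norm \<Omega> (snd (fourier T y (Suc j))))\<^sup>2)) sequentially"
    proof eventually_elim
      case (elim j)
      show ?case unfolding eq[OF elim] ..
    qed
    from summable_cong[OF this] show ?thesis using y(3) unfolding finite_half_norm_def by simp
  qed
  show "?v \<in> H1half \<Omega> T" using spair_has_sgrad[OF sp] fin vL by (auto simp: H1half_def)
  fix q assume q: "q \<in> H1half \<Omega> T"
  have qL: "q \<in> L2 Q" "finite_half_norm \<Omega> T q" and qg: "sgrad \<Omega> T q \<in> L2 Q"
    using q H1half_spair[OF q] by (auto simp: H1half_def spair_def)
  have lin: "hterm ?v q j = hterm y q j + c * hterm ?m q j" for j
  proof -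
    have F: "l2inner \<Omega> (\<lambda>x. \<sigma> x *\<^sub>R F x) g = l2inner \<Omega> (\<lambda>x. \<sigma> x *\<^sub>R G x) g + c * l2inner \<Omega> (\<lambda>x. \<sigma> x *\<^sub>R H x) g"
      if L: "F \<in> L2 \<Omega>" "G \<in> L2 \<Omega>" "H \<in> L2 \<Omega>" "g \<in> L2 \<Omega>" and ae: "AE x in lborel. x \<in> \<Omega> \<longrightarrow> F x = G x + c * H x"
      for F G H g :: "real^'n \<Rightarrow> real"
    proof -
      have GH: "(\<lambda>x. G x + c * H x) \<in> L2 \<Omega>" by (intro L2_add L2_cmult L)
      have "l2inner \<Omega> (\<lambda>x. \<sigma> x *\<^sub>R F x) g = l2inner \<Omega> (\<lambda>x. \<sigma> x *\<^sub>R (G x + c * H x)) g"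
        by (rule l2inner_cong_AE[OF \<sigma>_L2[OF L(1)] \<sigma>_L2[OF GH] L(4)]) (use ae in eventually_elim, auto)
      then show ?thesis using weighted_linear_left[OF \<sigma>_L2[OF L(2)] \<sigma>_L2[OF L(3)] L(4), of 1 c] by simp
    qed
    show ?thesis
      unfolding hterm_def
        F[OF fourier_L2(2)[OF vL] fourier_L2(2)[OF y(2)] fourier_L2(2)[OF m(2)] fourier_L2(1)[OF qL(1)] fourier_linear(2)[OF y(2) m(2)]]
        F[OF fourier_L2(1)[OF vL] fourier_L2(1)[OF y(2)] fourier_L2(1)[OF m(2)] fourier_L2(2)[OF qL(1)] fourier_linear(1)[OF y(2) m(2)]]
      by (simp add: algebra_simps)
  qed
  have sy: "summable (hterm y q)" by (rule hterm_summable[OF y(2,3) qL])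
  have sm: "summable (hterm ?m q)" by (rule hterm_summable[OF m(2) mode_finite_half_norm qL])
  have "(\<Sum>j. hterm ?v q j) = (\<Sum>j. hterm y q j) + c * (\<Sum>j. hterm ?m q j)"
    unfolding lin using suminf_add[OF sy summable_mult[OF sm, of c]] suminf_mult[OF sm, of c] by simp
  then have half: "half_form \<Omega> T \<sigma> (fourier T ?v) (fourier_perp T q)
    = half_form \<Omega> T \<sigma> (fourier T y) (fourier_perp T q) + c * half_form \<Omega> T \<sigma> (fourier T ?m) (fourier_perp T q)"
    unfolding half_form_hterm by (simp add: algebra_simps)
  have G: "sgrad \<Omega> T y \<in> L2 Q" "sgrad \<Omega> T ?m \<in> L2 Q" using H1half_spair[OF y(1)] H1half_spair[OF m(1)] by (auto simp: spair_def)
  have grad: "l2inner Q (\<lambda>z. \<nu> (fst z) *\<^sub>R (sgrad \<Omega> T y z + c *\<^sub>R sgrad \<Omega> T ?m z)) (sgrad \<Omega> T q)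
    = l2inner Q (\<lambda>z. \<nu> (fst z) *\<^sub>R sgrad \<Omega> T y z) (sgrad \<Omega> T q) + c * l2inner Q (\<lambda>z. \<nu> (fst z) *\<^sub>R sgrad \<Omega> T ?m z) (sgrad \<Omega> T q)"
    using weighted_linear_left[OF \<nu>_L2_Q[OF G(1)] \<nu>_L2_Q[OF G(2)] qg, of 1 c] by simp
  have E1: "l2inner Q (\<lambda>z. \<nu> (fst z) *\<^sub>R sgrad \<Omega> T y z) (sgrad \<Omega> T q) + half_form \<Omega> T \<sigma> (fourier T y) (fourier_perp T q) = l2inner Q u q"
    using st q by (simp add: is_state_def l2inner_def)
  have E2: "l2inner Q (\<lambda>z. \<nu> (fst z) *\<^sub>R sgrad \<Omega> T ?m z) (sgrad \<Omega> T q) + half_form \<Omega> T \<sigma> (fourier T ?m) (fourier_perp T q) = l2inner Q ?f q"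
    using mode_is_state[OF e] q by (simp add: is_state_def l2inner_def)
  have R: "l2inner Q (\<lambda>z. u z + c * ?f z) q = l2inner Q u q + c * l2inner Q ?f q"
    using l2inner_linear_left[OF u fL qL(1), of 1 c] by simp
  show "(LINT z:Q|lborel. \<nu> (fst z) * (sgrad \<Omega> T ?v z \<bullet> sgrad \<Omega> T q z)) + half_form \<Omega> T \<sigma> (fourier T ?v) (fourier_perp T q)
    = (LINT z:Q|lborel. (u z + c * ?f z) * q z)"
  proof -
    have "l2inner Q (\<lambda>z. u z + c * ?f z) q = (LINT z:Q|lborel. (u z + c * ?f z) * q z)" by (simp add: l2inner_def)
    moreover have "c * l2inner Q (\<lambda>z. \<nu> (fst z) *\<^sub>R sgrad \<Omega> T ?m z) (sgrad \<Omega> T q)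
        + c * half_form \<Omega> T \<sigma> (fourier T ?m) (fourier_perp T q) = c * l2inner Q ?f q"
      using E2 by (simp flip: distrib_left)
    ultimately show ?thesis unfolding grad_form[OF sp q] grad half using E1 R by linarith
  qed
qed

text \<open>
  The cost along the line from \<open>u\<close> in direction of a harmonic is a parabola with its minimum at
  \<open>u\<close>.
\<close>

lemma first_order_condition:
  assumes opt: "optimal_pair \<Omega> T \<sigma> \<nu> lam y\<^sub>d u y" and yd: "y\<^sub>d \<in> L2 Q"
    and e: "ellip (1 * (real k * (2 * pi / T))) a b zc gc zs gs"
  shows "l2inner Q (\<lambda>z. y z - y\<^sub>d z) (mode T k zc zs) + lam * l2inner Q u (mode T k a b) = 0"
proof (rule linear_term_zero_of_quadratic_nonneg)
  fix c :: real
  let ?f = "mode T k a b" and ?m = "mode T k zc zs"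
  have u: "u \<in> L2 Q" and st: "is_state \<Omega> T \<sigma> \<nu> u y" using opt by (auto simp: optimal_pair_def)
  have y: "y \<in> L2 Q" using st by (simp add: is_state_def H1half_def)
  have L: "?f \<in> L2 Q" "?m \<in> L2 Q" using regD(1,2)[OF mode_reg[OF e]] by auto
  have yy: "(\<lambda>z. y z - y\<^sub>d z) \<in> L2 Q" by (rule L2_diff[OF y yd])
  have sq: "(l2norm Q (\<lambda>z. w z + c * v z))\<^sup>2 = (l2norm Q w)\<^sup>2 + 2 * c * l2inner Q w v + c\<^sup>2 * (l2norm Q v)\<^sup>2"
    if wv: "w \<in> L2 Q" "v \<in> L2 Q" for w v :: "(real^'n) \<times> real \<Rightarrow> real"
  proof -
    have eq: "cls Q (\<lambda>z. w z + c * v z) = cls Q w + c *\<^sub>R cls Q v"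
      using cls_add[OF wv(1) L2_cmult[OF wv(2), of c]] cls_scaleR[OF wv(2), of c] by simp
    have "(norm (x + c *\<^sub>R v))\<^sup>2 = (norm x)\<^sup>2 + 2 * c * (x \<bullet> v) + c\<^sup>2 * (norm v)\<^sup>2" for x v :: "((real^'n) \<times> real, real) l2"
      unfolding power2_norm_eq_inner
      by (simp add: inner_add_left inner_add_right inner_commute power2_eq_square algebra_simps)
    note expand = this
    have n: "l2norm Q (\<lambda>z. w z + c * v z) = norm (cls Q w + c *\<^sub>R cls Q v)"
      using norm_cls[OF L2_add[OF wv(1) L2_cmult[OF wv(2), of c]]] eq by simp
    show ?thesis unfolding n expand norm_cls[OF wv(1)] norm_cls[OF wv(2)] inner_cls[OF wv] ..
  qed
  have "cost \<Omega> T lam y\<^sub>d y u \<le> cost \<Omega> T lam y\<^sub>d (\<lambda>z. y z + c * ?m z) (\<lambda>z. u z + c * ?f z)"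
    using opt is_state_add_mode[OF st u e, of c] L2_add[OF u L2_cmult[OF L(1), of c]]
    unfolding optimal_pair_def by blast
  moreover have "(\<lambda>z. y z + c * ?m z - y\<^sub>d z) = (\<lambda>z. (y z - y\<^sub>d z) + c * ?m z)" by (simp add: algebra_simps)
  ultimately have main: "1 / 2 * (l2norm Q (\<lambda>z. y z - y\<^sub>d z))\<^sup>2 + lam / 2 * (l2norm Q u)\<^sup>2
     \<le> 1 / 2 * ((l2norm Q (\<lambda>z. y z - y\<^sub>d z))\<^sup>2 + 2 * c * l2inner Q (\<lambda>z. y z - y\<^sub>d z) ?m + c\<^sup>2 * (l2norm Q ?m)\<^sup>2)
      + lam / 2 * ((l2norm Q u)\<^sup>2 + 2 * c * l2inner Q u ?f + c\<^sup>2 * (l2norm Q ?f)\<^sup>2)"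
    unfolding cost_def by (simp only: sq[OF yy L(2)] sq[OF u L(1)])
  have gen: "0 \<le> c * (P + lam * R) + c\<^sup>2 * (1 / 2 * M + lam / 2 * F)"
    if "1 / 2 * N + lam / 2 * U \<le> 1 / 2 * (N + 2 * c * P + c\<^sup>2 * M) + lam / 2 * (U + 2 * c * R + c\<^sup>2 * F)" for N U P M R F :: real
    using that by (simp add: algebra_simps)
  show "0 \<le> c * (l2inner Q (\<lambda>z. y z - y\<^sub>d z) ?m + lam * l2inner Q u ?f)
      + c\<^sup>2 * (1 / 2 * (l2norm Q ?m)\<^sup>2 + lam / 2 * (l2norm Q ?f)\<^sup>2)"
    by (rule gen[OF main])
qed

text \<open>
  The state is tested with solutions of the adjoint equation, the multiple \<open>- lam * u\<close> of the
  control with solutions of the state equation; hence the signs \<open>- 1\<close> and \<open>1\<close> in the two uses of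
  the regularity theorem.
\<close>

theorem optimal_pair_regularity:
  assumes opt: "optimal_pair \<Omega> T \<sigma> \<nu> lam y\<^sub>d u y" and yd: "y\<^sub>d \<in> L2 Q"
  obtains g h g' h' where "spair y g" "tpair y h" "dpair (\<lambda>z. \<nu> (fst z) *\<^sub>R g z) (\<lambda>z. \<sigma> (fst z) * h z - u z)"
    "spair (\<lambda>z. - lam * u z) g'" "tpair (\<lambda>z. - lam * u z) h'"
    "dpair (\<lambda>z. \<nu> (fst z) *\<^sub>R g' z) (\<lambda>z. - (\<sigma> (fst z) * h' z) - (y z - y\<^sub>d z))"
proof -
  have u: "u \<in> L2 Q" and st: "is_state \<Omega> T \<sigma> \<nu> u y" using opt by (auto simp: optimal_pair_def)
  have y: "y \<in> L2 Q" using st by (simp add: is_state_def H1half_def)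
  have yy: "(\<lambda>z. y z - y\<^sub>d z) \<in> L2 Q" by (rule L2_diff[OF y yd])
  have s: "(- 1) * (- 1) = (1::real)" "1 * 1 = (1::real)" by simp_all
  obtain g h where 1: "spair y g" "tpair y h" "dpair (\<lambda>z. \<nu> (fst z) *\<^sub>R g z) (\<lambda>z. - ((- 1) * (\<sigma> (fst z) * h z)) - u z)"
  proof (rule very_weak_regularity[OF s(1) y u])
    show "l2inner Q y (mode T k a b) = l2inner Q u (mode T k zc zs)"
      if e: "ellip (- 1 * (real k * (2 * pi / T))) a b zc gc zs gs" for k a b zc gc zs gs
      by (rule state_tested_with_mode[OF st u e])
  qed (rule that)
  have dual: "l2inner Q (\<lambda>z. - lam * u z) (mode T k a b) = l2inner Q (\<lambda>z. y z - y\<^sub>d z) (mode T k zc zs)"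
    if "ellip (1 * (real k * (2 * pi / T))) a b zc gc zs gs" for k a b zc gc zs gs
    using first_order_condition[OF opt yd that] l2inner_scale_left[of Q "- lam" u "mode T k a b"] by simp
  obtain g' h' where 2: "spair (\<lambda>z. - lam * u z) g'" "tpair (\<lambda>z. - lam * u z) h'"
     "dpair (\<lambda>z. \<nu> (fst z) *\<^sub>R g' z) (\<lambda>z. - (1 * (\<sigma> (fst z) * h' z)) - (y z - y\<^sub>d z))"
  proof (rule very_weak_regularity[OF s(2) L2_cmult[OF u] yy])
    show "l2inner Q (\<lambda>z. - lam * u z) (mode T k a b) = l2inner Q (\<lambda>z. y z - y\<^sub>d z) (mode T k zc zs)"
      if e: "ellip (1 * (real k * (2 * pi / T))) a b zc gc zs gs" for k a b zc gc zs gs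
      by (rule dual[OF e])
  qed (rule that)
  show thesis using that[of g h g' h'] 1 2 by simp
qed

end

section \<open>The minorant\<close>

text \<open>
  The estimate in two abstract inner product spaces, for scalar functions and for vector
  fields. The vectors \<open>S\<close>, \<open>N\<close>, \<open>g\<close> and \<open>d\<close> with an index stand for \<open>\<sigma> \<partial>\<^sub>t\<close>, \<open>\<nu>\<nabla>\<close>, \<open>\<nabla>\<close> and \<open>div\<close> of the
  indexed function, and the hypotheses list the integral identities between them. Here \<open>p\<close> is
  \<open>- lam\<close> times the control.
\<close>

lemma minorant_le_cost_algebra:
  fixes \<eta> \<zeta> p y y\<^sub>d S\<eta> S\<zeta> Sy d\<tau> d\<rho> :: "'x::real_inner" and g\<eta> g\<zeta> gy N\<eta> N\<zeta> Ny \<tau> \<rho> :: "'y::real_inner"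
    and C lam \<mu> \<nu>_lo :: real
  defines "e \<equiv> \<eta> - y" and "\<gamma> \<equiv> g\<eta> - gy"
  defines "A \<equiv> C * norm (S\<eta> - d\<tau> + (1 / lam) *\<^sub>R \<zeta>) + norm (\<tau> - N\<eta>)"
    and "B \<equiv> C * norm (\<eta> - y\<^sub>d + d\<rho> + S\<zeta>) + norm (\<rho> - N\<zeta>)"
  assumes pos: "lam > 0" "C > 0" "0 < \<mu>" "\<mu> \<le> \<nu>_lo"
    and \<tau>: "\<tau> \<bullet> \<gamma> + d\<tau> \<bullet> e = 0" and \<rho>: "\<rho> \<bullet> \<gamma> + d\<rho> \<bullet> e = 0"
    and state: "Ny \<bullet> g\<zeta> + Sy \<bullet> \<zeta> = - (1 / lam) * (p \<bullet> \<zeta>)" "Ny \<bullet> \<gamma> + Sy \<bullet> e = - (1 / lam) * (p \<bullet> e)"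
    and sym: "(N\<eta> - Ny) \<bullet> g\<zeta> = N\<zeta> \<bullet> \<gamma>"
    and skew: "(S\<eta> - Sy) \<bullet> \<zeta> + S\<zeta> \<bullet> e = 0" and energy: "(S\<eta> - Sy) \<bullet> e = 0"
    and coercive: "\<nu>_lo * (norm \<gamma>)\<^sup>2 \<le> (N\<eta> - Ny) \<bullet> \<gamma>" and friedrichs: "norm e \<le> C * norm \<gamma>"
  shows "1 / 2 * (norm (\<eta> - y\<^sub>d))\<^sup>2 + 1 / (2 * lam) * (norm \<zeta>)\<^sup>2 - (N\<eta> \<bullet> g\<zeta> + S\<eta> \<bullet> \<zeta> + 1 / lam * (norm \<zeta>)\<^sup>2)
      - C\<^sup>2 / (\<mu>\<^sup>2 * lam) * B\<^sup>2 - 1 / \<mu> * A * B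
    \<le> 1 / 2 * (norm (y - y\<^sub>d))\<^sup>2 + 1 / (2 * lam) * (norm p)\<^sup>2" (is "?main - _ - _ \<le> ?cost")
proof -
  define G s where "G = norm \<gamma>" and "s = norm (\<zeta> - p)"
  define R1 R2 R3 R4 where R: "R1 = S\<eta> - d\<tau> + (1 / lam) *\<^sub>R \<zeta>" "R2 = \<tau> - N\<eta>" "R3 = \<eta> - y\<^sub>d + d\<rho> + S\<zeta>" "R4 = \<rho> - N\<zeta>"
  have nn: "A \<ge> 0" "B \<ge> 0" "G \<ge> 0" "s \<ge> 0" using pos by (auto simp: A_def B_def G_def s_def)
  \<comment> \<open>A pair of residuals tested with \<open>e\<close> and its gradient.\<close>
  have test: "\<bar>a \<bullet> e\<bar> + \<bar>b \<bullet> \<gamma>\<bar> \<le> (C * norm a + norm b) * G" for a :: 'x and b :: 'y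
  proof -
    have "\<bar>a \<bullet> e\<bar> \<le> norm a * norm e" "\<bar>b \<bullet> \<gamma>\<bar> \<le> norm b * G" unfolding G_def by (rule Cauchy_Schwarz_ineq2)+
    moreover have "norm a * norm e \<le> norm a * (C * G)" using friedrichs by (intro mult_left_mono) (auto simp: G_def)
    ultimately show ?thesis by (simp add: algebra_simps)
  qed
  \<comment> \<open>The defect of the adjoint equation, in terms of its residuals \<open>R3\<close> and \<open>R4\<close>.\<close>
  have defect: "?main - ?cost = (R3 \<bullet> e + R4 \<bullet> \<gamma>) - 1 / 2 * (norm e)\<^sup>2 - 1 / (2 * lam) * s\<^sup>2"
  proof -
    have n: "(norm (\<eta> - y\<^sub>d))\<^sup>2 = (norm (y - y\<^sub>d))\<^sup>2 + 2 * ((\<eta> - y\<^sub>d) \<bullet> e) - (norm e)\<^sup>2"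
      unfolding e_def power2_norm_eq_inner by (simp add: inner_diff_left inner_diff_right inner_commute)
    have l: "1 / (2 * lam) * (norm \<zeta>)\<^sup>2 - 1 / lam * (norm \<zeta>)\<^sup>2 = 1 / (2 * lam) * (norm p)\<^sup>2 - 1 / (2 * lam) * s\<^sup>2 - 1 / lam * (p \<bullet> \<zeta>)"
      unfolding s_def power2_norm_eq_inner using pos(1) by (simp add: inner_diff_left inner_diff_right inner_commute field_simps)
    have "R3 \<bullet> e + R4 \<bullet> \<gamma> = (\<eta> - y\<^sub>d) \<bullet> e + S\<zeta> \<bullet> e - N\<zeta> \<bullet> \<gamma>"
      using \<rho> unfolding R by (simp add: inner_diff_left inner_add_left)
    moreover have "N\<eta> \<bullet> g\<zeta> + S\<eta> \<bullet> \<zeta> = N\<zeta> \<bullet> \<gamma> - S\<zeta> \<bullet> e - 1 / lam * (p \<bullet> \<zeta>)"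
      using sym skew state(1) by (simp add: inner_diff_left)
    ultimately show ?thesis using n l by argo
  qed
  have F: "R3 \<bullet> e + R4 \<bullet> \<gamma> \<le> B * G"
    using test[of R3 R4] unfolding B_def R[symmetric] by linarith
  \<comment> \<open>The state equation for the error \<open>e\<close>, in terms of its residuals \<open>R1\<close> and \<open>R2\<close>.\<close>
  have "(N\<eta> - Ny) \<bullet> \<gamma> = (R1 - (1 / lam) *\<^sub>R (\<zeta> - p)) \<bullet> e - R2 \<bullet> \<gamma>"
    using \<tau> state(2) energy unfolding R by (simp add: inner_diff_left inner_add_left algebra_simps)
  also have "\<dots> = R1 \<bullet> e - R2 \<bullet> \<gamma> - (1 / lam) * ((\<zeta> - p) \<bullet> e)" by (simp add: inner_diff_left)
  also have "\<dots> \<le> A * G + (1 / lam) * (C * s * G)"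
  proof -
    have "\<bar>(\<zeta> - p) \<bullet> e\<bar> \<le> C * s * G" using test[of "\<zeta> - p" 0] by (simp add: s_def)
    then have "- ((\<zeta> - p) \<bullet> e) \<le> C * s * G" by linarith
    then have "(1 / lam) * (- ((\<zeta> - p) \<bullet> e)) \<le> (1 / lam) * (C * s * G)" using pos by (intro mult_left_mono) auto
    then show ?thesis using test[of R1 R2] unfolding A_def R[symmetric] by (simp add: abs_le_iff)
  qed
  finally have "\<nu>_lo * G\<^sup>2 \<le> (A + C * s / lam) * G" using coercive unfolding G_def by (simp add: algebra_simps)
  then have "(\<nu>_lo * G) * G \<le> (A + C * s / lam) * G" by (simp add: power2_eq_square mult.assoc)
  moreover have "0 \<le> A + C * s / lam" using nn pos by simp
  ultimately have "\<nu>_lo * G \<le> A + C * s / lam"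
    using nn(3) by (cases "G = 0") (auto dest: mult_right_le_imp_le)
  moreover have "\<mu> * G \<le> \<nu>_lo * G" using pos nn by (intro mult_right_mono) auto
  ultimately have "G * \<mu> \<le> A + C * s / lam" by (simp add: mult.commute)
  then have "G \<le> (A + C * s / lam) / \<mu>" using pos(3) by (simp only: pos_le_divide_eq)
  then have BG: "B * G \<le> B * ((A + C * s / lam) / \<mu>)" using nn by (intro mult_left_mono) auto
  \<comment> \<open>Completing the square in \<open>s\<close>: this is Young's inequality for \<open>C B s / \<mu>\<close>.\<close>
  have young: "B * ((A + C * s / lam) / \<mu>) = 1 / \<mu> * A * B + 1 / (2 * lam) * (C\<^sup>2 * B\<^sup>2 / \<mu>\<^sup>2 + s\<^sup>2 - (C * B / \<mu> - s)\<^sup>2)"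
    using pos by (simp add: power2_eq_square field_simps)
  have "1 / (2 * lam) * (C\<^sup>2 * B\<^sup>2 / \<mu>\<^sup>2 + s\<^sup>2 - (C * B / \<mu> - s)\<^sup>2) \<le> 1 / (2 * lam) * (2 * (C\<^sup>2 * B\<^sup>2 / \<mu>\<^sup>2) + s\<^sup>2)"
  proof (rule mult_left_mono)
    have "0 \<le> (C * B / \<mu> - s)\<^sup>2" "0 \<le> C\<^sup>2 * B\<^sup>2 / \<mu>\<^sup>2" by simp_all
    then show "C\<^sup>2 * B\<^sup>2 / \<mu>\<^sup>2 + s\<^sup>2 - (C * B / \<mu> - s)\<^sup>2 \<le> 2 * (C\<^sup>2 * B\<^sup>2 / \<mu>\<^sup>2) + s\<^sup>2" by linarith
  qed (use pos in simp)
  also have "\<dots> = C\<^sup>2 / (\<mu>\<^sup>2 * lam) * B\<^sup>2 + 1 / (2 * lam) * s\<^sup>2" using pos by (simp add: field_simps)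
  finally have "B * G \<le> 1 / \<mu> * A * B + C\<^sup>2 / (\<mu>\<^sup>2 * lam) * B\<^sup>2 + 1 / (2 * lam) * s\<^sup>2" using BG young by linarith
  moreover have "0 \<le> 1 / 2 * (norm e)\<^sup>2" by simp
  ultimately show ?thesis using defect F by linarith
qed

context parabolic begin

text \<open>
  The integral in the minorant, split into inner products that bilinear algebra can handle.
\<close>

lemma minorant_integral_eq:
  assumes H: "\<eta> \<in> H11 \<Omega> T" "\<zeta> \<in> H11 \<Omega> T"
  shows "(LINT z:Q|lborel. \<nu> (fst z) * (sgrad \<Omega> T \<eta> z \<bullet> sgrad \<Omega> T \<zeta> z)
              + \<sigma> (fst z) * tderiv \<Omega> T \<eta> z * \<zeta> z + 1 / lam * (\<zeta> z)\<^sup>2)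
    = l2inner Q (\<lambda>z. \<nu> (fst z) *\<^sub>R sgrad \<Omega> T \<eta> z) (sgrad \<Omega> T \<zeta>)
      + l2inner Q (\<lambda>z. \<sigma> (fst z) *\<^sub>R tderiv \<Omega> T \<eta> z) \<zeta> + 1 / lam * (l2norm Q \<zeta>)\<^sup>2"
proof -
  have L: "sgrad \<Omega> T \<eta> \<in> L2 Q" "sgrad \<Omega> T \<zeta> \<in> L2 Q" "tderiv \<Omega> T \<eta> \<in> L2 Q" "\<zeta> \<in> L2 Q"
    using H11_pairs[OF H(1)] H11_pairs[OF H(2)] by (auto simp: spair_def tpair_def)
  note i = L2_inner_integrable[OF \<nu>_L2_Q[OF L(1)] L(2)] L2_inner_integrable[OF \<sigma>_L2_Q[OF L(3)] L(4)]
    L2_inner_integrable[OF L2_scaleR[OF L(4), of "1 / lam"] L(4)]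
  have "(LINT z:Q|lborel. \<nu> (fst z) * (sgrad \<Omega> T \<eta> z \<bullet> sgrad \<Omega> T \<zeta> z)
              + \<sigma> (fst z) * tderiv \<Omega> T \<eta> z * \<zeta> z + 1 / lam * (\<zeta> z)\<^sup>2)
    = (LINT z:Q|lborel. (\<nu> (fst z) *\<^sub>R sgrad \<Omega> T \<eta> z) \<bullet> sgrad \<Omega> T \<zeta> z + (\<sigma> (fst z) *\<^sub>R tderiv \<Omega> T \<eta> z) \<bullet> \<zeta> z + ((1 / lam) *\<^sub>R \<zeta> z) \<bullet> \<zeta> z)"
    by (simp add: power2_eq_square)
  also have "\<dots> = l2inner Q (\<lambda>z. \<nu> (fst z) *\<^sub>R sgrad \<Omega> T \<eta> z) (sgrad \<Omega> T \<zeta>)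
      + l2inner Q (\<lambda>z. \<sigma> (fst z) *\<^sub>R tderiv \<Omega> T \<eta> z) \<zeta> + l2inner Q (\<lambda>z. (1 / lam) *\<^sub>R \<zeta> z) \<zeta>"
    unfolding l2inner_def using i by (subst set_integral_add; (intro set_integral_add)?; simp)+
  finally show ?thesis unfolding l2inner_scale_left l2inner_self .
qed

lemma inner_cls_weight_sym:
  assumes "(\<lambda>z. m z *\<^sub>R f z) \<in> L2 S" "(\<lambda>z. m z *\<^sub>R g z) \<in> L2 S" "f \<in> L2 S" "g \<in> L2 S"
  shows "cls S (\<lambda>z. m z *\<^sub>R f z) \<bullet> cls S g = cls S (\<lambda>z. m z *\<^sub>R g z) \<bullet> cls S f"
  using assms by (simp add: inner_cls) (simp add: l2inner_def inner_commute)

text \<open>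
  The abstract estimate applied to classes of functions. Testing the state equation with \<open>\<zeta>\<close> and
  with \<open>e\<close> is the divergence theorem for the flux of the state, which uses that \<open>y\<close> is regular.
\<close>

lemma minorant_le_cost:
  assumes lam: "lam > 0" and \<mu>: "0 < \<mu>" "\<mu> \<le> \<nu>_lo" and yd: "y\<^sub>d \<in> L2 Q" and u: "u \<in> L2 Q"
    and y: "spair y g" "tpair y h" "dpair (\<lambda>z. \<nu> (fst z) *\<^sub>R g z) (\<lambda>z. \<sigma> (fst z) * h z - u z)"
    and H: "\<eta> \<in> H11 \<Omega> T" "\<zeta> \<in> H11 \<Omega> T" "\<tau> \<in> Hdiv \<Omega> T" "\<rho> \<in> Hdiv \<Omega> T"
  shows "minorant \<Omega> T \<sigma> \<nu> lam y\<^sub>d C \<mu> \<eta> \<zeta> \<tau> \<rho> \<le> cost \<Omega> T lam y\<^sub>d y u"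
proof -
  let ?c = "cls Q" and ?g\<eta> = "sgrad \<Omega> T \<eta>" and ?g\<zeta> = "sgrad \<Omega> T \<zeta>" and ?h\<eta> = "tderiv \<Omega> T \<eta>" and ?h\<zeta> = "tderiv \<Omega> T \<zeta>"
    and ?d\<tau> = "sdiv \<Omega> T \<tau>" and ?d\<rho> = "sdiv \<Omega> T \<rho>" and ?c' = "cls Q"
  let ?S = "\<lambda>f z. \<sigma> (fst z) *\<^sub>R f z" and ?N = "\<lambda>f z. \<nu> (fst z) *\<^sub>R f z"
  note p\<eta> = H11_pairs[OF H(1)] and p\<zeta> = H11_pairs[OF H(2)]
  note d\<tau> = Hdiv_dpair[OF H(3)] and d\<rho> = Hdiv_dpair[OF H(4)]
  have L: "\<eta> \<in> L2 Q" "\<zeta> \<in> L2 Q" "?g\<eta> \<in> L2 Q" "?g\<zeta> \<in> L2 Q" "?h\<eta> \<in> L2 Q" "?h\<zeta> \<in> L2 Q" "\<tau> \<in> L2 Q" "\<rho> \<in> L2 Q"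
    "?d\<tau> \<in> L2 Q" "?d\<rho> \<in> L2 Q" "y \<in> L2 Q" "g \<in> L2 Q" "h \<in> L2 Q"
    using p\<eta> p\<zeta> d\<tau> d\<rho> y by (auto simp: spair_def tpair_def dpair_def has_sdiv_def)
  note W = \<sigma>_L2_Q[OF L(5)] \<sigma>_L2_Q[OF L(6)] \<sigma>_L2_Q[OF L(13)] \<nu>_L2_Q[OF L(3)] \<nu>_L2_Q[OF L(4)] \<nu>_L2_Q[OF L(12)]
  note LW = L W yd u
  let ?e = "\<lambda>z. \<eta> z - y z" and ?\<gamma> = "\<lambda>z. ?g\<eta> z - g z" and ?k = "\<lambda>z. ?h\<eta> z - h z"
  have es: "spair ?e ?\<gamma>" "tpair ?e ?k"
    using spair_linear[OF p\<eta>(1) y(1), of 1 "-1"] tpair_linear[OF p\<eta>(2) y(2), of 1 "-1"] by simp_all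
  have Le: "?e \<in> L2 Q" "?\<gamma> \<in> L2 Q" "?k \<in> L2 Q" using es by (auto simp: spair_def tpair_def)
  have e: "?c ?e = ?c \<eta> - ?c y" "?c' ?\<gamma> = ?c' ?g\<eta> - ?c' g" by (simp_all add: cls_diff L)
  have Sk: "?c (?S ?k) = ?c (?S ?h\<eta>) - ?c (?S h)"
    using cls_diff[OF W(1) W(3)] by (simp add: scaleR_diff_right right_diff_distrib)
  have N\<gamma>: "?c' (?N ?\<gamma>) = ?c' (?N ?g\<eta>) - ?c' (?N g)"
    using cls_diff[OF W(4) W(6)] by (simp add: scaleR_diff_right)
  have state: "?c' (?N g) \<bullet> ?c' \<gamma> + ?c (?S h) \<bullet> ?c q = - (1 / lam) * (?c (\<lambda>z. - lam * u z) \<bullet> ?c q)"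
    if q: "spair q \<gamma>" for q \<gamma>
  proof -
    have q': "q \<in> L2 Q" "\<gamma> \<in> L2 Q" using q by (auto simp: spair_def)
    have "?c (\<lambda>z. \<sigma> (fst z) * h z - u z) = ?c (?S h) - ?c u" using cls_diff[OF W(3) u] by simp
    moreover have "?c (\<lambda>z. - lam * u z) = - lam *\<^sub>R ?c u" using cls_scaleR[OF u, of "- lam"] by simp
    moreover have "(\<lambda>z. \<sigma> (fst z) * h z - u z) \<in> L2 Q" using L2_diff[OF W(3) u] by simp
    ultimately show ?thesis
      using divergence_theorem[OF y(3) q] inner_cls[OF W(6) q'(2)] inner_cls[OF _ q'(1), of "\<lambda>z. \<sigma> (fst z) * h z - u z"] lam
      by (simp add: inner_diff_left)
  qed
  have "1 / 2 * (norm (?c \<eta> - ?c y\<^sub>d))\<^sup>2 + 1 / (2 * lam) * (norm (?c \<zeta>))\<^sup>2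
      - (?c' (?N ?g\<eta>) \<bullet> ?c' ?g\<zeta> + ?c (?S ?h\<eta>) \<bullet> ?c \<zeta> + 1 / lam * (norm (?c \<zeta>))\<^sup>2)
      - C\<^sup>2 / (\<mu>\<^sup>2 * lam) * (C * norm (?c \<eta> - ?c y\<^sub>d + ?c ?d\<rho> + ?c (?S ?h\<zeta>)) + norm (?c' \<rho> - ?c' (?N ?g\<zeta>)))\<^sup>2
      - 1 / \<mu> * (C * norm (?c (?S ?h\<eta>) - ?c ?d\<tau> + (1 / lam) *\<^sub>R ?c \<zeta>) + norm (?c' \<tau> - ?c' (?N ?g\<eta>)))
        * (C * norm (?c \<eta> - ?c y\<^sub>d + ?c ?d\<rho> + ?c (?S ?h\<zeta>)) + norm (?c' \<rho> - ?c' (?N ?g\<zeta>)))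
    \<le> 1 / 2 * (norm (?c y - ?c y\<^sub>d))\<^sup>2 + 1 / (2 * lam) * (norm (?c (\<lambda>z. - lam * u z)))\<^sup>2"
  proof (rule minorant_le_cost_algebra[where \<nu>_lo = \<nu>_lo and \<eta> = "?c \<eta>" and \<zeta> = "?c \<zeta>" and y = "?c y" and y\<^sub>d = "?c y\<^sub>d"
      and p = "?c (\<lambda>z. - lam * u z)" and g\<eta> = "?c' ?g\<eta>" and g\<zeta> = "?c' ?g\<zeta>" and gy = "?c' g"
      and S\<eta> = "?c (?S ?h\<eta>)" and S\<zeta> = "?c (?S ?h\<zeta>)" and Sy = "?c (?S h)"
      and N\<eta> = "?c' (?N ?g\<eta>)" and N\<zeta> = "?c' (?N ?g\<zeta>)" and Ny = "?c' (?N g)"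
      and \<tau> = "?c' \<tau>" and \<rho> = "?c' \<rho>" and d\<tau> = "?c ?d\<tau>" and d\<rho> = "?c ?d\<rho>",
     folded e Sk N\<gamma>])
    show "0 < lam" "0 < C" "0 < \<mu>" "\<mu> \<le> \<nu>_lo" using lam \<mu> friedrichs by (auto simp: friedrichs_constant_def)
    show "?c' \<tau> \<bullet> ?c' ?\<gamma> + ?c ?d\<tau> \<bullet> ?c ?e = 0" "?c' \<rho> \<bullet> ?c' ?\<gamma> + ?c ?d\<rho> \<bullet> ?c ?e = 0"
      using divergence_theorem[OF d\<tau> es(1)] divergence_theorem[OF d\<rho> es(1)] by (simp_all add: inner_cls L Le)
    show "?c' (?N g) \<bullet> ?c' ?g\<zeta> + ?c (?S h) \<bullet> ?c \<zeta> = - (1 / lam) * (?c (\<lambda>z. - lam * u z) \<bullet> ?c \<zeta>)"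
      by (rule state[OF p\<zeta>(1)])
    show "?c' (?N g) \<bullet> ?c' ?\<gamma> + ?c (?S h) \<bullet> ?c ?e = - (1 / lam) * (?c (\<lambda>z. - lam * u z) \<bullet> ?c ?e)"
      by (rule state[OF es(1)])
    show "?c' (?N ?\<gamma>) \<bullet> ?c' ?g\<zeta> = ?c' (?N ?g\<zeta>) \<bullet> ?c' ?\<gamma>"
      by (rule inner_cls_weight_sym[OF \<nu>_L2_Q[OF Le(2)] W(5) Le(2) L(4)])
    have "?c (?S ?h\<zeta>) \<bullet> ?c ?e = ?c (?S ?e) \<bullet> ?c ?h\<zeta>"
      by (rule inner_cls_weight_sym[OF W(2) \<sigma>_L2_Q[OF Le(1)] L(6) Le(1)])
    then show "?c (?S ?k) \<bullet> ?c \<zeta> + ?c (?S ?h\<zeta>) \<bullet> ?c ?e = 0"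
      using time_integration_by_parts[OF es(2) p\<zeta>(2)]
      unfolding inner_cls[OF \<sigma>_L2_Q[OF Le(3)] L(2)] inner_cls[OF \<sigma>_L2_Q[OF Le(1)] L(6)] by simp
    show "?c (?S ?k) \<bullet> ?c ?e = 0"
      unfolding inner_cls[OF \<sigma>_L2_Q[OF Le(3)] Le(1)] by (rule energy_identity[OF es(2)])
    show "\<nu>_lo * (norm (?c' ?\<gamma>))\<^sup>2 \<le> ?c' (?N ?\<gamma>) \<bullet> ?c' ?\<gamma>"
      unfolding inner_cls[OF \<nu>_L2_Q[OF Le(2)] Le(2)] norm_cls[OF Le(2)] by (rule \<nu>_coercive[OF Le(2)])
    show "norm (?c ?e) \<le> C * norm (?c' ?\<gamma>)"
      unfolding norm_cls[OF Le(1)] norm_cls[OF Le(2)] by (rule spair_friedrichs[OF es(1)])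
  qed
  moreover have "norm (?c \<eta> - ?c y\<^sub>d) = l2norm Q (\<lambda>z. \<eta> z - y\<^sub>d z)" "norm (?c y - ?c y\<^sub>d) = l2norm Q (\<lambda>z. y z - y\<^sub>d z)"
    by (simp_all add: norm_cls L2_diff L yd flip: cls_diff)
  moreover have "norm (?c \<zeta>) = l2norm Q \<zeta>" by (simp add: norm_cls L)
  moreover have "norm (?c (\<lambda>z. - lam * u z)) = lam * l2norm Q u"
    using cls_scaleR[OF u, of "- lam"] lam by (simp add: norm_cls[OF u])
  moreover have "?c' (?N ?g\<eta>) \<bullet> ?c' ?g\<zeta> = l2inner Q (?N ?g\<eta>) ?g\<zeta>" "?c (?S ?h\<eta>) \<bullet> ?c \<zeta> = l2inner Q (?S ?h\<eta>) \<zeta>"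
    by (rule inner_cls[OF W(4) L(4)], rule inner_cls[OF W(1) L(2)])
  moreover have "norm (?c \<eta> - ?c y\<^sub>d + ?c ?d\<rho> + ?c (?S ?h\<zeta>)) = l2norm Q (R3 \<Omega> T \<sigma> y\<^sub>d \<zeta> \<rho> \<eta>)"
  proof -
    have "?c \<eta> - ?c y\<^sub>d + ?c ?d\<rho> + ?c (?S ?h\<zeta>) = ?c (\<lambda>z. \<eta> z - y\<^sub>d z + ?d\<rho> z + ?S ?h\<zeta> z)"
      using cls_add[OF L2_add[OF L2_diff[OF L(1) yd] L(10)] W(2)] cls_add[OF L2_diff[OF L(1) yd] L(10)] cls_diff[OF L(1) yd] by simp
    then show ?thesis using norm_cls[OF L2_add[OF L2_add[OF L2_diff[OF L(1) yd] L(10)] W(2)]] by (simp add: R3_def)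
  qed
  moreover have "norm (?c (?S ?h\<eta>) - ?c ?d\<tau> + (1 / lam) *\<^sub>R ?c \<zeta>) = l2norm Q (R1 \<Omega> T \<sigma> \<eta> \<tau> (\<lambda>z. - (1 / lam) * \<zeta> z))"
  proof -
    have "?c (?S ?h\<eta>) - ?c ?d\<tau> + (1 / lam) *\<^sub>R ?c \<zeta> = ?c (\<lambda>z. ?S ?h\<eta> z - ?d\<tau> z + (1 / lam) *\<^sub>R \<zeta> z)"
      using cls_add[OF L2_diff[OF W(1) L(9)] L2_scaleR[OF L(2)], of "1 / lam"] cls_diff[OF W(1) L(9)] cls_scaleR[OF L(2), of "1 / lam"] by simp
    then show ?thesis using norm_cls[OF L2_add[OF L2_diff[OF W(1) L(9)] L2_scaleR[OF L(2)]], of "1 / lam"] by (simp add: R1_def)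
  qed
  moreover have "norm (?c' \<tau> - ?c' (?N ?g\<eta>)) = l2norm Q (R2 \<Omega> T \<nu> \<eta> \<tau>)" "norm (?c' \<rho> - ?c' (?N ?g\<zeta>)) = l2norm Q (R4 \<Omega> T \<nu> \<zeta> \<rho>)"
    unfolding R2_def R4_def cls_diff[OF L(7) W(4), symmetric] cls_diff[OF L(8) W(5), symmetric]
    by (rule norm_cls[OF L2_diff[OF L(7) W(4)]], rule norm_cls[OF L2_diff[OF L(8) W(5)]])
  moreover have "1 / (2 * lam) * (lam * l2norm Q u)\<^sup>2 = lam / 2 * (l2norm Q u)\<^sup>2"
    using lam by (simp add: power2_eq_square)
  ultimately show ?thesis
    unfolding minorant_def Let_def cost_def minorant_integral_eq[OF H(1,2)] by simp
qed

text \<open>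
  All residuals vanish, and the state equation tested with \<open>- lam * u\<close> evaluates the remaining
  integral to \<open>(- lam + lam) |u|\<^sup>2 = 0\<close>, so that the quadratic terms alone remain.
\<close>

lemma minorant_at_optimum:
  assumes lam: "lam > 0" and yd: "y\<^sub>d \<in> L2 Q" and u: "u \<in> L2 Q"
    and y: "spair y g" "tpair y h" "dpair (\<lambda>z. \<nu> (fst z) *\<^sub>R g z) (\<lambda>z. \<sigma> (fst z) * h z - u z)"
    and p: "spair (\<lambda>z. - lam * u z) g'" "tpair (\<lambda>z. - lam * u z) h'"
      "dpair (\<lambda>z. \<nu> (fst z) *\<^sub>R g' z) (\<lambda>z. - (\<sigma> (fst z) * h' z) - (y z - y\<^sub>d z))"
  shows "minorant \<Omega> T \<sigma> \<nu> lam y\<^sub>d C \<mu> y (\<lambda>z. - lam * u z) (\<lambda>z. \<nu> (fst z) *\<^sub>R g z) (\<lambda>z. \<nu> (fst z) *\<^sub>R g' z)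
    = cost \<Omega> T lam y\<^sub>d y u"
proof -
  let ?p = "\<lambda>z. - lam * u z"
  have yH: "y \<in> H11 \<Omega> T" and pH: "?p \<in> H11 \<Omega> T" using pairs_H11 y p by blast+
  have L: "g \<in> L2 Q" "h \<in> L2 Q" "g' \<in> L2 Q" "?p \<in> L2 Q" using y p by (auto simp: spair_def tpair_def)
  note ae = sgrad_AE[OF y(1)] tderiv_AE[OF y(2)] sdiv_AE[OF y(3)] sgrad_AE[OF p(1)] tderiv_AE[OF p(2)] sdiv_AE[OF p(3)]
  have r1: "l2norm Q (R1 \<Omega> T \<sigma> y (\<lambda>z. \<nu> (fst z) *\<^sub>R g z) (\<lambda>z. - (1 / lam) * ?p z)) = 0"
    by (rule l2norm_AE_0) (use ae(2,3) in eventually_elim, use lam in \<open>auto simp: R1_def\<close>)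
  have r2: "l2norm Q (R2 \<Omega> T \<nu> y (\<lambda>z. \<nu> (fst z) *\<^sub>R g z)) = 0"
    by (rule l2norm_AE_0) (use ae(1) in eventually_elim, auto simp: R2_def)
  have r3: "l2norm Q (R3 \<Omega> T \<sigma> y\<^sub>d ?p (\<lambda>z. \<nu> (fst z) *\<^sub>R g' z) y) = 0"
    by (rule l2norm_AE_0) (use ae(5,6) in eventually_elim, auto simp: R3_def)
  have r4: "l2norm Q (R4 \<Omega> T \<nu> ?p (\<lambda>z. \<nu> (fst z) *\<^sub>R g' z)) = 0"
    by (rule l2norm_AE_0) (use ae(4) in eventually_elim, auto simp: R4_def)
  note LH = H11_pairs[OF yH] H11_pairs[OF pH]
  have sg: "sgrad \<Omega> T y \<in> L2 Q" "tderiv \<Omega> T y \<in> L2 Q" "sgrad \<Omega> T ?p \<in> L2 Q"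
    using LH by (auto simp: spair_def tpair_def)
  have i1: "l2inner Q (\<lambda>z. \<nu> (fst z) *\<^sub>R sgrad \<Omega> T y z) (sgrad \<Omega> T ?p) = l2inner Q (\<lambda>z. \<nu> (fst z) *\<^sub>R g z) (sgrad \<Omega> T ?p)"
    by (rule l2inner_cong_AE[OF \<nu>_L2_Q[OF sg(1)] \<nu>_L2_Q[OF L(1)] sg(3)]) (use ae(1) in eventually_elim, auto)
  have i2: "l2inner Q (\<lambda>z. \<sigma> (fst z) *\<^sub>R tderiv \<Omega> T y z) ?p = l2inner Q (\<lambda>z. \<sigma> (fst z) *\<^sub>R h z) ?p"
    by (rule l2inner_cong_AE[OF \<sigma>_L2_Q[OF sg(2)] \<sigma>_L2_Q[OF L(2)] L(4)]) (use ae(2) in eventually_elim, auto)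
  have "l2inner Q (\<lambda>z. \<sigma> (fst z) * h z - u z) ?p = l2inner Q (\<lambda>z. \<sigma> (fst z) *\<^sub>R h z) ?p - l2inner Q u ?p"
    using l2inner_linear_left[OF \<sigma>_L2_Q[OF L(2)] u L(4), of 1 "-1"] by simp
  moreover have "l2inner Q u ?p = - lam * (l2norm Q u)\<^sup>2"
    using l2inner_scale_left[of Q "- lam" u u] unfolding l2inner_commute[of Q u ?p] l2inner_self by simp
  moreover have "l2norm Q ?p = lam * l2norm Q u"
    using cls_scaleR[OF u, of "- lam"] norm_cls[OF u] norm_cls[OF L(4)] lam by simp
  ultimately show ?thesis
    using divergence_theorem[OF y(3) LH(3)] lam
    unfolding minorant_def Let_def cost_def minorant_integral_eq[OF yH pH] i1 i2 r1 r2 r3 r4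
    by (simp add: power2_eq_square)
qed

end

theorem theorem2:
  fixes \<Omega> :: "(real^'n) set"
    and T lam C\<^sub>F \<sigma>_lo \<sigma>_hi \<nu>_lo \<nu>_hi \<mu>\<^sub>1 :: real
    and \<sigma> \<nu> :: "real^'n \<Rightarrow> real"
    and y\<^sub>d u y :: "(real^'n) \<times> real \<Rightarrow> real"
  assumes "CARD('n) \<in> {1, 2, 3}"
    and "bounded_lipschitz_domain \<Omega>"
    and "T > 0" and "lam > 0"
    and "set_borel_measurable lborel \<Omega> \<sigma>" and "set_borel_measurable lborel \<Omega> \<nu>"
    and "0 < \<sigma>_lo" and "\<And>x. x \<in> \<Omega> \<Longrightarrow> \<sigma>_lo \<le> \<sigma> x \<and> \<sigma> x \<le> \<sigma>_hi"
    and "0 < \<nu>_lo" and "\<And>x. x \<in> \<Omega> \<Longrightarrow> \<nu>_lo \<le> \<nu> x \<and> \<nu> x \<le> \<nu>_hi"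
    and "y\<^sub>d \<in> L2 (cyl \<Omega> T)"
    and "friedrichs_constant \<Omega> C\<^sub>F"
    and "\<mu>\<^sub>1 = 1 / sqrt 2 * min \<nu>_lo \<sigma>_lo"
    and "optimal_pair \<Omega> T \<sigma> \<nu> lam y\<^sub>d u y"
  defines "J \<equiv> \<lambda>(\<eta>, \<zeta>, \<tau>, \<rho>). minorant \<Omega> T \<sigma> \<nu> lam y\<^sub>d C\<^sub>F \<mu>\<^sub>1 \<eta> \<zeta> \<tau> \<rho>"
    and "V \<equiv> H11 \<Omega> T \<times> H11 \<Omega> T \<times> Hdiv \<Omega> T \<times> Hdiv \<Omega> T"
  shows "bdd_above (J ` V) \<and> (SUP w\<in>V. J w) = cost \<Omega> T lam y\<^sub>d y u
           \<and> (\<exists>w\<in>V. J w = (SUP w\<in>V. J w))"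
proof -
  interpret parabolic \<Omega> T \<sigma>_lo \<sigma>_hi \<nu>_lo \<nu>_hi C\<^sub>F \<sigma> \<nu>
    by unfold_locales (use assms in \<open>auto simp: bounded_lipschitz_domain_def\<close>)
  have u: "u \<in> L2 (cyl \<Omega> T)" using assms(14) by (simp add: optimal_pair_def)
  obtain g h g' h' where y: "spair y g" "tpair y h" "dpair (\<lambda>z. \<nu> (fst z) *\<^sub>R g z) (\<lambda>z. \<sigma> (fst z) * h z - u z)"
    and p: "spair (\<lambda>z. - lam * u z) g'" "tpair (\<lambda>z. - lam * u z) h'"
      "dpair (\<lambda>z. \<nu> (fst z) *\<^sub>R g' z) (\<lambda>z. - (\<sigma> (fst z) * h' z) - (y z - y\<^sub>d z))"
    using optimal_pair_regularity[OF assms(14,11)] .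
  have m: "0 < min \<nu>_lo \<sigma>_lo" using assms(7,9) by simp
  have s: "1 / sqrt 2 \<le> (1::real)" "0 < 1 / sqrt (2::real)" by simp_all
  have \<mu>: "0 < \<mu>\<^sub>1" using m s(2) unfolding assms(13) by (rule mult_pos_pos[rotated])
  have "\<mu>\<^sub>1 \<le> 1 * min \<nu>_lo \<sigma>_lo" using m s(1) unfolding assms(13) by (intro mult_right_mono) auto
  then have \<mu>': "\<mu>\<^sub>1 \<le> \<nu>_lo" by simp
  have le: "J w \<le> cost \<Omega> T lam y\<^sub>d y u" if "w \<in> V" for w
    using that minorant_le_cost[OF assms(4) \<mu> \<mu>' assms(11) u y]
    unfolding J_def V_def by (cases w) auto
  define w where "w = (y, (\<lambda>z. - lam * u z), (\<lambda>z. \<nu> (fst z) *\<^sub>R g z), (\<lambda>z. \<nu> (fst z) *\<^sub>R g' z))"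
  have wV: "w \<in> V"
    unfolding w_def V_def using pairs_H11[OF y(1,2)] pairs_H11[OF p(1,2)] dpair_Hdiv[OF y(3)] dpair_Hdiv[OF p(3)] by simp
  have wJ: "J w = cost \<Omega> T lam y\<^sub>d y u"
    unfolding w_def J_def using minorant_at_optimum[OF assms(4,11) u y p] by simp
  have bdd: "bdd_above (J ` V)" using le by (rule bdd_aboveI2)
  have "(SUP w\<in>V. J w) = cost \<Omega> T lam y\<^sub>d y u"
    by (rule cSup_eq_maximum) (use imageI[OF wV, of J] wJ le in auto)
  then show ?thesis using bdd wV wJ by auto
qed

end
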